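(* Let $P\colon\mathcal W\to\mathcal W$ be an arbitrary odd linear map with $P^2=1$ on the vector representation $\mathcal W=\mathcal W_{1,\epsilon}$ of $\mathcal U(\epsilon)$, and let $\beta\in\mathsf Q^+$. Then, for each $\sharp\in\{\,',\mathsf{tw}\}$, the formulas of the context define a right $RC_\beta$-supermodule structure on $V^{\sharp\otimes\beta}_{\mathbb K}$, and $V^{\sharp\otimes\beta}_{\mathbb O}$ is a right $RC_\beta$-submodule of $V^{\sharp\otimes\beta}_{\mathbb K}$. Consequently $V'^{\otimes\beta}_{\mathbb O}$ is a $(\mathcal U(\epsilon)^P,RC_\beta)$-bisupermodule and $V^{\mathsf{tw}\otimes\beta}_{\mathbb O}$ is a $(\mathcal U^{\mathsf{tw}}(\epsilon)^P,RC_\beta)$-bisupermodule, where $\mathcal U(\epsilon)^P$ and $\mathcal U^{\mathsf{tw}}(\epsilon)^P$ are the subsuperalgebras of $\mathcal U(\epsilon)$ defined in the context.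
   Context: $\Bbbk=\overline{\mathbb Q(q)}$; $\mathrm{par}$ denotes $\mathbb Z/2\mathbb Z$-parity. An $(A,B)$-bisupermodule is a superspace that is a left $A$- and right $B$-supermodule (actions compatible with parity) with $(am)b=a(mb)$. **The algebra $\mathcal U(\epsilon)$.** $M\ge2$, $n=2M$, $\epsilon=(\epsilon_1,\dots,\epsilon_n)$ with $\epsilon_i=0$ for $i\le M$, $\epsilon_i=1$ for $i>M$; indices $i\in\{0,1,\dots,n-1\}$ are read modulo $n$ (so $\epsilon_0=\epsilon_n$, $\delta_0=\delta_n$). $q_i=(-1)^{\epsilon_i}q^{(-1)^{\epsilon_i}}$, $\mathsf P=\bigoplus_{i=1}^n\mathbb Z\delta_i$, $\alpha_i=\delta_i-\delta_{i+1}$, $\mathbf q(\sum a_i\delta_i,\sum b_i\delta_i)=\prod_iq_i^{a_ib_i}$, $[2]=q+q^{-1}$; $i$ is called even if $\epsilon_i=\epsilon_{i+1}$ and odd otherwise. $\mathcal U(\epsilon)$ is generated by $k_\mu$ ($\mu\in\mathsf P$, even) and $e_i,f_i$ (parity $\epsilon_i+\epsilon_{i+1}$) with relations: $k_0=1$, $k_{\mu+\mu'}=k_\mu k_{\mu'}$; $k_\mu e_ik_\mu^{-1}=\mathbf q(\mu,\alpha_i)e_i$, $k_\mu f_ik_\mu^{-1}=\mathbf q(\mu,\alpha_i)^{-1}f_i$; $e_if_j-f_je_i=\delta_{ij}\frac{k_{\alpha_i}-k_{\alpha_i}^{-1}}{q_i-q_i^{-1}}$; $e_i^2=f_i^2=0$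 for $i$ odd; $e_ie_j=e_je_i$, $f_if_j=f_jf_i$ for $i-j\not\equiv\pm1$; for $i$ even and $j\equiv i\pm1$: $e_i^2e_j-(-1)^{\epsilon_i}[2]e_ie_je_i+e_je_i^2=0$ and the same for $f$; for $i$ odd: $e_ie_{i-1}e_ie_{i+1}-e_ie_{i+1}e_ie_{i-1}+e_{i+1}e_ie_{i-1}e_i-e_{i-1}e_ie_{i+1}e_i+(-1)^{\epsilon_i}[2]e_ie_{i-1}e_{i+1}e_i=0$ and the same for $f$. It acts on tensor products through $\Delta(k_\mu)=k_\mu\otimes k_\mu$, $\Delta(e_i)=1\otimes e_i+e_i\otimes k_{\alpha_i}^{-1}$, $\Delta(f_i)=f_i\otimes1+k_{\alpha_i}\otimes f_i$ (no extra signs). **Vector representation.** $\mathcal W=\mathcal W_{1,\epsilon}$ has basis $w_1,\dots,w_n$ ($w_0:=w_n$), $\mathrm{par}(w_i)=\epsilon_i$, $k_\mu w_i=\mathbf q(\mu,\delta_i)w_i$, $e_iw_j=\delta_{j,i+1}w_i$, $f_iw_j=\delta_{j,i}w_{i+1}$ (indices mod $n$). Its affinization is $\Bbbk[z^{\pm1}]\otimes\mathcal W$ with $e_0,f_0$ multiplied by $z,z^{-1}$ respectively. The normalized R-matrix $R(z)\in\mathrm{End}(\mathcal W\otimes\mathcal W)\otimes\Bbbk(z)$ is: $R(z)(w_i\otimes w_i)=\frac{1-q^2z}{z-q^2}w_i\otimes w_i$ if $i\le M$, $=w_i\otimes w_i$ if $i>M$; $R(z)(w_i\otimes w_j)=\frac{1-q^2}{z-q^2}w_i\otimes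 w_j+\frac{q(1-z)}{z-q^2}w_j\otimes w_i$ if $i<j$; $R(z)(w_i\otimes w_j)=\frac{z(1-q^2)}{z-q^2}w_i\otimes w_j+\frac{q(1-z)}{z-q^2}w_j\otimes w_i$ if $i>j$ ($1\le i,j\le n$). **The superalgebra $RC_\beta$ (type $A_\infty$).** $I=\mathbb Z$, $a_{ii}=2$, $a_{ij}=-1$ if $|i-j|=1$, $a_{ij}=0$ otherwise. $\mathsf Q^+=\bigoplus_{i\in\mathbb Z}\mathbb Z_{\ge0}\alpha_i$, $|\sum m_i\alpha_i|=\sum m_i$. $\mathcal Q_{ii}=0$, $\mathcal Q_{ij}(u,v)=(u-v)^{-a_{ij}}$ if $i>j$, $(v-u)^{-a_{ij}}$ if $i<j$. $J=\mathbb Z\times\{0,1\}$ with projections $\pi_1,\pi_2$, $c(i,\varepsilon)=(i,1-\varepsilon)$, $\tilde{\mathcal Q}_{ij}(u,v)=\mathcal Q_{\pi_1(i),\pi_1(j)}((-1)^{\pi_2(i)}u,(-1)^{\pi_2(j)}v)$. For $|\beta|=\ell$: $J^\beta=\{\nu\in J^\ell\mid\sum_p\alpha_{\pi_1(\nu_p)}=\beta\}$; $s_a=(a,a+1)$ permutes places; $c_p(\nu)$ replaces $\nu_p$ by $c(\nu_p)$. $RC_\beta$ is generated by even $e(\nu)$ ($\nu\in J^\beta$), $x_p$ ($1\le p\le\ell$), $\sigma_a$ ($1\le a<\ell$) and odd $\mathsf c_p$ ($1\le p\le\ell$) with relations: $e(\mu)e(\nu)=\delta_{\mu\nu}e(\mu)$,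 $\sum_\nu e(\nu)=1$, $x_pe(\nu)=e(\nu)x_p$, $\mathsf c_pe(\nu)=e(c_p(\nu))\mathsf c_p$; $x_px_q=x_qx_p$, $\mathsf c_p\mathsf c_q+\mathsf c_q\mathsf c_p=2\delta_{pq}$, $\mathsf c_px_q=(-1)^{\delta_{pq}}x_q\mathsf c_p$; $\sigma_ae(\nu)=e(s_a\nu)\sigma_a$, $\sigma_a\mathsf c_p=\mathsf c_{s_a(p)}\sigma_a$; $\sigma_ax_p=x_p\sigma_a$ ($p\ne a,a+1$); $(\sigma_ax_{a+1}-x_a\sigma_a)e(\nu)=e(\nu)$ if $\nu_a=\nu_{a+1}$, $-\mathsf c_a\mathsf c_{a+1}e(\nu)$ if $\nu_a=c(\nu_{a+1})$, $0$ otherwise; $(x_{a+1}\sigma_a-\sigma_ax_a)e(\nu)=e(\nu)$ if $\nu_a=\nu_{a+1}$, $\mathsf c_a\mathsf c_{a+1}e(\nu)$ if $\nu_a=c(\nu_{a+1})$, $0$ otherwise; $\sigma_a^2e(\nu)=\tilde{\mathcal Q}_{\nu_a,\nu_{a+1}}(x_a,x_{a+1})e(\nu)$; $\sigma_a\sigma_b=\sigma_b\sigma_a$ ($|a-b|>1$); $(\sigma_{a+1}\sigma_a\sigma_{a+1}-\sigma_a\sigma_{a+1}\sigma_a)e(\nu)$ equals $\frac{\tilde{\mathcal Q}_{\nu_a,\nu_{a+1}}(x_{a+2},x_{a+1})-\tilde{\mathcal Q}_{\nu_a,\nu_{a+1}}(x_a,x_{a+1})}{x_{a+2}-x_a}e(\nu)$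 if $\nu_a=\nu_{a+2}$, $\frac{\tilde{\mathcal Q}_{\nu_a,\nu_{a+1}}(x_{a+2},x_{a+1})-\tilde{\mathcal Q}_{\nu_a,\nu_{a+1}}(-x_a,x_{a+1})}{x_{a+2}+x_a}\mathsf c_a\mathsf c_{a+2}e(\nu)$ if $\nu_a=c(\nu_{a+2})$, $0$ otherwise. **The spaces.** For $\sharp\in\{\,',\mathsf{tw}\}$ let $X'(j,\varepsilon)=q^{-2j}$ and $X^{\mathsf{tw}}(j,\varepsilon)=q^{-(-1)^\varepsilon2j}$. For $\nu\in J^\beta$ put $\mathbb O^\sharp_\nu=\Bbbk[[X_1-X^\sharp(\nu_1),\dots,X_\ell-X^\sharp(\nu_\ell)]]$ and $\mathbb K^\sharp_\nu=\mathrm{Frac}(\mathbb O^\sharp_\nu)$ (both even), and let $x_p\in\mathbb O^\sharp_\nu$ denote $\frac{X_p-X'(\nu_p)}{X'(\nu_p)}$ if $\sharp={}'$, and $\frac{X_p-X^{\mathsf{tw}}(\nu_p)}{X_p+X^{\mathsf{tw}}(\nu_p)}$ if $\sharp=\mathsf{tw}$. Put $V^{\sharp\otimes\beta}_{\mathbb O}=\bigoplus_{\nu\in J^\beta}(\mathbb O^\sharp_\nu\otimes_\Bbbk\mathcal W^{\otimes\ell})e(\nu)$ and $V^{\sharp\otimes\beta}_{\mathbb K}=\bigoplus_{\nu\in J^\beta}(\mathbb K^\sharp_\nu\otimes_\Bbbk\mathcal W^{\otimes\ell})e(\nu)$. $\mathcal U(\epsilon)$ acts on the left, linearly over the coefficient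 rings, on each $\nu$-summand via the iterated coproduct, where on the $p$-th tensor factor $e_0,f_0$ act with the extra factor $X_p,X_p^{-1}$. **The right action of $RC_\beta$.** $e(\nu)$ acts as projection to the $\nu$-summand. For $m=f\otimes(v_1\otimes\cdots\otimes v_\ell)e(\nu)$, \[m.\mathsf c_p=(-1)^{\mathrm{par}(v_p)+\cdots+\mathrm{par}(v_\ell)}\sqrt{-1}\;\theta^\sharp_p(f)\otimes(\cdots\otimes P(v_p)\otimes\cdots)e(c_p(\nu)),\] where $\theta'_p(f)=f$, and $\theta^{\mathsf{tw}}_p\colon\mathbb K^{\mathsf{tw}}_\nu\to\mathbb K^{\mathsf{tw}}_{c_p(\nu)}$ is the substitution $X_p\mapsto X_p^{-1}$. If $\pi_2(\nu_p)=0$ for all $p$: $m.x_p=x_pm$, and - if $\nu_k\ne\nu_{k+1}$: $m.\sigma_k=s_k\big(f\,P_{\pi_1(\nu_k),\pi_1(\nu_{k+1})}(x_k,x_{k+1})\big)\otimes R_k(v_1\otimes\cdots\otimes v_\ell)\,e(s_k\nu)$; - if $\nu_k=\nu_{k+1}$: $m.\sigma_k=\dfrac{s_k(f)\otimes R_k(v_1\otimes\cdots\otimes v_\ell)-f\otimes(v_1\otimes\cdots\otimes v_\ell)}{x_k-x_{k+1}}e(\nu)$. Here $P_{ij}=1$ if $i>j$, $P_{ij}=\mathcal Q_{ij}$ if $i<j$; $s_k\colon\mathbb K^\sharp_\nu\to\mathbb K^\sharp_{s_k\nu}$ exchanges $X_k$ and $X_{k+1}$; $R_k$ is $R(X_{k+1}/X_k)$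 (in target coordinates, i.e. $R$ evaluated at the ratio of the spectral parameter of the original $k$-th factor by that of the original $(k+1)$-st) applied to tensor factors $k,k+1$. For general $\nu$ let $\{p\mid\pi_2(\nu_p)=1\}=\{j_1<\cdots<j_r\}$ and set $m.x_p=(-1)^{\#(\{p\}\cap\{j_1,\dots,j_r\})}\,m.\mathsf c_{j_1}\cdots\mathsf c_{j_r}.x_p.\mathsf c_{j_r}\cdots\mathsf c_{j_1}$, $\quad m.\sigma_k=m.\mathsf c_{j_1}\cdots\mathsf c_{j_r}.\sigma_k.\mathsf c_{s_k(j_r)}\cdots\mathsf c_{s_k(j_1)}$. **The subalgebras.** $\mathcal U(\epsilon)^P=\bigcap_{\beta\in\mathsf Q^+}\{u\in\mathcal U(\epsilon)\mid u(ma)=(um)a\ \ \forall a\in RC_\beta,\ m\in V'^{\otimes\beta}_{\mathbb O}\}$, and $\mathcal U^{\mathsf{tw}}(\epsilon)^P$ is defined in the same way with $V^{\mathsf{tw}\otimes\beta}_{\mathbb O}$. *)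

theory Defs
  imports
    "HOL-Algebra.Algebraic_Closure_Type"
    "HOL-Algebra.QuotRing"
    "HOL-Algebra.Subrings"
    "HOL-Computational_Algebra.Computational_Algebra"
    "HOL-Combinatorics.Transposition"
    "HOL-Library.Poly_Mapping"
    "HOL-Library.Multiset_Order"
    "HOL-Library.Z2"
begin

section \<open>The ground field\<close>

type_synonym base = "rat poly fract alg_closure"

definition qq :: base where
  "qq = to_ac (Fraction_Field.Fract [:0, 1:] 1)"

definition iu :: base where
  "iu = (SOME z. z ^ 2 = -1)"


section \<open>Formal power series in several variables\<close>

text \<open>
  A monomial in the variables \<open>t\<^sub>0, t\<^sub>1, \<dots>\<close> is a multiset of indices. All the rings of power series
  in finitely many variables are subrings of the domain defined here (see \<open>ser_ring\<close> below).
\<close>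

typedef 'a mfps = "UNIV :: (nat multiset \<Rightarrow> 'a) set"
  morphisms mcoeff Abs_mfps ..

setup_lifting type_definition_mfps

lemma mfps_eqI: "(\<And>m. mcoeff f m = mcoeff g m) \<Longrightarrow> f = g"
  by transfer auto

lemma finite_splits: "finite {(a, b). a + b = (m :: 'a multiset)}"
proof -
  have "{(a, b). a + b = m} \<subseteq> (\<lambda>a. (a, m - a)) ` {a. a \<subseteq># m}"
    by (auto simp: image_iff)
  moreover have "finite {a. a \<subseteq># m}"
  proof (induction m)
    case (add x m)
    have "{a. a \<subseteq># add_mset x m} \<subseteq> {a. a \<subseteq># m} \<union> add_mset x ` {a. a \<subseteq># m}"
    proof
      fix a assume "a \<in> {a. a \<subseteq># add_mset x m}"
      then have a: "a \<subseteq># add_mset x m" by simp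
      show "a \<in> {a. a \<subseteq># m} \<union> add_mset x ` {a. a \<subseteq># m}"
      proof (cases "x \<in># a")
        case True
        then obtain b where b: "a = add_mset x b" by (metis mset_add)
        with a have "b \<subseteq># m" by simp
        with b show ?thesis by auto
      next
        case False
        with a have "a \<subseteq># m"
          by (metis diff_single_trivial subset_eq_diff_conv add_mset_add_single)
        then show ?thesis by simp
      qed
    qed
    with add show ?case by (meson finite_Un finite_imageI finite_subset)
  qed simp
  ultimately show ?thesis
    by (meson finite_imageI finite_subset)
qed

lemma finite_splits': "finite {p. fst p + snd p = (m :: 'a multiset)}"
  using finite_splits[of m] by (simp add: case_prod_unfold)

instantiation mfps :: (comm_ring_1) comm_ring_1
begin

lift_definition zero_mfps :: "'a mfps" is "\<lambda>_. 0" .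
lift_definition one_mfps :: "'a mfps" is "\<lambda>m. if m = {#} then 1 else 0" .
lift_definition plus_mfps :: "'a mfps \<Rightarrow> 'a mfps \<Rightarrow> 'a mfps" is "\<lambda>f g m. f m + g m" .
lift_definition minus_mfps :: "'a mfps \<Rightarrow> 'a mfps \<Rightarrow> 'a mfps" is "\<lambda>f g m. f m - g m" .
lift_definition uminus_mfps :: "'a mfps \<Rightarrow> 'a mfps" is "\<lambda>f m. - f m" .
lift_definition times_mfps :: "'a mfps \<Rightarrow> 'a mfps \<Rightarrow> 'a mfps" is
  "\<lambda>f g m. \<Sum>(a, b) | a + b = m. f a * g b" .

instance
proof
  fix f g h :: "'a mfps"
  show "f * g * h = f * (g * h)"
  proof (rule mfps_eqI)
    fix m :: "nat multiset"
    let ?T = "{(a, b, c). a + b + c = m}"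
    have "mcoeff (f * g * h) m = (\<Sum>(d, c) | d + c = m. \<Sum>(a, b) | a + b = d. mcoeff f a * mcoeff g b * mcoeff h c)"
      by (simp add: times_mfps.rep_eq sum_distrib_right case_prod_unfold)
    also have "\<dots> = (\<Sum>((d, c), (a, b)) \<in> (SIGMA (d, c) : {(d, c). d + c = m}. {(a, b). a + b = d}).
        mcoeff f a * mcoeff g b * mcoeff h c)"
      by (subst sum.Sigma[symmetric]) (auto simp: finite_splits' case_prod_unfold)
    also have "\<dots> = (\<Sum>(a, b, c) \<in> ?T. mcoeff f a * mcoeff g b * mcoeff h c)"
      by (rule sum.reindex_bij_witness[where i = "\<lambda>(a, b, c). ((a + b, c), (a, b))"
            and j = "\<lambda>((d, c), (a, b)). (a, b, c)"]) auto
    also have "\<dots> = (\<Sum>((a, d), (b, c)) \<in> (SIGMA (a, d) : {(a, d). a + d = m}. {(b, c). b + c = d}).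
        mcoeff f a * mcoeff g b * mcoeff h c)"
      by (rule sum.reindex_bij_witness[where j = "\<lambda>(a, b, c). ((a, b + c), (b, c))"
            and i = "\<lambda>((a, d), (b, c)). (a, b, c)"]) (auto simp: add.assoc)
    also have "\<dots> = (\<Sum>(a, d) | a + d = m. \<Sum>(b, c) | b + c = d. mcoeff f a * mcoeff g b * mcoeff h c)"
      by (subst sum.Sigma[symmetric]) (auto simp: finite_splits' case_prod_unfold)
    also have "\<dots> = mcoeff (f * (g * h)) m"
      by (simp add: times_mfps.rep_eq sum_distrib_left case_prod_unfold mult.assoc)
    finally show "mcoeff (f * g * h) m = mcoeff (f * (g * h)) m" .
  qed
  show "f * g = g * f"
  proof (rule mfps_eqI)
    fix m :: "nat multiset"
    show "mcoeff (f * g) m = mcoeff (g * f) m"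
      unfolding times_mfps.rep_eq
      by (rule sum.reindex_bij_witness[where i = prod.swap and j = prod.swap])
        (auto simp: add.commute mult.commute)
  qed
  show "1 * f = f"
  proof (rule mfps_eqI)
    fix m :: "nat multiset"
    have "mcoeff (1 * f) m = (\<Sum>(a, b) | a + b = m. (if a = {#} then 1 else 0) * mcoeff f b)"
      by (simp add: times_mfps.rep_eq one_mfps.rep_eq)
    also have "\<dots> = (\<Sum>(a, b) \<in> {({#} :: nat multiset, m)}. (if a = {#} then 1 else 0) * mcoeff f b)"
      by (rule sum.mono_neutral_right) (auto simp: finite_splits split: if_splits)
    finally show "mcoeff (1 * f) m = mcoeff f m" by simp
  qed
  show "(f + g) * h = f * h + g * h"
    by (rule mfps_eqI)
      (simp add: times_mfps.rep_eq plus_mfps.rep_eq sum.distrib[symmetric] case_prod_unfold distrib_right)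
  show "f + g + h = f + (g + h)" "f + g = g + f" "0 + f = f" "- f + f = 0" "f - g = f + - g"
    by (transfer; simp add: add_ac fun_eq_iff)+
  show "(0 :: 'a mfps) \<noteq> 1"
    by transfer (auto simp: fun_eq_iff)
qed

end

instance mfps :: (idom) idom
proof
  fix f g :: "'a mfps"
  assume nz: "f \<noteq> 0" "g \<noteq> 0"
  let ?a = "LEAST m. mcoeff f m \<noteq> 0" and ?b = "LEAST m. mcoeff g m \<noteq> 0"
  from nz have ex: "\<exists>m. mcoeff f m \<noteq> 0" "\<exists>m. mcoeff g m \<noteq> 0"
    by (metis mfps_eqI zero_mfps.rep_eq)+
  then have ab: "mcoeff f ?a \<noteq> 0" "mcoeff g ?b \<noteq> 0"
    by (metis (mono_tags, lifting) LeastI_ex)+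
  have "mcoeff (f * g) (?a + ?b) = (\<Sum>(c, d) | c + d = ?a + ?b. mcoeff f c * mcoeff g d)"
    by (simp add: times_mfps.rep_eq)
  also have "\<dots> = (\<Sum>(c, d) \<in> {(?a, ?b)}. mcoeff f c * mcoeff g d)"
  proof (rule sum.mono_neutral_right)
    show "\<forall>i\<in>{(c, d). c + d = ?a + ?b} - {(?a, ?b)}. (case i of (c, d) \<Rightarrow> mcoeff f c * mcoeff g d) = 0"
    proof
      fix x assume x: "x \<in> {(c, d). c + d = ?a + ?b} - {(?a, ?b)}"
      obtain c d where xcd: "x = (c, d)" by fastforce
      with x have cd: "c + d = ?a + ?b" and ne: "\<not> (c = ?a \<and> d = ?b)" by auto
      have "mcoeff f c * mcoeff g d = 0"
      proof (rule ccontr)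
        assume "mcoeff f c * mcoeff g d \<noteq> 0"
        then have "?a \<le> c" "?b \<le> d" by (auto intro: Least_le)
        with ne have "?a + ?b < c + d"
          by (metis add_less_le_mono add_le_less_mono order_le_less)
        with cd show False by simp
      qed
      with xcd show "(case x of (c, d) \<Rightarrow> mcoeff f c * mcoeff g d) = 0" by simp
    qed
  qed (auto simp: finite_splits)
  finally have "mcoeff (f * g) (?a + ?b) \<noteq> 0"
    using ab by simp
  then show "f * g \<noteq> 0"
    by (auto simp: zero_mfps.rep_eq)
qed

lift_definition mconst :: "'a::zero \<Rightarrow> 'a mfps" is "\<lambda>c m. if m = {#} then c else 0" .
lift_definition mvar :: "nat \<Rightarrow> 'a::zero_neq_one mfps" is "\<lambda>i m. if m = {#i#} then 1 else 0" .

definition mfps_inv :: "'a::comm_ring_1 mfps \<Rightarrow> 'a mfps" where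
  "mfps_inv f = (THE g. f * g = 1)"

text \<open>
  The series \<open>f(g\<^sub>0, g\<^sub>1, \<dots>)\<close>; the sum over the monomials of \<open>f\<close> is finite for the two kinds of
  substitutions used below.
\<close>

lift_definition mfps_subst :: "(nat \<Rightarrow> 'a::comm_ring_1 mfps) \<Rightarrow> 'a mfps \<Rightarrow> 'a mfps" is
  "\<lambda>g f n. \<Sum>m | f m * mcoeff (\<Prod>i\<in>#m. g i) n \<noteq> 0. f m * mcoeff (\<Prod>i\<in>#m. g i) n" .

text \<open>The extension of an injective ring homomorphism to fraction fields.\<close>

definition fract_map :: "('a::idom \<Rightarrow> 'a) \<Rightarrow> 'a fract \<Rightarrow> 'a fract" where
  "fract_map h z = (THE y. \<forall>a b. b \<noteq> 0 \<and> z = Fraction_Field.Fract a b \<longrightarrow>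
      y = Fraction_Field.Fract (h a) (h b))"

text \<open>
  The ring \<open>\<O>\<^sub>\<nu>\<close> and its fraction field, for \<open>\<nu>\<close> of length \<open>l\<close>. The variable \<open>t\<^sub>p\<close> stands for
  \<open>X\<^sub>p - X(\<nu>\<^sub>p)\<close>, with \<open>p\<close> running from \<open>0\<close> to \<open>l - 1\<close>; so the set of series does not depend on \<open>\<nu>\<close>,
  but the series which is called \<open>X\<^sub>p\<close> does.
\<close>

type_synonym K = "base mfps fract"

abbreviation to_K :: "base mfps \<Rightarrow> K" where
  "to_K f \<equiv> Fraction_Field.Fract f 1"

abbreviation cK :: "base \<Rightarrow> K" where
  "cK c \<equiv> to_K (mconst c)"

definition ser_ring :: "nat \<Rightarrow> base mfps set" where
  "ser_ring l = {f. \<forall>m. mcoeff f m \<noteq> 0 \<longrightarrow> set_mset m \<subseteq> {..<l}}"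

definition ser_frac :: "nat \<Rightarrow> K set" where
  "ser_frac l = {Fraction_Field.Fract f g | f g. f \<in> ser_ring l \<and> g \<in> ser_ring l \<and> g \<noteq> 0}"


section \<open>Superspaces, superalgebras, supermodules\<close>

locale superspace = vector_space sm
  for sm :: "base \<Rightarrow> 'v::ab_group_add \<Rightarrow> 'v" +
  fixes V :: "'v set" and Vp :: "bit \<Rightarrow> 'v set"
  assumes subspace_carrier: "subspace V"
    and subspace_parity: "subspace (Vp d)"
    and parity_sum: "V = {v + w | v w. v \<in> Vp 0 \<and> w \<in> Vp 1}"
    and parity_direct: "Vp 0 \<inter> Vp 1 = {0}"

text \<open>The algebra structure over the ground field is given by its structure map \<open>sc\<close>.\<close>

locale superalgebra = ring A for A (structure) +
  fixes sc :: "base \<Rightarrow> 'a" and Ap :: "bit \<Rightarrow> 'a set"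
  assumes sc_hom: "sc \<in> ring_hom ring_of_type_algebra A"
    and sc_central: "a \<in> carrier A \<Longrightarrow> sc c \<otimes> a = a \<otimes> sc c"
    and parity_subgroup: "additive_subgroup (Ap d) A"
    and parity_scale: "a \<in> Ap d \<Longrightarrow> sc c \<otimes> a \<in> Ap d"
    and parity_sum: "carrier A = Ap 0 <+>\<^bsub>A\<^esub> Ap 1"
    and parity_direct: "Ap 0 \<inter> Ap 1 = {\<zero>}"
    and parity_one: "\<one> \<in> Ap 0"
    and parity_mult: "a \<in> Ap d \<Longrightarrow> b \<in> Ap d' \<Longrightarrow> a \<otimes> b \<in> Ap (d + d')"

definition subsuperalgebra ::
  "('a, 'b) ring_scheme \<Rightarrow> (base \<Rightarrow> 'a) \<Rightarrow> (bit \<Rightarrow> 'a set) \<Rightarrow> 'a set \<Rightarrow> bool" where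
  "subsuperalgebra A sc Ap S \<longleftrightarrow> superalgebra A sc Ap \<and> subring S A \<and> Set.range sc \<subseteq> S \<and>
     S = (S \<inter> Ap 0) <+>\<^bsub>A\<^esub> (S \<inter> Ap 1)"

locale left_supermodule =
  alg: superalgebra A sc Ap + spc: superspace sm V Vp
  for A :: "('a, 'b) ring_scheme" (structure) and sc Ap
    and sm :: "base \<Rightarrow> 'v::ab_group_add \<Rightarrow> 'v" and V Vp +
  fixes la :: "'a \<Rightarrow> 'v \<Rightarrow> 'v"
  assumes act_closed: "a \<in> carrier A \<Longrightarrow> m \<in> V \<Longrightarrow> la a m \<in> V"
    and act_add_alg: "a \<in> carrier A \<Longrightarrow> b \<in> carrier A \<Longrightarrow> m \<in> V \<Longrightarrow> la (a \<oplus> b) m = la a m + la b m"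
    and act_add_spc: "a \<in> carrier A \<Longrightarrow> m \<in> V \<Longrightarrow> m' \<in> V \<Longrightarrow> la a (m + m') = la a m + la a m'"
    and act_scalar: "m \<in> V \<Longrightarrow> la (sc c) m = sm c m"
    and act_one: "m \<in> V \<Longrightarrow> la \<one> m = m"
    and act_mult: "a \<in> carrier A \<Longrightarrow> b \<in> carrier A \<Longrightarrow> m \<in> V \<Longrightarrow> la (a \<otimes> b) m = la a (la b m)"
    and act_parity: "a \<in> Ap d \<Longrightarrow> m \<in> Vp d' \<Longrightarrow> la a m \<in> Vp (d + d')"

locale right_supermodule =
  alg: superalgebra A sc Ap + spc: superspace sm V Vp
  for A :: "('a, 'b) ring_scheme" (structure) and sc Ap
    and sm :: "base \<Rightarrow> 'v::ab_group_add \<Rightarrow> 'v" and V Vp +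
  fixes ra :: "'v \<Rightarrow> 'a \<Rightarrow> 'v"
  assumes act_closed: "m \<in> V \<Longrightarrow> a \<in> carrier A \<Longrightarrow> ra m a \<in> V"
    and act_add_alg: "m \<in> V \<Longrightarrow> a \<in> carrier A \<Longrightarrow> b \<in> carrier A \<Longrightarrow> ra m (a \<oplus> b) = ra m a + ra m b"
    and act_add_spc: "m \<in> V \<Longrightarrow> m' \<in> V \<Longrightarrow> a \<in> carrier A \<Longrightarrow> ra (m + m') a = ra m a + ra m' a"
    and act_scalar: "m \<in> V \<Longrightarrow> ra m (sc c) = sm c m"
    and act_one: "m \<in> V \<Longrightarrow> ra m \<one> = m"
    and act_mult: "m \<in> V \<Longrightarrow> a \<in> carrier A \<Longrightarrow> b \<in> carrier A \<Longrightarrow> ra m (a \<otimes> b) = ra (ra m a) b"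
    and act_parity: "m \<in> Vp d \<Longrightarrow> a \<in> Ap d' \<Longrightarrow> ra m a \<in> Vp (d + d')"

definition right_submodule ::
  "('a, 'b) ring_scheme \<Rightarrow> (base \<Rightarrow> 'v::ab_group_add \<Rightarrow> 'v) \<Rightarrow> 'v set \<Rightarrow> ('v \<Rightarrow> 'a \<Rightarrow> 'v) \<Rightarrow> 'v set \<Rightarrow> bool" where
  "right_submodule A sm V ra V' \<longleftrightarrow> V' \<subseteq> V \<and> module.subspace sm V' \<and>
     (\<forall>m\<in>V'. \<forall>a\<in>carrier A. ra m a \<in> V')"

definition bisupermodule where
  "bisupermodule A scA Ap B scB Bp sm V Vp la ra \<longleftrightarrow>
     left_supermodule A scA Ap sm V Vp la \<and> right_supermodule B scB Bp sm V Vp ra \<and>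
     (\<forall>a\<in>carrier A. \<forall>m\<in>V. \<forall>b\<in>carrier B. ra (la a m) b = la a (ra m b))"


section \<open>Superalgebras given by generators and relations\<close>

datatype 'g fmon = Mon (letters: "'g list")

instantiation fmon :: (type) monoid_add
begin
definition "0 = Mon []"
definition "v + w = Mon (letters v @ letters w)"
instance by standard (auto simp: zero_fmon_def plus_fmon_def)
end

text \<open>The free algebra is the monoid algebra of the free monoid.\<close>

type_synonym 'g fa = "'g fmon \<Rightarrow>\<^sub>0 base"

definition gen :: "'g \<Rightarrow> 'g fa" where
  "gen g = Poly_Mapping.single (Mon [g]) 1"

definition scal :: "base \<Rightarrow> 'g fa" where
  "scal c = Poly_Mapping.single 0 c"

definition free_alg :: "'g set \<Rightarrow> 'g fa ring" where
  "free_alg G = \<lparr>carrier = {x. \<forall>w\<in>Poly_Mapping.keys x. set (letters w) \<subseteq> G},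
     monoid.mult = (*), one = 1, ring.zero = 0, add = (+)\<rparr>"

definition rel_ideal :: "'g set \<Rightarrow> 'g fa set \<Rightarrow> 'g fa set" where
  "rel_ideal G S = genideal (free_alg G) S"

definition presented :: "'g set \<Rightarrow> 'g fa set \<Rightarrow> 'g fa set ring" where
  "presented G S = free_alg G Quot rel_ideal G S"

definition cls :: "'g set \<Rightarrow> 'g fa set \<Rightarrow> 'g fa \<Rightarrow> 'g fa set" where
  "cls G S x = rel_ideal G S +>\<^bsub>free_alg G\<^esub> x"

definition presented_parity :: "('g \<Rightarrow> bit) \<Rightarrow> 'g set \<Rightarrow> 'g fa set \<Rightarrow> bit \<Rightarrow> 'g fa set set" where
  "presented_parity pr G S d = {cls G S x | x. x \<in> carrier (free_alg G) \<and>
     (\<forall>w\<in>Poly_Mapping.keys x. (\<Sum>g\<leftarrow>letters w. pr g) = d)}"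

text \<open>
  The left and the right action of the free algebra determined by operators \<open>h g\<close> for the
  generators \<open>g\<close>; an element of the quotient acts by the common value of its representatives.
\<close>

definition free_lact ::
  "(base \<Rightarrow> 'v::ab_group_add \<Rightarrow> 'v) \<Rightarrow> ('g \<Rightarrow> 'v \<Rightarrow> 'v) \<Rightarrow> 'g fa \<Rightarrow> 'v \<Rightarrow> 'v" where
  "free_lact sm h x m = (\<Sum>w\<in>Poly_Mapping.keys x. sm (Poly_Mapping.lookup x w) (foldr h (letters w) m))"

definition free_ract ::
  "(base \<Rightarrow> 'v::ab_group_add \<Rightarrow> 'v) \<Rightarrow> ('g \<Rightarrow> 'v \<Rightarrow> 'v) \<Rightarrow> 'g fa \<Rightarrow> 'v \<Rightarrow> 'v" where
  "free_ract sm h x m = (\<Sum>w\<in>Poly_Mapping.keys x. sm (Poly_Mapping.lookup x w) (fold h (letters w) m))"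

definition coset_lact where
  "coset_lact sm h a m = (THE m'. \<forall>x\<in>a. free_lact sm h x m = m')"

definition coset_ract where
  "coset_ract sm h m a = (THE m'. \<forall>x\<in>a. free_ract sm h x m = m')"


section \<open>The algebra \<open>\<U>(\<epsilon>)\<close>\<close>

text \<open>Throughout \<open>n = 2 * M\<close>. The function \<open>cyc M\<close> reduces an index to the range \<open>1, \<dots>, n\<close> modulo \<open>n\<close>.\<close>

definition cyc :: "nat \<Rightarrow> nat \<Rightarrow> nat" where
  "cyc M i = (if i mod (2 * M) = 0 then 2 * M else i mod (2 * M))"

definition eps :: "nat \<Rightarrow> nat \<Rightarrow> nat" where
  "eps M i = (if cyc M i \<le> M then 0 else 1)"

definition qi :: "nat \<Rightarrow> nat \<Rightarrow> base" where
  "qi M i = (-1) ^ eps M i * qq powi ((-1) ^ eps M i)"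

definition wts :: "nat \<Rightarrow> (nat \<Rightarrow>\<^sub>0 int) set" where
  "wts M = {\<mu>. Poly_Mapping.keys \<mu> \<subseteq> {1..2 * M}}"

definition dl :: "nat \<Rightarrow> nat \<Rightarrow> (nat \<Rightarrow>\<^sub>0 int)" where
  "dl M i = Poly_Mapping.single (cyc M i) 1"

definition al :: "nat \<Rightarrow> nat \<Rightarrow> (nat \<Rightarrow>\<^sub>0 int)" where
  "al M i = dl M i - dl M (i + 1)"

definition bq :: "nat \<Rightarrow> (nat \<Rightarrow>\<^sub>0 int) \<Rightarrow> (nat \<Rightarrow>\<^sub>0 int) \<Rightarrow> base" where
  "bq M \<mu> \<mu>' = (\<Prod>i = 1..2 * M. qi M i powi (Poly_Mapping.lookup \<mu> i * Poly_Mapping.lookup \<mu>' i))"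

datatype ugen = UK "nat \<Rightarrow>\<^sub>0 int" | UE nat | UF nat

definition U_gens :: "nat \<Rightarrow> ugen set" where
  "U_gens M = UK ` wts M \<union> UE ` {..<2 * M} \<union> UF ` {..<2 * M}"

fun U_par :: "nat \<Rightarrow> ugen \<Rightarrow> bit" where
  "U_par M (UK \<mu>) = 0"
| "U_par M (UE i) = of_nat (eps M i + eps M (i + 1))"
| "U_par M (UF i) = of_nat (eps M i + eps M (i + 1))"

abbreviation uk :: "(nat \<Rightarrow>\<^sub>0 int) \<Rightarrow> ugen fa" where
  "uk \<mu> \<equiv> gen (UK \<mu>)"

abbreviation ue :: "nat \<Rightarrow> nat \<Rightarrow> ugen fa" where
  "ue M i \<equiv> gen (UE (i mod (2 * M)))"

abbreviation uf :: "nat \<Rightarrow> nat \<Rightarrow> ugen fa" where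
  "uf M i \<equiv> gen (UF (i mod (2 * M)))"

definition even_ix :: "nat \<Rightarrow> nat \<Rightarrow> bool" where
  "even_ix M i \<longleftrightarrow> eps M i = eps M (i + 1)"

definition adj_ix :: "nat \<Rightarrow> nat \<Rightarrow> nat \<Rightarrow> bool" where
  "adj_ix M i j \<longleftrightarrow> (i + 1) mod (2 * M) = j mod (2 * M) \<or> (j + 1) mod (2 * M) = i mod (2 * M)"

definition two_q :: base where
  "two_q = qq + inverse qq"

text \<open>
  An element \<open>x - y\<close> of the following set encodes the relation \<open>x = y\<close>. By the first two relations
  \<open>k\<^sub>-\<^sub>\<mu>\<close> is the inverse of \<open>k\<^sub>\<mu>\<close>. The index \<open>i + 2 * M - 1\<close> is \<open>i - 1\<close> modulo \<open>n\<close>.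
\<close>

inductive_set U_rels :: "nat \<Rightarrow> ugen fa set" for M where
  k_zero: "uk 0 - 1 \<in> U_rels M"
| k_add: "\<lbrakk>\<mu> \<in> wts M; \<mu>' \<in> wts M\<rbrakk> \<Longrightarrow> uk (\<mu> + \<mu>') - uk \<mu> * uk \<mu>' \<in> U_rels M"
| k_e: "\<lbrakk>\<mu> \<in> wts M; i < 2 * M\<rbrakk> \<Longrightarrow>
    uk \<mu> * ue M i * uk (- \<mu>) - scal (bq M \<mu> (al M i)) * ue M i \<in> U_rels M"
| k_f: "\<lbrakk>\<mu> \<in> wts M; i < 2 * M\<rbrakk> \<Longrightarrow>
    uk \<mu> * uf M i * uk (- \<mu>) - scal (inverse (bq M \<mu> (al M i))) * uf M i \<in> U_rels M"
| e_f: "\<lbrakk>i < 2 * M; j < 2 * M\<rbrakk> \<Longrightarrow>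
    ue M i * uf M j - uf M j * ue M i
    - (if i = j then scal (inverse (qi M i - inverse (qi M i))) * (uk (al M i) - uk (- al M i)) else 0)
    \<in> U_rels M"
| odd_square: "\<lbrakk>y = ue M \<or> y = uf M; i < 2 * M; \<not> even_ix M i\<rbrakk> \<Longrightarrow> y i * y i \<in> U_rels M"
| commute: "\<lbrakk>y = ue M \<or> y = uf M; i < 2 * M; j < 2 * M; \<not> adj_ix M i j\<rbrakk> \<Longrightarrow>
    y i * y j - y j * y i \<in> U_rels M"
| even_serre: "\<lbrakk>y = ue M \<or> y = uf M; i < 2 * M; j < 2 * M; even_ix M i; adj_ix M i j\<rbrakk> \<Longrightarrow>
    y i * y i * y j - scal ((-1) ^ eps M i * two_q) * (y i * y j * y i) + y j * y i * y i \<in> U_rels M"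
| odd_serre: "\<lbrakk>y = ue M \<or> y = uf M; i < 2 * M; \<not> even_ix M i; h = i + 2 * M - 1\<rbrakk> \<Longrightarrow>
    y i * y h * y i * y (i + 1) - y i * y (i + 1) * y i * y h
    + y (i + 1) * y i * y h * y i - y h * y i * y (i + 1) * y i
    + scal ((-1) ^ eps M i * two_q) * (y i * y h * y (i + 1) * y i) \<in> U_rels M"

abbreviation U :: "nat \<Rightarrow> ugen fa set ring" where
  "U M \<equiv> presented (U_gens M) (U_rels M)"

abbreviation U_sc :: "nat \<Rightarrow> base \<Rightarrow> ugen fa set" where
  "U_sc M c \<equiv> cls (U_gens M) (U_rels M) (scal c)"

abbreviation U_parity :: "nat \<Rightarrow> bit \<Rightarrow> ugen fa set set" where
  "U_parity M \<equiv> presented_parity (U_par M) (U_gens M) (U_rels M)"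


section \<open>The superalgebra \<open>RC\<^sub>\<beta>\<close>\<close>

text \<open>In \<open>J\<close> the components \<open>0\<close> and \<open>1\<close> are \<open>False\<close> and \<open>True\<close>. Places are numbered from \<open>0\<close>.\<close>

type_synonym J = "int \<times> bool"

definition cart :: "int \<Rightarrow> int \<Rightarrow> int" where
  "cart i j = (if i = j then 2 else if \<bar>i - j\<bar> = 1 then -1 else 0)"

definition Qp :: "int \<Rightarrow> int \<Rightarrow> 'a::ring_1 \<Rightarrow> 'a \<Rightarrow> 'a" where
  "Qp i j u v = (if i = j then 0 else if i > j then (u - v) ^ nat (- cart i j)
     else (v - u) ^ nat (- cart i j))"

definition Qt :: "J \<Rightarrow> J \<Rightarrow> 'a::ring_1 \<Rightarrow> 'a \<Rightarrow> 'a" where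
  "Qt i j u v = Qp (fst i) (fst j) ((-1) ^ of_bool (snd i) * u) ((-1) ^ of_bool (snd j) * v)"

text \<open>
  The polynomial \<open>(Q(w, v) - Q(u, v)) / (w - u)\<close> for commuting \<open>u\<close>, \<open>v\<close>, \<open>w\<close>, where \<open>Q(u, v)\<close> is
  given as a polynomial in \<open>u\<close> whose coefficients are polynomials in \<open>v\<close>.
\<close>

definition ddiff :: "(base \<Rightarrow> 'a::ring_1) \<Rightarrow> base poly poly \<Rightarrow> 'a \<Rightarrow> 'a \<Rightarrow> 'a \<Rightarrow> 'a" where
  "ddiff h Q w u v = (\<Sum>r\<le>degree Q. \<Sum>s\<le>degree (coeff Q r).
     h (coeff (coeff Q r) s) * (\<Sum>k<r. w ^ (r - 1 - k) * u ^ k) * v ^ s)"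

definition Qt_poly :: "J \<Rightarrow> J \<Rightarrow> base poly poly" where
  "Qt_poly i j = Qt i j [:0, 1:] [:[:0, 1:]:]"

lemma ddiff_Qt_poly:
  fixes w u v :: "'a::comm_ring_1"
  assumes "h 0 = 0" "h 1 = 1" "h (-1) = -1"
  shows "(w - u) * ddiff h (Qt_poly i j) w u v = Qt i j w v - Qt i j u v"
proof -
  have "fst i = fst j \<or> cart (fst i) (fst j) = -1 \<or> cart (fst i) (fst j) = 0"
    by (auto simp: cart_def)
  then show ?thesis
    using assms
    by (auto simp: Qt_poly_def Qt_def Qp_def ddiff_def of_bool_def one_pCons algebra_simps)
qed

datatype rcgen = GE "J list" | GX nat | GS nat | GC nat

definition ht :: "(int \<Rightarrow>\<^sub>0 nat) \<Rightarrow> nat" where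
  "ht \<beta> = (\<Sum>i\<in>Poly_Mapping.keys \<beta>. Poly_Mapping.lookup \<beta> i)"

definition Jseq :: "(int \<Rightarrow>\<^sub>0 nat) \<Rightarrow> J list set" where
  "Jseq \<beta> = {\<nu>. length \<nu> = ht \<beta> \<and> (\<Sum>j\<leftarrow>\<nu>. Poly_Mapping.single (fst j) 1) = \<beta>}"

definition flipJ :: "J \<Rightarrow> J" where
  "flipJ j = (fst j, \<not> snd j)"

definition flip :: "nat \<Rightarrow> J list \<Rightarrow> J list" where
  "flip p \<nu> = \<nu>[p := flipJ (\<nu> ! p)]"

definition swp :: "nat \<Rightarrow> J list \<Rightarrow> J list" where
  "swp a \<nu> = \<nu>[a := \<nu> ! Suc a, Suc a := \<nu> ! a]"

definition RC_gens :: "(int \<Rightarrow>\<^sub>0 nat) \<Rightarrow> rcgen set" where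
  "RC_gens \<beta> = GE ` Jseq \<beta> \<union> GX ` {..<ht \<beta>} \<union> GS ` {a. Suc a < ht \<beta>} \<union> GC ` {..<ht \<beta>}"

fun RC_par :: "rcgen \<Rightarrow> bit" where
  "RC_par (GE \<nu>) = 0"
| "RC_par (GX p) = 0"
| "RC_par (GS a) = 0"
| "RC_par (GC p) = 1"

abbreviation ge :: "J list \<Rightarrow> rcgen fa" where "ge \<nu> \<equiv> gen (GE \<nu>)"
abbreviation gx :: "nat \<Rightarrow> rcgen fa" where "gx p \<equiv> gen (GX p)"
abbreviation gs :: "nat \<Rightarrow> rcgen fa" where "gs a \<equiv> gen (GS a)"
abbreviation gc :: "nat \<Rightarrow> rcgen fa" where "gc p \<equiv> gen (GC p)"

inductive_set RC_rels :: "(int \<Rightarrow>\<^sub>0 nat) \<Rightarrow> rcgen fa set" for \<beta> where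
  e_e: "\<lbrakk>\<mu> \<in> Jseq \<beta>; \<nu> \<in> Jseq \<beta>\<rbrakk> \<Longrightarrow> ge \<mu> * ge \<nu> - (if \<mu> = \<nu> then ge \<mu> else 0) \<in> RC_rels \<beta>"
| e_sum: "(\<Sum>\<nu>\<in>Jseq \<beta>. ge \<nu>) - 1 \<in> RC_rels \<beta>"
| x_e: "\<lbrakk>p < ht \<beta>; \<nu> \<in> Jseq \<beta>\<rbrakk> \<Longrightarrow> gx p * ge \<nu> - ge \<nu> * gx p \<in> RC_rels \<beta>"
| c_e: "\<lbrakk>p < ht \<beta>; \<nu> \<in> Jseq \<beta>\<rbrakk> \<Longrightarrow> gc p * ge \<nu> - ge (flip p \<nu>) * gc p \<in> RC_rels \<beta>"
| x_x: "\<lbrakk>p < ht \<beta>; r < ht \<beta>\<rbrakk> \<Longrightarrow> gx p * gx r - gx r * gx p \<in> RC_rels \<beta>"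
| c_c: "\<lbrakk>p < ht \<beta>; r < ht \<beta>\<rbrakk> \<Longrightarrow> gc p * gc r + gc r * gc p - (if p = r then 2 else 0) \<in> RC_rels \<beta>"
| c_x: "\<lbrakk>p < ht \<beta>; r < ht \<beta>\<rbrakk> \<Longrightarrow> gc p * gx r - (-1) ^ of_bool (p = r) * (gx r * gc p) \<in> RC_rels \<beta>"
| s_e: "\<lbrakk>Suc a < ht \<beta>; \<nu> \<in> Jseq \<beta>\<rbrakk> \<Longrightarrow> gs a * ge \<nu> - ge (swp a \<nu>) * gs a \<in> RC_rels \<beta>"
| s_c: "\<lbrakk>Suc a < ht \<beta>; p < ht \<beta>\<rbrakk> \<Longrightarrow>
    gs a * gc p - gc (Transposition.transpose a (Suc a) p) * gs a \<in> RC_rels \<beta>"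
| s_x: "\<lbrakk>Suc a < ht \<beta>; p < ht \<beta>; p \<noteq> a; p \<noteq> Suc a\<rbrakk> \<Longrightarrow> gs a * gx p - gx p * gs a \<in> RC_rels \<beta>"
| s_x_right: "\<lbrakk>Suc a < ht \<beta>; \<nu> \<in> Jseq \<beta>\<rbrakk> \<Longrightarrow>
    (gs a * gx (Suc a) - gx a * gs a) * ge \<nu>
    - (if \<nu> ! a = \<nu> ! Suc a then ge \<nu>
       else if \<nu> ! a = flipJ (\<nu> ! Suc a) then - (gc a * gc (Suc a) * ge \<nu>) else 0) \<in> RC_rels \<beta>"
| s_x_left: "\<lbrakk>Suc a < ht \<beta>; \<nu> \<in> Jseq \<beta>\<rbrakk> \<Longrightarrow>
    (gx (Suc a) * gs a - gs a * gx a) * ge \<nu>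
    - (if \<nu> ! a = \<nu> ! Suc a then ge \<nu>
       else if \<nu> ! a = flipJ (\<nu> ! Suc a) then gc a * gc (Suc a) * ge \<nu> else 0) \<in> RC_rels \<beta>"
| s_square: "\<lbrakk>Suc a < ht \<beta>; \<nu> \<in> Jseq \<beta>\<rbrakk> \<Longrightarrow>
    gs a * gs a * ge \<nu> - Qt (\<nu> ! a) (\<nu> ! Suc a) (gx a) (gx (Suc a)) * ge \<nu> \<in> RC_rels \<beta>"
| s_commute: "\<lbrakk>Suc a < ht \<beta>; Suc b < ht \<beta>; Suc a < b \<or> Suc b < a\<rbrakk> \<Longrightarrow>
    gs a * gs b - gs b * gs a \<in> RC_rels \<beta>"
| s_braid: "\<lbrakk>Suc (Suc a) < ht \<beta>; \<nu> \<in> Jseq \<beta>\<rbrakk> \<Longrightarrow>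
    (gs (Suc a) * gs a * gs (Suc a) - gs a * gs (Suc a) * gs a) * ge \<nu>
    - (if \<nu> ! a = \<nu> ! (a + 2)
       then ddiff scal (Qt_poly (\<nu> ! a) (\<nu> ! Suc a)) (gx (a + 2)) (gx a) (gx (Suc a)) * ge \<nu>
       else if \<nu> ! a = flipJ (\<nu> ! (a + 2))
       then ddiff scal (Qt_poly (\<nu> ! a) (\<nu> ! Suc a)) (gx (a + 2)) (- gx a) (gx (Suc a))
         * (gc a * gc (a + 2)) * ge \<nu>
       else 0) \<in> RC_rels \<beta>"

abbreviation RC :: "(int \<Rightarrow>\<^sub>0 nat) \<Rightarrow> rcgen fa set ring" where
  "RC \<beta> \<equiv> presented (RC_gens \<beta>) (RC_rels \<beta>)"

abbreviation RC_gen :: "(int \<Rightarrow>\<^sub>0 nat) \<Rightarrow> rcgen \<Rightarrow> rcgen fa set" where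
  "RC_gen \<beta> g \<equiv> cls (RC_gens \<beta>) (RC_rels \<beta>) (gen g)"

abbreviation RC_sc :: "(int \<Rightarrow>\<^sub>0 nat) \<Rightarrow> base \<Rightarrow> rcgen fa set" where
  "RC_sc \<beta> c \<equiv> cls (RC_gens \<beta>) (RC_rels \<beta>) (scal c)"

abbreviation RC_parity :: "(int \<Rightarrow>\<^sub>0 nat) \<Rightarrow> bit \<Rightarrow> rcgen fa set set" where
  "RC_parity \<beta> \<equiv> presented_parity RC_par (RC_gens \<beta>) (RC_rels \<beta>)"


section \<open>The spaces\<close>

datatype sharp = Prime | Tw

text \<open>
  The element \<open>single (\<nu>, w) f\<close> stands for \<open>f \<otimes> (w\<^sub>i\<^sub>0 \<otimes> w\<^sub>i\<^sub>1 \<otimes> \<dots>) e(\<nu>)\<close>, where \<open>w\<close> is the list of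
  the indices \<open>i\<^sub>0, i\<^sub>1, \<dots>\<close>.
\<close>

type_synonym VT = "(J list \<times> nat list) \<Rightarrow>\<^sub>0 K"

definition kscale :: "K \<Rightarrow> VT \<Rightarrow> VT" where
  "kscale f m = Poly_Mapping.map ((*) f) m"

definition vscale :: "base \<Rightarrow> VT \<Rightarrow> VT" where
  "vscale c = kscale (cK c)"

definition words :: "nat \<Rightarrow> nat \<Rightarrow> nat list set" where
  "words M l = {w. length w = l \<and> set w \<subseteq> {1..2 * M}}"

text \<open>
  As sets of coordinate vectors these spaces do not depend on \<open>\<sharp>\<close>; the meaning of the variables
  \<open>t\<^sub>p\<close>, and hence all operators below, do.
\<close>

definition VK :: "nat \<Rightarrow> (int \<Rightarrow>\<^sub>0 nat) \<Rightarrow> VT set" where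
  "VK M \<beta> = {m. Poly_Mapping.keys m \<subseteq> Jseq \<beta> \<times> words M (ht \<beta>) \<and>
     (\<forall>b. Poly_Mapping.lookup m b \<in> ser_frac (ht \<beta>))}"

definition VO :: "nat \<Rightarrow> (int \<Rightarrow>\<^sub>0 nat) \<Rightarrow> VT set" where
  "VO M \<beta> = {m. Poly_Mapping.keys m \<subseteq> Jseq \<beta> \<times> words M (ht \<beta>) \<and>
     (\<forall>b. Poly_Mapping.lookup m b \<in> to_K ` ser_ring (ht \<beta>))}"

definition of_parity :: "nat \<Rightarrow> VT set \<Rightarrow> bit \<Rightarrow> VT set" where
  "of_parity M V d = {m \<in> V. \<forall>(\<nu>, w)\<in>Poly_Mapping.keys m. of_nat (\<Sum>i\<leftarrow>w. eps M i) = d}"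

text \<open>The value \<open>X(j)\<close>, the series \<open>X\<^sub>p\<close> and the element \<open>x\<^sub>p\<close> in the summand of \<open>\<nu>\<close>.\<close>

fun Xval :: "sharp \<Rightarrow> J \<Rightarrow> base" where
  "Xval Prime j = qq powi (- 2 * fst j)"
| "Xval Tw j = qq powi (- ((-1) ^ of_bool (snd j)) * 2 * fst j)"

definition Xser :: "sharp \<Rightarrow> J list \<Rightarrow> nat \<Rightarrow> base mfps" where
  "Xser s \<nu> p = mconst (Xval s (\<nu> ! p)) + mvar p"

abbreviation XK :: "sharp \<Rightarrow> J list \<Rightarrow> nat \<Rightarrow> K" where
  "XK s \<nu> p \<equiv> to_K (Xser s \<nu> p)"

fun xK :: "sharp \<Rightarrow> J list \<Rightarrow> nat \<Rightarrow> K" where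
  "xK Prime \<nu> p = (XK Prime \<nu> p - cK (Xval Prime (\<nu> ! p))) / cK (Xval Prime (\<nu> ! p))"
| "xK Tw \<nu> p = (XK Tw \<nu> p - cK (Xval Tw (\<nu> ! p))) / (XK Tw \<nu> p + cK (Xval Tw (\<nu> ! p)))"

text \<open>The additive extension of an operator given on the elements \<open>single b f\<close>.\<close>

definition lin_ext :: "(K \<Rightarrow> J list \<times> nat list \<Rightarrow> VT) \<Rightarrow> VT \<Rightarrow> VT" where
  "lin_ext h m = (\<Sum>b\<in>Poly_Mapping.keys m. h (Poly_Mapping.lookup m b) b)"


subsection \<open>The left action\<close>

text \<open>
  On \<open>l\<close> tensor factors the iterated coproduct is \<open>\<Sum>\<^sub>p 1 \<otimes> \<dots> \<otimes> 1 \<otimes> e\<^sub>i \<otimes> k\<^sup>-\<^sup>1 \<otimes> \<dots> \<otimes> k\<^sup>-\<^sup>1\<close> for \<open>e\<^sub>i\<close> and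
  \<open>\<Sum>\<^sub>p k \<otimes> \<dots> \<otimes> k \<otimes> f\<^sub>i \<otimes> 1 \<otimes> \<dots> \<otimes> 1\<close> for \<open>f\<^sub>i\<close>, where \<open>k\<close> belongs to \<open>\<alpha>\<^sub>i\<close> and \<open>e\<^sub>i\<close>, \<open>f\<^sub>i\<close> are at
  place \<open>p\<close>.
\<close>

fun U_op1 :: "nat \<Rightarrow> sharp \<Rightarrow> ugen \<Rightarrow> K \<Rightarrow> J list \<times> nat list \<Rightarrow> VT" where
  "U_op1 M s (UK \<mu>) f (\<nu>, w) =
     Poly_Mapping.single (\<nu>, w) (cK (\<Prod>i\<leftarrow>w. bq M \<mu> (dl M i)) * f)"
| "U_op1 M s (UE i) f (\<nu>, w) = (\<Sum>p<length w. if w ! p = cyc M (i + 1) then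
     Poly_Mapping.single (\<nu>, w[p := cyc M i])
       ((if i = 0 then XK s \<nu> p else 1) * cK (\<Prod>j\<leftarrow>drop (Suc p) w. bq M (- al M i) (dl M j)) * f)
     else 0)"
| "U_op1 M s (UF i) f (\<nu>, w) = (\<Sum>p<length w. if w ! p = cyc M i then
     Poly_Mapping.single (\<nu>, w[p := cyc M (i + 1)])
       ((if i = 0 then inverse (XK s \<nu> p) else 1) * cK (\<Prod>j\<leftarrow>take p w. bq M (al M i) (dl M j)) * f)
     else 0)"

definition U_op :: "nat \<Rightarrow> sharp \<Rightarrow> ugen \<Rightarrow> VT \<Rightarrow> VT" where
  "U_op M s g = lin_ext (U_op1 M s g)"

definition lact :: "nat \<Rightarrow> sharp \<Rightarrow> ugen fa set \<Rightarrow> VT \<Rightarrow> VT" where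
  "lact M s = coset_lact vscale (U_op M s)"


subsection \<open>The right action\<close>

definition WW :: "nat \<Rightarrow> (nat \<Rightarrow>\<^sub>0 base) set" where
  "WW M = {v. Poly_Mapping.keys v \<subseteq> {1..2 * M}}"

definition odd_involution :: "nat \<Rightarrow> ((nat \<Rightarrow>\<^sub>0 base) \<Rightarrow> (nat \<Rightarrow>\<^sub>0 base)) \<Rightarrow> bool" where
  "odd_involution M P \<longleftrightarrow>
     (\<forall>v\<in>WW M. P v \<in> WW M) \<and>
     (\<forall>v\<in>WW M. \<forall>v'\<in>WW M. P (v + v') = P v + P v') \<and>
     (\<forall>c. \<forall>v\<in>WW M. P (Poly_Mapping.map ((*) c) v) = Poly_Mapping.map ((*) c) (P v)) \<and>
     (\<forall>d. \<forall>v\<in>WW M. (\<forall>i\<in>Poly_Mapping.keys v. eps M i = d) \<longrightarrow>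
        (\<forall>i\<in>Poly_Mapping.keys (P v). eps M i \<noteq> d)) \<and>
     (\<forall>v\<in>WW M. P (P v) = v)"

text \<open>
  The substitutions \<open>X\<^sub>p \<mapsto> X\<^sub>p\<^sup>-\<^sup>1\<close> and \<open>X\<^sub>k \<leftrightarrow> X\<^sub>k\<^sub>+\<^sub>1\<close> out of the field of \<open>\<nu>\<close>. Since \<open>t\<^sub>p = X\<^sub>p - X(\<nu>\<^sub>p)\<close>, the
  former sends \<open>t\<^sub>p\<close> to \<open>X\<^sub>p\<^sup>-\<^sup>1 - X(\<nu>\<^sub>p)\<close>, where now \<open>X\<^sub>p\<close> is the series for \<open>c\<^sub>p(\<nu>)\<close>, and the latter
  exchanges \<open>t\<^sub>k\<close> and \<open>t\<^sub>k\<^sub>+\<^sub>1\<close>.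
\<close>

fun theta :: "sharp \<Rightarrow> J list \<Rightarrow> nat \<Rightarrow> K \<Rightarrow> K" where
  "theta Prime \<nu> p f = f"
| "theta Tw \<nu> p f = fract_map (mfps_subst
     (\<lambda>i. if i = p then mfps_inv (Xser Tw (flip p \<nu>) p) - mconst (Xval Tw (\<nu> ! p)) else mvar i)) f"

definition swapK :: "nat \<Rightarrow> K \<Rightarrow> K" where
  "swapK k = fract_map (mfps_subst (\<lambda>i. mvar (Transposition.transpose k (Suc k) i)))"

definition c_op1 :: "nat \<Rightarrow> ((nat \<Rightarrow>\<^sub>0 base) \<Rightarrow> (nat \<Rightarrow>\<^sub>0 base)) \<Rightarrow> sharp \<Rightarrow> nat \<Rightarrow>
    K \<Rightarrow> J list \<times> nat list \<Rightarrow> VT" where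
  "c_op1 M P s p f = (\<lambda>(\<nu>, w). let v = P (Poly_Mapping.single (w ! p) 1) in
     \<Sum>j\<in>Poly_Mapping.keys v. Poly_Mapping.single (flip p \<nu>, w[p := j])
       (cK ((-1) ^ (\<Sum>i\<leftarrow>drop p w. eps M i) * iu * Poly_Mapping.lookup v j) * theta s \<nu> p f))"

definition c_op :: "nat \<Rightarrow> ((nat \<Rightarrow>\<^sub>0 base) \<Rightarrow> (nat \<Rightarrow>\<^sub>0 base)) \<Rightarrow> sharp \<Rightarrow> nat \<Rightarrow> VT \<Rightarrow> VT" where
  "c_op M P s p = lin_ext (c_op1 M P s p)"

text \<open>The vector \<open>R(z)(w\<^sub>i \<otimes> w\<^sub>j)\<close> in the basis \<open>w\<^sub>a \<otimes> w\<^sub>b\<close>.\<close>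

definition Rmat :: "nat \<Rightarrow> K \<Rightarrow> nat \<Rightarrow> nat \<Rightarrow> (nat \<times> nat) \<Rightarrow>\<^sub>0 K" where
  "Rmat M z i j = (let q = cK qq in
     if i = j then Poly_Mapping.single (i, i) (if i \<le> M then (1 - q^2 * z) / (z - q^2) else 1)
     else Poly_Mapping.single (i, j) (if i < j then (1 - q^2) / (z - q^2) else z * (1 - q^2) / (z - q^2))
        + Poly_Mapping.single (j, i) (q * (1 - z) / (z - q^2)))"

definition R_op1 :: "nat \<Rightarrow> K \<Rightarrow> nat \<Rightarrow> K \<Rightarrow> J list \<times> nat list \<Rightarrow> VT" where
  "R_op1 M z k f = (\<lambda>(\<nu>, w). let r = Rmat M z (w ! k) (w ! Suc k) in
     \<Sum>(i, j)\<in>Poly_Mapping.keys r.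
       Poly_Mapping.single (\<nu>, w[k := i, Suc k := j]) (Poly_Mapping.lookup r (i, j) * f))"

definition Pp :: "int \<Rightarrow> int \<Rightarrow> K \<Rightarrow> K \<Rightarrow> K" where
  "Pp i j u v = (if i > j then 1 else Qp i j u v)"

text \<open>
  The operators of \<open>x\<^sub>p\<close> and \<open>\<sigma>\<^sub>k\<close> on the summands of those \<open>\<nu>\<close> all of whose second components
  are \<open>0\<close>, and then on all summands.
\<close>

definition x_op0 :: "sharp \<Rightarrow> nat \<Rightarrow> K \<Rightarrow> J list \<times> nat list \<Rightarrow> VT" where
  "x_op0 s p f = (\<lambda>(\<nu>, w). Poly_Mapping.single (\<nu>, w) (xK s \<nu> p * f))"

definition s_op0 :: "nat \<Rightarrow> sharp \<Rightarrow> nat \<Rightarrow> K \<Rightarrow> J list \<times> nat list \<Rightarrow> VT" where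
  "s_op0 M s k f = (\<lambda>(\<nu>, w). let z = XK s (swp k \<nu>) (Suc k) / XK s (swp k \<nu>) k in
     if \<nu> ! k \<noteq> \<nu> ! Suc k then
       R_op1 M z k (swapK k (f * Pp (fst (\<nu> ! k)) (fst (\<nu> ! Suc k)) (xK s \<nu> k) (xK s \<nu> (Suc k)))) (swp k \<nu>, w)
     else
       kscale (inverse (xK s \<nu> k - xK s \<nu> (Suc k)))
         (R_op1 M z k (swapK k f) (\<nu>, w) - Poly_Mapping.single (\<nu>, w) f))"

definition odd_places :: "J list \<Rightarrow> nat list" where
  "odd_places \<nu> = filter (\<lambda>p. snd (\<nu> ! p)) [0..<length \<nu>]"

definition x_op1 :: "nat \<Rightarrow> ((nat \<Rightarrow>\<^sub>0 base) \<Rightarrow> (nat \<Rightarrow>\<^sub>0 base)) \<Rightarrow> sharp \<Rightarrow> nat \<Rightarrow>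
    K \<Rightarrow> J list \<times> nat list \<Rightarrow> VT" where
  "x_op1 M P s p f = (\<lambda>(\<nu>, w). let js = odd_places \<nu> in
     vscale ((-1) ^ of_bool (p \<in> set js))
       (fold (c_op M P s) (rev js) (lin_ext (x_op0 s p)
         (fold (c_op M P s) js (Poly_Mapping.single (\<nu>, w) f)))))"

definition s_op1 :: "nat \<Rightarrow> ((nat \<Rightarrow>\<^sub>0 base) \<Rightarrow> (nat \<Rightarrow>\<^sub>0 base)) \<Rightarrow> sharp \<Rightarrow> nat \<Rightarrow>
    K \<Rightarrow> J list \<times> nat list \<Rightarrow> VT" where
  "s_op1 M P s k f = (\<lambda>(\<nu>, w). let js = odd_places \<nu> in
     fold (c_op M P s) (map (Transposition.transpose k (Suc k)) (rev js)) (lin_ext (s_op0 M s k)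
       (fold (c_op M P s) js (Poly_Mapping.single (\<nu>, w) f))))"

fun RC_op :: "nat \<Rightarrow> ((nat \<Rightarrow>\<^sub>0 base) \<Rightarrow> (nat \<Rightarrow>\<^sub>0 base)) \<Rightarrow> sharp \<Rightarrow> rcgen \<Rightarrow> VT \<Rightarrow> VT" where
  "RC_op M P s (GE \<mu>) =
     lin_ext (\<lambda>f (\<nu>, w). if \<nu> = \<mu> then Poly_Mapping.single (\<nu>, w) f else 0)"
| "RC_op M P s (GX p) = lin_ext (x_op1 M P s p)"
| "RC_op M P s (GS k) = lin_ext (s_op1 M P s k)"
| "RC_op M P s (GC p) = c_op M P s p"

definition ract :: "nat \<Rightarrow> ((nat \<Rightarrow>\<^sub>0 base) \<Rightarrow> (nat \<Rightarrow>\<^sub>0 base)) \<Rightarrow> sharp \<Rightarrow>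
    VT \<Rightarrow> rcgen fa set \<Rightarrow> VT" where
  "ract M P s = coset_ract vscale (RC_op M P s)"


subsection \<open>The subalgebras\<close>

definition U_P :: "nat \<Rightarrow> ((nat \<Rightarrow>\<^sub>0 base) \<Rightarrow> (nat \<Rightarrow>\<^sub>0 base)) \<Rightarrow> sharp \<Rightarrow> ugen fa set set" where
  "U_P M P s = (\<Inter>\<beta>. {u \<in> carrier (U M). \<forall>a\<in>carrier (RC \<beta>). \<forall>m\<in>VO M \<beta>.
     lact M s u (ract M P s m a) = ract M P s (lact M s u m) a})"

end

(*
  The module over RC_beta. Up to the factor (1 - z)/(z - q^2) the R-matrix differs from the identity by an operator
  N without spectral parameter, so R inherits unitarity and the Yang-Baxter equation from the Hecke relations for N.
  Together with the substitutions s_k these give all relations on the summands whose second components are 0: the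
  division by x_k - x_{k+1} for equal residues and the factor P_ij for different ones turn R into intertwiners, and
  the right hand sides are the corresponding divided differences. Every other summand is reached from such a one by
  the invertible operators c_p, and the defects of the relations are compatible with the c_p; so the relations hold
  everywhere, by induction on the number of places with second component 1. The lattice over the power series is
  preserved because a pole of R at the base point occurs only between neighbouring residues, where P_ij cancels it,
  and because an antisymmetric series is divisible by the difference of its two variables.

  The module over U(epsilon). The relations are checked by induction on the number of tensor factors: e_i (or f_i)
  acts as A_i + B_i with A_i B_j = c_ij B_j A_i, where B_i acts on one factor only, and the mixed terms cancel.
  The relation between e_i and f_i is a telescoping sum over the places.

  The commutant of a graded action is graded, since the two defects of the homogeneous parts of an element of the
  commutant are of opposite parity and sum up to 0.
*)
theory Submission
  imports Defs
begin

section \<open>The domain of power series: units, substitutions, passage to fractions\<close>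

section \<open>Power series in several variables\<close>

text \<open>The action on a summand with odd second components is never computed. There the
  operators are conjugates, by an ordered product of c_j, of their even versions; reordering the
  anticommuting c_j costs signs, which occur twice and cancel. For the same reason little has to be
  known about \<theta>: a ring homomorphism fixing constants, with \<theta>_p an involution and
  \<theta>_p, \<theta>_r commuting. So both values of \<sharp> are treated together. That c_p
  squares to 1 comes from two signs -1: the square of the chosen root of -1, and the parity change
  of the p-th factor, which is counted in the sign of c_p. All series live in one domain with
  infinitely many variables, where substitution has to be shown meaningful before it can be
  multiplicative. The operators of RC are only semilinear over the fraction field, so equalities are
  checked on basis vectors with arbitrary coefficients; those of U(\<epsilon>) are linear. The
  superalgebra structure of a quotient needs an argument too: its even and odd parts meet in 0
  because the relations are homogeneous.\<close>

lemmas mcoeff_simps [simp] = zero_mfps.rep_eq one_mfps.rep_eq plus_mfps.rep_eq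
  minus_mfps.rep_eq uminus_mfps.rep_eq mconst.rep_eq mvar.rep_eq

lemma mcoeff_sum: "mcoeff (sum f A) m = (\<Sum>x\<in>A. mcoeff (f x) m)"
  by (induction A rule: infinite_finite_induct) auto

lemma mcoeff_mult_nonzeroE:
  assumes "mcoeff (f * g) m \<noteq> 0"
  obtains a b where "a + b = m" "mcoeff f a \<noteq> 0" "mcoeff g b \<noteq> 0"
proof -
  from assms obtain x where "x \<in> {(a, b). a + b = m}" "(case x of (a, b) \<Rightarrow> mcoeff f a * mcoeff g b) \<noteq> 0"
    unfolding times_mfps.rep_eq by (meson sum.not_neutral_contains_not_neutral)
  then show ?thesis using that by (cases x) (metis (mono_tags, lifting) case_prod_conv mem_Collect_eq mult_zero_left mult_zero_right)
qed

lemma mcoeff_mconst_mult [simp]: "mcoeff (mconst c * f) m = c * mcoeff f m"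
proof -
  have "mcoeff (mconst c * f) m = (\<Sum>(a, b) \<in> {({#} :: nat multiset, m)}. (if a = {#} then c else 0) * mcoeff f b)"
    unfolding times_mfps.rep_eq mconst.rep_eq
    by (rule sum.mono_neutral_right) (auto simp: finite_splits split: if_splits)
  then show ?thesis by simp
qed

lemma mcoeff_mvar_mult:
  "mcoeff (mvar i * f) m = (if i \<in># m then mcoeff f (m - {#i#}) else 0)"
proof -
  have "mcoeff (mvar i * f) m =
      (\<Sum>(a, b) \<in> (if i \<in># m then {({#i#}, m - {#i#})} else {}). (if a = {#i#} then 1 else 0) * mcoeff f b)"
    unfolding times_mfps.rep_eq mvar.rep_eq
    by (rule sum.mono_neutral_right) (auto simp: finite_splits split: if_splits)
  then show ?thesis by simp
qed

lemma mconst_hom [simp]: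
  "mconst 0 = 0" "mconst (1 :: 'a::comm_ring_1) = 1"
  "mconst (a + b :: 'a) = mconst a + mconst b" "mconst (a - b :: 'a) = mconst a - mconst b"
  "mconst (- a :: 'a) = - mconst a" "mconst (a * b :: 'a) = mconst a * mconst b"
  by (rule mfps_eqI; simp)+

lemma mconst_eq_iff [simp]: "mconst a = mconst b \<longleftrightarrow> a = b"
  by (metis mconst.rep_eq)

text \<open>Sets of variables other than \<open>{..<l}\<close> occur as well:
  \<open>ser_on {p}\<close> describes the series in \<open>t_p\<close> alone, which is how a
  substitution changing one variable is controlled.\<close>

definition ser_on :: "nat set \<Rightarrow> 'a::comm_ring_1 mfps set" where
  "ser_on S = {f. \<forall>m. mcoeff f m \<noteq> 0 \<longrightarrow> set_mset m \<subseteq> S}"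

lemma ser_ring_eq: "ser_ring l = ser_on {..<l}"
  by (simp add: ser_ring_def ser_on_def)

lemma ser_on_closed [intro]:
  "0 \<in> ser_on S" "1 \<in> ser_on S" "mconst c \<in> ser_on S" "i \<in> S \<Longrightarrow> mvar i \<in> ser_on S"
  "f \<in> ser_on S \<Longrightarrow> g \<in> ser_on S \<Longrightarrow> f + g \<in> ser_on S"
  "f \<in> ser_on S \<Longrightarrow> g \<in> ser_on S \<Longrightarrow> f - g \<in> ser_on S"
  "f \<in> ser_on S \<Longrightarrow> - f \<in> ser_on S"
proof -
  show "f \<in> ser_on S \<Longrightarrow> g \<in> ser_on S \<Longrightarrow> f + g \<in> ser_on S"
    unfolding ser_on_def by (auto, metis add.right_neutral add.left_neutral subsetD)
  show "f \<in> ser_on S \<Longrightarrow> g \<in> ser_on S \<Longrightarrow> f - g \<in> ser_on S"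
    unfolding ser_on_def by (auto, metis diff_self subsetD)
qed (auto simp: ser_on_def)

lemma ser_on_mult [intro]:
  assumes "f \<in> ser_on S" "g \<in> ser_on S" shows "f * g \<in> ser_on S"
  using assms unfolding ser_on_def by (auto elim!: mcoeff_mult_nonzeroE) (meson in_mono)+

lemma ser_on_power [intro]: "f \<in> ser_on S \<Longrightarrow> f ^ n \<in> ser_on S"
  by (induction n) auto

lemma ser_on_sum [intro]: "(\<And>x. x \<in> A \<Longrightarrow> f x \<in> ser_on S) \<Longrightarrow> sum f A \<in> ser_on S"
  by (induction A rule: infinite_finite_induct) auto

text \<open>Each of the \<open>k\<close> factors contributes a nonempty monomial, so their product
  has size at least \<open>k\<close>.\<close>

lemma mcoeff_power_eq_0:
  assumes "mcoeff f {#} = 0" "size n < k"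
  shows "mcoeff (f ^ k) n = 0"
  using assms(2)
proof (induction k arbitrary: n)
  case (Suc k)
  show ?case
  proof (rule ccontr)
    assume "mcoeff (f ^ Suc k) n \<noteq> 0"
    then obtain a b where ab: "a + b = n" "mcoeff f a \<noteq> 0" "mcoeff (f ^ k) b \<noteq> 0"
      by (auto elim: mcoeff_mult_nonzeroE)
    with assms have "a \<noteq> {#}" by auto
    then have "size a > 0" by (simp add: nonempty_has_size)
    with ab Suc have "mcoeff (f ^ k) b = 0" by (intro Suc.IH) auto
    with ab show False by simp
  qed
qed simp

text \<open>The geometric series: its coefficient at \<open>n\<close> is a finite sum, as \<open>h\<close> has no constant term.\<close>

lemma ex_inverse_one_minus:
  fixes h :: "'a::comm_ring_1 mfps"
  assumes h: "mcoeff h {#} = 0" "h \<in> ser_on S"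
  shows "\<exists>g\<in>ser_on S. (1 - h) * g = 1"
proof
  define g where "g = Abs_mfps (\<lambda>n. mcoeff (\<Sum>k\<le>size n. h ^ k) n)"
  have g: "mcoeff g n = mcoeff (\<Sum>k\<le>size n. h ^ k) n" for n
    by (simp add: g_def Abs_mfps_inverse)
  have g': "mcoeff g b = mcoeff (\<Sum>k\<le>N. h ^ k) b" if "size b \<le> N" for b N
  proof -
    have "mcoeff (\<Sum>k\<le>N. h ^ k) b = (\<Sum>k\<le>N. mcoeff (h ^ k) b)" by (simp add: mcoeff_sum)
    also have "\<dots> = (\<Sum>k\<le>size b. mcoeff (h ^ k) b)"
      using that by (intro sum.mono_neutral_right) (auto intro!: mcoeff_power_eq_0 h)
    finally show ?thesis by (simp add: g mcoeff_sum)
  qed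
  show "(1 - h) * g = 1"
  proof (rule mfps_eqI)
    fix n
    have "mcoeff ((1 - h) * g) n = mcoeff ((1 - h) * (\<Sum>k\<le>size n. h ^ k)) n"
      unfolding times_mfps.rep_eq by (intro sum.cong refl) (auto intro!: g' arg_cong2[where f = "(*)"])
    also have "(1 - h) * (\<Sum>k\<le>size n. h ^ k) = 1 - h ^ Suc (size n)"
      using one_diff_power_eq[of h "Suc (size n)"] by (simp add: lessThan_Suc_atMost)
    also have "mcoeff (1 - h ^ Suc (size n)) n = mcoeff 1 n"
      using mcoeff_power_eq_0[OF h(1), of n "Suc (size n)"] by simp
    finally show "mcoeff ((1 - h) * g) n = mcoeff 1 n" .
  qed
  show "g \<in> ser_on S"
    unfolding ser_on_def mem_Collect_eq
  proof (intro allI impI)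
    fix n assume "mcoeff g n \<noteq> 0"
    moreover have "(\<Sum>k\<le>size n. h ^ k) \<in> ser_on S" using h(2) by auto
    ultimately show "set_mset n \<subseteq> S" unfolding g ser_on_def by blast
  qed
qed

text \<open>\<open>f\<close> is its constant term times \<open>1 - h\<close> with \<open>h\<close>
  free of a constant term, so the geometric series applies; uniqueness of inverses in a commutative
  ring gives the description in \<open>mfps_inv\<close> its meaning.\<close>

lemma mfps_inv_props:
  fixes f :: "'a::field mfps"
  assumes "mcoeff f {#} \<noteq> 0" "f \<in> ser_on S"
  shows mult_mfps_inv: "f * mfps_inv f = 1" and mfps_inv_ser_on: "mfps_inv f \<in> ser_on S"
proof -
  define c where "c = mcoeff f {#}"
  define h where "h = 1 - mconst (inverse c) * f"
  have "mcoeff h {#} = 0" using assms(1) by (simp add: h_def c_def)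
  moreover have "h \<in> ser_on S" using assms(2) by (auto simp: h_def)
  ultimately obtain g where g: "g \<in> ser_on S" "(1 - h) * g = 1"
    using ex_inverse_one_minus by blast
  define g' where "g' = mconst (inverse c) * g"
  have g': "f * g' = 1" "g' \<in> ser_on S"
    using g by (auto simp: g'_def h_def mult_ac)
  have "mfps_inv f = g'"
    unfolding mfps_inv_def
  proof (rule the_equality)
    fix y assume "f * y = 1"
    with g' show "y = g'" by (metis mult.commute mult.left_commute mult_1)
  qed (use g' in simp)
  with g' show "f * mfps_inv f = 1" "mfps_inv f \<in> ser_on S" by auto
qed

subsection \<open>Substitution\<close>

text \<open>Makes every coefficient of \<open>mfps_subst g f\<close> a finite sum, for all
  \<open>f\<close>. Over an infinite index set the sum in \<open>mfps_subst\<close> would be 0 by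
  convention.\<close>

definition admissible :: "(nat \<Rightarrow> 'a::comm_ring_1 mfps) \<Rightarrow> bool" where
  "admissible g \<longleftrightarrow> (\<forall>n. finite {m. mcoeff (\<Prod>i\<in>#m. g i) n \<noteq> 0})"

lemma mcoeff_subst:
  assumes "admissible g" "finite Z" "\<And>m. mcoeff f m * mcoeff (\<Prod>i\<in>#m. g i) n \<noteq> 0 \<Longrightarrow> m \<in> Z"
  shows "mcoeff (mfps_subst g f) n = (\<Sum>m\<in>Z. mcoeff f m * mcoeff (\<Prod>i\<in>#m. g i) n)"
  unfolding mfps_subst.rep_eq
  by (rule sum.mono_neutral_left) (use assms in auto)

lemma mcoeff_subst':
  assumes "admissible g"
  shows "mcoeff (mfps_subst g f) n =
    (\<Sum>m | mcoeff (\<Prod>i\<in>#m. g i) n \<noteq> 0. mcoeff f m * mcoeff (\<Prod>i\<in>#m. g i) n)"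
  by (rule mcoeff_subst) (use assms in \<open>auto simp: admissible_def\<close>)

context
  fixes g :: "nat \<Rightarrow> 'a::comm_ring_1 mfps"
  assumes adm: "admissible g"
begin

lemma subst_add: "mfps_subst g (f + f') = mfps_subst g f + mfps_subst g f'"
  by (rule mfps_eqI) (simp add: mcoeff_subst'[OF adm] sum.distrib[symmetric] distrib_right)

lemma subst_mconst [simp]: "mfps_subst g (mconst c) = mconst c"
proof (rule mfps_eqI)
  fix n
  have "mcoeff (mfps_subst g (mconst c)) n =
      (\<Sum>m\<in>{{#}}. mcoeff (mconst c) m * mcoeff (\<Prod>i\<in>#m. g i) n)"
    by (rule mcoeff_subst[OF adm]) (auto split: if_splits)
  then show "mcoeff (mfps_subst g (mconst c)) n = mcoeff (mconst c) n" by simp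
qed

lemma subst_mvar [simp]: "mfps_subst g (mvar i) = g i"
proof (rule mfps_eqI)
  fix n
  have "mcoeff (mfps_subst g (mvar i)) n =
      (\<Sum>m\<in>{{#i#}}. mcoeff (mvar i :: 'a mfps) m * mcoeff (\<Prod>i\<in>#m. g i) n)"
    by (rule mcoeff_subst[OF adm]) (auto split: if_splits)
  then show "mcoeff (mfps_subst g (mvar i)) n = mcoeff (g i) n" by simp
qed

lemma subst_mult: "mfps_subst g (f * f') = mfps_subst g f * mfps_subst g f'"
proof (rule mfps_eqI)
  fix n
  let ?G = "\<lambda>m. \<Prod>i\<in>#m. g i"
  let ?F = "\<lambda>n. {m. mcoeff (?G m) n \<noteq> 0}"
  have fin: "finite (?F n)" for n using adm by (simp add: admissible_def)
  define D where "D = {(c :: nat multiset, d). c + d = n}"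
  \<comment> \<open>\<open>A\<close> and \<open>B\<close> hold every monomial that can contribute on
    either side, uniformly in the splitting \<open>n = c + d\<close>; over the fixed rectangle
    \<open>A \<times> B\<close> the sums may be exchanged.\<close>
  define A where "A = (\<Union>(c, d)\<in>D. ?F c) \<union> (\<Union>m\<in>?F n. {a. a \<subseteq># m})"
  define B where "B = (\<Union>(c, d)\<in>D. ?F d) \<union> (\<Union>m\<in>?F n. {a. a \<subseteq># m})"
  have finsub: "finite {a. a \<subseteq># m}" for m :: "nat multiset"
    by (rule finite_subset[OF _ finite_imageI[OF finite_splits[of m], of fst]])
      (auto simp: image_iff subset_mset.le_iff_add)
  have finD: "finite D" by (simp add: D_def finite_splits)
  have finAB: "finite A" "finite B"
    using finD fin finsub by (auto simp: A_def B_def)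
  have "mcoeff (mfps_subst g (f * f')) n =
      (\<Sum>m\<in>?F n. \<Sum>(a, b) | a + b = m. mcoeff f a * mcoeff f' b * mcoeff (?G (a + b)) n)"
    by (auto simp: mcoeff_subst'[OF adm] times_mfps.rep_eq sum_distrib_right case_prod_unfold intro!: sum.cong)
  also have "\<dots> = (\<Sum>(a, b)\<in>A \<times> B. mcoeff f a * mcoeff f' b * mcoeff (?G (a + b)) n)"
    (is "_ = sum ?h _")
  proof -
    have "(\<Sum>m\<in>?F n. sum ?h {(a, b). a + b = m}) = sum ?h (\<Union>m\<in>?F n. {(a, b). a + b = m})"
      by (rule sum.UNION_disjoint[symmetric]) (auto simp: fin finite_splits)
    also have "\<dots> = sum ?h (A \<times> B)"
    proof (rule sum.mono_neutral_left)
      show "(\<Union>m\<in>?F n. {(a, b). a + b = m}) \<subseteq> A \<times> B"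
      proof clarify
        fix a b assume "mcoeff (?G (a + b)) n \<noteq> 0"
        then show "a \<in> A \<and> b \<in> B"
          unfolding A_def B_def by (intro conjI UnI2 UN_I[of "a + b"]) simp_all
      qed
    qed (use finAB in auto)
    finally show ?thesis .
  qed
  also have "\<dots> = (\<Sum>(a, b)\<in>A \<times> B. \<Sum>(c, d)\<in>D.
      (mcoeff f a * mcoeff (?G a) c) * (mcoeff f' b * mcoeff (?G b) d))"
    by (auto intro!: sum.cong simp: times_mfps.rep_eq D_def sum_distrib_left case_prod_unfold mult_ac)
  also have "\<dots> = (\<Sum>(c, d)\<in>D. \<Sum>(a, b)\<in>A \<times> B.
      (mcoeff f a * mcoeff (?G a) c) * (mcoeff f' b * mcoeff (?G b) d))"
    unfolding case_prod_unfold by (rule sum.swap)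
  also have "\<dots> = (\<Sum>(c, d)\<in>D. mcoeff (mfps_subst g f) c * mcoeff (mfps_subst g f') d)"
  proof (intro sum.cong refl, clarify)
    fix c d assume cd: "(c, d) \<in> D"
    have "mcoeff (mfps_subst g f) c = (\<Sum>a\<in>A. mcoeff f a * mcoeff (?G a) c)"
      by (rule mcoeff_subst[OF adm finAB(1)]) (use cd in \<open>force simp: A_def\<close>)
    moreover have "mcoeff (mfps_subst g f') d = (\<Sum>a\<in>B. mcoeff f' a * mcoeff (?G a) d)"
      by (rule mcoeff_subst[OF adm finAB(2)]) (use cd in \<open>force simp: B_def\<close>)
    ultimately show "(\<Sum>(a, b)\<in>A \<times> B. (mcoeff f a * mcoeff (?G a) c) * (mcoeff f' b * mcoeff (?G b) d)) =
        mcoeff (mfps_subst g f) c * mcoeff (mfps_subst g f') d"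
      by (simp add: sum_product sum.cartesian_product case_prod_unfold)
  qed
  also have "\<dots> = mcoeff (mfps_subst g f * mfps_subst g f') n"
    by (simp add: times_mfps.rep_eq D_def)
  finally show "mcoeff (mfps_subst g (f * f')) n = mcoeff (mfps_subst g f * mfps_subst g f') n" .
qed

lemma subst_1 [simp]: "mfps_subst g 1 = 1"
  using subst_mconst[of 1] by simp

lemma subst_0 [simp]: "mfps_subst g 0 = 0"
  using subst_mconst[of 0] by simp

lemma subst_uminus: "mfps_subst g (- f) = - mfps_subst g f"
  using subst_add[of f "- f"] by (simp add: eq_neg_iff_add_eq_0 add.commute)

lemma subst_diff: "mfps_subst g (f - f') = mfps_subst g f - mfps_subst g f'"
  using subst_add[of f "- f'"] by (simp add: subst_uminus)

lemma subst_prod_mset: "mfps_subst g (\<Prod>i\<in>#m. h i) = (\<Prod>i\<in>#m. mfps_subst g (h i))"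
  by (induction m) (auto simp: subst_mult)

lemma subst_subst:
  assumes adm': "admissible h"
    and adm'': "admissible (\<lambda>i. mfps_subst g (h i))"
  shows "mfps_subst g (mfps_subst h f) = mfps_subst (\<lambda>i. mfps_subst g (h i)) f"
proof (rule mfps_eqI)
  fix n
  let ?G = "\<lambda>m. \<Prod>i\<in>#m. g i" and ?H = "\<lambda>m. \<Prod>i\<in>#m. h i"
  let ?F = "{m. mcoeff (?G m) n \<noteq> 0}"
  \<comment> \<open>Collects the monomials that reach \<open>n\<close> through some \<open>m\<close>
    and those that reach it under the composite substitution, so that both sides become sums over
    one finite set.\<close>
  define Z where "Z = (\<Union>m\<in>?F. {k. mcoeff (?H k) m \<noteq> 0}) \<union>
    {k. mcoeff (\<Prod>i\<in>#k. mfps_subst g (h i)) n \<noteq> 0}"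
  have fin: "finite Z"
    using adm adm' adm'' by (auto simp: admissible_def Z_def)
  have "mcoeff (mfps_subst g (mfps_subst h f)) n =
      (\<Sum>m\<in>?F. mcoeff (mfps_subst h f) m * mcoeff (?G m) n)"
    by (rule mcoeff_subst'[OF adm])
  also have "\<dots> = (\<Sum>m\<in>?F. (\<Sum>k\<in>Z. mcoeff f k * mcoeff (?H k) m) * mcoeff (?G m) n)"
    by (intro sum.cong refl arg_cong2[where f = "(*)"] mcoeff_subst[OF adm' fin]) (auto simp: Z_def)
  also have "\<dots> = (\<Sum>k\<in>Z. mcoeff f k * (\<Sum>m\<in>?F. mcoeff (?H k) m * mcoeff (?G m) n))"
    unfolding sum_distrib_right sum_distrib_left by (subst sum.swap) (simp add: mult.assoc)
  also have "\<dots> = (\<Sum>k\<in>Z. mcoeff f k * mcoeff (\<Prod>i\<in>#k. mfps_subst g (h i)) n)"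
    by (simp add: mcoeff_subst'[OF adm, symmetric] subst_prod_mset)
  also have "\<dots> = mcoeff (mfps_subst (\<lambda>i. mfps_subst g (h i)) f) n"
    by (rule mcoeff_subst[OF adm'' fin, symmetric]) (auto simp: Z_def)
  finally show "mcoeff (mfps_subst g (mfps_subst h f)) n = mcoeff (mfps_subst (\<lambda>i. mfps_subst g (h i)) f) n" .
qed

end

lemma mcoeff_prod_mvar:
  "mcoeff (\<Prod>i\<in>#m. mvar (\<sigma> i) :: 'a::comm_ring_1 mfps) n = (if n = image_mset \<sigma> m then 1 else 0)"
  by (induction m arbitrary: n) (auto simp: mcoeff_mvar_mult dest: multi_member_split)

text \<open>A renaming sends the monomial \<open>m\<close> to \<open>image_mset \<sigma> m\<close>,
  so each \<open>n\<close> is reached from at most one \<open>m\<close>.\<close>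

lemma admissible_perm:
  assumes "inj \<sigma>" shows "admissible (\<lambda>i. mvar (\<sigma> i))"
  unfolding admissible_def
proof
  fix n
  have "image_mset (inv_into UNIV \<sigma>) (image_mset \<sigma> m) = m" for m
    unfolding image_mset.compositionality comp_def inv_f_f[OF assms] by simp
  then have "inj (image_mset \<sigma>)" by (metis injI)
  then have "{m. n = image_mset \<sigma> m} \<subseteq> {inv_into UNIV (image_mset \<sigma>) n}" by auto
  then show "finite {m. mcoeff (\<Prod>i\<in>#m. mvar (\<sigma> i) :: 'a mfps) n \<noteq> 0}"
    by (auto simp: mcoeff_prod_mvar intro: finite_subset)
qed

lemma subst_mvar_id [simp]: "mfps_subst mvar f = f"
proof (rule mfps_eqI)
  fix n
  have "mcoeff (mfps_subst mvar f) n = (\<Sum>m\<in>{n}. mcoeff f m * mcoeff (\<Prod>i\<in>#m. mvar i) n)"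
  proof (rule mcoeff_subst)
    show "admissible mvar" using admissible_perm[of id] by simp
    show "m \<in> {n}" if "mcoeff f m * mcoeff (\<Prod>i\<in>#m. mvar i) n \<noteq> 0" for m
    proof -
      have "mcoeff (\<Prod>i\<in>#m. mvar i) n \<noteq> (0 :: 'a)" using that by force
      then show ?thesis using mcoeff_prod_mvar[of id m n, where 'a = 'a] by (simp split: if_splits)
    qed
  qed simp
  then show "mcoeff (mfps_subst mvar f) n = mcoeff f n"
    using mcoeff_prod_mvar[of id n, where 'a = 'a] by simp
qed

text \<open>Every factor \<open>g i\<close> contributes at least one \<open>t_i\<close> and no other
  variable, so \<open>m\<close> and \<open>n\<close> involve the same variables and \<open>n\<close>
  is at least as long.\<close>

lemma prod_mset_nonzero_bounds:
  fixes g :: "nat \<Rightarrow> 'a::comm_ring_1 mfps"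
  assumes g: "\<And>i n. mcoeff (g i) n \<noteq> 0 \<Longrightarrow> n \<noteq> {#} \<and> set_mset n \<subseteq> {i}"
    and "mcoeff (\<Prod>i\<in>#m. g i) n \<noteq> 0"
  shows "set_mset m = set_mset n \<and> size m \<le> size n"
  using assms(2)
proof (induction m arbitrary: n)
  case (add x m)
  then obtain a b where ab: "a + b = n" "mcoeff (g x) a \<noteq> 0" "mcoeff (\<Prod>i\<in>#m. g i) b \<noteq> 0"
    by (auto elim: mcoeff_mult_nonzeroE)
  from g[OF ab(2)] have "set_mset a = {x}" "size a > 0"
    by (auto simp: nonempty_has_size subset_singleton_iff)
  with add.IH[OF ab(3)] ab(1) show ?case by auto
qed (auto split: if_splits)

lemma admissible_diagonal:
  fixes g :: "nat \<Rightarrow> 'a::comm_ring_1 mfps"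
  assumes g: "\<And>i n. mcoeff (g i) n \<noteq> 0 \<Longrightarrow> n \<noteq> {#} \<and> set_mset n \<subseteq> {i}"
  shows "admissible g"
  unfolding admissible_def
proof
  fix n
  have finsub: "finite {a. a \<subseteq># m}" for m :: "nat multiset"
    by (rule finite_subset[OF _ finite_imageI[OF finite_splits[of m], of fst]])
      (auto simp: image_iff subset_mset.le_iff_add)
  \<comment> \<open>By the bounds, \<open>m\<close> uses only variables of \<open>n\<close>, each at
    most \<open>size n\<close> times; as these occur in \<open>n\<close> at least once,
    \<open>m\<close> is contained in \<open>size n\<close> copies of \<open>n\<close>.\<close>
  have "{m. mcoeff (\<Prod>i\<in>#m. g i) n \<noteq> 0} \<subseteq> {m. m \<subseteq># repeat_mset (size n) n}"
  proof
    fix m assume "m \<in> {m. mcoeff (\<Prod>i\<in>#m. g i) n \<noteq> 0}"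
    with prod_mset_nonzero_bounds[OF g] have m: "set_mset m = set_mset n" "size m \<le> size n" by auto
    have "count m x \<le> size n * count n x" for x
    proof (cases "x \<in># n")
      case True
      then have "1 \<le> count n x" by simp
      moreover have "count m x \<le> size n" using m(2) count_le_size[of m x] by simp
      ultimately show ?thesis by (metis mult.right_neutral mult_le_mono)
    next
      case False
      with m(1) have "x \<notin># m" by simp
      then show ?thesis by (simp add: not_in_iff)
    qed
    then show "m \<in> {m. m \<subseteq># repeat_mset (size n) n}" by (simp add: subseteq_mset_def)
  qed
  with finsub show "finite {m. mcoeff (\<Prod>i\<in>#m. g i) n \<noteq> 0}" by (meson finite_subset)
qed

lemma subst_ser_on_id:
  assumes "admissible g" "f \<in> ser_on S" "\<And>i. i \<in> S \<Longrightarrow> g i = mvar i"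
  shows "mfps_subst g f = f"
proof (rule mfps_eqI)
  fix n
  have prod: "(\<Prod>i\<in>#m. g i) = (\<Prod>i\<in>#m. mvar i)" if "mcoeff f m \<noteq> 0" for m
  proof -
    have "set_mset m \<subseteq> S" using that assms(2) by (simp add: ser_on_def)
    then have "image_mset g m = image_mset mvar m"
      by (intro image_mset_cong) (use assms(3) in auto)
    then show ?thesis by simp
  qed
  have c: "mcoeff f m * mcoeff (\<Prod>i\<in>#m. g i) n = mcoeff f m * (if n = m then 1 else 0)" for m
    using prod[of m] mcoeff_prod_mvar[of id m n, where 'a = 'a] by (cases "mcoeff f m = 0") auto
  have "mcoeff (mfps_subst g f) n = (\<Sum>m\<in>{n}. mcoeff f m * mcoeff (\<Prod>i\<in>#m. g i) n)"
    by (rule mcoeff_subst[OF assms(1)]) (auto simp: c split: if_splits)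
  then show "mcoeff (mfps_subst g f) n = mcoeff f n"
    by (simp add: c)
qed

text \<open>The inversion of one \<open>X_p\<close> has this shape in the variables
  \<open>t_i\<close>: it maps the centre of one expansion to the centre of the other, so no constant
  term appears.\<close>

definition diagonal_subst :: "(nat \<Rightarrow> 'a::comm_ring_1 mfps) \<Rightarrow> bool" where
  "diagonal_subst g \<longleftrightarrow> (\<forall>i. mcoeff (g i) {#} = 0 \<and> g i \<in> ser_on {i})"

lemma diagonal_substD:
  "diagonal_subst g \<Longrightarrow> mcoeff (g i) n \<noteq> 0 \<Longrightarrow> n \<noteq> {#} \<and> set_mset n \<subseteq> {i}"
  unfolding diagonal_subst_def ser_on_def by blast

lemma diagonal_subst_admissible: "diagonal_subst g \<Longrightarrow> admissible g"
  by (rule admissible_diagonal) (rule diagonal_substD)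

lemma diagonal_subst_ser_on:
  assumes "diagonal_subst g" "f \<in> ser_on S"
  shows "mfps_subst g f \<in> ser_on S"
  unfolding ser_on_def mem_Collect_eq
proof (intro allI impI)
  fix n assume "mcoeff (mfps_subst g f) n \<noteq> 0"
  then obtain m where "mcoeff f m * mcoeff (\<Prod>i\<in>#m. g i) n \<noteq> 0"
    unfolding mcoeff_subst'[OF diagonal_subst_admissible[OF assms(1)]]
    by (meson sum.not_neutral_contains_not_neutral)
  then have m: "mcoeff f m \<noteq> 0" "mcoeff (\<Prod>i\<in>#m. g i) n \<noteq> 0" by auto
  then show "set_mset n \<subseteq> S"
    using prod_mset_nonzero_bounds[OF diagonal_substD[OF assms(1)], where m = m and n = n] assms(2)
    unfolding ser_on_def by blast
qed

lemma perm_subst_ser_on: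
  assumes "inj \<sigma>" "\<sigma> ` S \<subseteq> S" "f \<in> ser_on S"
  shows "mfps_subst (\<lambda>i. mvar (\<sigma> i)) f \<in> ser_on S"
  unfolding ser_on_def mem_Collect_eq
proof (intro allI impI)
  fix n assume "mcoeff (mfps_subst (\<lambda>i. mvar (\<sigma> i)) f) n \<noteq> 0"
  then obtain m where "mcoeff f m * mcoeff (\<Prod>i\<in>#m. mvar (\<sigma> i)) n \<noteq> 0"
    unfolding mcoeff_subst'[OF admissible_perm[OF assms(1)]]
    by (meson sum.not_neutral_contains_not_neutral)
  then have "mcoeff f m \<noteq> 0" "n = image_mset \<sigma> m"
    by (auto simp: mcoeff_prod_mvar split: if_splits)
  then show "set_mset n \<subseteq> S"
    using assms(2,3) unfolding ser_on_def by auto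
qed

subsection \<open>Fraction fields\<close>

locale mono_endo =
  fixes h :: "'a::idom \<Rightarrow> 'a"
  assumes add: "h (a + b) = h a + h b" and mult: "h (a * b) = h a * h b"
    and one: "h 1 = 1" and nonzero: "h a = 0 \<Longrightarrow> a = 0"

text \<open>The exchange of two variables and the inversion of one, extended to fractions, are both
  handled through this locale.\<close>

locale field_endo =
  fixes \<phi> :: "'a::field \<Rightarrow> 'a"
  assumes add: "\<phi> (a + b) = \<phi> a + \<phi> b" and mult: "\<phi> (a * b) = \<phi> a * \<phi> b"
    and one: "\<phi> 1 = 1"
begin

lemma zero: "\<phi> 0 = 0" using add[of 0 0] by (metis add_0 add_cancel_left_left)

lemma uminus: "\<phi> (- a) = - \<phi> a"
  using add[of a "- a"] zero by (simp add: eq_neg_iff_add_eq_0 add.commute)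

lemma diff: "\<phi> (a - b) = \<phi> a - \<phi> b"
  using add[of a "- b"] uminus by simp

lemma nonzero: "\<phi> a = 0 \<longleftrightarrow> a = 0"
proof
  assume "\<phi> a = 0"
  then have "\<phi> (a * inverse a) = 0" by (simp add: mult)
  then show "a = 0" using one by (cases "a = 0") auto
qed (simp add: zero)

lemma inverse: "\<phi> (inverse a) = inverse (\<phi> a)"
proof (cases "a = 0")
  case False
  then have "\<phi> (inverse a) * \<phi> a = 1" by (simp add: mult[symmetric] one)
  then show ?thesis using False nonzero[of a] by (simp add: field_simps)
qed (simp add: zero)

lemma divide: "\<phi> (a / b) = \<phi> a / \<phi> b"
  by (simp add: divide_inverse mult inverse)

lemma power: "\<phi> (a ^ n) = \<phi> a ^ n"
  by (induction n) (auto simp: one mult)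

lemmas hom = zero one add mult uminus diff nonzero inverse divide power

end

lemma fract_map_Fract:
  assumes "mono_endo h" "b \<noteq> 0"
  shows "fract_map h (Fraction_Field.Fract a b) = Fraction_Field.Fract (h a) (h b)"
proof -
  interpret mono_endo h by fact
  show ?thesis
    unfolding fract_map_def
  proof (rule the_equality)
    show "\<forall>a' b'. b' \<noteq> 0 \<and> Fraction_Field.Fract a b = Fraction_Field.Fract a' b' \<longrightarrow>
        Fraction_Field.Fract (h a) (h b) = Fraction_Field.Fract (h a') (h b')"
    proof (intro allI impI, elim conjE)
      fix a' b' assume "b' \<noteq> 0" "Fraction_Field.Fract a b = Fraction_Field.Fract a' b'"
      then have "h (a * b') = h (a' * b)" using assms by (simp add: eq_fract)
      then have "h a * h b' = h a' * h b" by (simp add: mult)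
      moreover have "h b \<noteq> 0" "h b' \<noteq> 0" using nonzero assms(2) \<open>b' \<noteq> 0\<close> by auto
      ultimately show "Fraction_Field.Fract (h a) (h b) = Fraction_Field.Fract (h a') (h b')"
        by (simp add: eq_fract)
    qed
  qed (use assms(2) in blast)
qed

lemma fract_map_field_endo:
  assumes "mono_endo h" shows "field_endo (fract_map h)"
proof -
  interpret mono_endo h by fact
  show ?thesis
  proof
    fix x y :: "'a fract"
    obtain a b c d where [simp]: "x = Fraction_Field.Fract a b" "y = Fraction_Field.Fract c d" and nz: "b \<noteq> 0" "d \<noteq> 0"
      by (cases x, cases y) auto
    have "h b \<noteq> 0" "h d \<noteq> 0" using nz nonzero by auto
    with nz show "fract_map h (x + y) = fract_map h x + fract_map h y"
      "fract_map h (x * y) = fract_map h x * fract_map h y"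
      by (simp_all add: fract_map_Fract[OF assms] add mult)
    show "fract_map h 1 = 1"
      using fract_map_Fract[OF assms, of 1 1] by (simp add: one One_fract_def[symmetric])
  qed
qed

lemma fract_map_comp:
  assumes "mono_endo h" "mono_endo h'"
  shows "fract_map h (fract_map h' z) = fract_map (\<lambda>x. h (h' x)) z"
proof -
  interpret h: mono_endo h by fact
  interpret h': mono_endo h' by fact
  have "mono_endo (\<lambda>x. h (h' x))"
    by standard (auto simp: h.add h'.add h.mult h'.mult h.one h'.one dest!: h.nonzero h'.nonzero)
  then show ?thesis
  proof (cases z)
    case (Fract a b)
    then have "h' b \<noteq> 0" using h'.nonzero by auto
    with Fract \<open>mono_endo (\<lambda>x. h (h' x))\<close> assms show ?thesis by (simp add: fract_map_Fract)
  qed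
qed

lemma fract_map_id: "(\<And>x. h x = x) \<Longrightarrow> fract_map h z = z"
proof -
  assume h: "\<And>x. h x = x"
  then have "mono_endo h" by unfold_locales auto
  then show ?thesis by (cases z) (auto simp: fract_map_Fract h)
qed

lemma to_K_hom:
  "to_K 0 = 0" "to_K 1 = 1" "to_K (f + g) = to_K f + to_K g" "to_K (f - g) = to_K f - to_K g"
  "to_K (- f) = - to_K f" "to_K (f * g) = to_K f * to_K g" "to_K (f ^ n) = to_K f ^ n"
proof -
  show *: "to_K 1 = 1" "to_K (f * g) = to_K f * to_K g" for f g
    by (simp_all add: One_fract_def)
  show "to_K (f ^ n) = to_K f ^ n" by (induction n) (simp_all only: power.simps *)
qed (simp_all add: Zero_fract_def)

lemma to_K_eq_iff: "to_K f = to_K g \<longleftrightarrow> f = g"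
  by (simp add: eq_fract)

lemma to_K_eq_0_iff: "to_K f = 0 \<longleftrightarrow> f = 0"
  using to_K_eq_iff[of f 0] by (simp only: to_K_hom)

lemma Fract_conv_to_K: "Fraction_Field.Fract a b = to_K a / to_K b"
  by (simp add: divide_fract)

lemma cK_hom:
  "cK 0 = 0" "cK 1 = 1" "cK (c + d) = cK c + cK d" "cK (c - d) = cK c - cK d"
  "cK (- c) = - cK c" "cK (c * d) = cK c * cK d" "cK (c ^ n) = cK c ^ n"
  "cK (inverse c) = inverse (cK c)" "cK (c / d) = cK c / cK d"
proof -
  show "cK 0 = 0" "cK 1 = 1" "cK (c + d) = cK c + cK d" "cK (c - d) = cK c - cK d" "cK (- c) = - cK c"
    by (simp_all only: mconst_hom to_K_hom)
  show m: "cK (c * d) = cK c * cK d" for c d by (simp only: mconst_hom to_K_hom)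
  show "cK (c ^ n) = cK c ^ n"
    by (induction n) (simp_all only: power.simps m mconst_hom to_K_hom)
  show i: "cK (inverse c) = inverse (cK c)" for c
  proof (cases "c = 0")
    case False
    then have "cK (inverse c) * cK c = 1" by (simp only: m[symmetric]) (simp add: One_fract_def)
    then show ?thesis using False by (metis inverse_unique inverse_inverse_eq)
  qed (simp only: mconst_hom to_K_hom inverse_zero)
  show "cK (c / d) = cK c / cK d" by (simp only: divide_inverse m i)
qed

lemma cK_eq_iff: "cK c = cK d \<longleftrightarrow> c = d"
  by (simp add: eq_fract)

lemma cK_eq_0_iff: "cK c = 0 \<longleftrightarrow> c = 0"
  using cK_eq_iff[of c 0] by (simp only: cK_hom)

text \<open>\<open>to_K f\<close> abbreviates the fraction \<open>Fract f 1\<close>. With these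
  rules active the simplifier would merge sums and products of such elements into single fractions,
  out of reach of the homomorphism laws.\<close>

declare mult_fract [simp del] add_fract [simp del] diff_fract [simp del] divide_fract [simp del]
  minus_fract [simp del] inverse_fract [simp del]

section \<open>The coefficient rings\<close>

definition Oser :: "nat \<Rightarrow> K set" where
  "Oser l = to_K ` ser_ring l"

lemma Oser_closed:
  "0 \<in> Oser l" "1 \<in> Oser l" "cK c \<in> Oser l"
  "x \<in> Oser l \<Longrightarrow> y \<in> Oser l \<Longrightarrow> x + y \<in> Oser l"
  "x \<in> Oser l \<Longrightarrow> y \<in> Oser l \<Longrightarrow> x - y \<in> Oser l"
  "x \<in> Oser l \<Longrightarrow> - x \<in> Oser l"
  "x \<in> Oser l \<Longrightarrow> y \<in> Oser l \<Longrightarrow> x * y \<in> Oser l"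
  "p < l \<Longrightarrow> to_K (mvar p) \<in> Oser l"
proof -
  have *: "to_K f \<in> Oser l" if "f \<in> ser_on {..<l}" for f
    using that by (simp add: Oser_def ser_ring_eq)
  have E: "\<exists>f\<in>ser_on {..<l}. x = to_K f" if "x \<in> Oser l" for x
    using that by (auto simp: Oser_def ser_ring_eq)
  show "0 \<in> Oser l" "1 \<in> Oser l"
    by (metis * ser_on_closed(1) to_K_hom(1)) (metis * ser_on_closed(2) to_K_hom(2))
  show "cK c \<in> Oser l" by (intro * ser_on_closed)
  show "p < l \<Longrightarrow> to_K (mvar p) \<in> Oser l" by (intro * ser_on_closed) simp
  assume x: "x \<in> Oser l"
  then obtain f where f: "f \<in> ser_on {..<l}" "x = to_K f" using E by blast
  show "- x \<in> Oser l" unfolding f to_K_hom[symmetric] by (intro * ser_on_closed f)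
  assume "y \<in> Oser l"
  then obtain g where g: "g \<in> ser_on {..<l}" "y = to_K g" using E by blast
  show "x + y \<in> Oser l" "x - y \<in> Oser l" "x * y \<in> Oser l"
    unfolding f g to_K_hom[symmetric] by (intro * ser_on_closed ser_on_mult f g)+
qed

lemma Oser_inverse:
  assumes "f \<in> ser_ring l" "mcoeff f {#} \<noteq> 0"
  shows "inverse (to_K f) \<in> Oser l"
proof -
  have "to_K f * to_K (mfps_inv f) = 1"
    using mult_mfps_inv[OF assms(2), of "{..<l}"] assms(1) by (simp only: to_K_hom(6)[symmetric] ser_ring_eq to_K_hom)
  then have "inverse (to_K f) = to_K (mfps_inv f)" by (rule inverse_unique)
  then show ?thesis using mfps_inv_ser_on[OF assms(2), of "{..<l}"] assms(1) by (simp add: ser_ring_eq Oser_def)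
qed

lemma ser_frac_iff: "x \<in> ser_frac l \<longleftrightarrow> (\<exists>a\<in>Oser l. \<exists>b\<in>Oser l. b \<noteq> 0 \<and> x = a / b)"
proof
  assume "x \<in> ser_frac l"
  then obtain f g where "f \<in> ser_ring l" "g \<in> ser_ring l" "g \<noteq> 0" "x = Fraction_Field.Fract f g"
    by (auto simp: ser_frac_def)
  then show "\<exists>a\<in>Oser l. \<exists>b\<in>Oser l. b \<noteq> 0 \<and> x = a / b"
    by (intro bexI[of _ "to_K f"] bexI[of _ "to_K g"])
      (simp_all add: to_K_eq_0_iff Oser_def, simp add: divide_fract)
next
  assume "\<exists>a\<in>Oser l. \<exists>b\<in>Oser l. b \<noteq> 0 \<and> x = a / b"
  then obtain f g where "f \<in> ser_ring l" "g \<in> ser_ring l" "to_K g \<noteq> 0" "x = to_K f / to_K g"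
    by (auto simp: Oser_def)
  then show "x \<in> ser_frac l"
    unfolding ser_frac_def by (auto simp: to_K_eq_0_iff Fract_conv_to_K[symmetric])
qed

lemma Oser_ser_frac: "x \<in> Oser l \<Longrightarrow> x \<in> ser_frac l"
  unfolding ser_frac_iff by (intro bexI[of _ x] bexI[of _ 1]) (auto simp: Oser_closed)

lemma ser_frac_closed:
  "0 \<in> ser_frac l" "1 \<in> ser_frac l" "cK c \<in> ser_frac l"
  "x \<in> ser_frac l \<Longrightarrow> y \<in> ser_frac l \<Longrightarrow> x + y \<in> ser_frac l"
  "x \<in> ser_frac l \<Longrightarrow> y \<in> ser_frac l \<Longrightarrow> x - y \<in> ser_frac l"
  "x \<in> ser_frac l \<Longrightarrow> - x \<in> ser_frac l"
  "x \<in> ser_frac l \<Longrightarrow> y \<in> ser_frac l \<Longrightarrow> x * y \<in> ser_frac l"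
  "x \<in> ser_frac l \<Longrightarrow> inverse x \<in> ser_frac l"
  "x \<in> ser_frac l \<Longrightarrow> y \<in> ser_frac l \<Longrightarrow> x / y \<in> ser_frac l"
  "p < l \<Longrightarrow> to_K (mvar p) \<in> ser_frac l"
proof -
  show "0 \<in> ser_frac l" "1 \<in> ser_frac l" "cK c \<in> ser_frac l" "p < l \<Longrightarrow> to_K (mvar p) \<in> ser_frac l"
    by (auto intro!: Oser_ser_frac Oser_closed)
  have add: "x + y \<in> ser_frac l" if "x \<in> ser_frac l" "y \<in> ser_frac l" for x y
  proof -
    from that obtain a b c d where "a \<in> Oser l" "b \<in> Oser l" "c \<in> Oser l" "d \<in> Oser l" "b \<noteq> 0" "d \<noteq> 0"
      "x = a / b" "y = c / d" unfolding ser_frac_iff by blast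
    then have "x + y = (a * d + c * b) / (b * d)" "a * d + c * b \<in> Oser l" "b * d \<in> Oser l" "b * d \<noteq> 0"
      by (simp_all add: Oser_closed add_frac_eq)
    then show ?thesis unfolding ser_frac_iff by blast
  qed
  have mult: "x * y \<in> ser_frac l" if "x \<in> ser_frac l" "y \<in> ser_frac l" for x y
  proof -
    from that obtain a b c d where "a \<in> Oser l" "b \<in> Oser l" "c \<in> Oser l" "d \<in> Oser l" "b \<noteq> 0" "d \<noteq> 0"
      "x = a / b" "y = c / d" unfolding ser_frac_iff by blast
    then have "x * y = (a * c) / (b * d)" "a * c \<in> Oser l" "b * d \<in> Oser l" "b * d \<noteq> 0"
      by (simp_all add: Oser_closed)
    then show ?thesis unfolding ser_frac_iff by blast
  qed
  have uminus: "- x \<in> ser_frac l" if "x \<in> ser_frac l" for x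
    using that unfolding ser_frac_iff by (metis Oser_closed(6) minus_divide_left)
  have inv: "inverse x \<in> ser_frac l" if "x \<in> ser_frac l" for x
  proof (cases "x = 0")
    case False
    from that obtain a b where "a \<in> Oser l" "b \<in> Oser l" "b \<noteq> 0" "x = a / b"
      unfolding ser_frac_iff by blast
    with False show ?thesis unfolding ser_frac_iff
      by (intro bexI[of _ b] bexI[of _ a]) auto
  qed (simp add: \<open>0 \<in> ser_frac l\<close>)
  show "x \<in> ser_frac l \<Longrightarrow> y \<in> ser_frac l \<Longrightarrow> x + y \<in> ser_frac l"
    "x \<in> ser_frac l \<Longrightarrow> y \<in> ser_frac l \<Longrightarrow> x - y \<in> ser_frac l"
    "x \<in> ser_frac l \<Longrightarrow> - x \<in> ser_frac l"
    "x \<in> ser_frac l \<Longrightarrow> y \<in> ser_frac l \<Longrightarrow> x * y \<in> ser_frac l"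
    "x \<in> ser_frac l \<Longrightarrow> inverse x \<in> ser_frac l"
    "x \<in> ser_frac l \<Longrightarrow> y \<in> ser_frac l \<Longrightarrow> x / y \<in> ser_frac l"
    using add[of x y] add[of x "- y"] mult[of x y] mult[of x "inverse y"] uminus[of x] uminus[of y]
      inv[of x] inv[of y] by (simp_all add: divide_inverse)
qed

subsection \<open>Exchanging two variables\<close>

abbreviation tr :: "nat \<Rightarrow> nat \<Rightarrow> nat" where
  "tr k \<equiv> Transposition.transpose k (Suc k)"

abbreviation swap_subst :: "nat \<Rightarrow> base mfps \<Rightarrow> base mfps" where
  "swap_subst k \<equiv> mfps_subst (\<lambda>i. mvar (tr k i))"

lemma adm_tr: "admissible (\<lambda>i. mvar (tr k i) :: base mfps)"
  by (rule admissible_perm) (rule inj_transpose)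

lemma perm_subst_subst:
  assumes "inj \<sigma>" "inj \<tau>"
  shows "mfps_subst (\<lambda>i. mvar (\<sigma> i)) (mfps_subst (\<lambda>i. mvar (\<tau> i)) f)
    = mfps_subst (\<lambda>i. mvar (\<sigma> (\<tau> i)) :: base mfps) f"
proof -
  have "inj (\<lambda>i. \<sigma> (\<tau> i))" using inj_compose[OF assms] by (simp add: comp_def)
  then show ?thesis
    using assms by (subst subst_subst) (simp_all add: admissible_perm)
qed

lemma swap_subst_swap_subst: "swap_subst k (swap_subst k f) = f"
  by (subst perm_subst_subst) simp_all

lemma mono_endo_swap: "mono_endo (swap_subst k)"
proof
  fix a :: "base mfps" assume "swap_subst k a = 0"
  then have "swap_subst k (swap_subst k a) = 0" by (simp add: adm_tr)
  then show "a = 0" by (simp add: swap_subst_swap_subst)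
qed (auto simp: subst_add subst_mult adm_tr)

lemma swap_subst_eq_0_iff: "swap_subst k f = 0 \<longleftrightarrow> f = 0"
  using mono_endo.nonzero[OF mono_endo_swap] subst_0[OF adm_tr] by blast

interpretation swapK: field_endo "swapK k" for k
  unfolding swapK_def by (rule fract_map_field_endo) (rule mono_endo_swap)

lemma swapK_to_K: "swapK k (to_K f) = to_K (swap_subst k f)"
  unfolding swapK_def using mono_endo_swap[of k]
  by (simp add: fract_map_Fract adm_tr)

lemma swapK_cK: "swapK k (cK c) = cK c"
  by (simp add: swapK_to_K adm_tr)

lemma swapK_swapK: "swapK k (swapK k z) = z"
  unfolding swapK_def
  by (subst fract_map_comp[OF mono_endo_swap mono_endo_swap], rule fract_map_id, rule swap_subst_swap_subst)

lemma swapK_braid: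
  "swapK k (swapK (Suc k) (swapK k z)) = swapK (Suc k) (swapK k (swapK (Suc k) z))"
proof -
  have "tr k (tr (Suc k) (tr k i)) = tr (Suc k) (tr k (tr (Suc k) i))" for i
    by (simp add: Transposition.transpose_def)
  then have "swap_subst k (swap_subst (Suc k) (swap_subst k f)) =
      swap_subst (Suc k) (swap_subst k (swap_subst (Suc k) f))" for f
    by (simp add: perm_subst_subst inj_compose[unfolded comp_def])
  then show ?thesis
    by (cases z) (simp add: swapK_def fract_map_Fract mono_endo_swap swap_subst_eq_0_iff)
qed

lemma swapK_commute:
  assumes "Suc j < k \<or> Suc k < j"
  shows "swapK k (swapK j z) = swapK j (swapK k z)"
proof -
  have "tr k (tr j i) = tr j (tr k i)" for i
    using assms by (auto simp: Transposition.transpose_def)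
  then have "swap_subst k (swap_subst j f) = swap_subst j (swap_subst k f)" for f
    by (simp add: perm_subst_subst inj_compose[unfolded comp_def])
  then show ?thesis
    by (cases z) (simp add: swapK_def fract_map_Fract mono_endo_swap swap_subst_eq_0_iff)
qed

lemma swapK_Oser:
  assumes "Suc k < l" "x \<in> Oser l" shows "swapK k x \<in> Oser l"
proof -
  have "swap_subst k f \<in> ser_ring l" if "f \<in> ser_ring l" for f
    using that assms(1) unfolding ser_ring_eq
    by (intro perm_subst_ser_on inj_transpose) (auto simp: Transposition.transpose_def)
  with assms(2) show ?thesis by (auto simp: swapK_to_K Oser_def)
qed

lemma field_endo_ser_frac:
  assumes "field_endo \<phi>" "\<And>y. y \<in> Oser l \<Longrightarrow> \<phi> y \<in> Oser l" "x \<in> ser_frac l"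
  shows "\<phi> x \<in> ser_frac l"
proof -
  obtain a b where ab: "a \<in> Oser l" "b \<in> Oser l" "b \<noteq> 0" "x = a / b"
    using assms(3) unfolding ser_frac_iff by blast
  have "\<phi> a \<in> Oser l" "\<phi> b \<in> Oser l" using assms(2) ab by blast+
  moreover have "\<phi> b \<noteq> 0" using field_endo.nonzero[OF assms(1)] ab(3) by blast
  moreover have "\<phi> x = \<phi> a / \<phi> b" unfolding ab(4) by (rule field_endo.divide[OF assms(1)])
  ultimately show ?thesis unfolding ser_frac_iff by blast
qed

lemma swapK_ser_frac:
  assumes "Suc k < l" "x \<in> ser_frac l" shows "swapK k x \<in> ser_frac l"
  by (rule field_endo_ser_frac[OF swapK.field_endo_axioms _ assms(2)]) (rule swapK_Oser[OF assms(1)])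


subsection \<open>The parameter \<open>q\<close>\<close>

lemma qq_nonzero [simp]: "qq \<noteq> 0"
  by (simp add: qq_def Zero_fract_def eq_fract)

text \<open>\<open>q\<close> is no root of unity: the equation would hold already for the variable
  of the polynomial ring, where \<open>n\<close> can be read off as a degree.\<close>

lemma qq_power_eq_1_iff: "qq ^ n = 1 \<longleftrightarrow> n = 0"
proof
  assume "qq ^ n = 1"
  then have "(Fraction_Field.Fract [:0, 1 :: rat:] 1) ^ n = 1"
    by (simp add: qq_def to_ac_power[symmetric] del: to_ac_power)
  moreover have "(Fraction_Field.Fract [:0, 1 :: rat:] 1) ^ n = Fraction_Field.Fract ([:0, 1:] ^ n) 1"
    by (induction n) (simp_all add: One_fract_def mult_fract)
  ultimately have "[:0, 1 :: rat:] ^ n = 1"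
    by (simp add: One_fract_def eq_fract)
  then have "degree ([:0, 1 :: rat:] ^ n) = 0" by simp
  then show "n = 0" by (simp add: degree_power_eq)
qed simp

lemma qq_powi_eq_1_iff: "qq powi n = 1 \<longleftrightarrow> n = 0"
  by (auto simp: power_int_def qq_power_eq_1_iff power_inverse split: if_splits)

text \<open>Lets the colour \<open>j\<close> be recovered from the base point, the power of
  \<open>q\<close> with exponent \<open>-2j\<close>; this is how the poles of the R-matrix are
  located.\<close>

lemma qq_powi_eq_iff: "qq powi m = qq powi n \<longleftrightarrow> m = n"
proof
  assume "qq powi m = qq powi n"
  then have "qq powi (m - n) = 1" by (simp add: power_int_diff)
  then show "m = n" by (simp add: qq_powi_eq_1_iff)
qed simp

lemma qq_square_neq_1 [simp]: "qq ^ 2 \<noteq> 1"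
  by (simp add: qq_power_eq_1_iff)

lemma iu_square: "iu ^ 2 = -1"
proof -
  have "\<exists>z :: base. z ^ 2 = -1" by (rule nth_root_exists) simp
  then show ?thesis unfolding iu_def by (rule someI_ex)
qed

lemma Xval_nonzero [simp]: "Xval s j \<noteq> 0"
  by (cases s) auto

lemma Xval_flipJ: "Xval Tw (flipJ j) = inverse (Xval Tw j)"
  by (auto simp: flipJ_def power_int_minus)

declare xK.simps [simp del] Xval.simps [simp del] theta.simps [simp del]

section \<open>The operations \<open>flip\<close> and \<open>swp\<close> on sequences in
  \<open>J\<close>\<close>

lemma flipJ_flipJ [simp]: "flipJ (flipJ j) = j"
  by (simp add: flipJ_def)

lemma length_flip [simp]: "length (flip p \<nu>) = length \<nu>"
  by (simp add: flip_def)

lemma flip_flip: "flip p (flip p \<nu>) = \<nu>"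
  by (cases "p < length \<nu>") (auto simp: flip_def list_update_beyond)

lemma flip_commute: "flip p (flip r \<nu>) = flip r (flip p \<nu>)"
  by (cases "p = r") (auto simp: flip_def list_update_swap)

lemma nth_flip: "r < length \<nu> \<Longrightarrow> flip p \<nu> ! r = (if r = p then flipJ (\<nu> ! r) else \<nu> ! r)"
  by (auto simp: flip_def)

lemma length_swp [simp]: "length (swp k \<nu>) = length \<nu>"
  by (simp add: swp_def)

lemma nth_swp:
  assumes "Suc k < length \<nu>" "r < length \<nu>"
  shows "swp k \<nu> ! r = \<nu> ! tr k r"
  using assms by (auto simp: swp_def Transposition.transpose_def nth_list_update)

lemma tr_less: "Suc k < l \<Longrightarrow> r < l \<Longrightarrow> tr k r < l"
  by (auto simp: Transposition.transpose_def)

lemma swp_swp: "Suc k < length \<nu> \<Longrightarrow> swp k (swp k \<nu>) = \<nu>"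
  by (rule nth_equalityI) (auto simp: nth_swp tr_less)

lemma tr_eq_iff: "tr k r = p \<longleftrightarrow> r = tr k p"
  by (metis transpose_involutory)

lemma swp_flip:
  assumes "Suc k < length \<nu>" "p < length \<nu>"
  shows "swp k (flip p \<nu>) = flip (tr k p) (swp k \<nu>)"
proof (rule nth_equalityI)
  fix r assume "r < length (swp k (flip p \<nu>))"
  with assms show "swp k (flip p \<nu>) ! r = flip (tr k p) (swp k \<nu>) ! r"
    by (simp add: nth_swp nth_flip tr_less tr_eq_iff)
qed simp

subsection \<open>Inverting a variable\<close>

definition theta_subst :: "J list \<Rightarrow> nat \<Rightarrow> nat \<Rightarrow> base mfps" where
  "theta_subst \<nu> p i = (if i = p then mfps_inv (Xser Tw (flip p \<nu>) p) - mconst (Xval Tw (\<nu> ! p)) else mvar i)"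

lemma theta_Tw: "theta Tw \<nu> p = fract_map (mfps_subst (theta_subst \<nu> p))"
  by (simp add: theta_subst_def[abs_def] fun_eq_iff theta.simps)

lemma Xser_props [simp]:
  "mcoeff (Xser s \<nu> p) {#} = Xval s (\<nu> ! p)" "Xser s \<nu> p \<in> ser_on {p}"
  by (auto simp: Xser_def)

lemma Xser_inv:
  "Xser s \<nu> p * mfps_inv (Xser s \<nu> p) = 1" "mfps_inv (Xser s \<nu> p) \<in> ser_on {p}"
  by (rule mult_mfps_inv[of _ "{p}"] mfps_inv_ser_on; simp)+

lemma mcoeff_mult_empty: "mcoeff (f * g) {#} = mcoeff f {#} * mcoeff g {#}"
proof -
  have "mcoeff (f * g) {#} = (\<Sum>(a, b)\<in>{({#}, {#})}. mcoeff f a * mcoeff g b)"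
    unfolding times_mfps.rep_eq by (rule sum.cong) auto
  then show ?thesis by simp
qed

text \<open>The constant term of the inverse of \<open>X_p\<close> around the flipped centre is the
  inverse of \<open>X(c(j))\<close>, that is \<open>X(j)\<close>, and this is what
  \<open>theta_subst\<close> subtracts.\<close>

lemma theta_subst_diagonal:
  assumes "p < length \<nu>" shows "diagonal_subst (theta_subst \<nu> p)"
proof -
  have "Xval Tw (flipJ (\<nu> ! p)) * mcoeff (mfps_inv (Xser Tw (flip p \<nu>) p)) {#} = 1"
    using arg_cong[OF Xser_inv(1)[of Tw "flip p \<nu>" p], of "\<lambda>f. mcoeff f {#}"] assms
    by (simp add: mcoeff_mult_empty nth_flip)
  from inverse_unique[OF this] have "mcoeff (mfps_inv (Xser Tw (flip p \<nu>) p)) {#} = Xval Tw (\<nu> ! p)"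
    by (simp add: Xval_flipJ)
  then show ?thesis
    unfolding diagonal_subst_def theta_subst_def using Xser_inv(2) by auto
qed

lemma adm_theta_subst: "p < length \<nu> \<Longrightarrow> admissible (theta_subst \<nu> p)"
  by (intro diagonal_subst_admissible theta_subst_diagonal)

lemma comm_monoid_mult_inverse_unique:
  fixes a :: "'a::comm_monoid_mult"
  assumes "a * b = 1" "a * c = 1" shows "b = c"
proof -
  have "b = (a * c) * b" using assms(2) by simp
  also have "\<dots> = (a * b) * c" by (simp add: mult_ac)
  finally show ?thesis using assms(1) by simp
qed

text \<open>The outer substitution sends the \<open>X_p\<close> of the flipped sequence to the
  inverse of the original \<open>X_p\<close>, hence the inverse of the former to the original
  \<open>X_p\<close>; subtracting the centre gives \<open>t_p\<close>.\<close>

lemma theta_subst_inverse: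
  assumes p: "p < length \<nu>"
  shows "mfps_subst (theta_subst (flip p \<nu>) p) (mfps_subst (theta_subst \<nu> p) f) = f"
proof -
  let ?g = "theta_subst (flip p \<nu>) p" and ?X = "Xser Tw (flip p \<nu>) p"
  have adm: "admissible ?g" using p by (simp add: adm_theta_subst)
  have X: "mfps_subst ?g ?X = mfps_inv (Xser Tw \<nu> p)"
    unfolding Xser_def[of _ "flip p \<nu>"]
    by (simp add: subst_add[OF adm] subst_mconst[OF adm] subst_mvar[OF adm] theta_subst_def flip_flip)
  have "mfps_inv (Xser Tw \<nu> p) * mfps_subst ?g (mfps_inv ?X) = mfps_subst ?g (?X * mfps_inv ?X)"
    by (simp add: subst_mult[OF adm] X)
  also have "\<dots> = 1" by (simp add: Xser_inv adm)
  finally have "mfps_subst ?g (mfps_inv ?X) = Xser Tw \<nu> p"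
    by (rule comm_monoid_mult_inverse_unique) (metis Xser_inv(1) mult.commute)
  then have "mfps_subst ?g (theta_subst \<nu> p i) = mvar i" for i
    by (auto simp: theta_subst_def[of \<nu>] subst_diff[OF adm] subst_mconst[OF adm] subst_mvar[OF adm]
        Xser_def[of _ \<nu>]) (simp add: theta_subst_def)
  then show ?thesis
    using subst_subst[OF adm adm_theta_subst[OF p]] admissible_perm[of id] by simp
qed

text \<open>Each of the two substitutions moves one variable to a series in that variable alone, so
  both orders give the same simultaneous substitution.\<close>

lemma theta_subst_commute:
  assumes "p < length \<nu>" "r < length \<nu>" "p \<noteq> r"
  shows "mfps_subst (theta_subst (flip r \<nu>) p) (mfps_subst (theta_subst \<nu> r) f) =
    mfps_subst (theta_subst (flip p \<nu>) r) (mfps_subst (theta_subst \<nu> p) f)"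
proof -
  have eq: "theta_subst (flip r \<nu>) p = theta_subst \<nu> p" if "p < length \<nu>" "r < length \<nu>" "p \<noteq> r" for p r
    using that by (auto simp: theta_subst_def fun_eq_iff nth_flip Xser_def flip_commute[of p r])
  define g where "g i = (if i = p then theta_subst \<nu> p p else theta_subst \<nu> r i)" for i
  have g: "mfps_subst (theta_subst \<nu> p) (theta_subst \<nu> r i) = (if i = p then theta_subst \<nu> p p else theta_subst \<nu> r i)"
    if "p < length \<nu>" "r < length \<nu>" "p \<noteq> r" for p r i
  proof (cases "i = p")
    case True
    then have "theta_subst \<nu> r i = mvar p" using that by (simp add: theta_subst_def)
    then show ?thesis using that True by (simp add: subst_mvar adm_theta_subst)
  next
    case False
    have "theta_subst \<nu> r i \<in> ser_on {i}"
      using theta_subst_diagonal[OF that(2)] by (simp add: diagonal_subst_def)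
    then have "mfps_subst (theta_subst \<nu> p) (theta_subst \<nu> r i) = theta_subst \<nu> r i"
      by (rule subst_ser_on_id[OF adm_theta_subst[OF that(1)]]) (use False in \<open>auto simp: theta_subst_def\<close>)
    with False show ?thesis by simp
  qed
  have adm: "admissible (\<lambda>i. if i = p then theta_subst \<nu> p p else theta_subst \<nu> r i)"
    by (rule diagonal_subst_admissible)
      (use theta_subst_diagonal[OF assms(1)] theta_subst_diagonal[OF assms(2)] in \<open>auto simp: diagonal_subst_def\<close>)
  have sym: "(\<lambda>i. if i = p then theta_subst \<nu> p p else theta_subst \<nu> r i) =
      (\<lambda>i. if i = r then theta_subst \<nu> r r else theta_subst \<nu> p i)"
    using assms(3) by (auto simp: theta_subst_def fun_eq_iff)
  show ?thesis
    using assms adm sym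
    by (simp add: eq subst_subst adm_theta_subst g eq_commute[of r p])
qed

lemma mono_endo_theta:
  assumes "p < length \<nu>" shows "mono_endo (mfps_subst (theta_subst \<nu> p))"
proof
  have adm: "admissible (theta_subst \<nu> p)" "admissible (theta_subst (flip p \<nu>) p)"
    using assms by (simp_all add: adm_theta_subst)
  fix a assume "mfps_subst (theta_subst \<nu> p) a = 0"
  then show "a = 0" using theta_subst_inverse[OF assms, of a] by (simp add: adm)
qed (auto simp: subst_add subst_mult adm_theta_subst assms)

lemma theta_field_endo: "p < length \<nu> \<Longrightarrow> field_endo (theta s \<nu> p)"
  by (cases s) (simp_all only: theta_Tw fract_map_field_endo mono_endo_theta, unfold_locales, auto simp: theta.simps)

lemma theta_to_K:
  "p < length \<nu> \<Longrightarrow> theta Tw \<nu> p (to_K f) = to_K (mfps_subst (theta_subst \<nu> p) f)"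
  by (simp only: theta_Tw) (simp add: fract_map_Fract mono_endo_theta adm_theta_subst)

lemma theta_cK: "p < length \<nu> \<Longrightarrow> theta s \<nu> p (cK c) = cK c"
  by (cases s) (simp_all only: theta_to_K subst_mconst adm_theta_subst, simp add: theta.simps)

lemma theta_theta:
  assumes "p < length \<nu>" shows "theta s (flip p \<nu>) p (theta s \<nu> p z) = z"
proof (cases s)
  case Tw
  then show ?thesis
    using assms mono_endo_theta[OF assms] mono_endo_theta[of p "flip p \<nu>"]
    by (simp only: theta_Tw fract_map_comp length_flip) (rule fract_map_id, rule theta_subst_inverse)
qed (simp add: theta.simps)

lemma theta_commute:
  assumes "p < length \<nu>" "r < length \<nu>" "p \<noteq> r"
  shows "theta s (flip r \<nu>) p (theta s \<nu> r z) = theta s (flip p \<nu>) r (theta s \<nu> p z)"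
proof (cases s)
  case Tw
  then show ?thesis
    using assms by (simp only: theta_Tw fract_map_comp length_flip mono_endo_theta theta_subst_commute[OF assms])
qed (simp add: theta.simps)

lemma theta_Oser:
  assumes "p < length \<nu>" "x \<in> Oser l" shows "theta s \<nu> p x \<in> Oser l"
proof (cases s)
  case Tw
  from assms(2) obtain f where f: "x = to_K f" "f \<in> ser_on {..<l}" by (auto simp: Oser_def ser_ring_eq)
  have "mfps_subst (theta_subst \<nu> p) f \<in> ser_on {..<l}"
    by (rule diagonal_subst_ser_on) (use assms f in \<open>auto simp: theta_subst_diagonal\<close>)
  then show ?thesis unfolding Tw f theta_to_K[OF assms(1)] by (simp add: Oser_def ser_ring_eq)
qed (use assms in \<open>simp add: theta.simps\<close>)

lemma theta_ser_frac:
  "p < length \<nu> \<Longrightarrow> x \<in> ser_frac l \<Longrightarrow> theta s \<nu> p x \<in> ser_frac l"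
  by (rule field_endo_ser_frac[OF theta_field_endo]) (auto intro: theta_Oser)

subsection \<open>The elements \<open>X\<^sub>p\<close> and \<open>x\<^sub>p\<close>\<close>

lemma XK_eq: "XK s \<nu> p = cK (Xval s (\<nu> ! p)) + to_K (mvar p)"
  by (simp only: Xser_def to_K_hom)

lemma swapK_XK:
  assumes "Suc k < length \<nu>" "p < length \<nu>"
  shows "swapK k (XK s \<nu> p) = XK s (swp k \<nu>) (tr k p)"
  unfolding XK_eq swapK.add swapK_cK
  using assms by (simp add: nth_swp tr_less swapK_to_K subst_mvar adm_tr)

lemma swapK_xK:
  assumes "Suc k < length \<nu>" "p < length \<nu>"
  shows "swapK k (xK s \<nu> p) = xK s (swp k \<nu>) (tr k p)"
  using assms
  by (cases s) (simp_all only: xK.simps swapK.hom swapK_cK swapK_XK nth_swp tr_less transpose_involutory)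

text \<open>Whatever the centres are, the monomial \<open>t_p\<close> occurs with coefficient
  \<open>a\<close>. The denominators of the R-matrix are nonzero for this reason.\<close>

lemma XK_lin_comb_nonzero:
  assumes "p \<noteq> r" "a \<noteq> 0"
  shows "cK a * XK s \<nu> p + cK b * XK s' \<nu>' r + cK c \<noteq> 0"
proof
  assume "cK a * XK s \<nu> p + cK b * XK s' \<nu>' r + cK c = 0"
  then have "to_K (mconst a * Xser s \<nu> p + mconst b * Xser s' \<nu>' r + mconst c) = 0"
    by (simp only: to_K_hom)
  then have "mconst a * Xser s \<nu> p + mconst b * Xser s' \<nu>' r + mconst c = 0"
    by (simp only: to_K_eq_0_iff)
  then have "mcoeff (mconst a * Xser s \<nu> p + mconst b * Xser s' \<nu>' r + mconst c) {#p#} = 0" by simp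
  then show False using assms by (simp add: Xser_def)
qed

lemma XK_nonzero [simp]: "XK s \<nu> p \<noteq> 0"
  \<comment> \<open>\<open>Suc p\<close> with coefficient 0 is a dummy second place.\<close>
  using XK_lin_comb_nonzero[of p "Suc p" 1 s \<nu> 0 s \<nu> 0] by (simp only: cK_hom) simp

lemma XK_minus_mult_nonzero: "p \<noteq> r \<Longrightarrow> XK s \<nu> p - cK c * XK s' \<nu>' r \<noteq> 0"
  using XK_lin_comb_nonzero[of p r 1 s \<nu> "- c" s' \<nu>' 0] by (simp only: cK_hom) simp

section \<open>Superalgebras given by generators and relations\<close>

lemma poly_mapping_expand: "x = (\<Sum>k\<in>Poly_Mapping.keys x. Poly_Mapping.single k (Poly_Mapping.lookup x k))"
proof (rule poly_mapping_eqI)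
  fix k
  have "(\<Sum>j\<in>Poly_Mapping.keys x. Poly_Mapping.lookup (Poly_Mapping.single j (Poly_Mapping.lookup x j)) k)
      = (\<Sum>j\<in>Poly_Mapping.keys x. if j = k then Poly_Mapping.lookup x k else 0)"
    by (rule sum.cong) (auto simp: lookup_single when_def)
  also have "\<dots> = Poly_Mapping.lookup x k"
    by (simp add: in_keys_iff)
  finally show "Poly_Mapping.lookup x k = Poly_Mapping.lookup
      (\<Sum>k\<in>Poly_Mapping.keys x. Poly_Mapping.single k (Poly_Mapping.lookup x k)) k"
    by (simp add: lookup_sum)
qed

lemma letters_zero [simp]: "letters 0 = []"
  by (simp add: zero_fmon_def)

lemma letters_plus [simp]: "letters (v + w) = letters v @ letters w"
  by (simp add: plus_fmon_def)

lemma carrier_free_alg: "carrier (free_alg G) = {x. \<forall>w\<in>Poly_Mapping.keys x. set (letters w) \<subseteq> G}"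
  by (simp add: free_alg_def)

lemma free_alg_sel [simp]:
  "x \<otimes>\<^bsub>free_alg G\<^esub> y = x * y" "\<one>\<^bsub>free_alg G\<^esub> = 1" "\<zero>\<^bsub>free_alg G\<^esub> = 0" "x \<oplus>\<^bsub>free_alg G\<^esub> y = x + y"
  by (simp_all add: free_alg_def)

abbreviation FA :: "'g set \<Rightarrow> 'g fa set" where
  "FA G \<equiv> carrier (free_alg G)"

lemma FA_closed:
  fixes x y :: "'g fa"
  shows "0 \<in> FA G" "1 \<in> FA G" "scal c \<in> FA G" "g \<in> G \<Longrightarrow> gen g \<in> FA G"
    "x \<in> FA G \<Longrightarrow> y \<in> FA G \<Longrightarrow> x + y \<in> FA G"
    "x \<in> FA G \<Longrightarrow> y \<in> FA G \<Longrightarrow> x - y \<in> FA G"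
    "x \<in> FA G \<Longrightarrow> - x \<in> FA G"
    "x \<in> FA G \<Longrightarrow> y \<in> FA G \<Longrightarrow> x * y \<in> FA G"
    "x \<in> FA G \<Longrightarrow> x ^ n \<in> FA G"
proof -
  note carrier_free_alg [simp]
  show one: "1 \<in> FA G" by simp
  show mult: "x * y \<in> FA G" if "x \<in> FA G" "y \<in> FA G" for x y :: "'g fa"
    using that keys_mult[of x y] by fastforce
  show "x \<in> FA G \<Longrightarrow> x ^ n \<in> FA G"
    by (induction n) (simp_all only: power.simps one mult)
  show "x \<in> FA G \<Longrightarrow> y \<in> FA G \<Longrightarrow> x + y \<in> FA G"
    using Poly_Mapping.keys_add[of x y] by auto
  show "x \<in> FA G \<Longrightarrow> y \<in> FA G \<Longrightarrow> x - y \<in> FA G"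
    using keys_diff[of x y] by auto
qed (auto simp: scal_def gen_def in_keys_iff carrier_free_alg)

lemma ring_free_alg: "ring (free_alg G)"
proof (rule ringI)
  show "abelian_group (free_alg G)"
  proof (rule abelian_groupI)
    fix x assume "x \<in> FA G"
    then show "\<exists>y\<in>FA G. y \<oplus>\<^bsub>free_alg G\<^esub> x = \<zero>\<^bsub>free_alg G\<^esub>"
      by (intro bexI[of _ "- x"] FA_closed) auto
  qed (simp_all only: free_alg_sel FA_closed add_0 add_0_right ac_simps)
  show "Group.monoid (free_alg G)"
    by (rule Group.monoidI) (simp_all only: free_alg_sel FA_closed mult.assoc mult_1_left mult_1_right)
qed (simp_all only: free_alg_sel distrib_left distrib_right)

lemma scal_hom: "scal 0 = 0" "scal 1 = 1" "scal (c + d) = scal c + scal d" "scal (c * d) = scal c * scal d"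
  "scal (- c) = - scal c"
  by (simp_all add: scal_def single_add mult_single single_uminus)

lemma scal_commute: "scal c * x = x * scal c" for x :: "'a fa"
proof -
  have "scal c * Poly_Mapping.single k d = Poly_Mapping.single k d * scal c" for k :: "'a fmon" and d
    by (simp add: scal_def mult_single mult.commute)
  then show ?thesis
    by (subst (1 2) poly_mapping_expand[of x]) (simp add: sum_distrib_left sum_distrib_right)
qed

locale presentation =
  fixes G :: "'g set" and S :: "'g fa set" and pr :: "'g \<Rightarrow> bit"
  assumes rels_carrier: "S \<subseteq> FA G"
begin

sublocale R: ring "free_alg G" by (rule ring_free_alg)

abbreviation "I \<equiv> rel_ideal G S"

lemma I_ideal: "ideal I (free_alg G)"
  unfolding rel_ideal_def using rels_carrier by (rule R.genideal_ideal)

sublocale I: ideal "rel_ideal G S" "free_alg G" by (rule I_ideal)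

lemma I_carrier: "x \<in> I \<Longrightarrow> x \<in> FA G"
  by (rule I.Icarr)

lemma a_minus_eq: "x \<in> FA G \<Longrightarrow> y \<in> FA G \<Longrightarrow> x \<ominus>\<^bsub>free_alg G\<^esub> y = x - y"
proof -
  assume x: "x \<in> FA G" and y: "y \<in> FA G"
  have "\<ominus>\<^bsub>free_alg G\<^esub> y = - y"
    by (rule R.minus_equality) (use y FA_closed(7)[OF y] in \<open>simp_all\<close>)
  then show ?thesis by (simp add: a_minus_def)
qed

lemma I_closed:
  "0 \<in> I" "x \<in> I \<Longrightarrow> y \<in> I \<Longrightarrow> x + y \<in> I" "x \<in> I \<Longrightarrow> y \<in> FA G \<Longrightarrow> x * y \<in> I"
  "x \<in> I \<Longrightarrow> y \<in> FA G \<Longrightarrow> y * x \<in> I" "x \<in> S \<Longrightarrow> x \<in> I"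
  using I.zero_closed I.a_closed[of x y] I.I_l_closed[of x y] I.I_r_closed[of x y]
    R.genideal_self[OF rels_carrier] by (auto simp: rel_ideal_def)

lemma I_minimal: "ideal J (free_alg G) \<Longrightarrow> S \<subseteq> J \<Longrightarrow> I \<subseteq> J"
  unfolding rel_ideal_def by (rule R.genideal_minimal)

lemma idealI_free:
  assumes "J \<subseteq> FA G" "0 \<in> J" "\<And>x y. x \<in> J \<Longrightarrow> y \<in> J \<Longrightarrow> x + y \<in> J"
    "\<And>x y. x \<in> J \<Longrightarrow> y \<in> FA G \<Longrightarrow> x * y \<in> J" "\<And>x y. x \<in> J \<Longrightarrow> y \<in> FA G \<Longrightarrow> y * x \<in> J"
  shows "ideal J (free_alg G)"
proof (rule idealI[OF ring_free_alg])
  show "subgroup J (add_monoid (free_alg G))"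
  proof (rule R.add.subgroupI)
    show "J \<subseteq> FA G" "J \<noteq> {}" using assms(1,2) by auto
    fix a b assume "a \<in> J" "b \<in> J"
    then show "a \<oplus>\<^bsub>free_alg G\<^esub> b \<in> J" using assms(3) by simp
  next
    fix a assume a: "a \<in> J"
    \<comment> \<open>Negation comes from the multiplicative closure, as \<open>- a\<close> is
      \<open>a\<close> times \<open>- 1\<close>.\<close>
    then have "- a \<in> J" using assms(4)[OF a, of "- 1"] by (simp add: FA_closed)
    moreover have "\<ominus>\<^bsub>free_alg G\<^esub> a = - a"
      using a_minus_eq[of 0 a] a assms(1) FA_closed(1)[where G = G] by (auto simp: a_minus_def)
    ultimately show "\<ominus>\<^bsub>free_alg G\<^esub> a \<in> J" by (simp only:)
  qed
qed (use assms(4,5) in \<open>simp_all only: free_alg_sel\<close>)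

subsection \<open>The quotient\<close>

abbreviation "A \<equiv> presented G S"

sublocale A: ring A
  unfolding presented_def by (rule I.quotient_is_ring)

abbreviation "cl \<equiv> cls G S"

lemma cl_hom: "cl \<in> ring_hom (free_alg G) A"
  using I.rcos_ring_hom by (simp add: cls_def[abs_def] presented_def)

lemma cl_simps:
  "x \<in> FA G \<Longrightarrow> y \<in> FA G \<Longrightarrow> cl x \<oplus>\<^bsub>A\<^esub> cl y = cl (x + y)"
  "x \<in> FA G \<Longrightarrow> y \<in> FA G \<Longrightarrow> cl x \<otimes>\<^bsub>A\<^esub> cl y = cl (x * y)"
  "\<one>\<^bsub>A\<^esub> = cl 1" "x \<in> FA G \<Longrightarrow> cl x \<in> carrier A"
  using ring_hom_add[OF cl_hom] ring_hom_mult[OF cl_hom] ring_hom_one[OF cl_hom] ring_hom_closed[OF cl_hom]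
  by (simp_all only: free_alg_sel)

lemma cl_zero: "\<zero>\<^bsub>A\<^esub> = cl 0"
proof -
  have "cl 0 \<oplus>\<^bsub>A\<^esub> cl 0 = cl 0" by (simp add: cl_simps(1) FA_closed)
  then show ?thesis using cl_simps(4)[OF FA_closed(1)] A.add.l_cancel_one by metis
qed

lemma carrier_A: "carrier A = cl ` FA G"
  by (auto simp: presented_def FactRing_def A_RCOSETS_def' cls_def)

lemma mem_cl: "x \<in> FA G \<Longrightarrow> y \<in> cl x \<longleftrightarrow> (\<exists>i\<in>I. y = i + x)"
  by (auto simp: cls_def a_r_coset_def')

lemma cl_eq_iff:
  assumes "x \<in> FA G" "y \<in> FA G" shows "cl x = cl y \<longleftrightarrow> x - y \<in> I"
  using R.quotient_eq_iff_same_a_r_cos[OF I_ideal assms] a_minus_eq[OF assms] by (simp add: cls_def)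

lemma cl_uminus: assumes "x \<in> FA G" shows "\<ominus>\<^bsub>A\<^esub> cl x = cl (- x)"
  by (rule A.minus_equality) (use assms in \<open>simp_all only: cl_simps cl_zero FA_closed left_minus\<close>)

subsection \<open>Parity\<close>

definition wpar :: "'g fmon \<Rightarrow> bit" where
  "wpar w = (\<Sum>g\<leftarrow>letters w. pr g)"

lemma wpar_simps [simp]: "wpar 0 = 0" "wpar (v + w) = wpar v + wpar w"
  by (simp_all add: wpar_def)

definition hom :: "bit \<Rightarrow> 'g fa set" where
  "hom d = {x \<in> FA G. \<forall>w\<in>Poly_Mapping.keys x. wpar w = d}"

definition hpart :: "bit \<Rightarrow> 'g fa \<Rightarrow> 'g fa" where
  "hpart d x = Poly_Mapping.mapp (\<lambda>w c. c when wpar w = d) x"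

lemma lookup_hpart: "Poly_Mapping.lookup (hpart d x) w = (Poly_Mapping.lookup x w when wpar w = d)"
  by (auto simp: hpart_def lookup_mapp when_def in_keys_iff)

lemma hpart_add: "hpart d (x + y) = hpart d x + hpart d y"
  by (rule poly_mapping_eqI) (simp add: lookup_hpart lookup_add when_def)

lemma hpart_diff: "hpart d (x - y) = hpart d x - hpart d y"
  by (rule poly_mapping_eqI) (simp add: lookup_hpart lookup_minus when_def)

lemma hpart_decomp: "x = hpart 0 x + hpart 1 x"
  by (rule poly_mapping_eqI) (auto simp: lookup_hpart lookup_add when_def)

lemma hpart_hom: "x \<in> hom e \<Longrightarrow> hpart d x = (if d = e then x else 0)"
  by (rule poly_mapping_eqI) (auto simp: lookup_hpart hom_def when_def in_keys_iff)

lemma hpart_in_hom: "x \<in> FA G \<Longrightarrow> hpart d x \<in> hom d"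
  by (auto simp: hom_def in_keys_iff lookup_hpart when_def carrier_free_alg split: if_splits)

lemma hom_FA: "x \<in> hom d \<Longrightarrow> x \<in> FA G"
  by (simp add: hom_def)

lemma hom_closed:
  "0 \<in> hom d" "1 \<in> hom 0" "scal c \<in> hom 0" "g \<in> G \<Longrightarrow> gen g \<in> hom (pr g)"
  "x \<in> hom d \<Longrightarrow> y \<in> hom d \<Longrightarrow> x + y \<in> hom d"
  "x \<in> hom d \<Longrightarrow> y \<in> hom d \<Longrightarrow> x - y \<in> hom d"
  "x \<in> hom d \<Longrightarrow> - x \<in> hom d"
  "x \<in> hom d \<Longrightarrow> y \<in> hom e \<Longrightarrow> x * y \<in> hom (d + e)"
proof -
  show "x \<in> hom d \<Longrightarrow> y \<in> hom d \<Longrightarrow> x + y \<in> hom d"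
    using Poly_Mapping.keys_add[of x y] FA_closed(5)[of x G y] by (auto simp: hom_def)
  show "x \<in> hom d \<Longrightarrow> y \<in> hom d \<Longrightarrow> x - y \<in> hom d"
    using keys_diff[of x y] FA_closed(6)[of x G y] by (auto simp: hom_def)
  show "x * y \<in> hom (d + e)" if xy: "x \<in> hom d" "y \<in> hom e"
  proof -
    have "x * y \<in> FA G" using xy by (intro FA_closed hom_FA)
    then show ?thesis using xy keys_mult[of x y] unfolding hom_def by fastforce
  qed
qed (auto simp: hom_def scal_def gen_def in_keys_iff wpar_def carrier_free_alg)

lemma hom_sum: "(\<And>i. i \<in> B \<Longrightarrow> f i \<in> hom d) \<Longrightarrow> sum f B \<in> hom d"
  by (induction B rule: infinite_finite_induct) (auto intro: hom_closed)

lemma hom_power: "x \<in> hom 0 \<Longrightarrow> x ^ n \<in> hom 0"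
  using hom_closed(8)[of x 0 _ 0] by (induction n) (auto intro: hom_closed)

lemma presented_parity_eq: "presented_parity pr G S d = cl ` hom d"
  by (auto simp: presented_parity_def hom_def wpar_def)

end

locale super_presentation = presentation +
  assumes rels_homogeneous: "x \<in> S \<Longrightarrow> \<exists>d. x \<in> hom d"
begin

text \<open>The elements of \<open>I\<close> all of whose homogeneous parts lie in \<open>I\<close>
  form an ideal containing the homogeneous relations, hence all of \<open>I\<close>. This makes the
  grading of the free algebra descend to the quotient.\<close>

lemma hpart_I: assumes "x \<in> I" shows "hpart d x \<in> I"
proof -
  define J where "J = {x \<in> I. \<forall>d. hpart d x \<in> I}"
  \<comment> \<open>Parity \<open>d\<close> arises as \<open>0 + d\<close> and as
    \<open>1 + (d + 1)\<close>.\<close>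
  have mult: "hpart d (x * y) = hpart 0 x * hpart d y + hpart 1 x * hpart (d + 1) y"
    if "x \<in> FA G" "y \<in> FA G" for x y d
  proof -
    have h: "hpart d' (hpart e x * hpart e' y) = (if d' = e + e' then hpart e x * hpart e' y else 0)" for d' e e'
      by (rule hpart_hom[OF hom_closed(8)]) (simp_all only: hpart_in_hom that)
    have "x * y = hpart 0 x * hpart 0 y + hpart 0 x * hpart 1 y + hpart 1 x * hpart 0 y + hpart 1 x * hpart 1 y"
      by (subst hpart_decomp[of x], subst hpart_decomp[of y]) (simp add: algebra_simps)
    then show ?thesis by (cases d) (simp_all add: hpart_add h)
  qed
  have hp: "hpart d x \<in> FA G" if "x \<in> FA G" for x d
    using hpart_in_hom[OF that] by (rule hom_FA)
  have "ideal J (free_alg G)"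
  proof (rule idealI_free)
    show "J \<subseteq> FA G" unfolding J_def using I_carrier by blast
    have "hpart d 0 = 0" for d by (rule poly_mapping_eqI) (simp add: lookup_hpart)
    then show "0 \<in> J" by (simp add: J_def I_closed)
    show "\<And>x y. x \<in> J \<Longrightarrow> y \<in> J \<Longrightarrow> x + y \<in> J"
      by (simp add: J_def I_closed hpart_add)
    show "x * y \<in> J" "y * x \<in> J" if "x \<in> J" "y \<in> FA G" for x y
    proof -
      have x: "x \<in> I" "x \<in> FA G" "\<And>d. hpart d x \<in> I" using that I_carrier by (auto simp: J_def)
      show "x * y \<in> J" "y * x \<in> J"
        unfolding J_def mem_Collect_eq mult[OF x(2) that(2)] mult[OF that(2) x(2)]
        by (intro conjI allI I_closed x hp that)+
    qed
  qed
  moreover have "S \<subseteq> J"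
  proof
    fix x assume x: "x \<in> S"
    then obtain e where "x \<in> hom e" using rels_homogeneous by blast
    then show "x \<in> J" using x by (simp add: J_def hpart_hom I_closed)
  qed
  ultimately show ?thesis using I_minimal assms by (auto simp: J_def)
qed

lemma superalgebra_presented:
  "superalgebra A (\<lambda>c. cl (scal c)) (presented_parity pr G S)"
proof (intro superalgebra.intro superalgebra_axioms.intro A.ring_axioms)
  show "(\<lambda>c. cl (scal c)) \<in> ring_hom ring_of_type_algebra A"
    by (rule ring_hom_memI)
      (simp_all only: ring_of_type_algebra_def ring_record_simps partial_object.simps monoid.simps cl_simps scal_hom FA_closed)
  fix a c
  assume "a \<in> carrier A"
  then show "cl (scal c) \<otimes>\<^bsub>A\<^esub> a = a \<otimes>\<^bsub>A\<^esub> cl (scal c)"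
    unfolding carrier_A by (auto simp: cl_simps FA_closed scal_commute)
next
  fix d
  show "additive_subgroup (presented_parity pr G S d) A"
    unfolding presented_parity_eq
  proof (intro additive_subgroup.intro A.add.subgroupI)
    show "cl ` hom d \<subseteq> carrier A" by (auto intro: cl_simps hom_FA)
    show "cl ` hom d \<noteq> {}" using hom_closed(1) by auto
    show "\<ominus>\<^bsub>A\<^esub> a \<in> cl ` hom d" if "a \<in> cl ` hom d" for a
      using that by (auto simp: cl_uminus hom_FA hom_closed)
    show "a \<oplus>\<^bsub>A\<^esub> b \<in> cl ` hom d" if "a \<in> cl ` hom d" "b \<in> cl ` hom d" for a b
      using that by (auto simp: cl_simps hom_FA hom_closed)
  qed
next
  fix a c d assume "a \<in> presented_parity pr G S d"
  then obtain x where x: "x \<in> hom d" "a = cl x" by (auto simp: presented_parity_eq)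
  have "scal c * x \<in> hom d"
    using hom_closed(8)[OF hom_closed(3)[of c] x(1)] by (simp only: add_0)
  then show "cl (scal c) \<otimes>\<^bsub>A\<^esub> a \<in> presented_parity pr G S d"
    using x hom_FA[OF x(1)] by (simp add: presented_parity_eq cl_simps FA_closed)
next
  show "carrier A = presented_parity pr G S 0 <+>\<^bsub>A\<^esub> presented_parity pr G S 1"
  proof (rule antisym)
    show "carrier A \<subseteq> presented_parity pr G S 0 <+>\<^bsub>A\<^esub> presented_parity pr G S 1"
    proof
      fix a assume "a \<in> carrier A"
      then obtain x where x: "x \<in> FA G" "a = cl x" by (auto simp: carrier_A)
      have "a = cl (hpart 0 x) \<oplus>\<^bsub>A\<^esub> cl (hpart 1 x)"
        using hpart_decomp[of x] x by (simp add: cl_simps hom_FA[OF hpart_in_hom])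
      then show "a \<in> presented_parity pr G S 0 <+>\<^bsub>A\<^esub> presented_parity pr G S 1"
        unfolding presented_parity_eq set_add_def' using hpart_in_hom[OF x(1)] by blast
    qed
    show "presented_parity pr G S 0 <+>\<^bsub>A\<^esub> presented_parity pr G S 1 \<subseteq> carrier A"
      unfolding presented_parity_eq set_add_def' by (auto simp: cl_simps hom_FA FA_closed)
  qed
  show "presented_parity pr G S 0 \<inter> presented_parity pr G S 1 = {\<zero>\<^bsub>A\<^esub>}"
  proof
    show "presented_parity pr G S 0 \<inter> presented_parity pr G S 1 \<subseteq> {\<zero>\<^bsub>A\<^esub>}"
    proof
      fix a assume "a \<in> presented_parity pr G S 0 \<inter> presented_parity pr G S 1"
      then obtain x y where xy: "x \<in> hom 0" "y \<in> hom 1" "a = cl x" "a = cl y" by (auto simp: presented_parity_eq)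
      \<comment> \<open>The even part of \<open>x - y\<close> is \<open>x\<close>, so
        \<open>x\<close> itself lies in the graded ideal; homogeneity of the relations is used
        here.\<close>
      then have "x - y \<in> I" using cl_eq_iff[of x y] by (simp add: hom_FA)
      then have "hpart 0 (x - y) \<in> I" by (rule hpart_I)
      then have "x \<in> I" using xy by (simp add: hpart_diff hpart_hom)
      then have "a = cl 0" using xy cl_eq_iff[of x 0] by (simp add: hom_FA FA_closed)
      then show "a \<in> {\<zero>\<^bsub>A\<^esub>}" by (simp add: cl_zero)
    qed
  qed (auto simp: presented_parity_eq cl_zero intro: hom_closed)
  show "\<one>\<^bsub>A\<^esub> \<in> presented_parity pr G S 0"
    by (auto simp: presented_parity_eq cl_simps intro: hom_closed)
next
  fix a b d d' assume "a \<in> presented_parity pr G S d" "b \<in> presented_parity pr G S d'"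
  then obtain x y where xy: "x \<in> hom d" "y \<in> hom d'" "a = cl x" "b = cl y" by (auto simp: presented_parity_eq)
  then have "a \<otimes>\<^bsub>A\<^esub> b = cl (x * y)" by (simp add: cl_simps hom_FA)
  moreover have "x * y \<in> hom (d + d')" using xy by (intro hom_closed(8))
  ultimately show "a \<otimes>\<^bsub>A\<^esub> b \<in> presented_parity pr G S (d + d')"
    unfolding presented_parity_eq by blast
qed

end

section \<open>Restriction of superalgebras and supermodules to a subsuperalgebra\<close>

lemma superalgebra_restrict:
  assumes "subsuperalgebra A sc Ap S"
  shows "superalgebra (A\<lparr>carrier := S\<rparr>) sc (\<lambda>d. S \<inter> Ap d)"
proof -
  interpret superalgebra A sc Ap using assms by (simp add: subsuperalgebra_def)
  have S: "subring S A" "Set.range sc \<subseteq> S" "S = (S \<inter> Ap 0) <+>\<^bsub>A\<^esub> (S \<inter> Ap 1)"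
    using assms by (simp_all add: subsuperalgebra_def)
  note SE = subringE[OF S(1)]
  interpret SR: ring "A\<lparr>carrier := S\<rparr>" by (rule subring_is_ring[OF S(1)])
  have SA: "x \<in> S \<Longrightarrow> x \<in> carrier A" for x using SE(1) by blast
  have scS: "sc c \<in> S" for c using S(2) by blast
  show ?thesis
  proof (intro superalgebra.intro superalgebra_axioms.intro SR.ring_axioms)
    show "sc \<in> ring_hom ring_of_type_algebra (A\<lparr>carrier := S\<rparr>)"
      using sc_hom S(2) by (auto simp: ring_hom_def)
    show "sc c \<otimes>\<^bsub>A\<lparr>carrier := S\<rparr>\<^esub> a = a \<otimes>\<^bsub>A\<lparr>carrier := S\<rparr>\<^esub> sc c" if "a \<in> carrier (A\<lparr>carrier := S\<rparr>)" for a c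
      using that SA sc_central by simp
    show "additive_subgroup (S \<inter> Ap d) (A\<lparr>carrier := S\<rparr>)" for d
    proof (intro additive_subgroup.intro SR.add.subgroupI)
      interpret d: additive_subgroup "Ap d" A by (rule parity_subgroup)
      show "S \<inter> Ap d \<subseteq> carrier (A\<lparr>carrier := S\<rparr>)" by simp
      show "S \<inter> Ap d \<noteq> {}" using SE(2) d.zero_closed by blast
      show "a \<oplus>\<^bsub>A\<lparr>carrier := S\<rparr>\<^esub> b \<in> S \<inter> Ap d" if "a \<in> S \<inter> Ap d" "b \<in> S \<inter> Ap d" for a b
        using that SE(7) d.a_closed by simp
      show "\<ominus>\<^bsub>A\<lparr>carrier := S\<rparr>\<^esub> a \<in> S \<inter> Ap d" if "a \<in> S \<inter> Ap d" for a
      proof -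
        have "\<ominus>\<^bsub>A\<lparr>carrier := S\<rparr>\<^esub> a = \<ominus>\<^bsub>A\<^esub> a"
          by (rule SR.minus_equality) (use that SE(5) SA l_neg in auto)
        then show ?thesis using that SE(5) d.a_inv_closed by auto
      qed
    qed
    show "sc c \<otimes>\<^bsub>A\<lparr>carrier := S\<rparr>\<^esub> a \<in> S \<inter> Ap d" if "a \<in> S \<inter> Ap d" for a c d
      using that scS parity_scale SE(6) by auto
    show "carrier (A\<lparr>carrier := S\<rparr>) = (S \<inter> Ap 0) <+>\<^bsub>A\<lparr>carrier := S\<rparr>\<^esub> (S \<inter> Ap 1)"
    proof -
      have "(S \<inter> Ap 0) <+>\<^bsub>A\<lparr>carrier := S\<rparr>\<^esub> (S \<inter> Ap 1) = (S \<inter> Ap 0) <+>\<^bsub>A\<^esub> (S \<inter> Ap 1)"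
        by (simp add: set_add_def')
      then show ?thesis by (simp only: S(3)[symmetric]) simp
    qed
    show "(S \<inter> Ap 0) \<inter> (S \<inter> Ap 1) = {\<zero>\<^bsub>A\<lparr>carrier := S\<rparr>\<^esub>}"
      using parity_direct SE(2) by auto
    show "\<one>\<^bsub>A\<lparr>carrier := S\<rparr>\<^esub> \<in> S \<inter> Ap 0"
      using parity_one SE(3) by simp
    show "a \<otimes>\<^bsub>A\<lparr>carrier := S\<rparr>\<^esub> b \<in> S \<inter> Ap (d + d')" if "a \<in> S \<inter> Ap d" "b \<in> S \<inter> Ap d'" for a b d d'
      using that parity_mult SE(6) by simp
  qed
qed

lemma left_supermodule_restrict:
  assumes "subsuperalgebra A sc Ap S" "left_supermodule A sc Ap sm V Vp la"
  shows "left_supermodule (A\<lparr>carrier := S\<rparr>) sc (\<lambda>d. S \<inter> Ap d) sm V Vp la"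
proof -
  interpret M: left_supermodule A sc Ap sm V Vp la by fact
  have SA: "x \<in> S \<Longrightarrow> x \<in> carrier A" for x
    using assms(1) subringE(1) unfolding subsuperalgebra_def by blast
  show ?thesis
  proof (rule left_supermodule.intro[OF superalgebra_restrict[OF assms(1)] M.spc.superspace_axioms],
      rule left_supermodule_axioms.intro)
    fix a d m d' assume "a \<in> S \<inter> Ap d" "m \<in> Vp d'"
    then show "la a m \<in> Vp (d + d')" using M.act_parity by blast
  qed (simp_all add: SA M.act_closed M.act_add_alg M.act_add_spc M.act_scalar M.act_one M.act_mult)
qed

section \<open>Modules over a presented algebra\<close>

text \<open>Common form of \<open>free_lact\<close> and \<open>free_ract\<close>: \<open>W w\<close>
  is the operator of a word, whose letters are applied from right to left or from left to
  right.\<close>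

definition word_act :: "(base \<Rightarrow> 'v::ab_group_add \<Rightarrow> 'v) \<Rightarrow> ('g fmon \<Rightarrow> 'v \<Rightarrow> 'v) \<Rightarrow> 'g fa \<Rightarrow> 'v \<Rightarrow> 'v" where
  "word_act sm W x m = (\<Sum>w\<in>Poly_Mapping.keys x. sm (Poly_Mapping.lookup x w) (W w m))"

text \<open>Left and right actions differ only in the rule for \<open>W (u + v)\<close>, which is
  kept out of the locale and enters as a disjunction in \<open>annihilator\<close>.\<close>

locale word_module = vector_space sm + presentation G S pr
  for sm :: "base \<Rightarrow> 'v::ab_group_add \<Rightarrow> 'v" and G :: "'g set" and S pr +
  fixes V :: "'v set" and W :: "'g fmon \<Rightarrow> 'v \<Rightarrow> 'v"
  assumes V: "subspace V"
    and W_closed: "set (letters w) \<subseteq> G \<Longrightarrow> m \<in> V \<Longrightarrow> W w m \<in> V"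
    and W_add: "set (letters w) \<subseteq> G \<Longrightarrow> m \<in> V \<Longrightarrow> m' \<in> V \<Longrightarrow> W w (m + m') = W w m + W w m'"
    and W_scale: "set (letters w) \<subseteq> G \<Longrightarrow> m \<in> V \<Longrightarrow> W w (sm c m) = sm c (W w m)"
    and W_zero: "m \<in> V \<Longrightarrow> W 0 m = m"
begin

abbreviation "act \<equiv> word_act sm W"

lemma act_sum_superset:
  assumes "finite Z" "Poly_Mapping.keys x \<subseteq> Z"
  shows "act x m = (\<Sum>w\<in>Z. sm (Poly_Mapping.lookup x w) (W w m))"
  unfolding word_act_def by (rule sum.mono_neutral_left) (use assms in \<open>auto simp: in_keys_iff\<close>)

lemma act_add: "act (x + y) m = act x m + act y m"
proof -
  let ?Z = "Poly_Mapping.keys x \<union> Poly_Mapping.keys y"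
  have "Poly_Mapping.keys (x + y) \<subseteq> ?Z" by (rule Poly_Mapping.keys_add)
  then show ?thesis
    by (simp add: act_sum_superset[where Z = ?Z] lookup_add scale_left_distrib sum.distrib)
qed

lemma act_0 [simp]: "act 0 m = 0"
  by (simp add: word_act_def)

lemma act_sum: "act (sum f B) m = (\<Sum>i\<in>B. act (f i) m)"
  by (induction B rule: infinite_finite_induct) (auto simp: act_add)

lemma act_uminus: "act (- x) m = - act x m"
  using act_add[of x "- x" m] by (simp add: eq_neg_iff_add_eq_0 add.commute)

lemma act_diff: "act (x - y) m = act x m - act y m"
  using act_add[of x "- y" m] by (simp add: act_uminus)

lemma act_single: "act (Poly_Mapping.single w c) m = sm c (W w m)"
  by (simp add: word_act_def)

lemma act_scal: "m \<in> V \<Longrightarrow> act (scal c) m = sm c m"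
  by (simp add: scal_def act_single W_zero)

lemma act_one: "m \<in> V \<Longrightarrow> act 1 m = m"
  using act_scal[of m 1] by (simp add: scal_hom)

lemma act_closed: "x \<in> FA G \<Longrightarrow> m \<in> V \<Longrightarrow> act x m \<in> V"
  unfolding word_act_def
  by (intro subspace_sum[OF V] subspace_scale[OF V] W_closed) (auto simp: carrier_free_alg)

lemma act_add_right:
  assumes "x \<in> FA G" "m \<in> V" "m' \<in> V" shows "act x (m + m') = act x m + act x m'"
  unfolding word_act_def sum.distrib[symmetric]
  by (rule sum.cong) (use assms in \<open>auto simp: W_add scale_right_distrib carrier_free_alg\<close>)

lemma W_sum:
  assumes "set (letters w) \<subseteq> G" "\<And>i. i \<in> B \<Longrightarrow> f i \<in> V"
  shows "W w (sum f B) = (\<Sum>i\<in>B. W w (f i))"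
  using assms(2)
proof (induction B rule: infinite_finite_induct)
  case (insert i B)
  then show ?case by (simp add: W_add assms(1) subspace_sum[OF V])
next
  case empty
  have "W w (0 + 0) = W w 0 + W w 0"
    using W_add[OF assms(1)] subspace_0[OF V] by blast
  then show ?case by simp
next
  case (infinite B)
  have "W w (0 + 0) = W w 0 + W w 0"
    using W_add[OF assms(1)] subspace_0[OF V] by blast
  then show ?case using infinite by simp
qed

lemma act_act:
  assumes x: "x \<in> FA G" and y: "y \<in> FA G" and m: "m \<in> V"
  shows "act x (act y m) = (\<Sum>u\<in>Poly_Mapping.keys x. \<Sum>v\<in>Poly_Mapping.keys y.
    sm (Poly_Mapping.lookup x u * Poly_Mapping.lookup y v) (W u (W v m)))"
proof -
  have W: "sm (Poly_Mapping.lookup y v) (W v m) \<in> V" if "v \<in> Poly_Mapping.keys y" for v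
    using that y m by (intro subspace_scale[OF V] W_closed) (auto simp: carrier_free_alg)
  have "W u (act y m) = (\<Sum>v\<in>Poly_Mapping.keys y. sm (Poly_Mapping.lookup y v) (W u (W v m)))"
    if u: "u \<in> Poly_Mapping.keys x" for u
    unfolding word_act_def using u x y m
    by (subst W_sum) (auto simp: W_scale W_closed W carrier_free_alg intro!: sum.cong)
  then show ?thesis
    by (simp add: word_act_def scale_sum_right)
qed

lemma act_mult_expand:
  "act (x * y) m = (\<Sum>u\<in>Poly_Mapping.keys x. \<Sum>v\<in>Poly_Mapping.keys y.
    sm (Poly_Mapping.lookup x u * Poly_Mapping.lookup y v) (W (u + v) m))"
  by (subst (1) poly_mapping_expand[of x], subst (1) poly_mapping_expand[of y])
    (simp add: sum_product act_sum mult_single act_single)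

text \<open>The elements which annihilate \<open>V\<close> form an ideal, so it suffices to check the relations.\<close>

lemma annihilator:
  assumes mult: "(\<forall>x\<in>FA G. \<forall>y\<in>FA G. \<forall>m\<in>V. act (x * y) m = act x (act y m)) \<or>
      (\<forall>x\<in>FA G. \<forall>y\<in>FA G. \<forall>m\<in>V. act (x * y) m = act y (act x m))"
    and rels: "\<And>x m. x \<in> S \<Longrightarrow> m \<in> V \<Longrightarrow> act x m = 0"
    and x: "x \<in> I" and m: "m \<in> V"
  shows "act x m = 0"
proof -
  define J where "J = {x \<in> FA G. \<forall>m\<in>V. act x m = 0}"
  have z: "act x 0 = 0" if "x \<in> FA G" for x
    using act_add_right[OF that, of 0 0] subspace_0[OF V] by simp
  have "ideal J (free_alg G)"
  proof (rule idealI_free)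
    show "J \<subseteq> FA G" by (auto simp: J_def)
    show "0 \<in> J" by (simp add: J_def FA_closed)
    show "x + y \<in> J" if "x \<in> J" "y \<in> J" for x y
      using that FA_closed(5)[of x G y] by (simp add: J_def act_add)
    show "x * y \<in> J" "y * x \<in> J" if "x \<in> J" "y \<in> FA G" for x y
      using that mult FA_closed(8)[of x G y] FA_closed(8)[of y G x]
      by (auto simp: J_def act_closed z)
  qed
  moreover have "S \<subseteq> J" using rels rels_carrier unfolding J_def by blast
  ultimately show ?thesis using I_minimal x m by (auto simp: J_def)
qed

lemma act_parity:
  assumes Vp: "\<And>d. subspace (Vp d)" "Vp e \<subseteq> V"
    and W: "\<And>w. set (letters w) \<subseteq> G \<Longrightarrow> W w m \<in> Vp (wpar w + e)"
    and x: "x \<in> hom d"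
  shows "act x m \<in> Vp (d + e)"
  unfolding word_act_def
proof (intro subspace_sum[OF Vp(1)] subspace_scale[OF Vp(1)])
  fix w assume "w \<in> Poly_Mapping.keys x"
  with x have "set (letters w) \<subseteq> G" "wpar w = d" by (auto simp: hom_def carrier_free_alg)
  then show "W w m \<in> Vp (d + e)" using W by blast
qed

text \<open>Representatives differ by an element of the ideal, which acts by 0, and a coset is never
  empty, so the common value is unique.\<close>

lemma act_coset:
  assumes kill: "\<And>x m. x \<in> I \<Longrightarrow> m \<in> V \<Longrightarrow> act x m = 0" and x: "x \<in> FA G" and m: "m \<in> V"
  shows "(THE m'. \<forall>y\<in>cl x. act y m = m') = act x m"
proof -
  have act: "act y m = act x m" if "y \<in> cl x" for y
  proof -
    have "\<exists>i\<in>I. y = i + x" using that unfolding mem_cl[OF x] .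
    then obtain i where "i \<in> I" "y = i + x" ..
    then show ?thesis using kill[OF _ m] by (simp add: act_add)
  qed
  have x': "x \<in> cl x"
    unfolding mem_cl[OF x] using I_closed(1) by (intro bexI[of _ 0]) simp_all
  show ?thesis
  proof (rule the_equality)
    show "\<forall>y\<in>cl x. act y m = act x m" by (intro ballI act)
    show "m' = act x m" if "\<forall>y\<in>cl x. act y m = m'" for m'
      using bspec[OF that x'] by (rule sym)
  qed
qed

end

lemma free_lact_eq: "free_lact sm h = word_act sm (\<lambda>w. foldr h (letters w))"
  by (simp add: free_lact_def word_act_def fun_eq_iff)

lemma free_ract_eq: "free_ract sm h = word_act sm (\<lambda>w. fold h (letters w))"
  by (simp add: free_ract_def word_act_def fun_eq_iff)

locale gen_module = vector_space sm + super_presentation G S pr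
  for sm :: "base \<Rightarrow> 'v::ab_group_add \<Rightarrow> 'v" and G :: "'g set" and S pr +
  fixes V :: "'v set" and h :: "'g \<Rightarrow> 'v \<Rightarrow> 'v"
  assumes V: "subspace V"
    and h_closed: "g \<in> G \<Longrightarrow> m \<in> V \<Longrightarrow> h g m \<in> V"
    and h_add: "g \<in> G \<Longrightarrow> m \<in> V \<Longrightarrow> m' \<in> V \<Longrightarrow> h g (m + m') = h g m + h g m'"
    and h_scale: "g \<in> G \<Longrightarrow> m \<in> V \<Longrightarrow> h g (sm c m) = sm c (h g m)"
begin

lemma foldr_props:
  assumes "set us \<subseteq> G" "m \<in> V"
  shows foldr_closed: "foldr h us m \<in> V"
    and foldr_add: "m' \<in> V \<Longrightarrow> foldr h us (m + m') = foldr h us m + foldr h us m'"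
    and foldr_scale: "foldr h us (sm c m) = sm c (foldr h us m)"
proof -
  have cl: "foldr h us m \<in> V" if "set us \<subseteq> G" "m \<in> V" for m us
    using that by (induction us) (auto simp: h_closed)
  show "foldr h us m \<in> V" using cl assms by blast
  show "foldr h us (sm c m) = sm c (foldr h us m)"
    using assms by (induction us) (auto simp: h_scale cl)
  show "foldr h us (m + m') = foldr h us m + foldr h us m'" if "m' \<in> V"
    using assms that by (induction us) (auto simp: h_add cl)
qed

lemma word_module_l: "word_module sm G S V (\<lambda>w. foldr h (letters w))"
  by unfold_locales (auto simp: V foldr_closed foldr_add foldr_scale)

lemma word_module_r: "word_module sm G S V (\<lambda>w. fold h (letters w))"
proof -
  have "fold h us = foldr h (rev us)" for us by (simp add: foldr_conv_fold)
  then show ?thesis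
    by unfold_locales (auto simp: V foldr_closed foldr_add foldr_scale)
qed

sublocale L: word_module sm G S pr V "\<lambda>w. foldr h (letters w)"
  by (rule word_module_l)
sublocale Rt: word_module sm G S pr V "\<lambda>w. fold h (letters w)"
  by (rule word_module_r)

abbreviation "fl \<equiv> free_lact sm h"
abbreviation "fr \<equiv> free_ract sm h"

lemma fl_mult: "x \<in> FA G \<Longrightarrow> y \<in> FA G \<Longrightarrow> m \<in> V \<Longrightarrow> fl (x * y) m = fl x (fl y m)"
  by (simp add: free_lact_eq L.act_act L.act_mult_expand)

lemma fr_mult: "x \<in> FA G \<Longrightarrow> y \<in> FA G \<Longrightarrow> m \<in> V \<Longrightarrow> fr (x * y) m = fr y (fr x m)"
  by (simp add: free_ract_eq Rt.act_act Rt.act_mult_expand mult.commute) (rule sum.swap)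

lemma fl_simps:
  "fl (x + y) m = fl x m + fl y m" "fl (x - y) m = fl x m - fl y m" "fl (- x) m = - fl x m" "fl 0 m = 0"
  "m \<in> V \<Longrightarrow> fl 1 m = m" "m \<in> V \<Longrightarrow> fl (scal c) m = sm c m" "fl (gen g) m = h g m"
  "x \<in> FA G \<Longrightarrow> m \<in> V \<Longrightarrow> fl x m \<in> V"
  by (simp_all add: free_lact_eq L.act_add L.act_diff L.act_uminus L.act_one L.act_scal L.act_closed
      gen_def L.act_single)

lemma fr_simps:
  "fr (x + y) m = fr x m + fr y m" "fr (x - y) m = fr x m - fr y m" "fr (- x) m = - fr x m" "fr 0 m = 0"
  "m \<in> V \<Longrightarrow> fr 1 m = m" "m \<in> V \<Longrightarrow> fr (scal c) m = sm c m" "fr (gen g) m = h g m"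
  "x \<in> FA G \<Longrightarrow> m \<in> V \<Longrightarrow> fr x m \<in> V"
  by (simp_all add: free_ract_eq Rt.act_add Rt.act_diff Rt.act_uminus Rt.act_one Rt.act_scal Rt.act_closed
      gen_def Rt.act_single)

lemma fr_sum: "fr (sum f B) m = (\<Sum>i\<in>B. fr (f i) m)"
  by (simp add: free_ract_eq Rt.act_sum)

lemma coset_lact_cls:
  assumes "\<And>x m. x \<in> S \<Longrightarrow> m \<in> V \<Longrightarrow> fl x m = 0" "x \<in> FA G" "m \<in> V"
  shows "coset_lact sm h (cl x) m = fl x m"
  unfolding coset_lact_def free_lact_eq
proof (rule L.act_coset[OF L.annihilator])
  show "(\<forall>x\<in>FA G. \<forall>y\<in>FA G. \<forall>m\<in>V. L.act (x * y) m = L.act x (L.act y m)) \<or>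
      (\<forall>x\<in>FA G. \<forall>y\<in>FA G. \<forall>m\<in>V. L.act (x * y) m = L.act y (L.act x m))"
    using fl_mult by (simp add: free_lact_eq)
qed (use assms in \<open>simp_all add: free_lact_eq\<close>)

lemma coset_ract_cls:
  assumes "\<And>x m. x \<in> S \<Longrightarrow> m \<in> V \<Longrightarrow> fr x m = 0" "x \<in> FA G" "m \<in> V"
  shows "coset_ract sm h m (cl x) = fr x m"
  unfolding coset_ract_def free_ract_eq
proof (rule Rt.act_coset[OF Rt.annihilator])
  show "(\<forall>x\<in>FA G. \<forall>y\<in>FA G. \<forall>m\<in>V. Rt.act (x * y) m = Rt.act x (Rt.act y m)) \<or>
      (\<forall>x\<in>FA G. \<forall>y\<in>FA G. \<forall>m\<in>V. Rt.act (x * y) m = Rt.act y (Rt.act x m))"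
    using fr_mult by (simp add: free_ract_eq)
qed (use assms in \<open>simp_all add: free_ract_eq\<close>)

lemma left_supermodule_presented:
  assumes rels: "\<And>x m. x \<in> S \<Longrightarrow> m \<in> V \<Longrightarrow> fl x m = 0"
    and sp: "superspace sm V Vp"
    and par: "\<And>g m d. g \<in> G \<Longrightarrow> m \<in> Vp d \<Longrightarrow> h g m \<in> Vp (pr g + d)"
  shows "left_supermodule A (\<lambda>c. cl (scal c)) (presented_parity pr G S) sm V Vp (coset_lact sm h)"
proof -
  interpret sp: superspace sm V Vp by fact
  have VpV: "Vp d \<subseteq> V" for d
  proof
    fix m assume "m \<in> Vp d"
    then have "m = m + 0 \<and> m = 0 + m \<and> 0 \<in> Vp 0 \<and> 0 \<in> Vp 1" using subspace_0[OF sp.subspace_parity] by simp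
    then show "m \<in> V" using \<open>m \<in> Vp d\<close> unfolding sp.parity_sum by (cases d) blast+
  qed
  have c: "coset_lact sm h (cl x) m = fl x m" if "x \<in> FA G" "m \<in> V" for x m
    by (rule coset_lact_cls) (use rels that in auto)
  have W: "foldr h us m \<in> Vp ((\<Sum>g\<leftarrow>us. pr g) + d)" if "set us \<subseteq> G" "m \<in> Vp d" for us m d
    using that
  proof (induction us)
    case (Cons g us)
    then show ?case using par[of g "foldr h us m" "(\<Sum>g\<leftarrow>us. pr g) + d"]
      by (simp only: list.map sum_list.Cons foldr_Cons o_apply add.assoc) simp
  qed (simp only: list.map sum_list.Nil foldr_Nil id_apply add_0)
  show ?thesis
  proof (rule left_supermodule.intro[OF superalgebra_presented sp], rule left_supermodule_axioms.intro)
    fix a m d e assume "a \<in> presented_parity pr G S d" "m \<in> Vp e"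
    then obtain x where x: "x \<in> hom d" "a = cl x" by (auto simp: presented_parity_eq)
    have "fl x m \<in> Vp (d + e)"
      unfolding free_lact_eq
      by (rule L.act_parity[OF sp.subspace_parity VpV _ x(1)]) (unfold wpar_def, rule W[OF _ \<open>m \<in> Vp e\<close>])
    moreover have "m \<in> V" using \<open>m \<in> Vp e\<close> VpV by blast
    ultimately show "coset_lact sm h a m \<in> Vp (d + e)"
      unfolding x(2) by (simp only: c hom_FA[OF x(1)])
  qed (auto simp: carrier_A c cl_simps FA_closed fl_simps fl_mult, auto simp: subspace_add[OF V] c free_lact_eq L.act_add_right)
qed

lemma right_supermodule_presented:
  assumes rels: "\<And>x m. x \<in> S \<Longrightarrow> m \<in> V \<Longrightarrow> fr x m = 0"
    and sp: "superspace sm V Vp"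
    and par: "\<And>g m d. g \<in> G \<Longrightarrow> m \<in> Vp d \<Longrightarrow> h g m \<in> Vp (pr g + d)"
  shows "right_supermodule A (\<lambda>c. cl (scal c)) (presented_parity pr G S) sm V Vp (coset_ract sm h)"
proof -
  interpret sp: superspace sm V Vp by fact
  have VpV: "Vp d \<subseteq> V" for d
  proof
    fix m assume "m \<in> Vp d"
    then have "m = m + 0 \<and> m = 0 + m \<and> 0 \<in> Vp 0 \<and> 0 \<in> Vp 1" using subspace_0[OF sp.subspace_parity] by simp
    then show "m \<in> V" using \<open>m \<in> Vp d\<close> unfolding sp.parity_sum by (cases d) blast+
  qed
  have c: "coset_ract sm h m (cl x) = fr x m" if "x \<in> FA G" "m \<in> V" for x m
    by (rule coset_ract_cls) (use rels that in auto)
  have W: "fold h us m \<in> Vp ((\<Sum>g\<leftarrow>us. pr g) + d)" if "set us \<subseteq> G" "m \<in> Vp d" for us m d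
    using that
  proof (induction us arbitrary: m d)
    case (Cons g us)
    then show ?case using Cons.IH[OF _ par[of g m d]] 
      by (simp only: list.map sum_list.Cons fold_Cons o_apply ac_simps) simp
  qed (simp only: list.map sum_list.Nil fold_Nil id_apply add_0)
  show ?thesis
  proof (rule right_supermodule.intro[OF superalgebra_presented sp], rule right_supermodule_axioms.intro)
    fix a m d e assume "m \<in> Vp e" "a \<in> presented_parity pr G S d"
    then obtain x where x: "x \<in> hom d" "a = cl x" by (auto simp: presented_parity_eq)
    have "fr x m \<in> Vp (d + e)"
      unfolding free_ract_eq
      by (rule Rt.act_parity[OF sp.subspace_parity VpV _ x(1)]) (unfold wpar_def, rule W[OF _ \<open>m \<in> Vp e\<close>])
    moreover have "m \<in> V" using \<open>m \<in> Vp e\<close> VpV by blast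
    ultimately show "coset_ract sm h m a \<in> Vp (e + d)"
      unfolding x(2) by (simp only: c hom_FA[OF x(1)] add.commute)
  qed (auto simp: carrier_A c cl_simps FA_closed fr_simps fr_mult, auto simp: subspace_add[OF V] c free_ract_eq Rt.act_add_right)
qed

end

section \<open>Operators on vectors\<close>

declare mconst_hom [simp del] cK_hom(1,2) [simp]

lemma lookup_kscale [simp]: "Poly_Mapping.lookup (kscale c m) b = c * Poly_Mapping.lookup m b"
  by (simp add: kscale_def Poly_Mapping.map.rep_eq when_def)

lemma kscale_simps:
  "kscale c (m + m') = kscale c m + kscale c m'" "kscale (c + d) m = kscale c m + kscale d m"
  "kscale c (m - m') = kscale c m - kscale c m'" "kscale (c - d) m = kscale c m - kscale d m"
  "kscale c (- m) = - kscale c m" "kscale (- c) m = - kscale c m"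
  "kscale c (kscale d m) = kscale (c * d) m" "kscale 1 m = m" "kscale 0 m = 0" "kscale c 0 = 0"
  "kscale c (Poly_Mapping.single b f) = Poly_Mapping.single b (c * f)"
  by (rule poly_mapping_eqI; simp add: lookup_add lookup_minus algebra_simps lookup_single when_def)+

lemma kscale_sum: "kscale c (sum f A) = (\<Sum>i\<in>A. kscale c (f i))"
  by (induction A rule: infinite_finite_induct) (simp_all add: kscale_simps)

interpretation vs: vector_space vscale
  by unfold_locales (simp_all only: vscale_def kscale_simps cK_hom)

definition supp :: "(J list \<times> nat list) set \<Rightarrow> VT set" where
  "supp B = {m. Poly_Mapping.keys m \<subseteq> B}"

lemma supp_iff: "m \<in> supp B \<longleftrightarrow> (\<forall>b. b \<notin> B \<longrightarrow> Poly_Mapping.lookup m b = 0)"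
  by (auto simp: supp_def in_keys_iff)

lemma supp_closed:
  "0 \<in> supp B" "m \<in> supp B \<Longrightarrow> m' \<in> supp B \<Longrightarrow> m + m' \<in> supp B"
  "m \<in> supp B \<Longrightarrow> m' \<in> supp B \<Longrightarrow> m - m' \<in> supp B" "m \<in> supp B \<Longrightarrow> - m \<in> supp B"
  "m \<in> supp B \<Longrightarrow> kscale c m \<in> supp B" "m \<in> supp B \<Longrightarrow> vscale d m \<in> supp B"
  "b \<in> B \<Longrightarrow> Poly_Mapping.single b f \<in> supp B"
  by (auto simp: supp_iff lookup_add lookup_minus vscale_def lookup_single when_def)

lemma supp_sum: "(\<And>i. i \<in> A \<Longrightarrow> f i \<in> supp B) \<Longrightarrow> sum f A \<in> supp B"
  by (induction A rule: infinite_finite_induct) (auto intro: supp_closed)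

lemma supp_subspace: "vs.subspace (supp B)"
  by (auto simp: vs.subspace_def supp_closed)

lemma supp_induct [consumes 1, case_names zero single add]:
  assumes m: "m \<in> supp B" and "Q 0" "\<And>b f. b \<in> B \<Longrightarrow> Q (Poly_Mapping.single b f)"
    "\<And>m m'. m \<in> supp B \<Longrightarrow> m' \<in> supp B \<Longrightarrow> Q m \<Longrightarrow> Q m' \<Longrightarrow> Q (m + m')"
  shows "Q m"
proof -
  have "Q (\<Sum>k\<in>A. Poly_Mapping.single k (Poly_Mapping.lookup m k))" if "finite A" "A \<subseteq> B" for A
    using that
  proof (induction A rule: finite_induct)
    case (insert k A)
    then have "Q (Poly_Mapping.single k (Poly_Mapping.lookup m k) +
        (\<Sum>k\<in>A. Poly_Mapping.single k (Poly_Mapping.lookup m k)))"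
      by (intro assms(3,4) supp_sum supp_closed) auto
    then show ?case using insert by simp
  qed (simp add: assms(2))
  from this[of "Poly_Mapping.keys m"] m show ?thesis
    by (simp add: supp_def poly_mapping_expand[of m, symmetric])
qed

text \<open>Additivity in the coefficient is what the operators of \<open>c_p\<close> and
  \<open>\<sigma>_k\<close> have: they twist coefficients by \<open>theta\<close> or
  \<open>swapK\<close> and so are not linear over \<open>K\<close>. Linearity over the ground field
  is recorded by \<open>linop\<close>.\<close>

definition add_at :: "(K \<Rightarrow> J list \<times> nat list \<Rightarrow> VT) \<Rightarrow> J list \<times> nat list \<Rightarrow> bool" where
  "add_at h b \<longleftrightarrow> (\<forall>f g. h (f + g) b = h f b + h g b)"

lemma add_at_0: "add_at h b \<Longrightarrow> h 0 b = 0"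
  unfolding add_at_def by (metis add_0 add_cancel_left_left)

lemma lin_ext_superset:
  assumes "finite Z" "Poly_Mapping.keys m \<subseteq> Z" "\<And>b. b \<in> Z \<Longrightarrow> add_at h b"
  shows "lin_ext h m = (\<Sum>b\<in>Z. h (Poly_Mapping.lookup m b) b)"
  unfolding lin_ext_def
  by (rule sum.mono_neutral_left) (use assms in \<open>auto simp: in_keys_iff add_at_0\<close>)

lemma lin_ext_single: "add_at h b \<Longrightarrow> lin_ext h (Poly_Mapping.single b f) = h f b"
  by (subst lin_ext_superset[of "{b}"]) auto

definition linop :: "VT set \<Rightarrow> VT set \<Rightarrow> (VT \<Rightarrow> VT) \<Rightarrow> bool" where
  "linop V V' F \<longleftrightarrow> (\<forall>m\<in>V. F m \<in> V' \<and> (\<forall>m'\<in>V. F (m + m') = F m + F m') \<and>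
     (\<forall>c. F (vscale c m) = vscale c (F m)))"

lemma linop_closed: "linop V V' F \<Longrightarrow> m \<in> V \<Longrightarrow> F m \<in> V'"
  and linop_add: "linop V V' F \<Longrightarrow> m \<in> V \<Longrightarrow> m' \<in> V \<Longrightarrow> F (m + m') = F m + F m'"
  and linop_scale: "linop V V' F \<Longrightarrow> m \<in> V \<Longrightarrow> F (vscale c m) = vscale c (F m)"
  by (auto simp: linop_def)

lemma linop_0:
  assumes "linop (supp B) V' F" shows "F 0 = 0"
  using linop_scale[OF assms supp_closed(1), of 0] by simp

lemma linop_uminus:
  assumes "linop (supp B) V' F" "m \<in> supp B" shows "F (- m) = - F m"
  using linop_scale[OF assms, of "- 1"] by simp

lemma linop_diff:
  assumes "linop (supp B) V' F" "m \<in> supp B" "m' \<in> supp B" shows "F (m - m') = F m - F m'"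
  using linop_add[OF assms(1,2) supp_closed(4)[OF assms(3)]] linop_uminus[OF assms(1,3)] by simp

lemma linop_lin_ext:
  assumes add: "\<And>b. b \<in> B \<Longrightarrow> add_at h b"
    and cl: "\<And>b f. b \<in> B \<Longrightarrow> h f b \<in> supp B'"
    and sc: "\<And>b f c. b \<in> B \<Longrightarrow> h (cK c * f) b = vscale c (h f b)"
  shows "linop (supp B) (supp B') (lin_ext h)"
  unfolding linop_def
proof (intro ballI conjI allI)
  fix m assume m: "m \<in> supp B"
  have k: "b \<in> B" if "b \<in> Poly_Mapping.keys m" for b
    using that m by (auto simp: supp_def)
  show "lin_ext h m \<in> supp B'"
    unfolding lin_ext_def by (intro supp_sum cl k)
  show "lin_ext h (vscale c m) = vscale c (lin_ext h m)" for c
  proof -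
    have "lin_ext h (vscale c m) = (\<Sum>b\<in>Poly_Mapping.keys m. h (cK c * Poly_Mapping.lookup m b) b)"
      by (subst lin_ext_superset[of "Poly_Mapping.keys m"])
        (auto simp: vscale_def in_keys_iff add k)
    then show ?thesis
      by (simp add: lin_ext_def vscale_def kscale_sum sc[unfolded vscale_def] k)
  qed
  fix m' assume m': "m' \<in> supp B"
  let ?Z = "Poly_Mapping.keys m \<union> Poly_Mapping.keys m'"
  have "?Z \<subseteq> B" using m m' by (auto simp: supp_def)
  then have Z: "add_at h b" if "b \<in> ?Z" for b using that add by blast
  have "lin_ext h (m + m') = (\<Sum>b\<in>?Z. h (Poly_Mapping.lookup (m + m') b) b)"
    by (rule lin_ext_superset) (auto intro!: Z simp: keys_add[THEN subsetD] dest!: keys_add[THEN subsetD])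
  also have "\<dots> = (\<Sum>b\<in>?Z. h (Poly_Mapping.lookup m b) b) + (\<Sum>b\<in>?Z. h (Poly_Mapping.lookup m' b) b)"
    unfolding sum.distrib[symmetric] lookup_add
    by (rule sum.cong) (use Z in \<open>auto simp: add_at_def\<close>)
  also have "\<dots> = lin_ext h m + lin_ext h m'"
    by (subst (1 2) lin_ext_superset[of ?Z, symmetric]) (auto intro!: Z)
  finally show "lin_ext h (m + m') = lin_ext h m + lin_ext h m'" .
qed

lemma linop_comp: "linop V V' F \<Longrightarrow> linop V' V'' G \<Longrightarrow> linop V V'' (\<lambda>m. G (F m))"
  by (simp add: linop_def)

lemma linop_id: "linop V V (\<lambda>m. m)"
  by (simp add: linop_def)

lemma vscale_kscale: "vscale c (kscale d m) = kscale d (vscale c m)"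
  by (simp add: vscale_def kscale_simps mult.commute)

lemma linop_kscale: "linop V (supp B) F \<Longrightarrow> linop V (supp B) (\<lambda>m. kscale c (F m))"
  by (simp add: linop_def supp_closed kscale_simps vscale_kscale)

lemma linop_vscale: "linop V (supp B) F \<Longrightarrow> linop V (supp B) (\<lambda>m. vscale c (F m))"
  by (simp add: vscale_def linop_kscale)

lemma linop_mono: "linop V V' F \<Longrightarrow> V1 \<subseteq> V \<Longrightarrow> V' \<subseteq> V2 \<Longrightarrow> linop V1 V2 F"
  unfolding linop_def by blast

text \<open>The coefficient \<open>f\<close> ranges over all of \<open>K\<close>, because the
  operators are linear only over the ground field.\<close>

lemma linop_ext:
  assumes "linop (supp B) V' F" "linop (supp B) V'' G"
    and "\<And>b f. b \<in> B \<Longrightarrow> F (Poly_Mapping.single b f) = G (Poly_Mapping.single b f)"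
    and "m \<in> supp B"
  shows "F m = G m"
  using assms(4)
  by (induction rule: supp_induct) (auto simp: linop_0[OF assms(1)] linop_0[OF assms(2)]
      linop_add[OF assms(1)] linop_add[OF assms(2)] assms(3))

lemma single_eq_vscale: "Poly_Mapping.single b (cK c * f) = vscale c (Poly_Mapping.single b f)"
  by (simp add: vscale_def kscale_simps)

section \<open>Sequences and words\<close>

lemma Jseq_length: "\<nu> \<in> Jseq \<beta> \<Longrightarrow> length \<nu> = ht \<beta>"
  by (simp add: Jseq_def)

lemma flip_Jseq: "\<nu> \<in> Jseq \<beta> \<Longrightarrow> flip p \<nu> \<in> Jseq \<beta>"
proof -
  assume \<nu>: "\<nu> \<in> Jseq \<beta>"
  have "map (\<lambda>j. Poly_Mapping.single (fst j) (1::nat)) (flip p \<nu>) = map (\<lambda>j. Poly_Mapping.single (fst j) 1) \<nu>"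
    by (rule nth_equalityI) (auto simp: nth_flip flipJ_def)
  with \<nu> show ?thesis by (simp add: Jseq_def)
qed

lemma swp_Jseq: "\<nu> \<in> Jseq \<beta> \<Longrightarrow> Suc k < ht \<beta> \<Longrightarrow> swp k \<nu> \<in> Jseq \<beta>"
proof -
  assume \<nu>: "\<nu> \<in> Jseq \<beta>" "Suc k < ht \<beta>"
  then have "mset (swp k \<nu>) = mset \<nu>"
    unfolding swp_def by (subst list_update_swap) (simp, rule mset_swap, simp_all add: Jseq_def)
  then have "mset (map (\<lambda>j. Poly_Mapping.single (fst j) (1::nat)) (swp k \<nu>)) =
      mset (map (\<lambda>j. Poly_Mapping.single (fst j) 1) \<nu>)" by simp
  then have "(\<Sum>j\<leftarrow>swp k \<nu>. Poly_Mapping.single (fst j) (1::nat)) = (\<Sum>j\<leftarrow>\<nu>. Poly_Mapping.single (fst j) 1)"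
    by (metis sum_mset_sum_list)
  with \<nu> show ?thesis by (simp add: Jseq_def)
qed

text \<open>Makes the sum over all idempotents \<open>e(\<nu>)\<close> meaningful. Only colours in
  the support of \<beta> can occur in \<nu>, and the length is fixed.\<close>

lemma finite_Jseq: "finite (Jseq \<beta>)"
proof -
  have "set \<nu> \<subseteq> Poly_Mapping.keys \<beta> \<times> UNIV" if "\<nu> \<in> Jseq \<beta>" for \<nu>
  proof
    fix j assume j: "j \<in> set \<nu>"
    have *: "Poly_Mapping.lookup (\<Sum>i\<leftarrow>xs. Poly_Mapping.single (fst i) (1::nat)) (fst j) =
        (\<Sum>i\<leftarrow>xs. if fst i = fst j then 1 else 0)" for xs :: "J list"
      by (induction xs) (auto simp: lookup_add lookup_single when_def)
    have "(\<Sum>i\<leftarrow>\<nu>. if fst i = fst j then 1 else 0) \<noteq> (0::nat)"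
      using j by (induction \<nu>) auto
    moreover have "Poly_Mapping.lookup \<beta> (fst j) = (\<Sum>i\<leftarrow>\<nu>. if fst i = fst j then 1 else 0)"
      using that unfolding *[symmetric] Jseq_def by blast
    ultimately have "fst j \<in> Poly_Mapping.keys \<beta>" by (simp only: in_keys_iff) simp
    then show "j \<in> Poly_Mapping.keys \<beta> \<times> UNIV" by (cases j) auto
  qed
  then have "Jseq \<beta> \<subseteq> {\<nu>. set \<nu> \<subseteq> Poly_Mapping.keys \<beta> \<times> UNIV \<and> length \<nu> = ht \<beta>}"
    by (auto simp: Jseq_def)
  moreover have "finite \<dots>" by (rule finite_lists_length_eq) simp
  ultimately show ?thesis by (rule finite_subset)
qed

lemma words_length: "w \<in> words M l \<Longrightarrow> length w = l"
  by (simp add: words_def)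

lemma words_nth: "w \<in> words M l \<Longrightarrow> p < l \<Longrightarrow> w ! p \<in> {1..2 * M}"
  unfolding words_def by (metis (mono_tags, lifting) mem_Collect_eq nth_mem subsetD)

lemma words_update: "w \<in> words M l \<Longrightarrow> j \<in> {1..2 * M} \<Longrightarrow> w[p := j] \<in> words M l"
  unfolding words_def using set_update_subset_insert[of w p j] by auto

locale rc =
  fixes M :: nat and P :: "(nat \<Rightarrow>\<^sub>0 base) \<Rightarrow> (nat \<Rightarrow>\<^sub>0 base)" and s :: sharp and \<beta> :: "int \<Rightarrow>\<^sub>0 nat"
  assumes P: "odd_involution M P"
begin

abbreviation "l \<equiv> ht \<beta>"
abbreviation "wds \<equiv> words M l"
abbreviation "VA \<equiv> supp (Jseq \<beta> \<times> wds)"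

definition VS :: "J list \<Rightarrow> VT set" where
  "VS \<nu> = supp ({\<nu>} \<times> wds)"

lemma VS_VA: "\<nu> \<in> Jseq \<beta> \<Longrightarrow> VS \<nu> \<subseteq> VA"
  unfolding VS_def supp_def by auto

lemma VS_closed:
  "0 \<in> VS \<nu>" "m \<in> VS \<nu> \<Longrightarrow> m' \<in> VS \<nu> \<Longrightarrow> m + m' \<in> VS \<nu>"
  "m \<in> VS \<nu> \<Longrightarrow> m' \<in> VS \<nu> \<Longrightarrow> m - m' \<in> VS \<nu>" "m \<in> VS \<nu> \<Longrightarrow> - m \<in> VS \<nu>"
  "m \<in> VS \<nu> \<Longrightarrow> kscale c m \<in> VS \<nu>" "m \<in> VS \<nu> \<Longrightarrow> vscale d m \<in> VS \<nu>"
  by (auto simp: VS_def supp_closed)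

lemma length_Jseq: "\<nu> \<in> Jseq \<beta> \<Longrightarrow> length \<nu> = l"
  by (rule Jseq_length)

subsection \<open>The operators \<open>c\<^sub>p\<close>\<close>

text \<open>The matrix of \<open>P\<close> in the basis of the \<open>w_i\<close>; that
  \<open>P\<close> is an involution reads \<open>pm_square\<close>, its oddness
  \<open>pm_odd\<close>.\<close>

definition pm :: "nat \<Rightarrow> nat \<Rightarrow> base" where
  "pm i j = Poly_Mapping.lookup (P (Poly_Mapping.single i 1)) j"

abbreviation "nn \<equiv> {1..2 * M}"

lemma WW_single: "i \<in> nn \<Longrightarrow> Poly_Mapping.single i c \<in> WW M"
  by (auto simp: WW_def)

lemma P_single_keys: "i \<in> nn \<Longrightarrow> Poly_Mapping.keys (P (Poly_Mapping.single i 1)) \<subseteq> nn"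
  using P WW_single unfolding odd_involution_def WW_def by blast

lemma pm_odd: "i \<in> nn \<Longrightarrow> pm i j \<noteq> 0 \<Longrightarrow> eps M j \<noteq> eps M i"
  using P WW_single[of i 1] unfolding odd_involution_def pm_def in_keys_iff[symmetric] by auto

lemma WW_zero: "0 \<in> WW M" by (simp add: WW_def)

lemma WW_sum: "(\<And>i. i \<in> A \<Longrightarrow> f i \<in> WW M) \<Longrightarrow> sum f A \<in> WW M"
  unfolding WW_def mem_Collect_eq by (rule order_trans[OF Poly_Mapping.keys_sum]) blast

lemma P_sum:
  assumes "\<And>i. i \<in> A \<Longrightarrow> f i \<in> WW M"
  shows "P (sum f A) = (\<Sum>i\<in>A. P (f i))"
proof -
  have add: "P (v + v') = P v + P v'" if "v \<in> WW M" "v' \<in> WW M" for v v'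
    using P that by (simp add: odd_involution_def)
  have "P 0 = 0" using add[OF WW_zero WW_zero] by simp
  with assms show ?thesis
    by (induction A rule: infinite_finite_induct) (auto simp: add WW_sum)
qed

lemma pm_square:
  assumes "i \<in> nn"
  shows "(\<Sum>j\<in>nn. pm i j * pm j k) = (if i = k then 1 else 0)"
proof -
  let ?v = "P (Poly_Mapping.single i 1)"
  have P1: "P (Poly_Mapping.map ((*) c) v) = Poly_Mapping.map ((*) c) (P v)" if "v \<in> WW M" for c v
    using P that by (simp add: odd_involution_def)
  have v: "?v = (\<Sum>j\<in>nn. Poly_Mapping.map ((*) (pm i j)) (Poly_Mapping.single j 1))"
  proof -
    have "?v = (\<Sum>j\<in>nn. Poly_Mapping.single j (pm i j))"
      unfolding pm_def
      by (rule trans[OF poly_mapping_expand[of ?v] sum.mono_neutral_left])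
        (use P_single_keys[OF assms] in \<open>auto simp: in_keys_iff\<close>)
    then show ?thesis by simp
  qed
  have "P ?v = Poly_Mapping.single i 1"
    using P WW_single[OF assms] by (simp add: odd_involution_def)
  also have "P ?v = (\<Sum>j\<in>nn. Poly_Mapping.map ((*) (pm i j)) (P (Poly_Mapping.single j 1)))"
    unfolding v by (subst P_sum) (simp_all add: WW_single P1[symmetric])
  finally have "Poly_Mapping.lookup (\<Sum>j\<in>nn. Poly_Mapping.map ((*) (pm i j)) (P (Poly_Mapping.single j 1))) k
      = Poly_Mapping.lookup (Poly_Mapping.single i 1) k" by simp
  then show ?thesis
    by (simp add: lookup_sum Poly_Mapping.map.rep_eq lookup_single when_def pm_def)
      (smt (verit, best) mult_zero_right sum.cong)
qed

text \<open>The sign of \<open>c_p\<close>. The parity of place \<open>p\<close> itself is counted,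
  and this term changes under \<open>P\<close>.\<close>

definition sg :: "nat \<Rightarrow> nat list \<Rightarrow> base" where
  "sg p w = (-1) ^ (\<Sum>i\<leftarrow>drop p w. eps M i)"

abbreviation "C \<equiv> c_op M P s"

lemma c_op1_eq:
  assumes "w \<in> wds" "p < l"
  shows "c_op1 M P s p f (\<nu>, w) = (\<Sum>j\<in>nn. Poly_Mapping.single (flip p \<nu>, w[p := j])
    (cK (sg p w * iu * pm (w ! p) j) * theta s \<nu> p f))"
proof -
  have "c_op1 M P s p f (\<nu>, w) = (\<Sum>j\<in>Poly_Mapping.keys (P (Poly_Mapping.single (w ! p) 1)).
      Poly_Mapping.single (flip p \<nu>, w[p := j]) (cK (sg p w * iu * pm (w ! p) j) * theta s \<nu> p f))"
    by (simp add: c_op1_def Let_def sg_def pm_def)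
  also have "\<dots> = (\<Sum>j\<in>nn. Poly_Mapping.single (flip p \<nu>, w[p := j])
    (cK (sg p w * iu * pm (w ! p) j) * theta s \<nu> p f))"
    by (rule sum.mono_neutral_left)
      (use P_single_keys[OF words_nth[OF assms]] in \<open>auto simp: pm_def in_keys_iff\<close>)
  finally show ?thesis .
qed

lemma c_op1_props:
  assumes "\<nu> \<in> Jseq \<beta>" "w \<in> wds" "p < l"
  shows "add_at (c_op1 M P s p) (\<nu>, w)"
    "c_op1 M P s p f (\<nu>, w) \<in> VS (flip p \<nu>)"
    "c_op1 M P s p (cK c * f) (\<nu>, w) = vscale c (c_op1 M P s p f (\<nu>, w))"
proof -
  interpret th: field_endo "theta s \<nu> p" using assms by (intro theta_field_endo) (simp add: length_Jseq)
  have th_c: "theta s \<nu> p (cK c) = cK c" using assms by (intro theta_cK) (simp add: length_Jseq)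
  show "add_at (c_op1 M P s p) (\<nu>, w)"
    by (simp add: add_at_def c_op1_eq[OF assms(2,3)] th.add distrib_left single_add sum.distrib)
  show "c_op1 M P s p f (\<nu>, w) \<in> VS (flip p \<nu>)"
    unfolding c_op1_eq[OF assms(2,3)] VS_def using assms by (intro supp_sum supp_closed) (auto intro: words_update)
  show "c_op1 M P s p (cK c * f) (\<nu>, w) = vscale c (c_op1 M P s p f (\<nu>, w))"
    by (simp add: c_op1_eq[OF assms(2,3)] th.mult th_c vscale_def kscale_sum kscale_simps mult_ac)
qed

lemma C_linop_VS: "\<nu> \<in> Jseq \<beta> \<Longrightarrow> p < l \<Longrightarrow> linop (VS \<nu>) (VS (flip p \<nu>)) (C p)"
  unfolding c_op_def VS_def by (rule linop_lin_ext) (auto intro!: c_op1_props[unfolded VS_def])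

lemma C_linop: "p < l \<Longrightarrow> linop VA VA (C p)"
  unfolding c_op_def
  by (rule linop_lin_ext) (auto intro!: c_op1_props VS_VA[OF flip_Jseq, THEN subsetD])

lemma C_single:
  assumes "\<nu> \<in> Jseq \<beta>" "w \<in> wds" "p < l"
  shows "C p (Poly_Mapping.single (\<nu>, w) f) = (\<Sum>j\<in>nn. Poly_Mapping.single (flip p \<nu>, w[p := j])
    (cK (sg p w * iu * pm (w ! p) j) * theta s \<nu> p f))"
  unfolding c_op_def using lin_ext_single[OF c_op1_props(1)[OF assms]] c_op1_eq[OF assms(2,3)] by simp

lemma linop_sum_eq:
  assumes "linop (supp B) V' F" "\<And>i. i \<in> A \<Longrightarrow> f i \<in> supp B"
  shows "F (sum f A) = (\<Sum>i\<in>A. F (f i))"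
  using assms(2)
  by (induction A rule: infinite_finite_induct)
    (auto simp: linop_0[OF assms(1)] linop_add[OF assms(1)] supp_sum)

lemma sg_square: "sg p w * sg p w = 1"
  by (simp add: sg_def power_mult_distrib[symmetric])

text \<open>An odd map changes the parity of the letter at \<open>p\<close>, hence exactly one term
  of the exponent.\<close>

lemma sg_update_le:
  assumes "w \<in> wds" "r \<le> p" "p < l" "pm (w ! p) j \<noteq> 0"
  shows "sg r (w[p := j]) = - sg r w"
proof -
  have w: "length w = l" using assms(1) by (rule words_length)
  have e: "eps M j \<noteq> eps M (w ! p)" "eps M j \<le> 1" "eps M (w ! p) \<le> 1"
    using pm_odd[OF words_nth[OF assms(1,3)] assms(4)] by (auto simp: eps_def)
  have "drop r w = take (p - r) (drop r w) @ w ! p # drop (Suc p) w"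
    using w assms id_take_nth_drop[of "p - r" "drop r w"] by (simp add: add.commute)
  moreover have "drop r (w[p := j]) = take (p - r) (drop r w) @ j # drop (Suc p) w"
    using w assms upd_conv_take_nth_drop[of "p - r" "drop r w" j] by (simp add: drop_update_swap add.commute)
  ultimately have eq: "sg r w = (-1) ^ (\<Sum>i\<leftarrow>take (p - r) (drop r w) @ w ! p # drop (Suc p) w. eps M i)"
    "sg r (w[p := j]) = (-1) ^ (\<Sum>i\<leftarrow>take (p - r) (drop r w) @ j # drop (Suc p) w. eps M i)"
    by (simp_all only: sg_def)
  have "eps M j = 0 \<and> eps M (w ! p) = 1 \<or> eps M j = 1 \<and> eps M (w ! p) = 0" using e by linarith
  then show ?thesis unfolding eq by (auto simp: power_add)
qed

lemma sg_update_gt: "p < r \<Longrightarrow> sg r (w[p := j]) = sg r w"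
  by (simp add: sg_def)

text \<open>The sign of the second \<open>c_p\<close> is opposite to that of the first, since
  \<open>P\<close> has changed the letter at \<open>p\<close>; with the square -1 of
  \<open>iu\<close> the scalar becomes 1. The rest is \<open>theta\<close> being an involution and
  \<open>pm_square\<close>.\<close>

lemma C_C:
  assumes "m \<in> VA" "p < l" shows "C p (C p m) = m"
proof (rule linop_ext[OF linop_comp[OF C_linop C_linop] linop_id _ assms(1)])
  fix b f assume "b \<in> Jseq \<beta> \<times> wds"
  then obtain \<nu> w where b: "b = (\<nu>, w)" and \<nu>: "\<nu> \<in> Jseq \<beta>" and w: "w \<in> wds" by auto
  have th: "theta s (flip p \<nu>) p (theta s \<nu> p f) = f"
    using \<nu> assms(2) by (simp add: theta_theta length_Jseq)
  interpret th: field_endo "theta s (flip p \<nu>) p" using \<nu> assms by (intro theta_field_endo) (simp add: length_Jseq)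
  have th_c: "theta s (flip p \<nu>) p (cK c) = cK c" for c using \<nu> assms by (intro theta_cK) (simp add: length_Jseq)
  have coef: "cK (sg p (w[p := j]) * iu * pm j i) * (cK (sg p w * iu * pm (w ! p) j) * f) = cK (pm (w ! p) j * pm j i) * f" for i j
  proof (cases "pm (w ! p) j = 0")
    case False
    have "sg p (w[p := j]) * iu * pm j i * (sg p w * iu * pm (w ! p) j) =
        - (sg p w * sg p w) * iu ^ 2 * (pm (w ! p) j * pm j i)"
      using sg_update_le[OF w order.refl assms(2) False] by (simp add: power2_eq_square)
    then show ?thesis by (simp only: sg_square iu_square cK_hom(6)[symmetric] mult.assoc[symmetric]) simp
  qed simp
  have "C p (C p (Poly_Mapping.single b f)) = (\<Sum>j\<in>nn. C p (Poly_Mapping.single (flip p \<nu>, w[p := j])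
      (cK (sg p w * iu * pm (w ! p) j) * theta s \<nu> p f)))"
    unfolding b C_single[OF \<nu> w assms(2)] using \<nu> w
    by (intro linop_sum_eq[OF C_linop] assms supp_closed) (auto intro: words_update flip_Jseq)
  also have "\<dots> = (\<Sum>j\<in>nn. \<Sum>i\<in>nn. Poly_Mapping.single (\<nu>, w[p := i]) (cK (pm (w ! p) j * pm j i) * f))"
  proof (rule sum.cong[OF refl])
    fix j assume j: "j \<in> nn"
    have "C p (Poly_Mapping.single (flip p \<nu>, w[p := j]) (cK (sg p w * iu * pm (w ! p) j) * theta s \<nu> p f)) =
       (\<Sum>i\<in>nn. Poly_Mapping.single (\<nu>, w[p := i])
          (cK (sg p (w[p := j]) * iu * pm j i) * (cK (sg p w * iu * pm (w ! p) j) * f)))"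
      using C_single[OF flip_Jseq[OF \<nu>] words_update[OF w j] assms(2)] w assms(2)
      by (simp add: flip_flip th.mult th_c th words_length)
    then show "C p (Poly_Mapping.single (flip p \<nu>, w[p := j]) (cK (sg p w * iu * pm (w ! p) j) * theta s \<nu> p f)) =
       (\<Sum>i\<in>nn. Poly_Mapping.single (\<nu>, w[p := i]) (cK (pm (w ! p) j * pm j i) * f))"
      by (simp only: coef)
  qed
  also have "\<dots> = (\<Sum>i\<in>nn. Poly_Mapping.single (\<nu>, w[p := i]) (cK (\<Sum>j\<in>nn. pm (w ! p) j * pm j i) * f))"
  proof (subst sum.swap, rule sum.cong[OF refl])
    fix i
    show "(\<Sum>j\<in>A. Poly_Mapping.single (\<nu>, w[p := i]) (cK (pm (w ! p) j * pm j i) * f)) =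
      Poly_Mapping.single (\<nu>, w[p := i]) (cK (\<Sum>j\<in>A. pm (w ! p) j * pm j i) * f)" for A
      by (induction A rule: infinite_finite_induct)
        (simp_all add: cK_hom(3) distrib_right single_add)
  qed
  also have "\<dots> = (\<Sum>i\<in>nn. if i = w ! p then Poly_Mapping.single (\<nu>, w) f else 0)"
    by (rule sum.cong[OF refl]) (simp only: pm_square[OF words_nth[OF w assms(2)]], auto)
  also have "\<dots> = Poly_Mapping.single b f"
    using words_nth[OF w assms(2)] by (simp add: b)
  finally show "C p (C p (Poly_Mapping.single b f)) = Poly_Mapping.single b f" .
qed (use assms in auto)

text \<open>The sign of \<open>c_p\<close> involves the letter at \<open>r\<close>, that of
  \<open>c_r\<close> does not involve the letter at \<open>p\<close>; so exactly one of the two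
  orders produces an extra -1.\<close>

lemma C_anticommute_less:
  assumes "m \<in> VA" "p < r" "r < l" shows "C p (C r m) = - C r (C p m)"
proof -
  have pl: "p < l" using assms by simp
  have "C p (C r m) = vscale (-1) (C r (C p m))"
  proof (rule linop_ext[OF linop_comp[OF C_linop C_linop] linop_vscale[OF linop_comp[OF C_linop C_linop]] _ assms(1)])
    fix b f assume "b \<in> Jseq \<beta> \<times> wds"
    then obtain \<nu> w where b: "b = (\<nu>, w)" and \<nu>: "\<nu> \<in> Jseq \<beta>" and w: "w \<in> wds" by auto
    have CC: "C a (C c (Poly_Mapping.single b f)) = (\<Sum>j\<in>nn. \<Sum>i\<in>nn.
        Poly_Mapping.single (flip a (flip c \<nu>), w[c := j, a := i]) (cK (sg a (w[c := j]) * iu * pm (w ! a) i) *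
          (cK (sg c w * iu * pm (w ! c) j) * theta s (flip c \<nu>) a (theta s \<nu> c f))))"
      if ac: "a < l" "c < l" "a \<noteq> c" for a c
    proof -
      interpret th: field_endo "theta s (flip c \<nu>) a" using \<nu> ac by (intro theta_field_endo) (simp add: length_Jseq)
      have th_c: "theta s (flip c \<nu>) a (cK d) = cK d" for d using \<nu> ac by (intro theta_cK) (simp add: length_Jseq)
      have "C a (C c (Poly_Mapping.single b f)) = (\<Sum>j\<in>nn. C a (Poly_Mapping.single (flip c \<nu>, w[c := j])
          (cK (sg c w * iu * pm (w ! c) j) * theta s \<nu> c f)))"
        unfolding b C_single[OF \<nu> w ac(2)] using \<nu> w
        by (intro linop_sum_eq[OF C_linop] ac supp_closed) (auto intro: words_update flip_Jseq)
      also have "\<dots> = (\<Sum>j\<in>nn. \<Sum>i\<in>nn.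
        Poly_Mapping.single (flip a (flip c \<nu>), w[c := j, a := i]) (cK (sg a (w[c := j]) * iu * pm (w ! a) i) *
          (cK (sg c w * iu * pm (w ! c) j) * theta s (flip c \<nu>) a (theta s \<nu> c f))))"
        by (rule sum.cong[OF refl], subst C_single[OF flip_Jseq[OF \<nu>] words_update[OF w] ac(1)])
          (use ac in \<open>simp_all add: th.mult th_c\<close>)
      finally show ?thesis .
    qed
    have coef: "cK (sg p (w[r := j]) * iu * pm (w ! p) i) * (cK (sg r w * iu * pm (w ! r) j) * g) =
       - (cK (sg r (w[p := i]) * iu * pm (w ! r) j) * (cK (sg p w * iu * pm (w ! p) i) * g))" for i j g
    proof (cases "pm (w ! r) j = 0")
      case False
      then have "sg p (w[r := j]) = - sg p w" using assms by (intro sg_update_le[OF w]) auto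
      moreover have "sg r (w[p := i]) = sg r w" using assms(2) by (rule sg_update_gt)
      ultimately show ?thesis by (simp add: cK_hom(5,6))
    qed simp
    have "C p (C r (Poly_Mapping.single b f)) = (\<Sum>j\<in>nn. \<Sum>i\<in>nn.
        - Poly_Mapping.single (flip r (flip p \<nu>), w[p := i, r := j]) (cK (sg r (w[p := i]) * iu * pm (w ! r) j) *
          (cK (sg p w * iu * pm (w ! p) i) * theta s (flip p \<nu>) r (theta s \<nu> p f))))"
      unfolding CC[OF pl assms(3) less_imp_neq[OF assms(2)]] coef single_uminus
      using assms \<nu> by (simp add: theta_commute[of p \<nu> r] length_Jseq flip_commute[of p r] list_update_swap[of p r])
    also have "\<dots> = vscale (-1) (C r (C p (Poly_Mapping.single b f)))"
      using assms(2)
      by (subst CC[OF assms(3) pl]) (simp_all add: sum_negf, rule sum.swap)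
    finally show "C p (C r (Poly_Mapping.single b f)) = vscale (-1) (C r (C p (Poly_Mapping.single b f)))" .
  qed (use assms in auto)
  then show ?thesis by simp
qed

lemma C_anticommute:
  assumes "m \<in> VA" "p \<noteq> r" "p < l" "r < l" shows "C p (C r m) = - C r (C p m)"
  using C_anticommute_less[of m p r] C_anticommute_less[of m r p] assms by (cases p r rule: linorder_cases) auto

end

section \<open>Scalar identities for the coefficients of the R-matrix\<close>

lemmas vec_simps = poly_mapping_eq_iff fun_eq_iff lookup_add lookup_minus kscale_simps(1-10) algebra_simps
  power2_eq_square

text \<open>Here \<open>q\<close> stands for the square of the parameter. The two quotients are the
  coefficients \<open>a\<close>, \<open>b\<close> in
  \<open>(1 + a N)(1 + b N) = 1 + (a + b + (1 + q) a b) N\<close>, expanded with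
  \<open>N^2 = (1 + q) N\<close>.\<close>

lemma unitarity_identity:
  fixes x y q :: "'a::field"
  assumes "x - q * y \<noteq> 0" "y - q * x \<noteq> 0"
  shows "(x - y) / (y - q * x) + (y - x) / (x - q * y) + (1 + q) * ((x - y) / (y - q * x) * ((y - x) / (x - q * y))) = 0"
  using assms by (simp add: divide_simps) (simp add: algebra_simps power2_eq_square)

text \<open>The vanishing of the coefficient of \<open>N_1 - N_2\<close> in the Yang-Baxter equation
  for \<open>1 + a N\<close>, with \<open>q\<close> again the square of the parameter.\<close>

lemma YBE_identity:
  fixes x y z q :: "'a::field"
  assumes "y - q * x \<noteq> 0" "z - q * x \<noteq> 0" "z - q * y \<noteq> 0"
  shows "(x - y) / (y - q * x) + (y - z) / (z - q * y) + (1 + q) * ((x - y) / (y - q * x) * ((y - z) / (z - q * y)))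
    + q * ((x - y) / (y - q * x) * ((x - z) / (z - q * x)) * ((y - z) / (z - q * y))) = (x - z) / (z - q * x)"
  using assms by (simp add: divide_simps) (simp add: algebra_simps power2_eq_square)

text \<open>Read in one coordinate: \<open>n1\<close>, \<open>n2\<close>, \<open>n12\<close>,
  \<open>n21\<close>, \<open>y\<close>, \<open>z\<close> stand for \<open>N_1\<close>,
  \<open>N_2\<close>, \<open>N_1 N_2\<close>, \<open>N_2 N_1\<close>, \<open>N_1 N_2 N_1\<close>,
  \<open>N_2 N_1 N_2\<close> applied to a vector with coordinate \<open>w\<close>. The second
  hypothesis is the braid relation for \<open>N\<close>; given it, the difference of the two sides
  is a multiple of that of the first.\<close>

lemma YBE_combine:
  fixes a b c q n1 n2 n12 n21 y z w :: "'a::field"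
  assumes "a + c + (1 + q) * (a * c) + q * (a * b * c) = b" and "y = z - q * n2 + q * n1"
  shows "w + a * n1 + b * (n2 + a * n12) + c * (n1 + a * ((1 + q) * n1) + b * (n21 + a * y)) =
    w + c * n2 + b * (n1 + c * n21) + a * (n2 + c * ((1 + q) * n2) + b * (n12 + c * z))"
proof -
  have "w + a * n1 + b * (n2 + a * n12) + c * (n1 + a * ((1 + q) * n1) + b * (n21 + a * y)) -
    (w + c * n2 + b * (n1 + c * n21) + a * (n2 + c * ((1 + q) * n2) + b * (n12 + c * z))) =
    (a + c + (1 + q) * (a * c) + q * (a * b * c) - b) * (n1 - n2)"
    unfolding assms(2) by (simp add: algebra_simps)
  then show ?thesis
    by (subst eq_iff_diff_eq_0) (simp only: assms(1) diff_self mult_zero_left)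
qed

context rc
begin

subsection \<open>The R-matrix\<close>

abbreviation "Q \<equiv> cK qq"

definition sw :: "nat \<Rightarrow> nat list \<Rightarrow> nat list" where
  "sw k w = w[k := w ! Suc k, Suc k := w ! k]"

lemma length_sw [simp]: "length (sw k w) = length w"
  by (simp add: sw_def)

lemma nth_sw:
  assumes "Suc k < length w" "r < length w"
  shows "sw k w ! r = w ! tr k r"
  using assms by (auto simp: sw_def Transposition.transpose_def nth_list_update)

lemma sw_wds: "w \<in> wds \<Longrightarrow> Suc k < l \<Longrightarrow> sw k w \<in> wds"
  unfolding sw_def by (intro words_update words_nth[of w M l]) auto

lemma sw_sw: "Suc k < length w \<Longrightarrow> sw k (sw k w) = w"
  by (rule nth_equalityI) (auto simp: nth_sw tr_less)

text \<open>
  \<open>R(z) = 1 + (1 - z) / (z - q\<^sup>2) N\<close> with \<open>N\<close> free of \<open>z\<close>; the unitarity and the Yang-Baxter equation for \<open>R\<close>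
  amount to the Hecke relations \<open>N\<^sup>2 = (1 + q\<^sup>2) N\<close> and \<open>N\<^sub>1 N\<^sub>2 N\<^sub>1 - q\<^sup>2 N\<^sub>1 = N\<^sub>2 N\<^sub>1 N\<^sub>2 - q\<^sup>2 N\<^sub>2\<close>.
\<close>

definition N1 :: "nat \<Rightarrow> K \<Rightarrow> J list \<times> nat list \<Rightarrow> VT" where
  "N1 k f = (\<lambda>(\<nu>, w). if w ! k = w ! Suc k
     then (if w ! k \<le> M then Poly_Mapping.single (\<nu>, w) ((1 + Q ^ 2) * f) else 0)
     else Poly_Mapping.single (\<nu>, w) ((if w ! k < w ! Suc k then 1 else Q ^ 2) * f)
        + Poly_Mapping.single (\<nu>, sw k w) (Q * f))"

definition Nop :: "nat \<Rightarrow> VT \<Rightarrow> VT" where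
  "Nop k = lin_ext (N1 k)"

text \<open>Moves the summand and the variables but keeps the letters: \<open>R\<close> is the
  identity at \<open>z = 1\<close>, and the exchange of letters is part of
  \<open>N1\<close>.\<close>

definition Sw :: "nat \<Rightarrow> VT \<Rightarrow> VT" where
  "Sw k = lin_ext (\<lambda>f (\<nu>, w). Poly_Mapping.single (swp k \<nu>, w) (swapK k f))"

lemma N1_add: "add_at (N1 k) b"
  by (auto simp: add_at_def N1_def distrib_left single_add split: prod.splits)

lemma N1_kscale: "N1 k (c * f) b = kscale c (N1 k f b)"
  by (auto simp: N1_def kscale_simps mult_ac split: prod.splits)

lemma Sw1_add: "add_at (\<lambda>f (\<nu>, w). Poly_Mapping.single (swp k \<nu>, w) (swapK k f)) b"
  by (auto simp: add_at_def swapK.add single_add split: prod.splits)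

lemma UNIV_supp: "m \<in> supp UNIV"
  by (simp add: supp_def)

lemma Nop_linop_UNIV: "linop (supp UNIV) (supp UNIV) (Nop k)"
  unfolding Nop_def by (rule linop_lin_ext) (auto simp: N1_add UNIV_supp N1_kscale vscale_def)

lemma Sw_linop_UNIV: "linop (supp UNIV) (supp UNIV) (Sw k)"
  unfolding Sw_def
  by (rule linop_lin_ext)
    (auto simp: Sw1_add UNIV_supp vscale_def swapK.mult swapK_cK kscale_simps split: prod.splits)

lemma Nop_add: "Nop k (m + m') = Nop k m + Nop k m'"
  and Nop_diff: "Nop k (m - m') = Nop k m - Nop k m'"
  and Nop_0: "Nop k 0 = 0"
  using linop_add[OF Nop_linop_UNIV] linop_diff[OF Nop_linop_UNIV] linop_0[OF Nop_linop_UNIV]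
  by (simp_all add: UNIV_supp)

lemma Sw_add: "Sw k (m + m') = Sw k m + Sw k m'"
  and Sw_diff: "Sw k (m - m') = Sw k m - Sw k m'"
  and Sw_0: "Sw k 0 = 0"
  using linop_add[OF Sw_linop_UNIV] linop_diff[OF Sw_linop_UNIV] linop_0[OF Sw_linop_UNIV]
  by (simp_all add: UNIV_supp)

lemma Nop_single: "Nop k (Poly_Mapping.single (\<nu>, w) f) = N1 k f (\<nu>, w)"
  unfolding Nop_def by (rule lin_ext_single[OF N1_add])

lemma Sw_single: "Sw k (Poly_Mapping.single (\<nu>, w) f) = Poly_Mapping.single (swp k \<nu>, w) (swapK k f)"
  unfolding Sw_def by (subst lin_ext_single[OF Sw1_add]) simp

lemma Nop_kscale: "Nop k (kscale c m) = kscale c (Nop k m)"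
  using UNIV_supp[of m]
  by (induction rule: supp_induct)
    (auto simp: Nop_0 kscale_simps Nop_add Nop_single N1_kscale split: prod.splits)

lemma Sw_kscale: "Sw k (kscale c m) = kscale (swapK k c) (Sw k m)"
  using UNIV_supp[of m]
  by (induction rule: supp_induct)
    (auto simp: Sw_0 kscale_simps Sw_add Sw_single swapK.mult split: prod.splits)

lemma N1_VS: "Suc k < l \<Longrightarrow> w \<in> wds \<Longrightarrow> N1 k f (\<nu>, w) \<in> VS \<nu>"
  unfolding VS_def by (auto simp: N1_def intro!: supp_closed sw_wds)

lemma Nop_VS: "Suc k < l \<Longrightarrow> m \<in> VS \<nu> \<Longrightarrow> Nop k m \<in> VS \<nu>"
  unfolding VS_def Nop_def
  by (rule linop_closed[OF linop_lin_ext])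
    (auto simp: N1_add N1_kscale vscale_def intro!: N1_VS[unfolded VS_def])

lemma Sw_VS: "m \<in> VS \<nu> \<Longrightarrow> Sw k m \<in> VS (swp k \<nu>)"
  unfolding VS_def Sw_def
  by (rule linop_closed[OF linop_lin_ext])
    (auto simp: Sw1_add vscale_def swapK.mult swapK_cK kscale_simps intro!: supp_closed)

lemma VS_induct [consumes 1, case_names zero single add]:
  assumes m: "m \<in> VS \<nu>" and "R 0" "\<And>w f. w \<in> wds \<Longrightarrow> R (Poly_Mapping.single (\<nu>, w) f)"
    "\<And>m m'. R m \<Longrightarrow> R m' \<Longrightarrow> R (m + m')"
  shows "R m"
  using m unfolding VS_def by (induction rule: supp_induct) (use assms in auto)

lemma Sw_Sw: "m \<in> VS \<nu> \<Longrightarrow> Suc k < length \<nu> \<Longrightarrow> Sw k (Sw k m) = m"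
  by (induction rule: VS_induct) (auto simp: Sw_0 Sw_add Sw_single swp_swp swapK_swapK)

lemma swp_braid:
  assumes "Suc (Suc k) < length \<nu>"
  shows "swp k (swp (Suc k) (swp k \<nu>)) = swp (Suc k) (swp k (swp (Suc k) \<nu>))"
  by (rule nth_equalityI) (use assms in \<open>auto simp: nth_swp tr_less, auto simp: Transposition.transpose_def\<close>)

lemma swp_commute:
  assumes "Suc k < length \<nu>" "Suc j < length \<nu>" "Suc j < k \<or> Suc k < j"
  shows "swp k (swp j \<nu>) = swp j (swp k \<nu>)"
  by (rule nth_equalityI) (use assms in \<open>auto simp: nth_swp tr_less, auto simp: Transposition.transpose_def\<close>)

lemma Sw_braid:
  assumes "m \<in> VS \<nu>" "Suc (Suc k) < length \<nu>"
  shows "Sw k (Sw (Suc k) (Sw k m)) = Sw (Suc k) (Sw k (Sw (Suc k) m))"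
  using assms by (induction rule: VS_induct) (auto simp: Sw_0 Sw_add Sw_single swp_braid swapK_braid)

lemma Sw_commute:
  assumes "m \<in> VS \<nu>" "Suc k < length \<nu>" "Suc j < length \<nu>" "Suc j < k \<or> Suc k < j"
  shows "Sw k (Sw j m) = Sw j (Sw k m)"
  using assms(1)
proof (induction rule: VS_induct)
  case (single w f)
  show ?case by (simp only: Sw_single swp_commute[OF assms(2-4)] swapK_commute[OF assms(4)])
qed (auto simp: Sw_0 Sw_add)

text \<open>The coefficients of \<open>N\<close> are constants and \<open>Sw\<close> leaves the
  letters alone. This lets all exchanges be moved inside, next to the vector.\<close>

lemma Nop_Sw: "Nop j (Sw k m) = Sw k (Nop j m)"
  using UNIV_supp[of m]
proof (induction rule: supp_induct)
  case (single b f)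
  obtain \<nu> w where "b = (\<nu>, w)" by fastforce
  then show ?case
    by (simp add: Sw_single Nop_single N1_def Sw_0 Sw_add swapK.hom swapK_cK)
qed (auto simp: Nop_0 Sw_0 Nop_add Sw_add)

lemma single_basis: "Poly_Mapping.single b f = kscale f (Poly_Mapping.single b 1)"
  by (simp add: kscale_simps)

lemma Nop_basis: "Nop k (Poly_Mapping.single (\<nu>, w) 1) = (if w ! k = w ! Suc k
     then (if w ! k \<le> M then kscale (1 + Q ^ 2) (Poly_Mapping.single (\<nu>, w) 1) else 0)
     else kscale (if w ! k < w ! Suc k then 1 else Q ^ 2) (Poly_Mapping.single (\<nu>, w) 1)
        + kscale Q (Poly_Mapping.single (\<nu>, sw k w) 1))"
  by (simp add: Nop_single N1_def kscale_simps)

text \<open>On the span of two words differing by the exchange, \<open>N\<close> has trace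
  \<open>1 + q^2\<close> and determinant 0; on a word with equal letters it is
  \<open>1 + q^2\<close> or 0.\<close>

lemma Nop_Nop:
  assumes "m \<in> VS \<nu>" "Suc k < l"
  shows "Nop k (Nop k m) = kscale (1 + Q ^ 2) (Nop k m)"
  using assms(1)
proof (induction rule: VS_induct)
  case (single w f)
  then have w: "length w = l" by (simp add: words_length)
  have "Nop k (Nop k (Poly_Mapping.single (\<nu>, w) 1)) = kscale (1 + Q ^ 2) (Nop k (Poly_Mapping.single (\<nu>, w) 1))"
    using w assms(2)
    by (cases "w ! k" "w ! Suc k" rule: linorder_cases;
        simp add: Nop_basis Nop_add Nop_kscale Nop_0 nth_sw sw_sw;
        (simp add: vec_simps)?)
  then show ?case
    unfolding single_basis[of _ f] Nop_kscale by (simp add: kscale_simps algebra_simps)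
qed (auto simp: Nop_0 Nop_add kscale_simps)

lemma Nop_commute:
  assumes "m \<in> VS \<nu>" "Suc k < l" "Suc j < l" "Suc j < k \<or> Suc k < j"
  shows "Nop k (Nop j m) = Nop j (Nop k m)"
  using assms(1)
proof (induction rule: VS_induct)
  case (single w f)
  then have w: "length w = l" by (simp add: words_length)
  have sw: "sw k (sw j w) = sw j (sw k w)"
    using w assms by (intro nth_equalityI) (auto simp: nth_sw tr_less, auto simp: Transposition.transpose_def)
  have n: "sw j w ! k = w ! k" "sw j w ! Suc k = w ! Suc k" "sw k w ! j = w ! j" "sw k w ! Suc j = w ! Suc j"
    using w assms by (auto simp: nth_sw Transposition.transpose_def)
  have "Nop k (Nop j (Poly_Mapping.single (\<nu>, w) 1)) = Nop j (Nop k (Poly_Mapping.single (\<nu>, w) 1))"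
    using w assms
    by (cases "w ! k" "w ! Suc k" rule: linorder_cases; cases "w ! j" "w ! Suc j" rule: linorder_cases;
        simp add: Nop_basis Nop_add Nop_kscale Nop_0 n sw;
        (simp add: vec_simps)?)
  then show ?case
    unfolding single_basis[of _ f] Nop_kscale by simp
qed (auto simp: Nop_0 Nop_add kscale_simps)

lemma Nop_braid:
  assumes "m \<in> VS \<nu>" "Suc (Suc k) < l"
  shows "Nop k (Nop (Suc k) (Nop k m)) - kscale (Q ^ 2) (Nop k m) =
    Nop (Suc k) (Nop k (Nop (Suc k) m)) - kscale (Q ^ 2) (Nop (Suc k) m)"
  using assms(1)
proof (induction rule: VS_induct)
  case (single w f)
  then have w: "length w = l" by (simp add: words_length)
  \<comment> \<open>Only the letters at the three places \<open>k\<close>, \<open>k + 1\<close>,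
    \<open>k + 2\<close> change, so the check is a finite case distinction on \<open>a\<close>,
    \<open>b\<close>, \<open>c\<close>.\<close>
  define B where "B a b c = Poly_Mapping.single (\<nu>, w[k := a, Suc k := b, Suc (Suc k) := c]) (1 :: K)" for a b c
  have B1: "Nop k (B a b c) = (if a = b then (if a \<le> M then kscale (1 + Q ^ 2) (B a b c) else 0)
     else kscale (if a < b then 1 else Q ^ 2) (B a b c) + kscale Q (B b a c))" for a b c
  proof -
    have "sw k (w[k := a, Suc k := b, Suc (Suc k) := c]) = w[k := b, Suc k := a, Suc (Suc k) := c]"
      using w assms(2) by (intro nth_equalityI) (auto simp: sw_def nth_list_update)
    then show ?thesis using w assms(2) by (simp add: B_def Nop_basis)
  qed
  have B2: "Nop (Suc k) (B a b c) = (if b = c then (if b \<le> M then kscale (1 + Q ^ 2) (B a b c) else 0)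
     else kscale (if b < c then 1 else Q ^ 2) (B a b c) + kscale Q (B a c b))" for a b c
  proof -
    have "sw (Suc k) (w[k := a, Suc k := b, Suc (Suc k) := c]) = w[k := a, Suc k := c, Suc (Suc k) := b]"
      using w assms(2) by (intro nth_equalityI) (auto simp: sw_def nth_list_update)
    then show ?thesis using w assms(2) by (simp add: B_def Nop_basis)
  qed
  have "Nop k (Nop (Suc k) (Nop k (B a b c))) - kscale (Q ^ 2) (Nop k (B a b c)) =
    Nop (Suc k) (Nop k (Nop (Suc k) (B a b c))) - kscale (Q ^ 2) (Nop (Suc k) (B a b c))" for a b c
    by (cases a b rule: linorder_cases; cases b c rule: linorder_cases; cases a c rule: linorder_cases;
        simp add: B1 B2 Nop_add Nop_kscale Nop_0;
        (simp add: vec_simps)?)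
  moreover have "B (w ! k) (w ! Suc k) (w ! Suc (Suc k)) = Poly_Mapping.single (\<nu>, w) 1"
    by (simp add: B_def)
  ultimately have "Nop k (Nop (Suc k) (Nop k (Poly_Mapping.single (\<nu>, w) 1))) - kscale (Q ^ 2) (Nop k (Poly_Mapping.single (\<nu>, w) 1)) =
    Nop (Suc k) (Nop k (Nop (Suc k) (Poly_Mapping.single (\<nu>, w) 1))) - kscale (Q ^ 2) (Nop (Suc k) (Poly_Mapping.single (\<nu>, w) 1))"
    by metis
  then have "kscale f (Nop k (Nop (Suc k) (Nop k (Poly_Mapping.single (\<nu>, w) 1))) - kscale (Q ^ 2) (Nop k (Poly_Mapping.single (\<nu>, w) 1))) =
    kscale f (Nop (Suc k) (Nop k (Nop (Suc k) (Poly_Mapping.single (\<nu>, w) 1))) - kscale (Q ^ 2) (Nop (Suc k) (Poly_Mapping.single (\<nu>, w) 1)))"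
    by simp
  then show ?case
    unfolding single_basis[of _ f] Nop_kscale by (simp only: kscale_simps mult.commute)
next
  case (add m m')
  have "Nop k (Nop (Suc k) (Nop k (m + m'))) - kscale (Q ^ 2) (Nop k (m + m')) =
    (Nop k (Nop (Suc k) (Nop k m)) - kscale (Q ^ 2) (Nop k m)) + (Nop k (Nop (Suc k) (Nop k m')) - kscale (Q ^ 2) (Nop k m'))"
    by (simp add: Nop_add kscale_simps)
  also have "\<dots> = Nop (Suc k) (Nop k (Nop (Suc k) (m + m'))) - kscale (Q ^ 2) (Nop (Suc k) (m + m'))"
    unfolding add by (simp add: Nop_add kscale_simps)
  finally show ?case .
qed (simp add: Nop_0)

subsection \<open>Intertwiners\<close>

text \<open>The factor \<open>(1 - z) / (z - q^2)\<close> at \<open>z = X_j / X_i\<close>, numerator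
  and denominator multiplied by \<open>X_i\<close>.\<close>

definition rr :: "J list \<Rightarrow> nat \<Rightarrow> nat \<Rightarrow> K" where
  "rr \<nu> i j = (XK s \<nu> i - XK s \<nu> j) / (XK s \<nu> j - Q ^ 2 * XK s \<nu> i)"

text \<open>The map sending \<open>f \<otimes> v\<close> to \<open>s_k(f) \<otimes> R_k(v)\<close>,
  common to both cases in the definition of \<open>\<sigma>_k\<close>. The spectral parameters are
  those of the target \<open>swp k \<nu>\<close>.\<close>

definition Tp :: "J list \<Rightarrow> nat \<Rightarrow> VT \<Rightarrow> VT" where
  "Tp \<nu> k m = Sw k m + kscale (rr (swp k \<nu>) k (Suc k)) (Nop k (Sw k m))"

lemma den_nonzero: "i \<noteq> j \<Longrightarrow> XK s \<nu> i - Q ^ 2 * XK s \<nu> j \<noteq> 0"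
  using XK_minus_mult_nonzero[of i j s \<nu> "qq ^ 2"] by (simp add: cK_hom)

lemma swapK_rr:
  assumes "Suc k < length \<nu>" "i < length \<nu>" "j < length \<nu>"
  shows "swapK k (rr \<nu> i j) = rr (swp k \<nu>) (tr k i) (tr k j)"
  using assms by (simp add: rr_def swapK.hom swapK_cK swapK_XK)

lemma rr_inverse:
  assumes "i \<noteq> j" shows "rr \<nu> i j + rr \<nu> j i + (1 + Q ^ 2) * (rr \<nu> i j * rr \<nu> j i) = 0"
  unfolding rr_def using den_nonzero[OF assms, of \<nu>] den_nonzero[OF assms[symmetric], of \<nu>]
  by (intro unitarity_identity)

lemma rr_YBE:
  assumes "i \<noteq> j" "j \<noteq> k" "i \<noteq> k"
  shows "rr \<nu> i j + rr \<nu> j k + (1 + Q ^ 2) * (rr \<nu> i j * rr \<nu> j k) + Q ^ 2 * (rr \<nu> i j * rr \<nu> i k * rr \<nu> j k) = rr \<nu> i k"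
  unfolding rr_def using den_nonzero[of j i \<nu>] den_nonzero[of k i \<nu>] den_nonzero[of k j \<nu>] assms
  by (intro YBE_identity) auto

lemma Tp_add: "Tp \<nu> k (m + m') = Tp \<nu> k m + Tp \<nu> k m'"
  and Tp_diff: "Tp \<nu> k (m - m') = Tp \<nu> k m - Tp \<nu> k m'"
  and Tp_0: "Tp \<nu> k 0 = 0"
  and Tp_kscale: "Tp \<nu> k (kscale c m) = kscale (swapK k c) (Tp \<nu> k m)"
  by (simp_all add: Tp_def Sw_add Nop_add Sw_diff Nop_diff Sw_0 Nop_0 kscale_simps Sw_kscale Nop_kscale mult.commute)

lemma Tp_VS: "Suc k < l \<Longrightarrow> m \<in> VS \<nu> \<Longrightarrow> Tp \<nu> k m \<in> VS (swp k \<nu>)"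
  unfolding Tp_def by (intro VS_closed Nop_VS Sw_VS)

text \<open>\<open>N\<close> commutes with the exchange, so the product is 1 plus a multiple of
  \<open>N\<close>, and that multiple vanishes by \<open>rr_inverse\<close>.\<close>

lemma Tp_Tp:
  assumes "m \<in> VS \<nu>" "length \<nu> = l" "Suc k < l"
  shows "Tp (swp k \<nu>) k (Tp \<nu> k m) = m"
proof -
  have sw: "swp k (swp k \<nu>) = \<nu>" using assms by (simp add: swp_swp)
  have "Tp (swp k \<nu>) k (Tp \<nu> k m) = m + kscale (rr \<nu> (Suc k) k + rr \<nu> k (Suc k) +
      (1 + Q ^ 2) * (rr \<nu> (Suc k) k * rr \<nu> k (Suc k))) (Nop k m)"
    using assms
    by (simp add: Tp_def sw Nop_Sw Sw_add Sw_kscale Sw_Sw[OF assms(1)] swapK_rr Nop_add Nop_kscale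
        Sw_Sw[OF Nop_VS] Sw_Sw[OF Nop_VS[OF _ Nop_VS]] Nop_Nop kscale_simps algebra_simps)
  then show ?thesis using rr_inverse[of "Suc k" k \<nu>] by (simp add: kscale_simps)
qed

lemma Tp_commute:
  assumes "m \<in> VS \<nu>" "length \<nu> = l" "Suc k < l" "Suc j < l" "Suc j < k \<or> Suc k < j"
  shows "Tp (swp j \<nu>) k (Tp \<nu> j m) = Tp (swp k \<nu>) j (Tp \<nu> k m)"
proof -
  have tr: "tr k j = j" "tr k (Suc j) = Suc j" "tr j k = k" "tr j (Suc k) = Suc k"
    using assms(5) by (auto simp: Transposition.transpose_def)
  have sw: "swp k (swp j \<nu>) = swp j (swp k \<nu>)"
    using assms by (intro swp_commute) auto
  have "Sw k (Sw j m) \<in> VS (swp k (swp j \<nu>))" by (intro Sw_VS assms)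
  note N = Nop_commute[OF this assms(3-5)]
  have S: "Sw j (Sw k m) = Sw k (Sw j m)"
    using Sw_commute[OF assms(1), of k j] assms by simp
  show ?thesis
    using assms N
    by (simp add: Tp_def Sw_add Sw_kscale swapK_rr Nop_add Nop_kscale Nop_Sw[symmetric] tr sw S kscale_simps)
      (simp add: ac_simps)
qed

lemma Tp_braid:
  assumes "m \<in> VS \<nu>" "length \<nu> = l" "Suc (Suc k) < l"
  shows "Tp (swp (Suc k) (swp k \<nu>)) k (Tp (swp k \<nu>) (Suc k) (Tp \<nu> k m)) =
    Tp (swp k (swp (Suc k) \<nu>)) (Suc k) (Tp (swp (Suc k) \<nu>) k (Tp \<nu> (Suc k) m))"
proof -
  let ?\<mu> = "swp k (swp (Suc k) (swp k \<nu>))"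
  \<comment> \<open>All exchanges are moved onto the vector; both sides become combinations of
    products of \<open>N\<close> applied to this one \<open>?m\<close>, with coefficients in the
    coordinates of \<open>?\<mu>\<close>.\<close>
  let ?m = "Sw k (Sw (Suc k) (Sw k m))"
  have tr: "tr k (Suc (Suc k)) = Suc (Suc k)" "tr (Suc k) k = k"
    by (auto simp: Transposition.transpose_def)
  have sw: "swp (Suc k) (swp k (swp (Suc k) \<nu>)) = ?\<mu>"
    using assms by (simp add: swp_braid)
  have S: "Sw (Suc k) (Sw k (Sw (Suc k) m)) = ?m"
    using Sw_braid[OF assms(1), of k] assms by simp
  have m: "?m \<in> VS ?\<mu>" by (intro Sw_VS assms)
  define a where "a = rr ?\<mu> k (Suc k)"
  define b where "b = rr ?\<mu> k (Suc (Suc k))"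
  define c where "c = rr ?\<mu> (Suc k) (Suc (Suc k))"
  have ybe: "a + c + (1 + Q ^ 2) * (a * c) + Q ^ 2 * (a * b * c) = b"
    unfolding a_def b_def c_def by (rule rr_YBE) auto
  define n1 where "n1 = Nop k ?m"
  define n2 where "n2 = Nop (Suc k) ?m"
  define n12 where "n12 = Nop k n2"
  define n21 where "n21 = Nop (Suc k) n1"
  have n11: "Nop k n1 = kscale (1 + Q ^ 2) n1" "Nop (Suc k) n2 = kscale (1 + Q ^ 2) n2"
    unfolding n1_def n2_def using assms by (intro Nop_Nop[OF m]; simp)+
  have br: "Nop k n21 - kscale (Q ^ 2) n1 = Nop (Suc k) n12 - kscale (Q ^ 2) n2"
    unfolding n1_def n2_def n12_def n21_def using assms by (intro Nop_braid[OF m]) auto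
  have L: "Tp (swp (Suc k) (swp k \<nu>)) k (Tp (swp k \<nu>) (Suc k) (Tp \<nu> k m)) =
     ?m + kscale a n1 + kscale b (n2 + kscale a n12) + kscale c (n1 + kscale a (kscale (1 + Q ^ 2) n1)
       + kscale b (n21 + kscale a (Nop k n21)))"
    using assms
    by (simp add: Tp_def Sw_add Sw_kscale swapK_rr Nop_add Nop_kscale Nop_Sw[symmetric] tr kscale_simps swapK.mult
       flip: a_def b_def c_def n1_def n2_def n12_def n21_def)
      (simp add: n11 kscale_simps algebra_simps)
  have R: "Tp (swp k (swp (Suc k) \<nu>)) (Suc k) (Tp (swp (Suc k) \<nu>) k (Tp \<nu> (Suc k) m)) =
     ?m + kscale c n2 + kscale b (n1 + kscale c n21) + kscale a (n2 + kscale c (kscale (1 + Q ^ 2) n2)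
       + kscale b (n12 + kscale c (Nop (Suc k) n12)))"
    using assms
    by (simp add: Tp_def Sw_add Sw_kscale swapK_rr Nop_add Nop_kscale Nop_Sw[symmetric] tr sw S kscale_simps swapK.mult
       flip: a_def b_def c_def n1_def n2_def n12_def n21_def)
      (simp add: n11 kscale_simps algebra_simps)
  show ?thesis
  proof (rule poly_mapping_eqI)
    fix x
    have "Poly_Mapping.lookup (Nop k n21) x = Poly_Mapping.lookup (Nop (Suc k) n12) x
        - Q ^ 2 * Poly_Mapping.lookup n2 x + Q ^ 2 * Poly_Mapping.lookup n1 x"
      using arg_cong[OF br, of "\<lambda>m. Poly_Mapping.lookup m x"] by (simp add: lookup_minus algebra_simps)
    then show "Poly_Mapping.lookup (Tp (swp (Suc k) (swp k \<nu>)) k (Tp (swp k \<nu>) (Suc k) (Tp \<nu> k m))) x =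
       Poly_Mapping.lookup (Tp (swp k (swp (Suc k) \<nu>)) (Suc k) (Tp (swp (Suc k) \<nu>) k (Tp \<nu> (Suc k) m))) x"
      unfolding L R lookup_add lookup_kscale by (rule YBE_combine[OF ybe])
  qed
qed

end

text \<open>That 2 is invertible is used for the denominators \<open>X_p + X(j)\<close> of the
  twisted case, whose constant term is \<open>2 X(j)\<close>, and for antisymmetric series.\<close>

lemma two_neq_0_base: "(2 :: base) \<noteq> 0"
proof -
  have "(2 :: rat poly fract) = Fraction_Field.Fract (1 + 1) 1"
    unfolding one_add_one[symmetric] One_fract_def by (subst add_fract) simp_all
  also have "\<dots> \<noteq> 0" by (simp add: Zero_fract_def eq_fract)
  finally have "to_ac (2 :: rat poly fract) \<noteq> 0" by simp
  then show ?thesis by (simp only: to_ac_numeral) simp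
qed

lemma two_neq_0_K: "(2 :: K) \<noteq> 0"
proof -
  have "(2 :: K) = cK 2"
    unfolding one_add_one[symmetric] cK_hom(3) cK_hom(2) by (rule refl)
  then show ?thesis unfolding \<open>2 = cK 2\<close> cK_eq_0_iff using two_neq_0_base by blast
qed

lemma inverse_sum_identity:
  fixes a b :: "'a::field"
  assumes "a \<noteq> 0" "b \<noteq> 0" "a + b \<noteq> 0"
  shows "inverse a * inverse b = inverse (a + b) * inverse a + inverse (a + b) * inverse b"
  using assms by (simp add: divide_simps)

text \<open>The divided difference of \<open>Q_ij\<close> in its first variable. It is a constant
  because \<open>Q_ij\<close> is at most linear, so the right hand sides of the braid relations are
  free of the \<open>x_p\<close>.\<close>

definition ddc :: "int \<Rightarrow> int \<Rightarrow> base" where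
  "ddc i j = (if \<bar>i - j\<bar> = 1 then if i > j then 1 else -1 else 0)"

lemma Qp_diff: "Qp i j u v - Qp i j u' v = cK (ddc i j) * (u - u')"
  by (auto simp: Qp_def ddc_def cart_def cK_hom)

context rc
begin

subsection \<open>The operators on the even summands\<close>

lemma R_op1_eq:
  assumes "Suc k < length w" "z \<noteq> Q ^ 2"
  shows "R_op1 M z k f (\<nu>, w) = Poly_Mapping.single (\<nu>, w) f + kscale ((1 - z) / (z - Q ^ 2)) (N1 k f (\<nu>, w))"
proof (cases "w ! k = w ! Suc k")
  case True
  define A where "A = (if w ! Suc k \<le> M then (1 - Q ^ 2 * z) / (z - Q ^ 2) else 1)"
  have upd: "w[k := w ! Suc k, Suc k := w ! Suc k] = w" using True by (metis list_update_id)
  have R: "Rmat M z (w ! k) (w ! Suc k) = Poly_Mapping.single (w ! Suc k, w ! Suc k) A"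
    using True by (simp add: Rmat_def Let_def A_def)
  have "R_op1 M z k f (\<nu>, w) = Poly_Mapping.single (\<nu>, w) (A * f)"
    by (cases "A = 0") (simp_all add: R_op1_def R upd)
  moreover have "A = (if w ! Suc k \<le> M then 1 + (1 - z) / (z - Q ^ 2) * (1 + Q ^ 2) else 1)"
    using assms(2) by (auto simp: A_def divide_simps algebra_simps)
  ultimately show ?thesis
    using True by (auto simp: N1_def kscale_simps single_add[symmetric] algebra_simps)
next
  case False
  define i j where "i = w ! k" and "j = w ! Suc k"
  define A where "A = (if i < j then (1 - Q ^ 2) / (z - Q ^ 2) else z * (1 - Q ^ 2) / (z - Q ^ 2))"
  define B where "B = Q * (1 - z) / (z - Q ^ 2)"
  have ij: "i \<noteq> j" using False by (simp add: i_def j_def)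
  have upd: "w[k := i, Suc k := j] = w" "w[k := j, Suc k := i] = sw k w"
    by (simp_all add: i_def j_def sw_def)
  define r where "r = Poly_Mapping.single (i, j) A + Poly_Mapping.single (j, i) B"
  have R: "Rmat M z i j = r"
    using ij by (simp add: Rmat_def Let_def A_def B_def r_def)
  have lk: "Poly_Mapping.lookup r (i, j) = A" "Poly_Mapping.lookup r (j, i) = B"
    using ij by (simp_all add: r_def lookup_add lookup_single when_def)
  have "Poly_Mapping.keys r \<subseteq> {(i, j), (j, i)}"
    unfolding r_def by (rule order_trans[OF Poly_Mapping.keys_add]) auto
  then have "R_op1 M z k f (\<nu>, w) = (\<Sum>(a, b)\<in>{(i, j), (j, i)}.
      Poly_Mapping.single (\<nu>, w[k := a, Suc k := b]) (Poly_Mapping.lookup r (a, b) * f))"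
    by (auto simp: R_op1_def R in_keys_iff simp flip: i_def j_def intro!: sum.mono_neutral_left)
  also have "\<dots> = Poly_Mapping.single (\<nu>, w) (A * f) + Poly_Mapping.single (\<nu>, sw k w) (B * f)"
    using ij by (simp add: upd lk)
  finally have *: "R_op1 M z k f (\<nu>, w) = Poly_Mapping.single (\<nu>, w) (A * f) + Poly_Mapping.single (\<nu>, sw k w) (B * f)" .
  have "A = 1 + (1 - z) / (z - Q ^ 2) * (if i < j then 1 else Q ^ 2)" "B = (1 - z) / (z - Q ^ 2) * Q"
    using assms(2) by (auto simp: A_def B_def divide_simps algebra_simps)
  then show ?thesis
    unfolding * using ij by (simp add: N1_def kscale_simps algebra_simps single_add flip: i_def j_def)
qed

text \<open>The even version of \<open>\<sigma>_k\<close> on a whole summand; unlike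
  \<open>s_op0\<close>, which is given on basis vectors, it can be composed.\<close>

definition S0f :: "J list \<Rightarrow> nat \<Rightarrow> VT \<Rightarrow> VT" where
  "S0f \<nu> k m = (if \<nu> ! k \<noteq> \<nu> ! Suc k
     then Tp \<nu> k (kscale (Pp (fst (\<nu> ! k)) (fst (\<nu> ! Suc k)) (xK s \<nu> k) (xK s \<nu> (Suc k))) m)
     else kscale (inverse (xK s \<nu> k - xK s \<nu> (Suc k))) (Tp \<nu> k m - m))"

lemma S0f_add: "S0f \<nu> k (m + m') = S0f \<nu> k m + S0f \<nu> k m'"
  and S0f_vscale: "S0f \<nu> k (vscale c m) = vscale c (S0f \<nu> k m)"
  by (simp_all add: S0f_def kscale_simps Tp_add Tp_kscale vscale_def swapK_cK swapK.mult mult_ac)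

lemma swp_eq: "\<nu> ! k = \<nu> ! Suc k \<Longrightarrow> swp k \<nu> = \<nu>"
  unfolding swp_def by (metis list_update_id)

lemma S0f_VS: "Suc k < l \<Longrightarrow> m \<in> VS \<nu> \<Longrightarrow> S0f \<nu> k m \<in> VS (swp k \<nu>)"
  using swp_eq[of \<nu> k] by (auto simp: S0f_def intro!: VS_closed Tp_VS dest: Tp_VS[of k m \<nu>])

lemma R_op1_Tp:
  assumes "length \<nu> = l" "w \<in> wds" "Suc k < l"
  shows "R_op1 M (XK s (swp k \<nu>) (Suc k) / XK s (swp k \<nu>) k) k (swapK k f) (swp k \<nu>, w) =
    Tp \<nu> k (Poly_Mapping.single (\<nu>, w) f)"
proof -
  let ?X = "XK s (swp k \<nu>) k" and ?Y = "XK s (swp k \<nu>) (Suc k)"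
  have nz: "?Y - Q ^ 2 * ?X \<noteq> 0" "?X \<noteq> 0" using den_nonzero[of "Suc k" k] by simp_all
  then have "?Y / ?X \<noteq> Q ^ 2" by (auto simp: field_simps)
  moreover have "(1 - ?Y / ?X) / (?Y / ?X - Q ^ 2) = rr (swp k \<nu>) k (Suc k)"
  proof -
    have "(1 - ?Y / ?X) / (?Y / ?X - Q ^ 2) = ((1 - ?Y / ?X) * ?X) / ((?Y / ?X - Q ^ 2) * ?X)"
      using nz by simp
    also have "\<dots> = rr (swp k \<nu>) k (Suc k)"
      unfolding rr_def using nz(2) by (simp add: left_diff_distrib)
    finally show ?thesis .
  qed
  ultimately show ?thesis
    using assms words_length[OF assms(2)] by (subst R_op1_eq) (simp_all add: Tp_def Sw_single Nop_single)
qed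

lemma s_op0_eq:
  assumes "length \<nu> = l" "w \<in> wds" "Suc k < l"
  shows "s_op0 M s k f (\<nu>, w) = S0f \<nu> k (Poly_Mapping.single (\<nu>, w) f)"
proof (cases "\<nu> ! k = \<nu> ! Suc k")
  case True
  then show ?thesis
    using R_op1_Tp[OF assms, unfolded swp_eq[OF True]] by (simp add: s_op0_def S0f_def Let_def swp_eq)
next
  case False
  then show ?thesis
    using R_op1_Tp[OF assms] by (simp add: s_op0_def S0f_def Let_def kscale_simps mult.commute)
qed

abbreviation "S0 k \<equiv> lin_ext (s_op0 M s k)"
abbreviation "X0 p \<equiv> lin_ext (x_op0 s p)"

lemma s_op0_props:
  assumes "length \<nu> = l" "w \<in> wds" "Suc k < l"
  shows "add_at (s_op0 M s k) (\<nu>, w)" "s_op0 M s k f (\<nu>, w) \<in> VS (swp k \<nu>)"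
    "s_op0 M s k (cK c * f) (\<nu>, w) = vscale c (s_op0 M s k f (\<nu>, w))"
  unfolding add_at_def s_op0_eq[OF assms] single_eq_vscale S0f_vscale
  using assms by (auto simp: single_add S0f_add VS_def intro!: S0f_VS[unfolded VS_def] supp_closed)

lemma S0_eq:
  assumes "m \<in> VS \<nu>" "length \<nu> = l" "Suc k < l"
  shows "S0 k m = S0f \<nu> k m"
proof (rule linop_ext[where B = "{\<nu>} \<times> wds" and F = "S0 k" and G = "S0f \<nu> k"])
  show "linop (supp ({\<nu>} \<times> wds)) (supp ({swp k \<nu>} \<times> wds)) (S0 k)"
    by (rule linop_lin_ext) (use assms s_op0_props[unfolded VS_def] in auto)
  show "linop (supp ({\<nu>} \<times> wds)) (supp ({swp k \<nu>} \<times> wds)) (S0f \<nu> k)"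
    using assms S0f_VS by (auto simp: linop_def S0f_add S0f_vscale VS_def)
qed (use assms in \<open>auto simp: VS_def lin_ext_single s_op0_props s_op0_eq\<close>)

lemma S0_linop_VS: "length \<nu> = l \<Longrightarrow> Suc k < l \<Longrightarrow> linop (VS \<nu>) (VS (swp k \<nu>)) (S0 k)"
  unfolding VS_def by (rule linop_lin_ext) (use s_op0_props[unfolded VS_def] in auto)

lemma S0_linop: "Suc k < l \<Longrightarrow> linop VA VA (S0 k)"
  by (rule linop_lin_ext) (auto intro!: s_op0_props VS_VA[OF swp_Jseq, THEN subsetD] simp: length_Jseq)

lemma x_op0_add: "add_at (x_op0 s p) b"
  by (auto simp: add_at_def x_op0_def distrib_left single_add split: prod.splits)

lemma X0_linop: "linop (supp B) (supp B) (X0 p)"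
  by (rule linop_lin_ext)
    (auto simp: x_op0_add, auto simp: x_op0_def vscale_def kscale_simps mult_ac intro!: supp_closed)

lemma X0_eq: "m \<in> VS \<nu> \<Longrightarrow> X0 p m = kscale (xK s \<nu> p) m"
proof (rule linop_ext[where B = "{\<nu>} \<times> wds" and F = "X0 p" and G = "kscale (xK s \<nu> p)"])
  show "linop (supp ({\<nu>} \<times> wds)) (supp ({\<nu>} \<times> wds)) (kscale (xK s \<nu> p))"
    by (rule linop_kscale[OF linop_id])
  show "X0 p (Poly_Mapping.single b f) = kscale (xK s \<nu> p) (Poly_Mapping.single b f)"
    if "b \<in> {\<nu>} \<times> wds" for b f
    using that by (auto simp: lin_ext_single x_op0_add, auto simp: x_op0_def kscale_simps)
qed (use X0_linop in \<open>auto simp: VS_def\<close>)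

subsection \<open>Relations on the even summands\<close>

lemma Pp_swapK: "swapK k (Pp i j u v) = Pp i j (swapK k u) (swapK k v)"
  by (simp add: Pp_def Qp_def swapK.hom)

lemma Qp_swapK: "swapK k (Qp i j u v) = Qp i j (swapK k u) (swapK k v)"
  by (simp add: Qp_def swapK.hom)

text \<open>One factor is 1, and the symmetry \<open>Q_ij(u, v) = Q_ji(v, u)\<close> takes care of
  the other.\<close>

lemma Pp_Pp: "i \<noteq> j \<Longrightarrow> Pp i j u v * Pp j i v u = Qp i j u v"
  by (auto simp: Pp_def Qp_def cart_def)

text \<open>\<open>x_p\<close> is a fractional linear function of \<open>X_p / X(\<nu>_p)\<close>,
  the same at every place, so equality would make \<open>X_p\<close> and \<open>X_r\<close>
  proportional.\<close>

lemma xK_neq: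
  assumes "p \<noteq> r" shows "xK s \<nu> p \<noteq> xK s \<nu> r"
proof
  assume eq: "xK s \<nu> p = xK s \<nu> r"
  define a b where "a = Xval s (\<nu> ! p)" and "b = Xval s (\<nu> ! r)"
  have nz: "cK a \<noteq> 0" "cK b \<noteq> 0" by (simp_all add: cK_eq_0_iff a_def b_def)
  have "cK b * XK s \<nu> p = cK a * XK s \<nu> r"
  proof (cases s)
    case Prime
    then have "(XK s \<nu> p - cK a) / cK a = (XK s \<nu> r - cK b) / cK b"
      using eq by (simp add: xK.simps a_def b_def)
    then show ?thesis using nz by (simp add: field_simps)
  next
    case Tw
    then have e: "(XK s \<nu> p - cK a) / (XK s \<nu> p + cK a) = (XK s \<nu> r - cK b) / (XK s \<nu> r + cK b)"
      using eq by (simp add: xK.simps a_def b_def)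
    have "XK s \<nu> p + cK a \<noteq> 0" "XK s \<nu> r + cK b \<noteq> 0"
      using XK_lin_comb_nonzero[of p "Suc p" 1 s \<nu> 0 s \<nu> a] XK_lin_comb_nonzero[of r "Suc r" 1 s \<nu> 0 s \<nu> b] by simp_all
    with e have "(XK s \<nu> p - cK a) * (XK s \<nu> r + cK b) = (XK s \<nu> r - cK b) * (XK s \<nu> p + cK a)"
      by (simp add: frac_eq_eq)
    then have "2 * (cK b * XK s \<nu> p) = 2 * (cK a * XK s \<nu> r)"
      by (simp add: algebra_simps)
    then show ?thesis using two_neq_0_K by simp
  qed
  then have "XK s \<nu> p - cK (a / b) * XK s \<nu> r = 0" using nz by (simp add: cK_hom field_simps)
  then show False using XK_minus_mult_nonzero[OF assms] by blast
qed

text \<open>The action is from the right, so \<open>X0 (Suc k) (S0 k m)\<close> is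
  \<open>m.\<sigma>_k.x_{k+1}\<close>. \<open>Tp\<close> turns \<open>x_k\<close> into
  \<open>x_{k+1}\<close>, so the terms with \<open>Tp\<close> cancel; for equal entries the
  subtracted \<open>m\<close>, divided by \<open>x_k - x_{k+1}\<close>, remains with the factor
  \<open>x_k - x_{k+1}\<close>.\<close>

lemma S0_x_right:
  assumes "m \<in> VS \<nu>" "length \<nu> = l" "Suc k < l"
  shows "X0 (Suc k) (S0 k m) - S0 k (X0 k m) = (if \<nu> ! k = \<nu> ! Suc k then m else 0)"
proof -
  have S: "S0f \<nu> k m \<in> VS (swp k \<nu>)" using assms by (intro S0f_VS)
  have nz: "xK s \<nu> k - xK s \<nu> (Suc k) \<noteq> 0" using xK_neq[of k "Suc k" \<nu>] by simp
  have "X0 (Suc k) (S0 k m) - S0 k (X0 k m) = kscale (xK s (swp k \<nu>) (Suc k)) (S0f \<nu> k m) - S0f \<nu> k (kscale (xK s \<nu> k) m)"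
    using assms S by (simp add: X0_eq S0_eq VS_closed)
  also have "\<dots> = (if \<nu> ! k = \<nu> ! Suc k then m else 0)"
    using assms nz swp_eq[of \<nu> k]
    by (auto simp: S0f_def Tp_kscale swapK_xK swapK.mult kscale_simps mult_ac)
      (simp add: vec_simps, simp add: field_simps)
  finally show ?thesis .
qed

lemma S0_x_left:
  assumes "m \<in> VS \<nu>" "length \<nu> = l" "Suc k < l"
  shows "S0 k (X0 (Suc k) m) - X0 k (S0 k m) = (if \<nu> ! k = \<nu> ! Suc k then m else 0)"
proof -
  have S: "S0f \<nu> k m \<in> VS (swp k \<nu>)" using assms by (intro S0f_VS)
  have nz: "xK s \<nu> k - xK s \<nu> (Suc k) \<noteq> 0" using xK_neq[of k "Suc k" \<nu>] by simp
  have "S0 k (X0 (Suc k) m) - X0 k (S0 k m) = S0f \<nu> k (kscale (xK s \<nu> (Suc k)) m) - kscale (xK s (swp k \<nu>) k) (S0f \<nu> k m)"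
    using assms S by (simp add: X0_eq S0_eq VS_closed)
  also have "\<dots> = (if \<nu> ! k = \<nu> ! Suc k then m else 0)"
    using assms nz swp_eq[of \<nu> k]
    by (auto simp: S0f_def Tp_kscale swapK_xK swapK.mult kscale_simps mult_ac)
      (simp add: vec_simps, simp add: field_simps)
  finally show ?thesis .
qed

lemma S0_X0:
  assumes "m \<in> VS \<nu>" "length \<nu> = l" "Suc k < l" "p < l" "p \<noteq> k" "p \<noteq> Suc k"
  shows "S0 k (X0 p m) = X0 p (S0 k m)"
proof -
  have S: "S0f \<nu> k m \<in> VS (swp k \<nu>)" using assms by (intro S0f_VS)
  have tr: "tr k p = p" using assms by (simp add: Transposition.transpose_def)
  have "S0f \<nu> k (kscale (xK s \<nu> p) m) = kscale (xK s (swp k \<nu>) p) (S0f \<nu> k m)"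
    using assms tr swp_eq[of \<nu> k]
    by (auto simp: S0f_def Tp_kscale swapK_xK swapK.mult kscale_simps mult_ac)
  then show ?thesis
    using assms S by (simp add: X0_eq[OF assms(1)] X0_eq[OF S] S0_eq S0_eq[OF VS_closed(5)[OF assms(1)]])
qed

text \<open>For equal entries \<open>\<sigma>_k\<close> is a Demazure operator
  \<open>y (T - 1)\<close> with \<open>T^2 = 1\<close> and \<open>y\<close> antisymmetric, so its
  square is 0. For different ones the factors \<open>P_ij\<close> and \<open>P_ji\<close> combine to
  \<open>Q_ij\<close>.\<close>

lemma S0_S0:
  assumes "m \<in> VS \<nu>" "length \<nu> = l" "Suc k < l"
    and even: "\<nu> ! k = \<nu> ! Suc k \<longleftrightarrow> fst (\<nu> ! k) = fst (\<nu> ! Suc k)"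
  shows "S0 k (S0 k m) = kscale (Qp (fst (\<nu> ! k)) (fst (\<nu> ! Suc k)) (xK s \<nu> k) (xK s \<nu> (Suc k))) m"
proof -
  have S: "S0f \<nu> k m \<in> VS (swp k \<nu>)" using assms by (intro S0f_VS)
  have nz: "xK s \<nu> k - xK s \<nu> (Suc k) \<noteq> 0" using xK_neq[of k "Suc k" \<nu>] by simp
  have nth: "swp k \<nu> ! k = \<nu> ! Suc k" "swp k \<nu> ! Suc k = \<nu> ! k" using assms by (simp_all add: nth_swp)
  have SS: "S0 k (S0 k m) = S0f (swp k \<nu>) k (S0f \<nu> k m)"
    using assms S by (simp add: S0_eq)
  show ?thesis
  proof (cases "\<nu> ! k = \<nu> ! Suc k")
    case True
    define y where "y = inverse (xK s \<nu> k - xK s \<nu> (Suc k))"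
    have TT: "Tp \<nu> k (Tp \<nu> k m) = m" using Tp_Tp[OF assms(1-3)] swp_eq[OF True] by simp
    have y: "swapK k y = - y"
      unfolding y_def using assms swp_eq[OF True]
      by (simp add: swapK.hom swapK_xK flip: inverse_minus_eq)
    show ?thesis
      unfolding SS using True TT y assms
      by (simp add: S0f_def swp_eq[OF True] Tp_kscale Tp_diff Qp_def kscale_simps flip: y_def)
  next
    case False
    then show ?thesis
      unfolding SS using assms Pp_Pp[of "fst (\<nu> ! k)" "fst (\<nu> ! Suc k)"]
      by (simp add: S0f_def nth Tp_kscale Pp_swapK Qp_swapK swapK_xK swp_swp swapK_swapK kscale_simps Tp_Tp mult_ac)
  qed
qed

lemma S0_commute:
  assumes m: "m \<in> VS \<nu>" "length \<nu> = l" and kj: "Suc k < l" "Suc j < l" "Suc j < k \<or> Suc k < j"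
  shows "S0 k (S0 j m) = S0 j (S0 k m)"
proof -
  have tr: "tr k j = j" "tr k (Suc j) = Suc j" "tr j k = k" "tr j (Suc k) = Suc k"
    using kj by (auto simp: Transposition.transpose_def)
  have sw: "swp k (swp j \<nu>) = swp j (swp k \<nu>)" using m kj by (intro swp_commute) auto
  have nth: "swp j \<nu> ! k = \<nu> ! k" "swp j \<nu> ! Suc k = \<nu> ! Suc k"
    "swp k \<nu> ! j = \<nu> ! j" "swp k \<nu> ! Suc j = \<nu> ! Suc j"
    using m kj by (simp_all add: nth_swp tr)
  have T: "Tp (swp j \<nu>) k (Tp \<nu> j m) = Tp (swp k \<nu>) j (Tp \<nu> k m)"
    by (rule Tp_commute[OF m kj])
  have e: "Tp (swp j \<nu>) k = Tp \<nu> k" if "\<nu> ! j = \<nu> ! Suc j" by (simp add: swp_eq[OF that])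
  have e': "Tp (swp k \<nu>) j = Tp \<nu> j" if "\<nu> ! k = \<nu> ! Suc k" by (simp add: swp_eq[OF that])
  have "S0f (swp j \<nu>) k (S0f \<nu> j m) = S0f (swp k \<nu>) j (S0f \<nu> k m)"
    using m kj T swp_eq[of \<nu> k] swp_eq[of \<nu> j] sw
    by (cases "\<nu> ! k = \<nu> ! Suc k"; cases "\<nu> ! j = \<nu> ! Suc j")
      (simp_all add: S0f_def nth Tp_kscale Tp_diff Pp_swapK swapK_xK swapK.hom tr kscale_simps mult_ac,
       (simp add: vec_simps)?)
  then show ?thesis using m kj S0f_VS[OF kj(1) m(1)] S0f_VS[OF kj(2) m(1)] by (simp add: S0_eq)
qed

lemma S0_braid:
  assumes m: "m \<in> VS \<nu>" and len: "length \<nu> = l" and k: "Suc (Suc k) < l"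
    and even: "\<And>p r. p < l \<Longrightarrow> r < l \<Longrightarrow> \<nu> ! p = \<nu> ! r \<longleftrightarrow> fst (\<nu> ! p) = fst (\<nu> ! r)"
  shows "S0 (Suc k) (S0 k (S0 (Suc k) m)) - S0 k (S0 (Suc k) (S0 k m)) =
    (if \<nu> ! k = \<nu> ! Suc (Suc k) then vscale (ddc (fst (\<nu> ! k)) (fst (\<nu> ! Suc k))) m else 0)"
proof -
  let ?k2 = "Suc k" and ?k3 = "Suc (Suc k)"
  let ?\<mu>1 = "swp k \<nu>" and ?\<mu>2 = "swp ?k2 \<nu>"
  have L: "S0 ?k2 (S0 k (S0 ?k2 m)) = S0f (swp k ?\<mu>2) ?k2 (S0f ?\<mu>2 k (S0f \<nu> ?k2 m))"
    using k len by (subst (1 2 3) S0_eq) (auto intro!: S0f_VS m simp: S0_eq[OF m])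
  have R: "S0 k (S0 ?k2 (S0 k m)) = S0f (swp ?k2 ?\<mu>1) k (S0f ?\<mu>1 ?k2 (S0f \<nu> k m))"
    using k len by (subst (1 2 3) S0_eq) (auto intro!: S0f_VS m simp: S0_eq[OF m])
  have tr: "tr k ?k3 = ?k3" "tr ?k2 k = k"
    by (auto simp: Transposition.transpose_def)
  have nth: "?\<mu>1 ! k = \<nu> ! ?k2" "?\<mu>1 ! ?k2 = \<nu> ! k" "?\<mu>1 ! ?k3 = \<nu> ! ?k3"
    "?\<mu>2 ! k = \<nu> ! k" "?\<mu>2 ! ?k2 = \<nu> ! ?k3" "?\<mu>2 ! ?k3 = \<nu> ! ?k2"
    "swp ?k2 ?\<mu>1 ! k = \<nu> ! ?k2" "swp ?k2 ?\<mu>1 ! ?k2 = \<nu> ! ?k3" "swp ?k2 ?\<mu>1 ! ?k3 = \<nu> ! k"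
    "swp k ?\<mu>2 ! k = \<nu> ! ?k3" "swp k ?\<mu>2 ! ?k2 = \<nu> ! k" "swp k ?\<mu>2 ! ?k3 = \<nu> ! ?k2"
    using k len by (simp_all add: nth_swp tr)
  have sw: "swp ?k2 (swp k ?\<mu>2) = swp k (swp ?k2 ?\<mu>1)"
    using k len by (simp add: swp_braid)
  note T = Tp_braid[OF m len k, symmetric]
  have ss: "swp k ?\<mu>1 = \<nu>" "swp ?k2 ?\<mu>2 = \<nu>" using k len by (simp_all add: swp_swp)
  have TT: "Tp ?\<mu>1 k (Tp \<nu> k m) = m" "Tp ?\<mu>2 ?k2 (Tp \<nu> ?k2 m) = m"
    using k len by (simp_all add: Tp_Tp m)
  note simps = S0f_def nth Tp_kscale Tp_diff Pp_swapK swapK_xK swapK.hom tr kscale_simps len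
  consider (distinct) "\<nu> ! k \<noteq> \<nu> ! ?k2" "\<nu> ! ?k2 \<noteq> \<nu> ! ?k3" "\<nu> ! k \<noteq> \<nu> ! ?k3"
    | (a) "\<nu> ! k = \<nu> ! ?k2" "\<nu> ! ?k2 \<noteq> \<nu> ! ?k3"
    | (b) "\<nu> ! k \<noteq> \<nu> ! ?k2" "\<nu> ! ?k2 = \<nu> ! ?k3"
    | (c) "\<nu> ! k = \<nu> ! ?k3" "\<nu> ! k \<noteq> \<nu> ! ?k2"
    | (eq) "\<nu> ! k = \<nu> ! ?k2" "\<nu> ! ?k2 = \<nu> ! ?k3" by metis
  then show ?thesis
  proof cases
    case distinct
    then show ?thesis
      unfolding L R using k by (simp add: simps T sw mult_ac)
  next
    case a
    have e: "?\<mu>1 = \<nu>" using a by (simp add: swp_eq)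
    have e2: "swp ?k2 (swp k ?\<mu>2) = swp k ?\<mu>2" by (rule swp_eq) (use a nth in simp)
    show ?thesis
      unfolding L R using k a T[unfolded e] by (simp add: simps e e2 mult_ac)
  next
    case b
    have e: "?\<mu>2 = \<nu>" using b by (simp add: swp_eq)
    have e2: "swp k (swp ?k2 ?\<mu>1) = swp ?k2 ?\<mu>1" by (rule swp_eq) (use b nth in simp)
    show ?thesis
      unfolding L R using k b T[unfolded e] by (simp add: simps e e2 mult_ac)
  next
    \<comment> \<open>The case that produces the right hand side: on both sides the middle step acts
      on the equal pair, and its subtracted term returns to \<open>m\<close> with different factors
      \<open>P\<close>.\<close>
    case c
    have e: "swp k ?\<mu>2 = ?\<mu>2" "swp ?k2 ?\<mu>1 = ?\<mu>1" by (rule swp_eq, use c nth in simp)+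
    define w where "w = inverse (xK s \<nu> k - xK s \<nu> ?k3)"
    define p where "p = Pp (fst (\<nu> ! k)) (fst (\<nu> ! ?k2))"
    define p' where "p' = Pp (fst (\<nu> ! ?k2)) (fst (\<nu> ! k))"
    define Tm where "Tm = Tp ?\<mu>1 k (Tp ?\<mu>1 ?k2 (Tp \<nu> k m))"
    define x1 x2 x3 where "x1 = xK s \<nu> k" and "x2 = xK s \<nu> ?k2" and "x3 = xK s \<nu> ?k3"
    have LL: "S0f (swp k ?\<mu>2) ?k2 (S0f ?\<mu>2 k (S0f \<nu> ?k2 m)) =
        kscale (w * p x3 x2) (kscale (p' x2 x1) Tm - kscale (p' x2 x3) m)"
      using k c T[unfolded e]
      by (simp add: simps e ss TT p_def p'_def w_def Tm_def x1_def x2_def x3_def mult_ac)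
    have RR: "S0f (swp ?k2 ?\<mu>1) k (S0f ?\<mu>1 ?k2 (S0f \<nu> k m)) =
        kscale (w * p' x2 x1) (kscale (p x3 x2) Tm - kscale (p x1 x2) m)"
      using k c
      by (simp add: simps e ss TT p_def p'_def w_def Tm_def x1_def x2_def x3_def mult_ac)
    have ij: "fst (\<nu> ! k) \<noteq> fst (\<nu> ! ?k2)" using c k even[of k ?k2] by simp
    have nz: "x1 - x3 \<noteq> 0" using xK_neq[of k ?k3 \<nu>] by (simp add: x1_def x3_def)
    have "w * p' x2 x1 * p x1 x2 - w * p x3 x2 * p' x2 x3 =
        w * (Qp (fst (\<nu> ! k)) (fst (\<nu> ! ?k2)) x1 x2 - Qp (fst (\<nu> ! k)) (fst (\<nu> ! ?k2)) x3 x2)"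
      unfolding Pp_Pp[OF ij, symmetric] by (simp add: p_def p'_def algebra_simps)
    also have "\<dots> = cK (ddc (fst (\<nu> ! k)) (fst (\<nu> ! ?k2)))"
      unfolding Qp_diff using nz by (simp add: w_def flip: x1_def x3_def)
    finally have co: "w * p' x2 x1 * p x1 x2 - w * p x3 x2 * p' x2 x3 = cK (ddc (fst (\<nu> ! k)) (fst (\<nu> ! ?k2)))" .
    have "S0f (swp k ?\<mu>2) ?k2 (S0f ?\<mu>2 k (S0f \<nu> ?k2 m)) - S0f (swp ?k2 ?\<mu>1) k (S0f ?\<mu>1 ?k2 (S0f \<nu> k m)) =
        kscale (w * p' x2 x1 * p x1 x2 - w * p x3 x2 * p' x2 x3) m"
      unfolding LL RR by (simp add: vec_simps)
    then show ?thesis unfolding L R co using c by (simp add: vscale_def)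
  next
    \<comment> \<open>All three entries agree: the operators are Demazure operators, and both sides
      expand to the same multiple of an alternating sum over the six permutations of the
      places.\<close>
    case eq
    have e: "?\<mu>1 = \<nu>" "?\<mu>2 = \<nu>" using eq by (simp_all add: swp_eq)
    define y12 where "y12 = inverse (xK s \<nu> k - xK s \<nu> ?k2)"
    define y23 where "y23 = inverse (xK s \<nu> ?k2 - xK s \<nu> ?k3)"
    define y13 where "y13 = inverse (xK s \<nu> k - xK s \<nu> ?k3)"
    have y: "swapK k y12 = - y12" "swapK k y23 = y13" "swapK k y13 = y23"
      "swapK ?k2 y12 = y13" "swapK ?k2 y23 = - y23" "swapK ?k2 y13 = y12"
      unfolding y12_def y23_def y13_def using k len e
      by (simp_all add: swapK.hom swapK_xK tr flip: inverse_minus_eq)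
    \<comment> \<open>The partial fraction identity for the reciprocals of the three differences; it
      merges the terms in which one exchange has been applied twice.\<close>
    have yy: "y12 * y23 = y13 * y12 + y13 * y23"
      using inverse_sum_identity[of "xK s \<nu> k - xK s \<nu> ?k2" "xK s \<nu> ?k2 - xK s \<nu> ?k3"]
        xK_neq[of k ?k2 \<nu>] xK_neq[of ?k2 ?k3 \<nu>] xK_neq[of k ?k3 \<nu>]
      unfolding y12_def y23_def y13_def by simp
    have T': "Tp \<nu> ?k2 (Tp \<nu> k (Tp \<nu> ?k2 m)) = Tp \<nu> k (Tp \<nu> ?k2 (Tp \<nu> k m))"
      using T[unfolded e] .
    have TT': "Tp \<nu> k (Tp \<nu> k m) = m" "Tp \<nu> ?k2 (Tp \<nu> ?k2 m) = m" using TT[unfolded e] by simp_all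
    have S1: "S0f \<nu> k n = kscale y12 (Tp \<nu> k n - n)" and S2: "S0f \<nu> ?k2 n = kscale y23 (Tp \<nu> ?k2 n - n)" for n
      using eq by (simp_all add: S0f_def y12_def y23_def)
    define t1 t2 t12 t21 t where "t1 = Tp \<nu> k m" and "t2 = Tp \<nu> ?k2 m" and "t12 = Tp \<nu> k t2"
      and "t21 = Tp \<nu> ?k2 t1" and "t = Tp \<nu> k t21"
    let ?S = "kscale (y12 * y13 * y23) (t - t21 - t12 + t1 + t2 - m)"
    have LL: "S0f \<nu> ?k2 (S0f \<nu> k (S0f \<nu> ?k2 m)) = ?S"
    proof -
      have "S0f \<nu> ?k2 (S0f \<nu> k (S0f \<nu> ?k2 m)) = kscale y23 (kscale (y12 * y13) (t - t21 - t12 + t1)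
          + kscale (y23 * (y12 - y13)) (t2 - m))"
        unfolding S1 S2
        by (simp add: Tp_kscale Tp_diff y swapK.hom T' TT' flip: t1_def t2_def t12_def t21_def t_def)
          (simp add: T' TT' t1_def t2_def t12_def t21_def t_def vec_simps)
      also have "y23 * (y12 - y13) = y12 * y13" using yy by (simp add: algebra_simps)
      finally show ?thesis by (simp add: vec_simps)
    qed
    have RR: "S0f \<nu> k (S0f \<nu> ?k2 (S0f \<nu> k m)) = ?S"
    proof -
      have "S0f \<nu> k (S0f \<nu> ?k2 (S0f \<nu> k m)) = kscale y12 (kscale (y23 * y13) (t - t21 - t12 + t2)
          + kscale (y12 * (y23 - y13)) (t1 - m))"
        unfolding S1 S2
        by (simp add: Tp_kscale Tp_diff y swapK.hom T' TT' flip: t1_def t2_def t12_def t21_def t_def)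
          (simp add: T' TT' t1_def t2_def t12_def t21_def t_def vec_simps)
      also have "y12 * (y23 - y13) = y23 * y13" using yy by (simp add: algebra_simps)
      finally show ?thesis by (simp add: vec_simps)
    qed
    show ?thesis unfolding L R e LL RR using eq by (simp add: ddc_def)
  qed
qed

end

text \<open>\<open>ddc\<close> for the signed polynomials on \<open>J\<close>: the sign of the first
  argument appears, as the difference is taken in that variable.\<close>

definition ddJ :: "J \<Rightarrow> J \<Rightarrow> base" where
  "ddJ i j = (-1) ^ of_bool (snd i) * ddc (fst i) (fst j)"

lemma ddJ_flip: "ddJ (flipJ i) j = - ddJ i j" "ddJ i (flipJ j) = ddJ i j"
  by (auto simp: ddJ_def flipJ_def)

context rc
begin

subsection \<open>The operators on all summands\<close>

lemma C_VA: "p < l \<Longrightarrow> m \<in> VA \<Longrightarrow> C p m \<in> VA"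
  using linop_closed[OF C_linop] .

lemma C_VS: "\<nu> \<in> Jseq \<beta> \<Longrightarrow> p < l \<Longrightarrow> m \<in> VS \<nu> \<Longrightarrow> C p m \<in> VS (flip p \<nu>)"
  using linop_closed[OF C_linop_VS] .

lemma fold_C_linop: "set js \<subseteq> {..<l} \<Longrightarrow> linop VA VA (fold C js)"
proof (induction js)
  case (Cons j js)
  then show ?case using linop_comp[OF C_linop[of j], of VA "fold C js"] by (simp add: comp_def)
qed (simp add: linop_id id_def)

lemma fold_flip_Jseq: "\<nu> \<in> Jseq \<beta> \<Longrightarrow> fold flip js \<nu> \<in> Jseq \<beta>"
  by (induction js arbitrary: \<nu>) (auto intro: flip_Jseq)

lemma fold_C_VS: "set js \<subseteq> {..<l} \<Longrightarrow> \<nu> \<in> Jseq \<beta> \<Longrightarrow> m \<in> VS \<nu> \<Longrightarrow> fold C js m \<in> VS (fold flip js \<nu>)"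
  by (induction js arbitrary: \<nu> m) (auto intro!: C_VS flip_Jseq)

lemma fold_C_VA: "set js \<subseteq> {..<l} \<Longrightarrow> m \<in> VA \<Longrightarrow> fold C js m \<in> VA"
  using linop_closed[OF fold_C_linop] .

lemma fold_flip_rev: "fold flip (rev js) (fold flip js \<nu>) = \<nu>"
  by (induction js arbitrary: \<nu>) (auto simp: flip_flip)

lemma swp_fold_flip:
  assumes "Suc k < l" "set js \<subseteq> {..<l}" "length \<nu> = l"
  shows "swp k (fold flip js \<nu>) = fold flip (map (tr k) js) (swp k \<nu>)"
  using assms by (induction js arbitrary: \<nu>) (auto simp: swp_flip)

lemma C_fold_C:
  assumes "p < l" "set js \<subseteq> {..<l}" "p \<notin> set js" "m \<in> VA"
  shows "C p (fold C js m) = vscale ((-1) ^ length js) (fold C js (C p m))"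
  using assms(2-)
proof (induction js arbitrary: m)
  case (Cons j js)
  have j: "j < l" "p \<noteq> j" "set js \<subseteq> {..<l}" "p \<notin> set js" using Cons.prems by auto
  have "C p (fold C js (C j m)) = vscale ((-1) ^ length js) (fold C js (C p (C j m)))"
    using Cons j by (intro Cons.IH C_VA) auto
  also have "C p (C j m) = - C j (C p m)"
    by (rule C_anticommute) (use j Cons.prems assms(1) in auto)
  also have "fold C js (- C j (C p m)) = - fold C js (C j (C p m))"
    by (rule linop_uminus[OF fold_C_linop]) (use j Cons.prems assms(1) in \<open>auto intro: C_VA\<close>)
  finally show ?case by simp
qed simp

lemma set_odd_places: "length \<nu> = l \<Longrightarrow> set (odd_places \<nu>) \<subseteq> {..<l}"
  by (auto simp: odd_places_def)

text \<open>\<open>fold\<close> applies the operators in list order, so \<open>fold C js m\<close>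
  is \<open>m.c_{j_1} ... c_{j_r}\<close> for the right action.\<close>

definition XF :: "J list \<Rightarrow> nat \<Rightarrow> VT \<Rightarrow> VT" where
  "XF \<nu> p m = vscale ((-1) ^ of_bool (p \<in> set (odd_places \<nu>)))
     (fold C (rev (odd_places \<nu>)) (X0 p (fold C (odd_places \<nu>) m)))"

definition SF :: "J list \<Rightarrow> nat \<Rightarrow> VT \<Rightarrow> VT" where
  "SF \<nu> k m = fold C (map (tr k) (rev (odd_places \<nu>))) (S0 k (fold C (odd_places \<nu>) m))"

abbreviation "Xo p \<equiv> lin_ext (x_op1 M P s p)"
abbreviation "So k \<equiv> lin_ext (s_op1 M P s k)"

lemma x_op1_eq: "x_op1 M P s p f (\<nu>, w) = XF \<nu> p (Poly_Mapping.single (\<nu>, w) f)"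
  by (simp add: x_op1_def XF_def Let_def)

lemma s_op1_eq: "s_op1 M P s k f (\<nu>, w) = SF \<nu> k (Poly_Mapping.single (\<nu>, w) f)"
  by (simp add: s_op1_def SF_def Let_def)

lemma map_tr_subset: "Suc k < l \<Longrightarrow> set js \<subseteq> {..<l} \<Longrightarrow> set (map (tr k) js) \<subseteq> {..<l}"
  using tr_less[of k l] by auto

lemma XF_linop: "\<nu> \<in> Jseq \<beta> \<Longrightarrow> linop VA VA (XF \<nu> p)"
  unfolding XF_def
  by (intro linop_vscale linop_comp[OF linop_comp[OF fold_C_linop X0_linop] fold_C_linop])
    (use set_odd_places length_Jseq in auto)

lemma SF_linop: "\<nu> \<in> Jseq \<beta> \<Longrightarrow> Suc k < l \<Longrightarrow> linop VA VA (SF \<nu> k)"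
  unfolding SF_def
  by (intro linop_comp[OF linop_comp[OF fold_C_linop S0_linop] fold_C_linop] map_tr_subset)
    (use set_odd_places length_Jseq in auto)

lemma XF_VS:
  assumes "\<nu> \<in> Jseq \<beta>" "m \<in> VS \<nu>" shows "XF \<nu> p m \<in> VS \<nu>"
proof -
  let ?js = "odd_places \<nu>"
  have js: "set ?js \<subseteq> {..<l}" using set_odd_places length_Jseq assms by blast
  have "X0 p (fold C ?js m) \<in> VS (fold flip ?js \<nu>)"
    using linop_closed[OF X0_linop] fold_C_VS[OF js assms] unfolding VS_def by blast
  then have "fold C (rev ?js) (X0 p (fold C ?js m)) \<in> VS (fold flip (rev ?js) (fold flip ?js \<nu>))"
    using js assms by (intro fold_C_VS fold_flip_Jseq) auto
  then show ?thesis by (simp add: XF_def fold_flip_rev VS_closed)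
qed

lemma SF_VS:
  assumes "\<nu> \<in> Jseq \<beta>" "m \<in> VS \<nu>" "Suc k < l" shows "SF \<nu> k m \<in> VS (swp k \<nu>)"
proof -
  let ?js = "odd_places \<nu>"
  have js: "set ?js \<subseteq> {..<l}" using set_odd_places length_Jseq assms by blast
  have len: "length (fold flip ?js \<nu>) = l" using length_Jseq fold_flip_Jseq assms by blast
  have "S0 k (fold C ?js m) \<in> VS (swp k (fold flip ?js \<nu>))"
    using linop_closed[OF S0_linop_VS[OF len assms(3)] fold_C_VS[OF js assms(1,2)]] .
  then have "SF \<nu> k m \<in> VS (fold flip (map (tr k) (rev ?js)) (swp k (fold flip ?js \<nu>)))"
    unfolding SF_def using js assms map_tr_subset[of k ?js]
    by (intro fold_C_VS swp_Jseq fold_flip_Jseq) auto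
  also have "fold flip (map (tr k) (rev ?js)) (swp k (fold flip ?js \<nu>)) = swp k \<nu>"
    using js assms len by (subst swp_fold_flip[symmetric]) (auto simp: fold_flip_rev)
  finally show ?thesis .
qed

lemma x_op1_props:
  assumes "\<nu> \<in> Jseq \<beta>" "w \<in> wds"
  shows "add_at (x_op1 M P s p) (\<nu>, w)" "x_op1 M P s p f (\<nu>, w) \<in> VS \<nu>"
    "x_op1 M P s p (cK c * f) (\<nu>, w) = vscale c (x_op1 M P s p f (\<nu>, w))"
  unfolding add_at_def x_op1_eq single_eq_vscale
proof -
  have sV: "Poly_Mapping.single (\<nu>, w) g \<in> VS \<nu>" for g
    using assms(2) by (simp add: VS_def supp_closed)
  have sA: "Poly_Mapping.single (\<nu>, w) g \<in> VA" for g
    using assms by (simp add: supp_closed)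
  show "\<forall>f g. XF \<nu> p (Poly_Mapping.single (\<nu>, w) (f + g)) =
      XF \<nu> p (Poly_Mapping.single (\<nu>, w) f) + XF \<nu> p (Poly_Mapping.single (\<nu>, w) g)"
    unfolding single_add using linop_add[OF XF_linop[OF assms(1)] sA sA] by blast
  show "XF \<nu> p (Poly_Mapping.single (\<nu>, w) f) \<in> VS \<nu>" by (rule XF_VS[OF assms(1) sV])
  show "XF \<nu> p (vscale c (Poly_Mapping.single (\<nu>, w) f)) = vscale c (XF \<nu> p (Poly_Mapping.single (\<nu>, w) f))"
    by (rule linop_scale[OF XF_linop[OF assms(1)] sA])
qed

lemma s_op1_props:
  assumes "\<nu> \<in> Jseq \<beta>" "w \<in> wds" "Suc k < l"
  shows "add_at (s_op1 M P s k) (\<nu>, w)" "s_op1 M P s k f (\<nu>, w) \<in> VS (swp k \<nu>)"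
    "s_op1 M P s k (cK c * f) (\<nu>, w) = vscale c (s_op1 M P s k f (\<nu>, w))"
  unfolding add_at_def s_op1_eq single_eq_vscale
proof -
  have sV: "Poly_Mapping.single (\<nu>, w) g \<in> VS \<nu>" for g
    using assms(2) by (simp add: VS_def supp_closed)
  have sA: "Poly_Mapping.single (\<nu>, w) g \<in> VA" for g
    using assms by (simp add: supp_closed)
  show "\<forall>f g. SF \<nu> k (Poly_Mapping.single (\<nu>, w) (f + g)) =
      SF \<nu> k (Poly_Mapping.single (\<nu>, w) f) + SF \<nu> k (Poly_Mapping.single (\<nu>, w) g)"
    unfolding single_add using linop_add[OF SF_linop[OF assms(1,3)] sA sA] by blast
  show "SF \<nu> k (Poly_Mapping.single (\<nu>, w) f) \<in> VS (swp k \<nu>)" by (rule SF_VS[OF assms(1) sV assms(3)])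
  show "SF \<nu> k (vscale c (Poly_Mapping.single (\<nu>, w) f)) = vscale c (SF \<nu> k (Poly_Mapping.single (\<nu>, w) f))"
    by (rule linop_scale[OF SF_linop[OF assms(1,3)] sA])
qed

lemma Xo_linop: "linop VA VA (Xo p)"
  by (rule linop_lin_ext) (auto intro!: x_op1_props VS_VA[THEN subsetD])

lemma So_linop: "Suc k < l \<Longrightarrow> linop VA VA (So k)"
  by (rule linop_lin_ext) (auto intro!: s_op1_props VS_VA[OF swp_Jseq, THEN subsetD])

lemma Xo_eq:
  assumes "\<nu> \<in> Jseq \<beta>" "m \<in> VS \<nu>" shows "Xo p m = XF \<nu> p m"
proof (rule linop_ext[where B = "{\<nu>} \<times> wds" and F = "Xo p" and G = "XF \<nu> p"])
  show "linop (supp ({\<nu>} \<times> wds)) VA (Xo p)" "linop (supp ({\<nu>} \<times> wds)) VA (XF \<nu> p)"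
    using linop_mono[OF Xo_linop VS_VA[OF assms(1), unfolded VS_def]]
      linop_mono[OF XF_linop[OF assms(1)] VS_VA[OF assms(1), unfolded VS_def]] by blast+
qed (use assms in \<open>auto simp: VS_def lin_ext_single x_op1_props x_op1_eq\<close>)

lemma So_eq:
  assumes "\<nu> \<in> Jseq \<beta>" "m \<in> VS \<nu>" "Suc k < l" shows "So k m = SF \<nu> k m"
proof (rule linop_ext[where B = "{\<nu>} \<times> wds" and F = "So k" and G = "SF \<nu> k"])
  show "linop (supp ({\<nu>} \<times> wds)) VA (So k)" "linop (supp ({\<nu>} \<times> wds)) VA (SF \<nu> k)"
    using linop_mono[OF So_linop[OF assms(3)] VS_VA[OF assms(1), unfolded VS_def]]
      linop_mono[OF SF_linop[OF assms(1,3)] VS_VA[OF assms(1), unfolded VS_def]] by blast+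
qed (use assms in \<open>auto simp: VS_def lin_ext_single s_op1_props s_op1_eq\<close>)

lemma Xo_VS: "\<nu> \<in> Jseq \<beta> \<Longrightarrow> m \<in> VS \<nu> \<Longrightarrow> Xo p m \<in> VS \<nu>"
  using XF_VS Xo_eq by simp

lemma So_VS: "\<nu> \<in> Jseq \<beta> \<Longrightarrow> m \<in> VS \<nu> \<Longrightarrow> Suc k < l \<Longrightarrow> So k m \<in> VS (swp k \<nu>)"
  using SF_VS So_eq by simp

text \<open>The \<open>c_j\<close> anticommute, so the position at which the new odd place enters
  the list has to be known.\<close>

lemma odd_places_flip:
  assumes "length \<nu> = l" "p < l" "\<not> snd (\<nu> ! p)"
  obtains L1 L2 where "odd_places \<nu> = L1 @ L2" "odd_places (flip p \<nu>) = L1 @ p # L2"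
    "p \<notin> set L1" "p \<notin> set L2" "set L1 \<subseteq> {..<l}" "set L2 \<subseteq> {..<l}"
proof
  let ?F = "filter (\<lambda>p. snd (\<nu> ! p))"
  have upt: "[0..<l] = [0..<p] @ p # [Suc p..<l]"
    using assms(2) upt_add_eq_append[of 0 p "l - p"] by (simp add: upt_conv_Cons)
  show "odd_places \<nu> = ?F [0..<p] @ ?F [Suc p..<l]"
    using assms by (simp add: odd_places_def upt)
  have "filter (\<lambda>r. snd (flip p \<nu> ! r)) [0..<p] = ?F [0..<p]"
    "filter (\<lambda>r. snd (flip p \<nu> ! r)) [Suc p..<l] = ?F [Suc p..<l]"
    using assms by (auto intro!: filter_cong simp: nth_flip)
  then show "odd_places (flip p \<nu>) = ?F [0..<p] @ p # ?F [Suc p..<l]"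
    using assms by (simp add: odd_places_def upt) (simp add: nth_flip flipJ_def)
qed (use assms in auto)

text \<open>Moving \<open>c_p\<close> past the places of \<open>L1\<close> to meet its double costs
  \<open>(-1) ^ length L1\<close>; moving the corresponding operator out of the list after
  \<open>\<sigma>_k\<close> costs the same sign again.\<close>

lemma So_C_even:
  assumes \<nu>: "\<nu> \<in> Jseq \<beta>" and m: "m \<in> VS \<nu>" and k: "Suc k < l" and p: "p < l" "\<not> snd (\<nu> ! p)"
  shows "So k (C p m) = C (tr k p) (So k m)"
proof -
  from odd_places_flip[OF length_Jseq[OF \<nu>] p] obtain L1 L2 where L: "odd_places \<nu> = L1 @ L2"
    "odd_places (flip p \<nu>) = L1 @ p # L2" "p \<notin> set L1" "p \<notin> set L2" "set L1 \<subseteq> {..<l}" "set L2 \<subseteq> {..<l}" .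
  have mA: "m \<in> VA" using m VS_VA[OF \<nu>] by blast
  have tp: "tr k p < l" using k p tr_less by blast
  note lin = linop_scale[OF fold_C_linop] linop_scale[OF S0_linop[OF k]] linop_scale[OF C_linop]
  let ?t1 = "map (tr k) (rev L1)" and ?t2 = "map (tr k) (rev L2)"
  have t: "set ?t1 \<subseteq> {..<l}" "set ?t2 \<subseteq> {..<l}" "tr k p \<notin> set ?t1" "tr k p \<notin> set ?t2"
    using map_tr_subset[OF k, of "rev L1"] map_tr_subset[OF k, of "rev L2"] L(3-6)
    by (auto simp: inj_image_mem_iff[OF inj_transpose])
  define m' where "m' = fold C L2 (fold C L1 m)"
  have m': "m' \<in> VA" unfolding m'_def by (intro fold_C_VA L mA)
  have f: "fold C L2 (C p (fold C L1 (C p m))) = vscale ((-1) ^ length L1) m'"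
  proof -
    have "C p (fold C L1 (C p m)) = vscale ((-1) ^ length L1) (fold C L1 m)"
      using C_fold_C[OF p(1) L(5,3) C_VA[OF p(1) mA]] C_C[OF mA p(1)] by simp
    then show ?thesis using lin(1)[OF L(6) fold_C_VA[OF L(5) mA]] by (simp add: m'_def)
  qed
  define y where "y = S0 k m'"
  have y: "y \<in> VA" unfolding y_def using linop_closed[OF S0_linop[OF k] m'] .
  have yy: "fold C ?t2 y \<in> VA" "C (tr k p) (fold C ?t2 y) \<in> VA" "fold C ?t1 (C (tr k p) (fold C ?t2 y)) \<in> VA"
    by (intro fold_C_VA C_VA t tp y)+
  have "So k (C p m) = fold C ?t1 (C (tr k p) (fold C ?t2 (S0 k (fold C L2 (C p (fold C L1 (C p m)))))))"
    by (simp add: So_eq[OF flip_Jseq[OF \<nu>] C_VS[OF \<nu> p(1) m] k] SF_def L)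
  also have "\<dots> = vscale ((-1) ^ length L1) (fold C ?t1 (C (tr k p) (fold C ?t2 y)))"
    unfolding f y_def[symmetric]
    by (simp only: lin(2)[OF m'] y_def[symmetric] lin(1)[OF t(2) y] lin(3)[OF tp yy(1)] lin(1)[OF t(1) yy(2)])
  also have "\<dots> = C (tr k p) (fold C ?t1 (fold C ?t2 y))"
    using C_fold_C[OF tp t(1,3) yy(1)] by simp
  also have "\<dots> = C (tr k p) (So k m)"
    using \<nu> m k by (simp add: So_eq[OF \<nu>] SF_def L y_def m'_def)
  finally show ?thesis .
qed

text \<open>As for \<open>\<sigma>_k\<close>, the signs from \<open>L1\<close> cancel. The sign
  built into \<open>x_r\<close> on odd places changes precisely for \<open>r = p\<close> and yields
  the anticommutation with \<open>c_p\<close>.\<close>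

lemma Xo_C_even:
  assumes \<nu>: "\<nu> \<in> Jseq \<beta>" and m: "m \<in> VS \<nu>" and p: "p < l" "\<not> snd (\<nu> ! p)"
  shows "Xo r (C p m) = vscale (if p = r then -1 else 1) (C p (Xo r m))"
proof -
  from odd_places_flip[OF length_Jseq[OF \<nu>] p] obtain L1 L2 where L: "odd_places \<nu> = L1 @ L2"
    "odd_places (flip p \<nu>) = L1 @ p # L2" "p \<notin> set L1" "p \<notin> set L2" "set L1 \<subseteq> {..<l}" "set L2 \<subseteq> {..<l}" .
  have mA: "m \<in> VA" using m VS_VA[OF \<nu>] by blast
  have lX: "linop VA VA (X0 r)" by (rule X0_linop)
  note lin = linop_scale[OF fold_C_linop] linop_scale[OF lX] linop_scale[OF C_linop]
  define m' where "m' = fold C L2 (fold C L1 m)"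
  have m': "m' \<in> VA" unfolding m'_def by (intro fold_C_VA L mA)
  have f: "fold C L2 (C p (fold C L1 (C p m))) = vscale ((-1) ^ length L1) m'"
  proof -
    have "C p (fold C L1 (C p m)) = vscale ((-1) ^ length L1) (fold C L1 m)"
      using C_fold_C[OF p(1) L(5,3) C_VA[OF p(1) mA]] C_C[OF mA p(1)] by simp
    then show ?thesis using lin(1)[OF L(6) fold_C_VA[OF L(5) mA]] by (simp add: m'_def)
  qed
  have rL: "set (rev L1) \<subseteq> {..<l}" "set (rev L2) \<subseteq> {..<l}" "p \<notin> set (rev L1)" using L by auto
  define y where "y = X0 r m'"
  have y: "y \<in> VA" unfolding y_def using linop_closed[OF lX m'] .
  have yy: "fold C (rev L2) y \<in> VA" "C p (fold C (rev L2) y) \<in> VA" "fold C (rev L1) (fold C (rev L2) y) \<in> VA"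
    by (intro fold_C_VA C_VA rL p y)+
  define c :: base where "c = (-1) ^ of_bool (r \<in> set L1 \<or> r \<in> set L2)"
  have c: "(-1) ^ of_bool (r = p \<or> r \<in> set L1 \<or> r \<in> set L2) = (if p = r then -1 else 1) * c"
    using L(3,4) by (auto simp: c_def)
  have "Xo r (C p m) = vscale ((if p = r then -1 else 1) * c)
      (fold C (rev L1) (C p (fold C (rev L2) (X0 r (fold C L2 (C p (fold C L1 (C p m))))))))"
    unfolding Xo_eq[OF flip_Jseq[OF \<nu>] C_VS[OF \<nu> p(1) m]] XF_def L c[symmetric] by (simp add: disj_ac)
  also have "\<dots> = vscale ((if p = r then -1 else 1) * c)
      (vscale ((-1) ^ length L1) (fold C (rev L1) (C p (fold C (rev L2) y))))"
    unfolding f y_def[symmetric]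
    by (simp only: lin(2)[OF m'] y_def[symmetric] lin(1)[OF rL(2) y] lin(3)[OF p(1) yy(1)] lin(1)[OF rL(1) yy(2)])
  also have "vscale ((-1) ^ length L1) (fold C (rev L1) (C p (fold C (rev L2) y))) = C p (fold C (rev L1) (fold C (rev L2) y))"
    using C_fold_C[OF p(1) rL(1,3) yy(1)] by simp
  also have "vscale ((if p = r then -1 else 1) * c) (C p (fold C (rev L1) (fold C (rev L2) y))) =
      vscale (if p = r then -1 else 1) (C p (Xo r m))"
  proof -
    have "Xo r m = vscale c (fold C (rev L1) (fold C (rev L2) y))"
      by (simp only: Xo_eq[OF \<nu> m] XF_def L set_append Un_iff c_def y_def m'_def rev_append fold_append o_apply)
    then show ?thesis using lin(3)[OF p(1) yy(3)] by simp
  qed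
  finally show ?thesis .
qed

lemma VA_from_VS:
  assumes "linop VA V' F" "linop VA V'' G" "m \<in> VA"
    and "\<And>\<nu> m. \<nu> \<in> Jseq \<beta> \<Longrightarrow> m \<in> VS \<nu> \<Longrightarrow> F m = G m"
  shows "F m = G m"
  by (rule linop_ext[OF assms(1,2) _ assms(3)]) (use assms(4) in \<open>auto simp: VS_def supp_closed\<close>)

text \<open>If place \<open>p\<close> is odd, the even case is applied to \<open>C p m\<close>,
  whose place \<open>p\<close> is even, and \<open>c_p\<close> is cancelled on both sides.\<close>

lemma So_C:
  assumes "m \<in> VA" "Suc k < l" "p < l"
  shows "So k (C p m) = C (tr k p) (So k m)"
proof (rule VA_from_VS[OF linop_comp[OF C_linop So_linop] linop_comp[OF So_linop C_linop] assms(1)])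
  fix \<nu> m assume \<nu>: "\<nu> \<in> Jseq \<beta>" and m: "m \<in> VS \<nu>"
  have mA: "m \<in> VA" using m VS_VA[OF \<nu>] by blast
  have tp: "tr k p < l" using assms tr_less by blast
  show "So k (C p m) = C (tr k p) (So k m)"
  proof (cases "snd (\<nu> ! p)")
    case True
    then have "\<not> snd (flip p \<nu> ! p)" using assms length_Jseq[OF \<nu>] by (simp add: nth_flip flipJ_def)
    from So_C_even[OF flip_Jseq[OF \<nu>] C_VS[OF \<nu> assms(3) m] assms(2,3) this]
    have "So k m = C (tr k p) (So k (C p m))" using C_C[OF mA assms(3)] by simp
    then show ?thesis
      using C_C[OF linop_closed[OF So_linop[OF assms(2)] C_VA[OF assms(3) mA]] tp] by simp
  qed (use So_C_even \<nu> m assms in auto)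
qed (use assms tr_less in auto)

lemma Xo_C:
  assumes "m \<in> VA" "p < l"
  shows "Xo r (C p m) = (if p = r then - C p (Xo r m) else C p (Xo r m))"
proof -
  have "Xo r (C p m) = vscale (if p = r then -1 else 1) (C p (Xo r m))"
  proof (rule VA_from_VS[OF linop_comp[OF C_linop Xo_linop] linop_vscale[OF linop_comp[OF Xo_linop C_linop]] assms(1)])
    fix \<nu> m assume \<nu>: "\<nu> \<in> Jseq \<beta>" and m: "m \<in> VS \<nu>"
    have mA: "m \<in> VA" using m VS_VA[OF \<nu>] by blast
    show "Xo r (C p m) = vscale (if p = r then -1 else 1) (C p (Xo r m))"
    proof (cases "snd (\<nu> ! p)")
      case True
      then have "\<not> snd (flip p \<nu> ! p)" using assms length_Jseq[OF \<nu>] by (simp add: nth_flip flipJ_def)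
      from Xo_C_even[OF flip_Jseq[OF \<nu>] C_VS[OF \<nu> assms(2) m] assms(2) this, of r]
      have e: "Xo r m = vscale (if p = r then -1 else 1) (C p (Xo r (C p m)))" using C_C[OF mA assms(2)] by simp
      have x: "Xo r (C p m) \<in> VA" by (rule linop_closed[OF Xo_linop C_VA[OF assms(2) mA]])
      show ?thesis
        using C_C[OF x assms(2)] linop_uminus[OF C_linop[OF assms(2)] C_VA[OF assms(2) x]] unfolding e by auto
    qed (use Xo_C_even \<nu> m assms in auto)
  qed (use assms in auto)
  then show ?thesis by simp
qed

text \<open>Every vector \<open>m\<close> of a summand with an odd place \<open>p\<close> is
  \<open>C p (C p m)\<close>, with \<open>C p m\<close> in a summand with one odd place
  less.\<close>

lemma odd_induct [consumes 2, case_names even step]: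
  assumes "\<nu> \<in> Jseq \<beta>" "m \<in> VS \<nu>"
    and base: "\<And>\<nu> m. \<nu> \<in> Jseq \<beta> \<Longrightarrow> m \<in> VS \<nu> \<Longrightarrow> odd_places \<nu> = [] \<Longrightarrow> R \<nu> m"
    and step: "\<And>\<nu> m p. \<nu> \<in> Jseq \<beta> \<Longrightarrow> m \<in> VS \<nu> \<Longrightarrow> p < l \<Longrightarrow> \<not> snd (\<nu> ! p) \<Longrightarrow> R \<nu> m \<Longrightarrow> R (flip p \<nu>) (C p m)"
  shows "R \<nu> m"
  using assms(1,2)
proof (induction "length (odd_places \<nu>)" arbitrary: \<nu> m)
  case 0
  then show ?case by (intro base) auto
next
  case (Suc n)
  then obtain p where p: "p \<in> set (odd_places \<nu>)" by (cases "odd_places \<nu>") auto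
  then have pl: "p < l" "snd (\<nu> ! p)" using length_Jseq[OF Suc.prems(1)] by (auto simp: odd_places_def)
  define \<mu> where "\<mu> = flip p \<nu>"
  have \<mu>: "\<mu> \<in> Jseq \<beta>" "\<not> snd (\<mu> ! p)"
    using Suc.prems pl length_Jseq by (auto simp: \<mu>_def flip_Jseq nth_flip flipJ_def)
  from odd_places_flip[OF length_Jseq[OF \<mu>(1)] pl(1) \<mu>(2)]
  have "length (odd_places (flip p \<mu>)) = Suc (length (odd_places \<mu>))" by (metis length_append length_Cons add_Suc_right)
  then have n: "n = length (odd_places \<mu>)" using Suc.hyps(2) by (simp add: \<mu>_def flip_flip)
  have Cm: "C p m \<in> VS \<mu>" unfolding \<mu>_def by (intro C_VS Suc.prems pl)
  have "R (flip p \<mu>) (C p (C p m))"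
    by (rule step[OF \<mu>(1) Cm pl(1) \<mu>(2) Suc.hyps(1)[OF n \<mu>(1) Cm]])
  then show ?case
    using C_C[OF VS_VA[OF Suc.prems(1), THEN subsetD, OF Suc.prems(2)] pl(1)] by (simp add: \<mu>_def flip_flip)
qed

lemma even_Xo: "\<nu> \<in> Jseq \<beta> \<Longrightarrow> m \<in> VS \<nu> \<Longrightarrow> odd_places \<nu> = [] \<Longrightarrow> Xo p m = X0 p m"
  by (simp add: Xo_eq XF_def)

lemma even_So: "\<nu> \<in> Jseq \<beta> \<Longrightarrow> m \<in> VS \<nu> \<Longrightarrow> odd_places \<nu> = [] \<Longrightarrow> Suc k < l \<Longrightarrow> So k m = S0 k m"
  by (simp add: So_eq SF_def)

lemma even_snd: "odd_places \<nu> = [] \<Longrightarrow> p < length \<nu> \<Longrightarrow> \<not> snd (\<nu> ! p)"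
  by (auto simp: odd_places_def filter_empty_conv)

lemma even_eq_iff:
  "odd_places \<nu> = [] \<Longrightarrow> p < length \<nu> \<Longrightarrow> r < length \<nu> \<Longrightarrow> \<nu> ! p = \<nu> ! r \<longleftrightarrow> fst (\<nu> ! p) = fst (\<nu> ! r)"
  using even_snd[of \<nu> p] even_snd[of \<nu> r] by (auto simp: prod_eq_iff)

lemma even_swp:
  assumes "odd_places \<nu> = []" "Suc k < length \<nu>" shows "odd_places (swp k \<nu>) = []"
proof -
  have "\<not> snd (swp k \<nu> ! r)" if "r < length \<nu>" for r
    using even_snd[OF assms(1) tr_less[OF assms(2) that]] nth_swp[OF assms(2) that] by simp
  then show ?thesis by (simp add: odd_places_def filter_empty_conv)
qed

lemma Xo_VA: "m \<in> VA \<Longrightarrow> Xo p m \<in> VA"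
  using linop_closed[OF Xo_linop] .

lemma So_VA: "Suc k < l \<Longrightarrow> m \<in> VA \<Longrightarrow> So k m \<in> VA"
  using linop_closed[OF So_linop] .

lemma C_arith:
  assumes "p < l"
  shows "m \<in> VA \<Longrightarrow> m' \<in> VA \<Longrightarrow> C p (m + m') = C p m + C p m'"
    "m \<in> VA \<Longrightarrow> m' \<in> VA \<Longrightarrow> C p (m - m') = C p m - C p m'"
    "m \<in> VA \<Longrightarrow> C p (- m) = - C p m" "C p 0 = 0" "m \<in> VA \<Longrightarrow> C p (vscale c m) = vscale c (C p m)"
  using linop_add[OF C_linop[OF assms]] linop_diff[OF C_linop[OF assms]] linop_uminus[OF C_linop[OF assms]]
    linop_0[OF C_linop[OF assms]] linop_scale[OF C_linop[OF assms]] by auto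

lemma Xo_arith:
  shows "m \<in> VA \<Longrightarrow> m' \<in> VA \<Longrightarrow> Xo p (m + m') = Xo p m + Xo p m'"
    "m \<in> VA \<Longrightarrow> m' \<in> VA \<Longrightarrow> Xo p (m - m') = Xo p m - Xo p m'"
    "m \<in> VA \<Longrightarrow> Xo p (- m) = - Xo p m" "Xo p 0 = 0" "m \<in> VA \<Longrightarrow> Xo p (vscale c m) = vscale c (Xo p m)"
  using linop_add[OF Xo_linop] linop_diff[OF Xo_linop] linop_uminus[OF Xo_linop]
    linop_0[OF Xo_linop] linop_scale[OF Xo_linop] by auto

lemma So_arith:
  assumes "Suc k < l"
  shows "m \<in> VA \<Longrightarrow> m' \<in> VA \<Longrightarrow> So k (m + m') = So k m + So k m'"
    "m \<in> VA \<Longrightarrow> m' \<in> VA \<Longrightarrow> So k (m - m') = So k m - So k m'"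
    "m \<in> VA \<Longrightarrow> So k (- m) = - So k m" "So k 0 = 0" "m \<in> VA \<Longrightarrow> So k (vscale c m) = vscale c (So k m)"
  using linop_add[OF So_linop[OF assms]] linop_diff[OF So_linop[OF assms]] linop_uminus[OF So_linop[OF assms]]
    linop_0[OF So_linop[OF assms]] linop_scale[OF So_linop[OF assms]] by auto

subsection \<open>Relations on all summands\<close>

lemma Xo_Xo:
  assumes "\<nu> \<in> Jseq \<beta>" "m \<in> VS \<nu>"
  shows "Xo p (Xo r m) = Xo r (Xo p m)"
  using assms
proof (induction rule: odd_induct)
  case (even \<nu> m)
  then have "Xo p m \<in> VS \<nu>" "Xo r m \<in> VS \<nu>" by (auto intro: Xo_VS)
  then show ?case using even
    by (simp add: even_Xo X0_eq) (simp add: X0_eq[OF VS_closed(5)] kscale_simps mult.commute)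
next
  case (step \<nu> m u)
  then have "m \<in> VA" using VS_VA by blast
  with step show ?case by (simp add: Xo_C Xo_VA Xo_arith C_VA)
qed

lemma So_Xo:
  assumes "\<nu> \<in> Jseq \<beta>" "m \<in> VS \<nu>" "Suc k < l" "p < l" "p \<noteq> k" "p \<noteq> Suc k"
  shows "So k (Xo p m) = Xo p (So k m)"
  using assms(1,2)
proof (induction rule: odd_induct)
  case (even \<nu> m)
  have S: "S0 k m \<in> VS (swp k \<nu>)" using So_VS[of \<nu> m k] even_So[of \<nu> m k] even assms by simp
  have X: "X0 p m \<in> VS \<nu>" using Xo_VS[of \<nu> m p] even_Xo[of \<nu> m p] even by simp
  have "odd_places (swp k \<nu>) = []" "swp k \<nu> \<in> Jseq \<beta>"
    using even assms even_swp[of \<nu> k] length_Jseq swp_Jseq by auto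
  then show ?case
    using even assms S X S0_X0[of m \<nu> k p] length_Jseq
    by (simp add: even_So even_Xo[of \<nu>] even_Xo[of "swp k \<nu>"] even_So[of \<nu> "X0 p m"])
next
  case (step \<nu> m u)
  have A: "m \<in> VA" using VS_VA step by blast
  have "tr k p = p" using assms by (simp add: Transposition.transpose_def)
  then have u: "tr k u = p \<longleftrightarrow> u = p" by (metis transpose_involutory)
  show ?case
    using A step assms tr_less[of k l u]
    by (simp add: Xo_C So_C Xo_VA So_VA So_arith C_VA u)
qed

text \<open>Applying \<open>c_k\<close> or \<open>c_{k+1}\<close> turns two equal neighbours into
  two that are exchanged by \<open>c\<close>, and conversely; this is how the terms with
  \<open>c_k c_{k+1}\<close> arise from those of the even summands. \<open>C (Suc k) (C k m)\<close>
  is \<open>m.c_k c_{k+1}\<close>.\<close>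

lemma So_x:
  assumes "\<nu> \<in> Jseq \<beta>" "m \<in> VS \<nu>" "Suc k < l"
  shows So_x_right: "Xo (Suc k) (So k m) - So k (Xo k m) = (if \<nu> ! k = \<nu> ! Suc k then m
      else if \<nu> ! k = flipJ (\<nu> ! Suc k) then - C (Suc k) (C k m) else 0)" (is "?A \<nu> m")
    and So_x_left: "So k (Xo (Suc k) m) - Xo k (So k m) = (if \<nu> ! k = \<nu> ! Suc k then m
      else if \<nu> ! k = flipJ (\<nu> ! Suc k) then C (Suc k) (C k m) else 0)" (is "?B \<nu> m")
proof -
  have "?A \<nu> m \<and> ?B \<nu> m"
    using assms(1,2)
  proof (induction rule: odd_induct)
    case (even \<nu> m)
    have len: "length \<nu> = l" using even length_Jseq by blast
    have S: "S0 k m \<in> VS (swp k \<nu>)" using So_VS[of \<nu> m k] even_So[of \<nu> m k] even assms by simp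
    have X: "X0 p m \<in> VS \<nu>" for p using Xo_VS[of \<nu> m p] even_Xo[of \<nu> m p] even by simp
    have sw: "odd_places (swp k \<nu>) = []" "swp k \<nu> \<in> Jseq \<beta>"
      using even assms even_swp[of \<nu> k] length_Jseq swp_Jseq by auto
    have "\<nu> ! k \<noteq> flipJ (\<nu> ! Suc k)"
      using even_snd[OF even(3), of k] even_snd[OF even(3), of "Suc k"] assms len
      by (auto simp: flipJ_def prod_eq_iff)
    then show ?case
      using even assms S X sw S0_x_right[OF even(2) len assms(3)] S0_x_left[OF even(2) len assms(3)]
      by (simp add: even_So even_Xo[of \<nu>] even_Xo[of "swp k \<nu>"] even_So[of \<nu> "X0 p m" for p])
  next
    case (step \<nu> m u)
    have A: "m \<in> VA" using VS_VA step by blast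
    have len: "length \<nu> = l" using step length_Jseq by blast
    have kl: "k < l" using assms by simp
    have co: "Xo p (So k (C u m)) = (if tr k u = p then - C (tr k u) (Xo p (So k m)) else C (tr k u) (Xo p (So k m)))"
      "So k (Xo p (C u m)) = (if u = p then - C (tr k u) (So k (Xo p m)) else C (tr k u) (So k (Xo p m)))" for p
      using A step assms tr_less[of k l u] by (simp_all add: Xo_C So_C Xo_VA So_VA So_arith C_VA)
    define L where "L = Xo (Suc k) (So k m) - So k (Xo k m)"
    define L' where "L' = So k (Xo (Suc k) m) - Xo k (So k m)"
    have VA: "Xo p (So k m) \<in> VA" "So k (Xo p m) \<in> VA" for p using A assms by (auto intro: Xo_VA So_VA)
    have neq: "\<nu> ! p \<noteq> flipJ (\<nu> ! p)" "(\<nu> ! u = flipJ (\<nu> ! p)) = (flipJ (\<nu> ! u) = \<nu> ! p)" for p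
      by (auto simp: flipJ_def prod_eq_iff)
    consider (k) "u = k" | (Sk) "u = Suc k" | (other) "u \<noteq> k" "u \<noteq> Suc k" by blast
    then show ?case
    proof cases
      case k
      have "Xo (Suc k) (So k (C u m)) - So k (Xo k (C u m)) = - C (Suc k) L"
        "So k (Xo (Suc k) (C u m)) - Xo k (So k (C u m)) = C (Suc k) L'"
        unfolding co L_def L'_def using k assms VA by (simp_all add: C_arith)
      moreover have fl: "flip u \<nu> ! k = flipJ (\<nu> ! k)" "flip u \<nu> ! Suc k = \<nu> ! Suc k"
        using k len assms by (simp_all add: nth_flip)
      moreover have "C (Suc k) (C (Suc k) (C k m)) = C k m" "C k (C k m) = m"
        using A assms kl by (simp_all add: C_C C_VA)
      ultimately show ?thesis
        using step(5) assms kl A k C_VA[of k m] C_VA[of "Suc k" "C k m"] unfolding L_def[symmetric] L'_def[symmetric]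
        by (auto simp: C_arith flipJ_def prod_eq_iff)
    next
      case Sk
      have tr: "tr k (Suc k) = k" by simp
      have "Xo (Suc k) (So k (C u m)) - So k (Xo k (C u m)) = C k L"
        "So k (Xo (Suc k) (C u m)) - Xo k (So k (C u m)) = - C k L'"
        unfolding co L_def L'_def using Sk assms VA kl by (simp_all add: C_arith)
      moreover have fl: "flip u \<nu> ! k = \<nu> ! k" "flip u \<nu> ! Suc k = flipJ (\<nu> ! Suc k)"
        using Sk len assms by (simp_all add: nth_flip)
      moreover have "C (Suc k) (C k m) = - C k (C (Suc k) m)"
        "C (Suc k) (C k (C (Suc k) m)) = - C k m" "C k (C k (C (Suc k) m)) = C (Suc k) m"
        using A assms kl by (simp_all add: C_C C_VA C_anticommute[of _ "Suc k" k])
      ultimately show ?thesis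
        using step(5) assms kl A Sk C_VA[of "Suc k" m] C_VA[of k "C (Suc k) m"] unfolding L_def[symmetric] L'_def[symmetric]
        by (auto simp: C_arith flipJ_def prod_eq_iff)
    next
      case other
      then have tr: "tr k u = u" by (simp add: Transposition.transpose_def)
      have "Xo (Suc k) (So k (C u m)) - So k (Xo k (C u m)) = C u L"
        "So k (Xo (Suc k) (C u m)) - Xo k (So k (C u m)) = C u L'"
        unfolding co L_def L'_def tr using other VA step(3) by (simp_all add: C_arith)
      moreover have "flip u \<nu> ! k = \<nu> ! k" "flip u \<nu> ! Suc k = \<nu> ! Suc k"
        using other len assms by (simp_all add: nth_flip)
      moreover have "C (Suc k) (C k (C u m)) = C u (C (Suc k) (C k m))"
        using A assms kl other step C_anticommute[of m k u] C_anticommute[of "C k m" "Suc k" u]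
        by (simp add: C_VA C_arith)
      ultimately show ?thesis
        using step(5) assms kl A step C_VA[of k m] C_VA[of "Suc k" "C k m"] unfolding L_def[symmetric] L'_def[symmetric]
        by (auto simp: C_arith)
    qed
  qed
  then show "?A \<nu> m" "?B \<nu> m" by blast+
qed

text \<open>The action of \<open>Qt i j\<close> at \<open>x_k\<close>, \<open>x_{k+1}\<close> on
  \<open>m\<close>, where \<open>a\<close> and \<open>b\<close> stand for \<open>m.x_k\<close> and
  \<open>m.x_{k+1}\<close>; it can be written out because the polynomial is at most linear.\<close>

definition qact :: "J \<Rightarrow> J \<Rightarrow> VT \<Rightarrow> VT \<Rightarrow> VT \<Rightarrow> VT" where
  "qact i j a b m = (if fst i = fst j then 0 else if cart (fst i) (fst j) = - 1 then
     vscale (if fst i > fst j then 1 else -1)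
       (vscale ((-1) ^ of_bool (snd i)) a - vscale ((-1) ^ of_bool (snd j)) b) else m)"

text \<open>Passing to a flipped place negates \<open>x_p\<close> and also the sign with which it
  enters \<open>Qt\<close>, so the formula is carried along unchanged.\<close>

lemma So_So:
  assumes "\<nu> \<in> Jseq \<beta>" "m \<in> VS \<nu>" "Suc k < l"
  shows "So k (So k m) = qact (\<nu> ! k) (\<nu> ! Suc k) (Xo k m) (Xo (Suc k) m) m"
  using assms(1,2)
proof (induction rule: odd_induct)
  case (even \<nu> m)
  have len: "length \<nu> = l" using even length_Jseq by blast
  have S: "S0 k m \<in> VS (swp k \<nu>)" using So_VS[of \<nu> m k] even_So[of \<nu> m k] even assms by simp
  have sw: "odd_places (swp k \<nu>) = []" "swp k \<nu> \<in> Jseq \<beta>"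
    using even assms even_swp[of \<nu> k] length_Jseq swp_Jseq by auto
  have e: "\<nu> ! k = \<nu> ! Suc k \<longleftrightarrow> fst (\<nu> ! k) = fst (\<nu> ! Suc k)"
    using assms len by (intro even_eq_iff even) auto
  have sn: "\<not> snd (\<nu> ! k)" "\<not> snd (\<nu> ! Suc k)" using even_snd[OF even(3)] assms len by auto
  have "So k (So k m) = kscale (Qp (fst (\<nu> ! k)) (fst (\<nu> ! Suc k)) (xK s \<nu> k) (xK s \<nu> (Suc k))) m"
    using even assms S sw S0_S0[OF even(2) len assms(3) e] by (simp add: even_So)
  also have "\<dots> = qact (\<nu> ! k) (\<nu> ! Suc k) (X0 k m) (X0 (Suc k) m) m"
    by (auto simp: qact_def Qp_def cart_def X0_eq[OF even(2)] sn kscale_simps)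
  finally show ?case using even by (simp add: even_Xo)
next
  case (step \<nu> m u)
  have A: "m \<in> VA" using VS_VA step by blast
  have len: "length \<nu> = l" using step length_Jseq by blast
  have q: "C u (qact i j a b m) = qact i j (C u a) (C u b) (C u m)" if "a \<in> VA" "b \<in> VA" for i j a b
    using step(3) that A by (simp add: qact_def C_arith supp_closed)
  have q1: "qact (flipJ i) j (- a) b m = qact i j a b m" "qact i (flipJ j) a (- b) m = qact i j a b m" for i j a b and m :: VT
    by (auto simp: qact_def flipJ_def)
  have "So k (So k (C u m)) = C u (So k (So k m))"
    using A assms step tr_less[of k l u] by (simp add: So_C So_VA)
  also have "\<dots> = qact (\<nu> ! k) (\<nu> ! Suc k) (C u (Xo k m)) (C u (Xo (Suc k) m)) (C u m)"
    unfolding step(5) using A by (intro q Xo_VA)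
  also have "\<dots> = qact (flip u \<nu> ! k) (flip u \<nu> ! Suc k) (Xo k (C u m)) (Xo (Suc k) (C u m)) (C u m)"
    using A step len assms by (auto simp: Xo_C nth_flip q1)
  finally show ?case .
qed

lemma So_commute:
  assumes "\<nu> \<in> Jseq \<beta>" "m \<in> VS \<nu>" "Suc k < l" "Suc j < l" "Suc j < k \<or> Suc k < j"
  shows "So k (So j m) = So j (So k m)"
  using assms(1,2)
proof (induction rule: odd_induct)
  case (even \<nu> m)
  have len: "length \<nu> = l" using even length_Jseq by blast
  have S: "S0 i m \<in> VS (swp i \<nu>)" "odd_places (swp i \<nu>) = []" "swp i \<nu> \<in> Jseq \<beta>" if "Suc i < l" for i
    using So_VS[of \<nu> m i] even_So[of \<nu> m i] even that even_swp[of \<nu> i] len swp_Jseq by auto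
  show ?case
    using even assms S[OF assms(3)] S[OF assms(4)] S0_commute[OF even(2) len assms(3-5)] by (simp add: even_So)
next
  case (step \<nu> m u)
  have A: "m \<in> VA" using VS_VA step by blast
  have "tr k (tr j u) = tr j (tr k u)" using assms(5) by (auto simp: Transposition.transpose_def)
  then show ?case
    using A assms step tr_less[of k l u] tr_less[of j l u] by (simp add: So_C So_VA)
qed

text \<open>\<open>c_k\<close> and \<open>c_{k+2}\<close> interchange the cases of equal and of
  flipped outer entries, while flipping the middle entry leaves \<open>ddJ\<close>
  unchanged.\<close>

lemma So_braid:
  assumes "\<nu> \<in> Jseq \<beta>" "m \<in> VS \<nu>" "Suc (Suc k) < l"
  shows "So (Suc k) (So k (So (Suc k) m)) - So k (So (Suc k) (So k m)) =
    (if \<nu> ! k = \<nu> ! Suc (Suc k) then vscale (ddJ (\<nu> ! k) (\<nu> ! Suc k)) m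
     else if \<nu> ! k = flipJ (\<nu> ! Suc (Suc k))
     then vscale (ddJ (\<nu> ! Suc (Suc k)) (\<nu> ! Suc k)) (C (Suc (Suc k)) (C k m)) else 0)"
  using assms(1,2)
proof (induction rule: odd_induct)
  case (even \<nu> m)
  let ?k2 = "Suc k" and ?k3 = "Suc (Suc k)"
  have len: "length \<nu> = l" using even length_Jseq by blast
  have S: "So i n = S0 i n \<and> S0 i n \<in> VS (swp i \<mu>) \<and> odd_places (swp i \<mu>) = [] \<and> swp i \<mu> \<in> Jseq \<beta>"
    if "Suc i < l" "\<mu> \<in> Jseq \<beta>" "n \<in> VS \<mu>" "odd_places \<mu> = []" for i \<mu> n
    using So_VS[of \<mu> n i] even_So[of \<mu> n i] that even_swp[of \<mu> i] length_Jseq swp_Jseq by auto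
  have k: "Suc k < l" "Suc (Suc k) < l" using assms by auto
  note s1 = S[OF k(1) even] and s2 = S[OF k(2) even]
  have "So ?k2 (So k (So ?k2 m)) = S0 ?k2 (S0 k (S0 ?k2 m))"
    using S[OF k(1), of "swp ?k2 \<nu>" "S0 ?k2 m"] S[OF k(2), of "swp k (swp ?k2 \<nu>)" "S0 k (S0 ?k2 m)"] s2 by simp
  moreover have "So k (So ?k2 (So k m)) = S0 k (S0 ?k2 (S0 k m))"
    using S[OF k(2), of "swp k \<nu>" "S0 k m"] S[OF k(1), of "swp ?k2 (swp k \<nu>)" "S0 ?k2 (S0 k m)"] s1 by simp
  moreover have "\<not> snd (\<nu> ! k)" "\<not> snd (\<nu> ! ?k3)" using even_snd[OF even(3)] assms len by auto
  ultimately show ?case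
    using S0_braid[OF even(2) len assms(3)] even_eq_iff[OF even(3)] len
    by (auto simp: ddJ_def flipJ_def prod_eq_iff)
next
  case (step \<nu> m u)
  let ?k2 = "Suc k" and ?k3 = "Suc (Suc k)"
  have A: "m \<in> VA" using VS_VA step by blast
  have len: "length \<nu> = l" using step length_Jseq by blast
  have k: "k < l" "?k2 < l" "?k3 < l" using assms by auto
  \<comment> \<open>Both triple products permute the places by exchanging \<open>k\<close> and
    \<open>k + 2\<close>, so \<open>c_u\<close> leaves either of them at the same place
    \<open>t\<close>.\<close>
  define t where "t = tr k (tr ?k2 (tr k u))"
  have t: "tr ?k2 (tr k (tr ?k2 u)) = t" by (auto simp: t_def Transposition.transpose_def)
  have t': "t = (if u = k then ?k3 else if u = ?k3 then k else u)" by (auto simp: t_def Transposition.transpose_def)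
  have tl: "t < l" using t' k step(3) by auto
  define L where "L = So ?k2 (So k (So ?k2 m)) - So k (So ?k2 (So k m))"
  have "So ?k2 (So k (So ?k2 (C u m))) - So k (So ?k2 (So k (C u m))) = C t L"
    using A k step(3) tr_less[of k l] tr_less[of ?k2 l] tl
    by (simp add: So_C So_VA t t_def[symmetric] L_def C_arith)
  moreover have "flip u \<nu> ! p = (if p = u then flipJ (\<nu> ! p) else \<nu> ! p)" if "p < l" for p
    using that len by (simp add: nth_flip)
  note fl = this[OF k(1)] this[OF k(2)] this[OF k(3)]
  note IH = step(5)[folded L_def]
  note Cs = C_VA[OF k(1) A] C_VA[OF k(3) A] C_VA[OF k(3) C_VA[OF k(1) A]] C_VA[OF k(1) C_VA[OF k(3) A]]
  consider (k) "u = k" | (k3) "u = ?k3" | (other) "u \<noteq> k" "u \<noteq> ?k3" by blast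
  then have "C t L = (if flip u \<nu> ! k = flip u \<nu> ! ?k3 then vscale (ddJ (flip u \<nu> ! k) (flip u \<nu> ! ?k2)) (C u m)
     else if flip u \<nu> ! k = flipJ (flip u \<nu> ! ?k3)
     then vscale (ddJ (flip u \<nu> ! ?k3) (flip u \<nu> ! ?k2)) (C ?k3 (C k (C u m))) else 0)"
  proof cases
    case k
    then show ?thesis
      unfolding fl t' IH using A assms Cs k
      by (auto simp: C_arith C_C flipJ_def prod_eq_iff ddJ_def)
  next
    case k3
    have "C ?k3 (C k (C ?k3 m)) = - C k m" "C k (C ?k3 (C k m)) = - C ?k3 m"
      using A Cs k C_anticommute[of m k ?k3] C_anticommute[of "C k m" k ?k3] by (simp_all add: C_arith C_C)
    then show ?thesis
      unfolding fl t' IH using A assms Cs k3 \<open>k < l\<close>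
      by (auto simp: C_arith flipJ_def prod_eq_iff ddJ_def)
  next
    case other
    have "C ?k3 (C k (C u m)) = C u (C ?k3 (C k m))"
      using A k other step(3) C_anticommute[of m k u] C_anticommute[of "C k m" ?k3 u] Cs
      by (simp add: C_VA C_arith)
    then show ?thesis
      unfolding fl t' IH using A assms Cs other step(3) by (auto simp: C_arith ddJ_flip)
  qed
  ultimately show ?case by simp
qed

end

section \<open>Integrality\<close>

lemma mcoeff_swap_subst: "mcoeff (swap_subst k f) m = mcoeff f (image_mset (tr k) m)"
proof -
  have inv: "image_mset (tr k) (image_mset (tr k) n) = n" for n
    by (simp add: image_mset.compositionality comp_def)
  have "mcoeff (swap_subst k f) m = (\<Sum>n\<in>{image_mset (tr k) m}. mcoeff f n * mcoeff (\<Prod>i\<in>#n. mvar (tr k i)) m)"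
    by (rule mcoeff_subst[OF adm_tr]) (auto simp: mcoeff_prod_mvar inv split: if_splits)
  then show ?thesis by (simp add: mcoeff_prod_mvar inv)
qed

text \<open>
  The quotient of an antisymmetric series by \<open>t - u\<close> is \<open>t\<^sup>a u\<^sup>b \<mapsto> h(a + 1, b) + h(a + 2, b - 1) + \<dots> + h(a + b + 1, 0)\<close>
  on coefficients.
\<close>

lemma swap_difference_divisible:
  fixes f :: "base mfps"
  assumes "f \<in> ser_on S" "k \<in> S" "Suc k \<in> S"
  shows "\<exists>g\<in>ser_on S. swap_subst k f - f = (mvar k - mvar (Suc k)) * g"
proof
  define h where "h m = mcoeff (swap_subst k f - f) m" for m
  define F where "F m = filter_mset (\<lambda>i. i \<noteq> Suc k) m" for m :: "nat multiset"
  define g where "g = Abs_mfps (\<lambda>m. \<Sum>i\<le>count m (Suc k).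
    h (F m + replicate_mset (Suc i) k + replicate_mset (count m (Suc k) - i) (Suc k)))"
  have g: "mcoeff g m = (\<Sum>i\<le>count m (Suc k).
    h (F m + replicate_mset (Suc i) k + replicate_mset (count m (Suc k) - i) (Suc k)))" for m
    by (simp add: g_def Abs_mfps_inverse)
  have S: "tr k i \<in> S \<longleftrightarrow> i \<in> S" for i using assms(2,3) by (auto simp: Transposition.transpose_def)
  have h0: "set_mset m \<subseteq> S" if "h m \<noteq> 0" for m
  proof -
    from that have "mcoeff f m \<noteq> 0 \<or> mcoeff f (image_mset (tr k) m) \<noteq> 0"
      by (auto simp: h_def mcoeff_swap_subst)
    then have "set_mset m \<subseteq> S \<or> set_mset (image_mset (tr k) m) \<subseteq> S"
      using assms(1) unfolding ser_on_def by blast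
    then show ?thesis using S by auto
  qed
  have anti: "h (image_mset (tr k) m) = - h m" for m
    by (simp add: h_def mcoeff_swap_subst image_mset.compositionality comp_def)
  show "g \<in> ser_on S"
    unfolding ser_on_def mem_Collect_eq
  proof (intro allI impI)
    fix m assume "mcoeff g m \<noteq> 0"
    then obtain i where "h (F m + replicate_mset (Suc i) k + replicate_mset (count m (Suc k) - i) (Suc k)) \<noteq> 0"
      unfolding g by (meson sum.not_neutral_contains_not_neutral)
    from h0[OF this] have "set_mset (F m) \<subseteq> S" by auto
    then show "set_mset m \<subseteq> S" using assms(3) by (auto simp: F_def)
  qed
  show "swap_subst k f - f = (mvar k - mvar (Suc k)) * g"
  proof (rule mfps_eqI)
    fix m
    define b where "b = count m (Suc k)"
    define H where "H j = h (F m + replicate_mset j k + replicate_mset (b - j) (Suc k))" for j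
    have m: "F m + replicate_mset b (Suc k) = m"
      unfolding F_def b_def by (rule multiset_eqI) auto
    then have H0: "H 0 = h m" by (simp add: H_def)
    have g1: "mcoeff g (m - {#k#}) = (\<Sum>j\<le>b. H j)" if "k \<in># m"
    proof -
      have "F (m - {#k#}) + {#k#} = F m" using that unfolding F_def by (intro multiset_eqI) auto
      moreover have "F (m - {#k#}) + replicate_mset (Suc i) k = (F (m - {#k#}) + {#k#}) + replicate_mset i k" for i
        by simp
      ultimately have "F (m - {#k#}) + replicate_mset (Suc i) k = F m + replicate_mset i k" for i
        by (simp only:)
      moreover have "count (m - {#k#}) (Suc k) = count m (Suc k)" by simp
      ultimately show ?thesis unfolding g H_def b_def by (simp only:)
    qed
    have g2: "mcoeff g (m - {#Suc k#}) = (\<Sum>j<b. H (Suc j))" if km: "Suc k \<in># m"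
    proof -
      have "F (m - {#Suc k#}) = F m" using km unfolding F_def by (intro multiset_eqI) auto
      moreover obtain c where c: "b = Suc c" using km unfolding b_def
        by (cases "count m (Suc k)") (auto simp: count_eq_zero_iff)
      ultimately show ?thesis by (simp add: g H_def b_def[symmetric] lessThan_Suc_atMost)
    qed
    have split: "(\<Sum>j\<le>b. H j) = H 0 + (\<Sum>j<b. H (Suc j))"
      by (simp add: sum.atMost_shift)
    have b0: "b = 0" if "Suc k \<notin># m" using that by (simp add: b_def not_in_iff)
    have "mcoeff ((mvar k - mvar (Suc k)) * g) m =
      (if k \<in># m then \<Sum>j\<le>b. H j else 0) - (\<Sum>j<b. H (Suc j))"
      using g1 g2 b0 by (cases "Suc k \<in># m") (auto simp: left_diff_distrib mcoeff_mvar_mult)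
    also have "\<dots> = h m"
    proof (cases "k \<in># m")
      \<comment> \<open>Without \<open>t_k\<close> in \<open>m\<close> the sum over all
        \<open>j\<close> has to vanish by itself: antisymmetry gives \<open>j\<close> and
        \<open>b - j\<close> opposite values, and 2 is invertible.\<close>
      case False
      have tF: "image_mset (tr k) (F m) = F m"
      proof -
        have "image_mset (tr k) (F m) = image_mset id (F m)"
          by (rule image_mset_cong) (use False in \<open>auto simp: F_def Transposition.transpose_def\<close>)
        then show ?thesis by simp
      qed
      have "H (b - j) = - H j" if "j \<le> b" for j
      proof -
        have e: "H (b - j) = h (image_mset (tr k) (F m + replicate_mset j k + replicate_mset (b - j) (Suc k)))"
          using that by (simp add: H_def tF add_ac)
        show ?thesis by (rule trans[OF e]) (simp only: anti H_def)
      qed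
      then have "(\<Sum>j\<le>b. H j) = - (\<Sum>j\<le>b. H (b - j))" by (simp add: sum_negf)
      also have "(\<Sum>j\<le>b. H (b - j)) = (\<Sum>j\<le>b. H j)"
        by (rule sum.reindex_bij_witness[where i = "\<lambda>j. b - j" and j = "\<lambda>j. b - j"]) auto
      finally have "2 * (\<Sum>j\<le>b. H j) = 0" by (simp only: mult_2 eq_neg_iff_add_eq_0)
      then have "(\<Sum>j\<le>b. H j) = 0" using two_neq_0_base by simp
      then have "h m = - (\<Sum>j<b. H (Suc j))" using split H0 by (simp add: eq_neg_iff_add_eq_0)
      then show ?thesis using False by simp
    qed (use split H0 in simp)
    finally show "mcoeff (swap_subst k f - f) m = mcoeff ((mvar k - mvar (Suc k)) * g) m"
      by (simp add: h_def)
  qed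
qed

abbreviation tK :: "nat \<Rightarrow> K" where
  "tK p \<equiv> to_K (mvar p)"

lemma Oser_inverse_affine:
  assumes "p < l" "r < l" "c \<noteq> 0"
  shows "inverse (cK c + cK d * tK p + cK e * tK r) \<in> Oser l"
proof -
  have "cK c + cK d * tK p + cK e * tK r = to_K (mconst c + mconst d * mvar p + mconst e * mvar r)"
    by (simp only: to_K_hom)
  moreover have "mconst c + mconst d * mvar p + mconst e * mvar r \<in> ser_ring l"
    unfolding ser_ring_eq using assms by (intro ser_on_closed ser_on_mult) auto
  ultimately show ?thesis using assms(3) by (auto intro!: Oser_inverse simp: mcoeff_mult_empty)
qed

lemma tK_neq: "p \<noteq> r \<Longrightarrow> tK p - tK r \<noteq> 0"
proof -
  assume "p \<noteq> r"
  then have "mcoeff (mvar p - mvar r :: base mfps) {#p#} \<noteq> 0" by simp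
  then have "(mvar p - mvar r :: base mfps) \<noteq> 0" by force
  then show ?thesis by (simp only: to_K_hom(4)[symmetric] to_K_eq_0_iff) simp
qed

lemma xK_Tw: "xK Tw \<nu> p = tK p / (2 * cK (Xval Tw (\<nu> ! p)) + tK p)"
  by (simp add: xK.simps XK_eq)

lemma xK_Prime: "xK Prime \<nu> p = tK p / cK (Xval Prime (\<nu> ! p))"
  by (simp add: xK.simps XK_eq)

lemma two_cK: "2 * cK a = cK (2 * a)"
  by (simp only: mult_2 cK_hom)

lemma two_plus_t_nonzero: "a \<noteq> 0 \<Longrightarrow> 2 * cK a + tK p \<noteq> 0"
proof
  assume "a \<noteq> 0" "2 * cK a + tK p = 0"
  then have "mconst (2 * a) + mvar p = 0"
    by (simp only: two_cK to_K_hom(3)[symmetric] to_K_eq_0_iff)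
  then have "mcoeff (mconst (2 * a) + mvar p) {#p#} = 0" by simp
  then show False by simp
qed

lemma xK_Oser:
  assumes "p < l" shows "xK s \<nu> p \<in> Oser l"
proof (cases s)
  case Prime
  then show ?thesis
    using assms by (simp only: xK_Prime divide_inverse cK_hom(8)[symmetric]) (intro Oser_closed)
next
  case Tw
  have "inverse (2 * cK (Xval Tw (\<nu> ! p)) + tK p) \<in> Oser l"
    using Oser_inverse_affine[OF assms assms, of "2 * Xval Tw (\<nu> ! p)" 1 0] two_neq_0_base
    by (simp add: two_cK)
  then show ?thesis
    unfolding Tw xK_Tw divide_inverse using assms by (intro Oser_closed)
qed

lemma field_swap_quotient:
  fixes t u a :: "'a::field"
  assumes "a + t \<noteq> 0" "a + u \<noteq> 0" "a \<noteq> 0"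
  shows "inverse (t / (a + t) - u / (a + u)) = inverse a * (a + t) * (a + u) / (t - u)"
proof -
  have "t / (a + t) - u / (a + u) = a * (t - u) / ((a + t) * (a + u))"
    using assms by (simp add: diff_frac_eq) (simp add: algebra_simps)
  then show ?thesis using assms by (simp add: field_simps)
qed

context rc
begin

text \<open>For equal entries the difference of \<open>x_k\<close> and \<open>x_{k+1}\<close> is, in
  either case of \<open>s\<close>, a unit times \<open>t_k - t_{k+1}\<close>.\<close>

lemma inverse_x_diff:
  assumes "\<nu> ! k = \<nu> ! Suc k" "Suc k < l"
  obtains Y where "Y \<in> Oser l" "inverse (xK s \<nu> k - xK s \<nu> (Suc k)) = Y / (tK k - tK (Suc k))"
proof -
  let ?a = "Xval s (\<nu> ! k)"
  show thesis
  proof (cases s)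
    case Prime
    have "inverse (xK s \<nu> k - xK s \<nu> (Suc k)) = cK ?a / (tK k - tK (Suc k))"
      using assms(1) by (simp add: Prime xK_Prime diff_divide_distrib[symmetric])
    then show ?thesis using that Oser_closed(3) by blast
  next
    case Tw
    have nz: "?a \<noteq> 0" "2 * cK ?a \<noteq> 0" using two_neq_0_K by (simp_all add: cK_eq_0_iff)
    have "inverse (xK s \<nu> k - xK s \<nu> (Suc k)) =
        inverse (2 * cK ?a) * (2 * cK ?a + tK k) * (2 * cK ?a + tK (Suc k)) / (tK k - tK (Suc k))"
      unfolding Tw xK_Tw assms(1)[symmetric]
      by (rule field_swap_quotient) (use nz two_plus_t_nonzero Tw in auto)
    moreover have "inverse (2 * cK ?a) * (2 * cK ?a + tK k) * (2 * cK ?a + tK (Suc k)) \<in> Oser l"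
      using assms(2) unfolding two_cK cK_hom(8)[symmetric] by (intro Oser_closed) auto
    ultimately show ?thesis using that by blast
  qed
qed

text \<open>The denominator has constant term \<open>X(\<nu>_k) (1 - q^2)\<close>, which is not 0,
  and the equal centres cancel in the numerator.\<close>

lemma rr_equal_Oser:
  assumes "\<nu> ! k = \<nu> ! Suc k" "Suc k < l"
  shows "\<exists>D\<in>Oser l. rr \<nu> k (Suc k) = (tK k - tK (Suc k)) * D"
proof
  let ?a = "Xval s (\<nu> ! k)"
  have "XK s \<nu> (Suc k) - Q ^ 2 * XK s \<nu> k = cK (?a * (1 - qq ^ 2)) + cK 1 * tK (Suc k) + cK (- (qq ^ 2)) * tK k"
    using assms(1) by (simp add: XK_eq cK_hom algebra_simps)
  moreover have "?a * (1 - qq ^ 2) \<noteq> 0" using qq_square_neq_1 by simp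
  ultimately show "inverse (XK s \<nu> (Suc k) - Q ^ 2 * XK s \<nu> k) \<in> Oser l"
    using assms(2) Oser_inverse_affine[of "Suc k" l k "?a * (1 - qq ^ 2)" 1 "- (qq ^ 2)"] by simp
  show "rr \<nu> k (Suc k) = (tK k - tK (Suc k)) * inverse (XK s \<nu> (Suc k) - Q ^ 2 * XK s \<nu> k)"
    using assms(1) by (simp add: rr_def XK_eq divide_inverse)
qed

text \<open>The two kinds of coefficients of \<open>\<sigma>_k\<close> for equal entries, after
  \<open>Tp\<close> has been written as the exchange plus a multiple of \<open>N\<close>: each
  contains the factor \<open>t_k - t_{k+1}\<close> by which it is divided.\<close>

lemma Oser_cases_S0_equal:
  assumes "\<nu> ! k = \<nu> ! Suc k" "Suc k < l"
  shows "inverse (xK s \<nu> k - xK s \<nu> (Suc k)) * rr \<nu> k (Suc k) \<in> Oser l"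
    and "f \<in> Oser l \<Longrightarrow> inverse (xK s \<nu> k - xK s \<nu> (Suc k)) * (swapK k f - f) \<in> Oser l"
proof -
  obtain Y where Y: "Y \<in> Oser l" "inverse (xK s \<nu> k - xK s \<nu> (Suc k)) = Y / (tK k - tK (Suc k))"
    using inverse_x_diff[OF assms] .
  have nz: "tK k - tK (Suc k) \<noteq> 0" by (rule tK_neq) simp
  obtain D where D: "D \<in> Oser l" "rr \<nu> k (Suc k) = (tK k - tK (Suc k)) * D"
    using rr_equal_Oser[OF assms] by blast
  have "inverse (xK s \<nu> k - xK s \<nu> (Suc k)) * rr \<nu> k (Suc k) = Y * D"
    unfolding Y(2) D(2) using nz by simp
  then show "inverse (xK s \<nu> k - xK s \<nu> (Suc k)) * rr \<nu> k (Suc k) \<in> Oser l"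
    using Oser_closed(7)[OF Y(1) D(1)] by simp
  assume "f \<in> Oser l"
  then obtain f' where f': "f = to_K f'" "f' \<in> ser_on {..<l}" by (auto simp: Oser_def ser_ring_eq)
  obtain g where g: "g \<in> ser_on {..<l}" "swap_subst k f' - f' = (mvar k - mvar (Suc k)) * g"
    using swap_difference_divisible[OF f'(2), of k] assms(2) by auto
  have "swapK k f - f = (tK k - tK (Suc k)) * to_K g"
    unfolding f'(1) swapK_to_K to_K_hom(4)[symmetric] g(2) to_K_hom(6)[symmetric] ..
  then have "inverse (xK s \<nu> k - xK s \<nu> (Suc k)) * (swapK k f - f) = Y * to_K g"
    unfolding Y(2) using nz by simp
  moreover have "to_K g \<in> Oser l" using g(1) by (simp add: Oser_def ser_ring_eq)
  ultimately show "inverse (xK s \<nu> k - xK s \<nu> (Suc k)) * (swapK k f - f) \<in> Oser l"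
    using Oser_closed(7)[OF Y(1)] by simp
qed

lemma Qp_Oser: "u \<in> Oser n \<Longrightarrow> v \<in> Oser n \<Longrightarrow> Qp i j u v \<in> Oser n"
  by (auto simp: Qp_def cart_def intro!: Oser_closed)

lemma Pp_Oser: "u \<in> Oser n \<Longrightarrow> v \<in> Oser n \<Longrightarrow> Pp i j u v \<in> Oser n"
  by (auto simp: Pp_def intro!: Qp_Oser Oser_closed)

lemma Xval_even: "\<not> snd j \<Longrightarrow> Xval s j = qq powi (- 2 * fst j)"
  by (cases s) (auto simp: Xval.simps)

text \<open>The only possible pole of the R-matrix is cancelled by the factor \<open>x\<^sub>k - x\<^sub>k\<^sub>+\<^sub>1\<close> of \<open>\<P>\<^sub>i\<^sub>j\<close>.\<close>

lemma rr_Pp_Oser: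
  assumes "\<not> snd (\<mu> ! k)" "\<not> snd (\<mu> ! Suc k)" "Suc k < l"
  shows "rr \<mu> k (Suc k) * Pp (fst (\<mu> ! Suc k)) (fst (\<mu> ! k)) (xK s \<mu> (Suc k)) (xK s \<mu> k) \<in> Oser l"
proof -
  let ?b = "Xval s (\<mu> ! k)" and ?b' = "Xval s (\<mu> ! Suc k)"
  let ?P = "Pp (fst (\<mu> ! Suc k)) (fst (\<mu> ! k)) (xK s \<mu> (Suc k)) (xK s \<mu> k)"
  define c where "c = ?b' - qq ^ 2 * ?b"
  have kl: "k < l" "Suc k < l" using assms by auto
  have den: "XK s \<mu> (Suc k) - Q ^ 2 * XK s \<mu> k = cK c + cK 1 * tK (Suc k) + cK (- (qq ^ 2)) * tK k"
    by (simp add: XK_eq cK_hom c_def algebra_simps)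
  have num: "XK s \<mu> k - XK s \<mu> (Suc k) \<in> Oser l"
    unfolding XK_eq by (intro Oser_closed kl)
  have P: "?P \<in> Oser l" by (intro Pp_Oser xK_Oser kl)
  show ?thesis
  proof (cases "c = 0")
    case False
    have "inverse (XK s \<mu> (Suc k) - Q ^ 2 * XK s \<mu> k) \<in> Oser l"
      unfolding den by (rule Oser_inverse_affine[OF kl(2,1) False])
    then show ?thesis unfolding rr_def divide_inverse by (intro Oser_closed num P)
  next
    \<comment> \<open>The constant term of the denominator vanishes, which forces the residues to be
      neighbours with the larger one at \<open>k\<close>; then \<open>P_ij\<close> is
      \<open>x_k - x_{k+1}\<close>.\<close>
    case True
    have b: "?b = qq powi (- 2 * fst (\<mu> ! k))" "?b' = qq powi (- 2 * fst (\<mu> ! Suc k))"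
      using assms by (simp_all add: Xval_even)
    have b': "?b' = qq ^ 2 * ?b" using True by (simp add: c_def)
    also have "\<dots> = qq powi (2 - 2 * fst (\<mu> ! k))"
      unfolding b(1) by (simp add: power_int_diff power_int_minus divide_inverse)
    finally have "fst (\<mu> ! k) = fst (\<mu> ! Suc k) + 1" unfolding b(2) qq_powi_eq_iff by linarith
    then have P': "?P = xK s \<mu> k - xK s \<mu> (Suc k)" by (simp add: Pp_def Qp_def cart_def)
    define D where "D = tK (Suc k) - Q ^ 2 * tK k"
    have den': "XK s \<mu> (Suc k) - Q ^ 2 * XK s \<mu> k = D"
      unfolding den True by (simp add: D_def cK_hom)
    have Dnz: "D \<noteq> 0" using den_nonzero[of "Suc k" k \<mu>] den' by simp
    have "\<exists>Z\<in>Oser l. xK s \<mu> k - xK s \<mu> (Suc k) = D * Z"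
    proof (cases s)
      case Prime
      have "xK s \<mu> k - xK s \<mu> (Suc k) = D * cK (- inverse ?b')"
        unfolding Prime xK_Prime b'[unfolded Prime] D_def cK_hom
        using Prime by (simp add: field_simps cK_eq_0_iff)
      then show ?thesis using Oser_closed(3) by blast
    next
      case Tw
      have nz: "2 * cK ?b + tK k \<noteq> 0" "2 * cK ?b' + tK (Suc k) \<noteq> 0" by (simp_all add: two_plus_t_nonzero)
      have "xK s \<mu> k - xK s \<mu> (Suc k) =
        (tK k * (2 * cK ?b' + tK (Suc k)) - tK (Suc k) * (2 * cK ?b + tK k)) /
          ((2 * cK ?b + tK k) * (2 * cK ?b' + tK (Suc k)))"
        unfolding Tw xK_Tw using nz[unfolded Tw] by (rule diff_frac_eq)
      \<comment> \<open>The quadratic terms cancel, and by \<open>?b' = q^2 ?b\<close> the numerator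
        is a multiple of the linear form \<open>D\<close> of the pole.\<close>
      also have "tK k * (2 * cK ?b' + tK (Suc k)) - tK (Suc k) * (2 * cK ?b + tK k) = D * (- (2 * cK ?b))"
        unfolding b' D_def by (simp add: cK_hom algebra_simps)
      finally have "xK s \<mu> k - xK s \<mu> (Suc k) = D * (- (2 * cK ?b) *
          inverse (2 * cK ?b + tK k) * inverse (2 * cK ?b' + tK (Suc k)))"
        by (simp add: divide_inverse)
      moreover have "- (2 * cK ?b) * inverse (2 * cK ?b + tK k) * inverse (2 * cK ?b' + tK (Suc k)) \<in> Oser l"
      proof -
        have "inverse (2 * cK ?b + tK k) \<in> Oser l"
          using Oser_inverse_affine[OF kl(1) kl(1), of "2 * ?b" 1 0] two_neq_0_base by (simp add: two_cK)
        moreover have "inverse (2 * cK ?b' + tK (Suc k)) \<in> Oser l"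
          using Oser_inverse_affine[OF kl(2) kl(2), of "2 * ?b'" 1 0] two_neq_0_base by (simp add: two_cK)
        ultimately show ?thesis unfolding two_cK by (intro Oser_closed)
      qed
      ultimately show ?thesis by blast
    qed
    then obtain Z where Z: "Z \<in> Oser l" "xK s \<mu> k - xK s \<mu> (Suc k) = D * Z" by blast
    have "rr \<mu> k (Suc k) * ?P = (XK s \<mu> k - XK s \<mu> (Suc k)) * Z"
      unfolding rr_def P' Z(2) den' using Dnz by simp
    then show ?thesis using Oser_closed(7)[OF num Z(1)] by simp
  qed
qed

end

section \<open>Parities, and stability of the vectors with coefficients in a subring\<close>

definition wpr :: "nat \<Rightarrow> nat list \<Rightarrow> bit" where
  "wpr M w = of_nat (\<Sum>i\<leftarrow>w. eps M i)"

definition shift :: "nat \<Rightarrow> bit set \<Rightarrow> bit set" where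
  "shift n D = (\<lambda>d. d + of_nat n) ` D"

lemma shift_shift: "shift n (shift n D) = D"
proof -
  have "d + of_nat n + of_nat n = d" for d :: bit
    by (simp only: add.assoc) (cases "of_nat n :: bit"; simp)
  then show ?thesis by (simp add: shift_def image_image)
qed

lemma shift_Suc: "shift n (shift (Suc 0) D) = shift (Suc n) D"
  unfolding shift_def image_image of_nat_Suc by (simp only: ac_simps of_nat_0 add_0_right)

lemma shift_0: "shift 0 D = D"
  by (simp only: shift_def of_nat_0 add_0_right image_ident)

text \<open>The closure properties of a coefficient ring \<open>R\<close> which make the vectors
  over \<open>R\<close> stable. The fraction field and the power series ring both have them, so one
  argument gives both modules. \<open>R_rr_Pp\<close>, \<open>R_equal\<close> and
  \<open>R_equal'\<close> isolate the coefficients with apparent poles.\<close>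

locale rc_ring = rc +
  fixes R :: "K set"
  assumes R_0: "0 \<in> R" and R_cK: "cK c \<in> R" and R_add: "x \<in> R \<Longrightarrow> y \<in> R \<Longrightarrow> x + y \<in> R"
    and R_mult: "x \<in> R \<Longrightarrow> y \<in> R \<Longrightarrow> x * y \<in> R"
    and R_theta: "\<nu> \<in> Jseq \<beta> \<Longrightarrow> p < l \<Longrightarrow> x \<in> R \<Longrightarrow> theta s \<nu> p x \<in> R"
    and R_swapK: "Suc k < l \<Longrightarrow> x \<in> R \<Longrightarrow> swapK k x \<in> R"
    and R_xK: "p < l \<Longrightarrow> xK s \<nu> p \<in> R"
    and R_Pp: "x \<in> R \<Longrightarrow> y \<in> R \<Longrightarrow> Pp i j x y \<in> R"
    and R_rr_Pp: "\<not> snd (\<nu> ! k) \<Longrightarrow> \<not> snd (\<nu> ! Suc k) \<Longrightarrow> Suc k < l \<Longrightarrow>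
      rr \<nu> k (Suc k) * Pp (fst (\<nu> ! Suc k)) (fst (\<nu> ! k)) (xK s \<nu> (Suc k)) (xK s \<nu> k) \<in> R"
    and R_equal: "\<nu> ! k = \<nu> ! Suc k \<Longrightarrow> Suc k < l \<Longrightarrow> inverse (xK s \<nu> k - xK s \<nu> (Suc k)) * rr \<nu> k (Suc k) \<in> R"
    and R_equal': "\<nu> ! k = \<nu> ! Suc k \<Longrightarrow> Suc k < l \<Longrightarrow> x \<in> R \<Longrightarrow>
      inverse (xK s \<nu> k - xK s \<nu> (Suc k)) * (swapK k x - x) \<in> R"
begin

definition WR :: "bit set \<Rightarrow> VT set" where
  "WR D = {m \<in> VA. (\<forall>b. Poly_Mapping.lookup m b \<in> R) \<and> (\<forall>(\<nu>, w)\<in>Poly_Mapping.keys m. wpr M w \<in> D)}"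

lemma WR_VA: "m \<in> WR D \<Longrightarrow> m \<in> VA"
  by (simp add: WR_def)

lemma WR_closed:
  "0 \<in> WR D" "m \<in> WR D \<Longrightarrow> m' \<in> WR D \<Longrightarrow> m + m' \<in> WR D" "c \<in> R \<Longrightarrow> m \<in> WR D \<Longrightarrow> kscale c m \<in> WR D"
  "m \<in> WR D \<Longrightarrow> vscale d m \<in> WR D"
  "\<nu> \<in> Jseq \<beta> \<Longrightarrow> w \<in> wds \<Longrightarrow> f \<in> R \<Longrightarrow> wpr M w \<in> D \<Longrightarrow> Poly_Mapping.single (\<nu>, w) f \<in> WR D"
proof -
  show "m \<in> WR D \<Longrightarrow> m' \<in> WR D \<Longrightarrow> m + m' \<in> WR D"
    using Poly_Mapping.keys_add[of m m'] unfolding WR_def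
    by (auto simp: supp_closed lookup_add R_add)
  show k: "c \<in> R \<Longrightarrow> m \<in> WR D \<Longrightarrow> kscale c m \<in> WR D" for c
    unfolding WR_def by (auto simp: supp_closed R_mult in_keys_iff)
  show "m \<in> WR D \<Longrightarrow> vscale d m \<in> WR D" unfolding vscale_def by (intro k R_cK)
qed (auto simp: WR_def supp_closed lookup_single when_def R_0 split: if_splits)

lemma WR_sum: "(\<And>i. i \<in> A \<Longrightarrow> f i \<in> WR D) \<Longrightarrow> sum f A \<in> WR D"
  by (induction A rule: infinite_finite_induct) (auto intro: WR_closed)

lemma WR_lin_ext:
  assumes "m \<in> WR D" "\<And>\<nu> w. (\<nu>, w) \<in> Poly_Mapping.keys m \<Longrightarrow> h (Poly_Mapping.lookup m (\<nu>, w)) (\<nu>, w) \<in> WR D'"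
  shows "lin_ext h m \<in> WR D'"
  unfolding lin_ext_def by (rule WR_sum) (use assms in auto)

lemma WR_keys:
  assumes "m \<in> WR D" "(\<nu>, w) \<in> Poly_Mapping.keys m"
  shows "\<nu> \<in> Jseq \<beta>" "w \<in> wds" "wpr M w \<in> D" "Poly_Mapping.lookup m (\<nu>, w) \<in> R"
  using assms by (auto simp: WR_def supp_def)

lemma wpr_update:
  assumes "w \<in> wds" "p < l" "pm (w ! p) j \<noteq> 0"
  shows "wpr M (w[p := j]) = wpr M w + 1"
proof -
  have w: "p < length w" using assms(1,2) by (simp add: words_length)
  have e: "eps M j \<noteq> eps M (w ! p)" "eps M j \<le> 1" "eps M (w ! p) \<le> 1"
    using pm_odd[OF words_nth[OF assms(1,2)] assms(3)] by (auto simp: eps_def)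
  then have "eps M j = 0 \<and> eps M (w ! p) = 1 \<or> eps M j = 1 \<and> eps M (w ! p) = 0" by linarith
  then have j: "(of_nat (eps M j) :: bit) = of_nat (eps M (w ! p)) + 1" by auto
  have "wpr M (w[p := j]) = wpr M (take p w) + (of_nat (eps M j) + wpr M (drop (Suc p) w))"
    unfolding wpr_def upd_conv_take_nth_drop[OF w] by (simp only: map_append sum_list_append list.map sum_list.Cons of_nat_add)
  also have "\<dots> = (wpr M (take p w) + (of_nat (eps M (w ! p)) + wpr M (drop (Suc p) w))) + 1"
    unfolding j by (simp only: ac_simps)
  also have "wpr M (take p w) + (of_nat (eps M (w ! p)) + wpr M (drop (Suc p) w)) = wpr M w"
    unfolding wpr_def by (subst (4) id_take_nth_drop[OF w])
      (simp only: map_append sum_list_append list.map sum_list.Cons of_nat_add)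
  finally show ?thesis .
qed

lemma C_WR:
  assumes "m \<in> WR D" "p < l" shows "C p m \<in> WR (shift 1 D)"
  unfolding c_op_def
proof (rule WR_lin_ext[OF assms(1)])
  fix \<nu> w assume b: "(\<nu>, w) \<in> Poly_Mapping.keys m"
  note k = WR_keys[OF assms(1) b]
  show "c_op1 M P s p (Poly_Mapping.lookup m (\<nu>, w)) (\<nu>, w) \<in> WR (shift 1 D)"
    unfolding c_op1_eq[OF k(2) assms(2)]
  proof (rule WR_sum)
    fix j assume j: "j \<in> nn"
    show "Poly_Mapping.single (flip p \<nu>, w[p := j])
        (cK (sg p w * iu * pm (w ! p) j) * theta s \<nu> p (Poly_Mapping.lookup m (\<nu>, w))) \<in> WR (shift 1 D)"
    proof (cases "pm (w ! p) j = 0")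
      case False
      then have "wpr M (w[p := j]) \<in> shift 1 D"
        using wpr_update[OF k(2) assms(2) False] k(3) by (simp add: shift_def)
      then show ?thesis
        using k j assms(2) by (intro WR_closed R_mult R_cK R_theta flip_Jseq words_update)
    qed (simp add: WR_closed)
  qed
qed

lemma fold_C_WR:
  assumes "set js \<subseteq> {..<l}" "m \<in> WR D" shows "fold C js m \<in> WR (shift (length js) D)"
  using assms
proof (induction js arbitrary: m D)
  case (Cons j js)
  have "fold C js (C j m) \<in> WR (shift (length js) (shift 1 D))"
    using Cons.prems by (intro Cons.IH C_WR) auto
  then show ?case by (simp add: shift_Suc)
qed (simp add: shift_0)

lemma X0_WR:
  assumes "m \<in> WR D" "p < l" shows "X0 p m \<in> WR D"
proof (rule WR_lin_ext[OF assms(1)])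
  fix \<nu> w assume b: "(\<nu>, w) \<in> Poly_Mapping.keys m"
  note k = WR_keys[OF assms(1) b]
  show "x_op0 s p (Poly_Mapping.lookup m (\<nu>, w)) (\<nu>, w) \<in> WR D"
    unfolding x_op0_def prod.case using k assms(2) by (intro WR_closed R_mult R_xK)
qed

lemma wpr_sw:
  assumes "Suc k < length w" shows "wpr M (sw k w) = wpr M w"
proof -
  have "mset (sw k w) = mset w"
    unfolding sw_def using assms by (subst list_update_swap) (simp, rule mset_swap, simp_all)
  then have "mset (map (eps M) (sw k w)) = mset (map (eps M) w)" by simp
  then have "(\<Sum>i\<leftarrow>sw k w. eps M i) = (\<Sum>i\<leftarrow>w. eps M i)" by (metis sum_mset_sum_list)
  then show ?thesis by (simp add: wpr_def)
qed

lemma R_Q: "1 \<in> R" "Q \<in> R" "Q ^ 2 \<in> R" "1 + Q ^ 2 \<in> R"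
  using R_cK[of 1] R_cK[of qq] R_cK[of "qq ^ 2"] R_cK[of "1 + qq ^ 2"] by (simp_all add: cK_hom)

lemma kscale_N1_WR:
  assumes "\<nu> \<in> Jseq \<beta>" "w \<in> wds" "wpr M w \<in> D" "Suc k < l" "c * f \<in> R"
  shows "kscale c (N1 k f (\<nu>, w)) \<in> WR D"
proof -
  have "Suc k < length w" using assms by (simp add: words_length)
  then have "N1 k (c * f) (\<nu>, w) \<in> WR D"
    unfolding N1_def prod.case using assms by (auto intro!: WR_closed R_mult R_Q sw_wds simp: wpr_sw)
  then show ?thesis by (simp add: N1_kscale)
qed

text \<open>Stated on even summands, where the base points are the powers of \<open>q\<close>
  determined by the residues, as \<open>R_rr_Pp\<close> demands; the general summand is conjugated
  into this situation.\<close>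

lemma S0_WR:
  assumes m: "m \<in> WR D" "m \<in> VS \<nu>" and \<nu>: "\<nu> \<in> Jseq \<beta>" "odd_places \<nu> = []" and k: "Suc k < l"
  shows "S0 k m \<in> WR D"
proof (rule WR_lin_ext[OF m(1)])
  fix \<nu>' w assume b: "(\<nu>', w) \<in> Poly_Mapping.keys m"
  have \<nu>': "\<nu>' = \<nu>" using m(2) b by (auto simp: VS_def supp_def)
  note kk = WR_keys[OF m(1) b, unfolded \<nu>']
  define f where "f = Poly_Mapping.lookup m (\<nu>, w)"
  have f: "f \<in> R" using kk by (simp add: f_def)
  have len: "length \<nu> = l" "k < l" "Suc k < l" using \<nu> k length_Jseq by auto
  let ?\<mu> = "swp k \<nu>"
  have \<mu>: "?\<mu> \<in> Jseq \<beta>" by (rule swp_Jseq[OF \<nu>(1) k])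
  have "S0f \<nu> k (Poly_Mapping.single (\<nu>, w) f) \<in> WR D"
  proof (cases "\<nu> ! k = \<nu> ! Suc k")
    case True
    let ?y = "inverse (xK s \<nu> k - xK s \<nu> (Suc k))"
    have "S0f \<nu> k (Poly_Mapping.single (\<nu>, w) f) = Poly_Mapping.single (\<nu>, w) (?y * (swapK k f - f)) +
        kscale (?y * rr \<nu> k (Suc k)) (N1 k (swapK k f) (\<nu>, w))"
      using True by (simp add: S0f_def Tp_def swp_eq Sw_single Nop_single kscale_simps right_diff_distrib single_diff)
    also have "\<dots> \<in> WR D"
      using kk f k \<nu> True by (intro WR_closed kscale_N1_WR R_equal' R_mult R_equal R_swapK)
    finally show ?thesis .
  next
    case False
    let ?P = "Pp (fst (?\<mu> ! Suc k)) (fst (?\<mu> ! k)) (xK s ?\<mu> (Suc k)) (xK s ?\<mu> k)"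
    have nth: "?\<mu> ! Suc k = \<nu> ! k" "?\<mu> ! k = \<nu> ! Suc k" using len by (simp_all add: nth_swp)
    have "S0f \<nu> k (Poly_Mapping.single (\<nu>, w) f) = Poly_Mapping.single (?\<mu>, w) (?P * swapK k f) +
        kscale (rr ?\<mu> k (Suc k)) (N1 k (?P * swapK k f) (?\<mu>, w))"
      using False len by (simp add: S0f_def Tp_def Sw_single Nop_single kscale_simps nth swapK.mult Pp_swapK swapK_xK)
    also have "\<dots> \<in> WR D"
    proof (intro WR_closed(2))
      show "Poly_Mapping.single (?\<mu>, w) (?P * swapK k f) \<in> WR D"
        using kk f k \<mu> len by (intro WR_closed R_mult R_Pp R_xK R_swapK)
      have "rr ?\<mu> k (Suc k) * ?P \<in> R"
        using even_snd[OF \<nu>(2)] len by (intro R_rr_Pp) (simp_all add: nth)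
      then have "rr ?\<mu> k (Suc k) * (?P * swapK k f) \<in> R"
        unfolding mult.assoc[symmetric] by (rule R_mult) (intro R_swapK k f)
      then show "kscale (rr ?\<mu> k (Suc k)) (N1 k (?P * swapK k f) (?\<mu>, w)) \<in> WR D"
        using kk k \<mu> by (intro kscale_N1_WR)
    qed
    finally show ?thesis .
  qed
  then show "s_op0 M s k (Poly_Mapping.lookup m (\<nu>', w)) (\<nu>', w) \<in> WR D"
    unfolding \<nu>' using len kk(2) by (simp add: s_op0_eq f_def)
qed

lemma nth_fold_flip:
  assumes "distinct js" "r < length \<nu>"
  shows "fold flip js \<nu> ! r = (if r \<in> set js then flipJ (\<nu> ! r) else \<nu> ! r)"
  using assms by (induction js arbitrary: \<nu>) (auto simp: nth_flip)

lemma length_fold_flip [simp]: "length (fold flip js \<nu>) = length \<nu>"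
  by (induction js arbitrary: \<nu>) auto

lemma odd_places_fold_flip: "odd_places (fold flip (odd_places \<nu>) \<nu>) = []"
proof -
  have "distinct (odd_places \<nu>)" by (simp add: odd_places_def)
  then have "\<not> snd (fold flip (odd_places \<nu>) \<nu> ! r)" if "r < length \<nu>" for r
    using that by (simp add: nth_fold_flip) (simp add: odd_places_def flipJ_def)
  then show ?thesis by (simp add: odd_places_def[of "fold _ _ _"] filter_empty_conv)
qed

text \<open>Each \<open>c_j\<close> is applied twice, so the two parity shifts cancel; the same
  happens for \<open>\<sigma>_k\<close>, up to a relabelling of the places.\<close>

lemma Xo_WR:
  assumes "m \<in> WR D" "p < l" shows "Xo p m \<in> WR D"
proof (rule WR_lin_ext[OF assms(1)])
  fix \<nu> w assume b: "(\<nu>, w) \<in> Poly_Mapping.keys m"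
  note k = WR_keys[OF assms(1) b]
  let ?js = "odd_places \<nu>"
  have js: "set ?js \<subseteq> {..<l}" using set_odd_places length_Jseq k by blast
  have "fold C (rev ?js) (X0 p (fold C ?js (Poly_Mapping.single (\<nu>, w) (Poly_Mapping.lookup m (\<nu>, w))))) \<in>
      WR (shift (length (rev ?js)) (shift (length ?js) D))"
    using js k by (intro fold_C_WR X0_WR assms WR_closed) auto
  then show "x_op1 M P s p (Poly_Mapping.lookup m (\<nu>, w)) (\<nu>, w) \<in> WR D"
    unfolding x_op1_eq XF_def by (intro WR_closed) (simp add: shift_shift)
qed

lemma So_WR:
  assumes "m \<in> WR D" "Suc k < l" shows "So k m \<in> WR D"
proof (rule WR_lin_ext[OF assms(1)])
  fix \<nu> w assume b: "(\<nu>, w) \<in> Poly_Mapping.keys m"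
  note kk = WR_keys[OF assms(1) b]
  let ?js = "odd_places \<nu>"
  let ?m = "Poly_Mapping.single (\<nu>, w) (Poly_Mapping.lookup m (\<nu>, w))"
  have js: "set ?js \<subseteq> {..<l}" using set_odd_places length_Jseq kk by blast
  have f: "fold C ?js ?m \<in> WR (shift (length ?js) D)"
    using js kk by (intro fold_C_WR WR_closed)
  have VS: "fold C ?js ?m \<in> VS (fold flip ?js \<nu>)"
    using js kk by (intro fold_C_VS) (auto simp: VS_def supp_closed)
  have "S0 k (fold C ?js ?m) \<in> WR (shift (length ?js) D)"
    by (rule S0_WR[OF f VS fold_flip_Jseq[OF kk(1)] odd_places_fold_flip assms(2)])
  then have "fold C (map (tr k) (rev ?js)) (S0 k (fold C ?js ?m)) \<in>
      WR (shift (length (map (tr k) (rev ?js))) (shift (length ?js) D))"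
    using js map_tr_subset[OF assms(2), of "rev ?js"] by (intro fold_C_WR) auto
  then show "s_op1 M P s k (Poly_Mapping.lookup m (\<nu>, w)) (\<nu>, w) \<in> WR D"
    unfolding s_op1_eq SF_def by (simp add: shift_shift)
qed

end

section \<open>The two coefficient rings: the fraction field and the power series\<close>

lemma (in rc) rc_ring_ser_frac: "rc_ring M P s \<beta> (ser_frac l)"
proof (unfold_locales)
  have x: "xK s \<nu> p \<in> ser_frac l" if "p < l" for \<nu> p by (intro Oser_ser_frac xK_Oser that)
  have X: "XK s \<nu> p \<in> ser_frac l" if "p < l" for \<nu> p unfolding XK_eq by (intro ser_frac_closed that)
  have q: "Q ^ 2 \<in> ser_frac l" unfolding cK_hom(7)[symmetric] by (rule ser_frac_closed)
  have r: "rr \<nu> k (Suc k) \<in> ser_frac l" if "Suc k < l" for \<nu> k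
    unfolding rr_def using that by (intro ser_frac_closed X q) auto
  have P: "Pp i j x y \<in> ser_frac l" if "x \<in> ser_frac l" "y \<in> ser_frac l" for i j x y
    using that by (auto simp: Pp_def Qp_def cart_def intro!: ser_frac_closed)
  show "theta s \<nu> p x \<in> ser_frac l" if "\<nu> \<in> Jseq \<beta>" "p < l" "x \<in> ser_frac l" for \<nu> p x
    using that by (intro theta_ser_frac) (simp_all add: length_Jseq)
  show "rr \<nu> k (Suc k) * Pp (fst (\<nu> ! Suc k)) (fst (\<nu> ! k)) (xK s \<nu> (Suc k)) (xK s \<nu> k) \<in> ser_frac l"
    if "\<not> snd (\<nu> ! k)" "\<not> snd (\<nu> ! Suc k)" "Suc k < l" for \<nu> k
    using that by (intro ser_frac_closed r P x) auto
  show "inverse (xK s \<nu> k - xK s \<nu> (Suc k)) * rr \<nu> k (Suc k) \<in> ser_frac l"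
    "z \<in> ser_frac l \<Longrightarrow> inverse (xK s \<nu> k - xK s \<nu> (Suc k)) * (swapK k z - z) \<in> ser_frac l"
    if "\<nu> ! k = \<nu> ! Suc k" "Suc k < l" for \<nu> k z
    using that by (intro ser_frac_closed r x swapK_ser_frac; simp)+
  show "xK s \<nu> p \<in> ser_frac l" if "p < l" for \<nu> p by (rule x[OF that])
  show "Pp i j x y \<in> ser_frac l" if "x \<in> ser_frac l" "y \<in> ser_frac l" for i j x y by (rule P[OF that])
qed (auto intro: ser_frac_closed swapK_ser_frac)

lemma (in rc) rc_ring_Oser: "rc_ring M P s \<beta> (Oser l)"
proof (unfold_locales)
  show "theta s \<nu> p x \<in> Oser l" if "\<nu> \<in> Jseq \<beta>" "p < l" "x \<in> Oser l" for \<nu> p x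
    using that by (intro theta_Oser) (simp_all add: length_Jseq)
  show "rr \<nu> k (Suc k) * Pp (fst (\<nu> ! Suc k)) (fst (\<nu> ! k)) (xK s \<nu> (Suc k)) (xK s \<nu> k) \<in> Oser l"
    if "\<not> snd (\<nu> ! k)" "\<not> snd (\<nu> ! Suc k)" "Suc k < l" for \<nu> k
    using that by (rule rr_Pp_Oser)
  show "inverse (xK s \<nu> k - xK s \<nu> (Suc k)) * rr \<nu> k (Suc k) \<in> Oser l"
    "z \<in> Oser l \<Longrightarrow> inverse (xK s \<nu> k - xK s \<nu> (Suc k)) * (swapK k z - z) \<in> Oser l"
    if "\<nu> ! k = \<nu> ! Suc k" "Suc k < l" for \<nu> k z
    using that by (rule Oser_cases_S0_equal)+
qed (auto intro: Oser_closed swapK_Oser xK_Oser Pp_Oser)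

section \<open>The action of \<open>RC\<^sub>\<beta>\<close>\<close>

text \<open>The polynomials are at most linear, so the divided difference in the braid relation is a
  scalar, whatever the arguments.\<close>

lemma ddiff_Qt_poly_scal: "ddiff scal (Qt_poly i j) w u v = scal (ddJ i j)"
proof -
  have "fst i = fst j \<or> cart (fst i) (fst j) = -1 \<or> cart (fst i) (fst j) = 0"
    by (auto simp: cart_def)
  then show ?thesis
    by (auto simp: Qt_poly_def Qt_def Qp_def ddiff_def of_bool_def one_pCons ddJ_def ddc_def cart_def
        scal_hom algebra_simps split: if_splits)
qed

text \<open>The closure rules for homogeneous elements are proved inside the locale of
  presentations; taken with the empty set of relations they serve to show that the actual relations
  lie in the free algebra and are homogeneous.\<close>

lemma presentation_empty: "presentation G {}"
  by unfold_locales simp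

abbreviation RC_hom :: "(int \<Rightarrow>\<^sub>0 nat) \<Rightarrow> bit \<Rightarrow> rcgen fa set" where
  "RC_hom \<beta> \<equiv> presentation.hom (RC_gens \<beta>) RC_par"

lemmas RC_hom_closed = presentation.hom_closed[OF presentation_empty, where pr = RC_par and G = "RC_gens \<beta>" for \<beta>]
lemmas RC_hom_FA = presentation.hom_FA[OF presentation_empty, where pr = RC_par and G = "RC_gens \<beta>" for \<beta>]
lemmas RC_hom_sum = presentation.hom_sum[OF presentation_empty, where pr = RC_par and G = "RC_gens \<beta>" for \<beta>]
lemmas RC_hom_power = presentation.hom_power[OF presentation_empty, where pr = RC_par and G = "RC_gens \<beta>" for \<beta>]

lemma RC_gen_hom:
  "\<nu> \<in> Jseq \<beta> \<Longrightarrow> ge \<nu> \<in> RC_hom \<beta> 0" "p < ht \<beta> \<Longrightarrow> gx p \<in> RC_hom \<beta> 0"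
  "p < ht \<beta> \<Longrightarrow> gc p \<in> RC_hom \<beta> 1" "Suc a < ht \<beta> \<Longrightarrow> gs a \<in> RC_hom \<beta> 0"
  using RC_hom_closed(4)[of "GE \<nu>" \<beta>] RC_hom_closed(4)[of "GX p" \<beta>] RC_hom_closed(4)[of "GC p" \<beta>]
    RC_hom_closed(4)[of "GS a" \<beta>]
  by (auto simp: RC_gens_def)

lemma RC_hom_mult:
  "x \<in> RC_hom \<beta> 0 \<Longrightarrow> y \<in> RC_hom \<beta> 0 \<Longrightarrow> x * y \<in> RC_hom \<beta> 0"
  "x \<in> RC_hom \<beta> 0 \<Longrightarrow> y \<in> RC_hom \<beta> 1 \<Longrightarrow> x * y \<in> RC_hom \<beta> 1"
  "x \<in> RC_hom \<beta> 1 \<Longrightarrow> y \<in> RC_hom \<beta> 0 \<Longrightarrow> x * y \<in> RC_hom \<beta> 1"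
  "x \<in> RC_hom \<beta> 1 \<Longrightarrow> y \<in> RC_hom \<beta> 1 \<Longrightarrow> x * y \<in> RC_hom \<beta> 0"
  using RC_hom_closed(8)[where x = x and y = y and \<beta> = \<beta> and d = 0 and e = 0]
    RC_hom_closed(8)[where x = x and y = y and \<beta> = \<beta> and d = 0 and e = 1]
    RC_hom_closed(8)[where x = x and y = y and \<beta> = \<beta> and d = 1 and e = 0]
    RC_hom_closed(8)[where x = x and y = y and \<beta> = \<beta> and d = 1 and e = 1]
  by simp_all

lemma RC_hom_2: "2 \<in> RC_hom \<beta> 0"
  unfolding one_add_one[symmetric] by (intro RC_hom_closed)

lemmas RC_hom_intros = RC_hom_closed(1-3,5-7) RC_hom_2 RC_gen_hom RC_hom_mult

lemma Qt_hom: "x \<in> RC_hom \<beta> 0 \<Longrightarrow> y \<in> RC_hom \<beta> 0 \<Longrightarrow> Qt i j x y \<in> RC_hom \<beta> 0"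
  by (auto simp: Qt_def Qp_def intro!: RC_hom_power RC_hom_intros)

lemma RC_rels_hom:
  assumes "x \<in> RC_rels \<beta>" shows "\<exists>d. x \<in> RC_hom \<beta> d"
  using assms
proof cases
  case (e_e \<mu> \<nu>)
  then show ?thesis by (intro exI[of _ 0]) (auto intro!: RC_hom_intros(1-12))
next
  case e_sum
  then show ?thesis by (intro exI[of _ 0]) (auto intro!: RC_hom_intros(1-12) RC_hom_sum)
next
  case (x_e p \<nu>)
  then show ?thesis by (intro exI[of _ 0]) (auto intro!: RC_hom_intros(1-12))
next
  case (c_e p \<nu>)
  then have "gc p * ge \<nu> \<in> RC_hom \<beta> 1" "ge (flip p \<nu>) * gc p \<in> RC_hom \<beta> 1"
    by (auto intro: RC_hom_mult RC_gen_hom flip_Jseq)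
  then show ?thesis unfolding c_e by (intro exI[of _ 1] RC_hom_closed)
next
  case (x_x p r)
  then show ?thesis by (intro exI[of _ 0]) (auto intro!: RC_hom_intros(1-12))
next
  case (c_c p r)
  then have "gc p * gc r \<in> RC_hom \<beta> 0" "gc r * gc p \<in> RC_hom \<beta> 0" by (auto intro: RC_hom_mult RC_gen_hom)
  then show ?thesis unfolding c_c by (intro exI[of _ 0]) (auto intro!: RC_hom_intros(1-7))
next
  case (c_x p r)
  then have "gc p * gx r \<in> RC_hom \<beta> 1" "gx r * gc p \<in> RC_hom \<beta> 1" by (auto intro: RC_hom_mult RC_gen_hom)
  moreover have "(-1) ^ of_bool (p = r) * (gx r * gc p) = (if p = r then - (gx r * gc p) else gx r * gc p)" by simp
  ultimately show ?thesis unfolding c_x by (intro exI[of _ 1]) (auto intro!: RC_hom_intros(1-7))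
next
  case (s_e a \<nu>)
  then show ?thesis by (intro exI[of _ 0]) (auto intro!: RC_hom_intros(1-12) swp_Jseq)
next
  case (s_c a p)
  then have "gs a * gc p \<in> RC_hom \<beta> 1" "gc (tr a p) * gs a \<in> RC_hom \<beta> 1"
    using tr_less[of a "ht \<beta>" p] by (auto intro: RC_hom_mult RC_gen_hom)
  then show ?thesis unfolding s_c by (intro exI[of _ 1] RC_hom_closed)
next
  case (s_x a p)
  then show ?thesis by (intro exI[of _ 0]) (auto intro!: RC_hom_intros(1-12))
next
  case (s_x_right a \<nu>)
  then have "gc a * gc (Suc a) \<in> RC_hom \<beta> 0" by (intro RC_hom_mult(4) RC_gen_hom(3)) auto
  then have "gc a * gc (Suc a) * ge \<nu> \<in> RC_hom \<beta> 0" using s_x_right by (auto intro: RC_hom_mult(1) RC_gen_hom)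
  with s_x_right show ?thesis by (intro exI[of _ 0]) (auto intro!: RC_hom_intros(1-6,8,9,11) RC_hom_mult(1))
next
  case (s_x_left a \<nu>)
  then have "gc a * gc (Suc a) \<in> RC_hom \<beta> 0" by (intro RC_hom_mult(4) RC_gen_hom(3)) auto
  then have "gc a * gc (Suc a) * ge \<nu> \<in> RC_hom \<beta> 0" using s_x_left by (auto intro: RC_hom_mult(1) RC_gen_hom)
  with s_x_left show ?thesis by (intro exI[of _ 0]) (auto intro!: RC_hom_intros(1-6,8,9,11) RC_hom_mult(1))
next
  case (s_square a \<nu>)
  then show ?thesis by (intro exI[of _ 0]) (auto intro!: RC_hom_intros(1-6,8,9,11) RC_hom_mult(1) Qt_hom)
next
  case (s_commute a b)
  then show ?thesis by (intro exI[of _ 0]) (auto intro!: RC_hom_intros(1-6,8,9,11) RC_hom_mult(1))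
next
  case (s_braid a \<nu>)
  then have "gc a * gc (a + 2) \<in> RC_hom \<beta> 0" by (intro RC_hom_mult(4) RC_gen_hom(3)) auto
  with s_braid show ?thesis
    unfolding ddiff_Qt_poly_scal by (intro exI[of _ 0]) (auto intro!: RC_hom_intros(1-6,8,9,11) RC_hom_mult(1))
qed

lemma RC_super_presentation: "super_presentation (RC_gens \<beta>) (RC_rels \<beta>) RC_par"
proof (intro super_presentation.intro presentation.intro super_presentation_axioms.intro)
  show "RC_rels \<beta> \<subseteq> FA (RC_gens \<beta>)" using RC_rels_hom RC_hom_FA by blast
  show "\<exists>d. x \<in> RC_hom \<beta> d" if "x \<in> RC_rels \<beta>" for x using RC_rels_hom[OF that] .
qed

declare RC_op.simps(1) [simp del]

context rc
begin

abbreviation "Eo \<nu> \<equiv> RC_op M P s (GE \<nu>)"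

lemma Eo_add: "add_at (\<lambda>f (\<nu>, w). if \<nu> = \<mu> then Poly_Mapping.single (\<nu>, w) f else 0) b"
  by (auto simp: add_at_def single_add split: prod.splits)

lemma Eo_linop: "linop VA VA (Eo \<mu>)"
  unfolding RC_op.simps by (rule linop_lin_ext) (auto simp: Eo_add vscale_def kscale_simps intro!: supp_closed)

lemma Eo_VS_linop: "linop (VS \<nu>) (VS \<nu>) (Eo \<mu>)"
  unfolding RC_op.simps VS_def by (rule linop_lin_ext) (auto simp: Eo_add vscale_def kscale_simps intro!: supp_closed)

lemma Eo_eq:
  assumes "m \<in> VS \<nu>" shows "Eo \<mu> m = (if \<nu> = \<mu> then m else 0)"
  using assms
proof (induction rule: VS_induct)
  case zero
  show ?case using linop_0[OF Eo_VS_linop[unfolded VS_def]] by simp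
next
  case (single w f)
  show ?case unfolding RC_op.simps by (subst lin_ext_single[OF Eo_add]) simp
next
  case (add m m')
  have "Eo \<mu> (m + m') = Eo \<mu> m + Eo \<mu> m'"
    unfolding RC_op.simps
    using linop_add[OF linop_lin_ext[of UNIV "\<lambda>f (\<nu>, w). if \<nu> = \<mu> then Poly_Mapping.single (\<nu>, w) f else 0" UNIV]]
    by (auto simp: Eo_add UNIV_supp vscale_def kscale_simps)
  then show ?case using add by simp
qed

lemma RC_op_linop: "g \<in> RC_gens \<beta> \<Longrightarrow> linop VA VA (RC_op M P s g)"
  using Eo_linop Xo_linop So_linop C_linop by (auto simp: RC_gens_def)

lemma gen_module_RC:
  assumes "vs.subspace V" "V \<subseteq> VA" "\<And>g m. g \<in> RC_gens \<beta> \<Longrightarrow> m \<in> V \<Longrightarrow> RC_op M P s g m \<in> V"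
  shows "gen_module vscale (RC_gens \<beta>) (RC_rels \<beta>) RC_par V (RC_op M P s)"
proof (intro gen_module.intro vs.vector_space_axioms RC_super_presentation gen_module_axioms.intro assms)
  fix g m m' c assume "g \<in> RC_gens \<beta>" "m \<in> V"
  then show "RC_op M P s g (vscale c m) = vscale c (RC_op M P s g m)"
    using linop_scale[OF RC_op_linop] assms(2) by blast
  assume "m' \<in> V"
  then show "RC_op M P s g (m + m') = RC_op M P s g m + RC_op M P s g m'"
    using linop_add[OF RC_op_linop] assms(2) \<open>g \<in> RC_gens \<beta>\<close> \<open>m \<in> V\<close> by blast
qed

sublocale A: gen_module vscale "RC_gens \<beta>" "RC_rels \<beta>" RC_par VA "RC_op M P s"
  by (rule gen_module_RC[OF supp_subspace order_refl]) (rule linop_closed[OF RC_op_linop])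

lemma gen_FA:
  "\<nu> \<in> Jseq \<beta> \<Longrightarrow> ge \<nu> \<in> FA (RC_gens \<beta>)" "p < l \<Longrightarrow> gx p \<in> FA (RC_gens \<beta>)"
  "p < l \<Longrightarrow> gc p \<in> FA (RC_gens \<beta>)" "Suc a < l \<Longrightarrow> gs a \<in> FA (RC_gens \<beta>)"
  by (auto intro!: FA_closed simp: RC_gens_def)

lemma fr_2: "m \<in> VA \<Longrightarrow> A.fr 2 m = m + m"
  unfolding one_add_one[symmetric] by (simp only: A.fr_simps)

lemma fr_Qt:
  assumes "m \<in> VA" "Suc a < l"
  shows "A.fr (Qt i j (gx a) (gx (Suc a))) m = qact i j (Xo a m) (Xo (Suc a) m) m"
    and "Qt i j (gx a) (gx (Suc a)) \<in> FA (RC_gens \<beta>)"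
proof -
  have "fst i = fst j \<or> cart (fst i) (fst j) = -1 \<or> cart (fst i) (fst j) = 0"
    by (auto simp: cart_def)
  then show "A.fr (Qt i j (gx a) (gx (Suc a))) m = qact i j (Xo a m) (Xo (Suc a) m) m"
    using assms(1) by (cases "snd i"; cases "snd j") (auto simp: Qt_def Qp_def qact_def A.fr_simps)
  show "Qt i j (gx a) (gx (Suc a)) \<in> FA (RC_gens \<beta>)"
    using assms(2) by (intro RC_hom_FA[OF Qt_hom] RC_gen_hom) auto
qed

lemma qact_VS: "a \<in> VS \<nu> \<Longrightarrow> b \<in> VS \<nu> \<Longrightarrow> m \<in> VS \<nu> \<Longrightarrow> qact i j a b m \<in> VS \<nu>"
  by (auto simp: qact_def intro!: VS_closed)

lemma linop_Eo_arith:
  "m \<in> VA \<Longrightarrow> m' \<in> VA \<Longrightarrow> Eo \<mu> (m - m') = Eo \<mu> m - Eo \<mu> m'"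
  "m \<in> VA \<Longrightarrow> Eo \<mu> (- m) = - Eo \<mu> m" "m \<in> VA \<Longrightarrow> Eo \<mu> (vscale c m) = vscale c (Eo \<mu> m)"
  using linop_diff[OF Eo_linop] linop_uminus[OF Eo_linop] linop_scale[OF Eo_linop] by auto

lemma flip_eq_iff: "flip p \<mu> = \<nu> \<longleftrightarrow> \<mu> = flip p \<nu>"
  by (metis flip_flip)

lemma flip_flip_iff:
  assumes "a < length \<mu>" "b < length \<mu>" "a \<noteq> b"
  shows "flip b (flip a \<mu>) ! a = flipJ (\<mu> ! a)" "flip b (flip a \<mu>) ! b = flipJ (\<mu> ! b)"
    "c < length \<mu> \<Longrightarrow> c \<noteq> a \<Longrightarrow> c \<noteq> b \<Longrightarrow> flip b (flip a \<mu>) ! c = \<mu> ! c"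
  using assms by (auto simp: nth_flip)

lemma flipJ_neq: "flipJ j \<noteq> j" "j \<noteq> flipJ j"
  by (auto simp: flipJ_def prod_eq_iff)

text \<open>In a right action the factors of a product apply in reading order, so each relation
  becomes one of the operator identities above, combined with projections to summands.\<close>

lemma relation_VS:
  assumes "x \<in> RC_rels \<beta>" and \<mu>: "\<mu> \<in> Jseq \<beta>" and m: "m \<in> VS \<mu>"
  shows "A.fr x m = 0"
proof -
  have mA: "m \<in> VA" using VS_VA[OF \<mu>] m by blast
  have len: "length \<mu> = l" by (rule length_Jseq[OF \<mu>])
  note F = A.fr_simps A.fr_mult FA_closed gen_FA Xo_VA C_VA So_VA mA
  show ?thesis
    using assms(1)
  proof cases
    case (e_e \<nu>1 \<nu>2)
    then show ?thesis using m by (simp add: F Eo_eq) (auto simp: Eo_eq F linop_0[OF Eo_linop])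
  next
    case e_sum
    have "(\<Sum>\<nu>\<in>Jseq \<beta>. Eo \<nu> m) = (\<Sum>\<nu>\<in>Jseq \<beta>. if \<mu> = \<nu> then m else 0)"
      by (rule sum.cong) (use m in \<open>auto simp: Eo_eq\<close>)
    also have "\<dots> = m" using \<mu> finite_Jseq by simp
    finally show ?thesis unfolding e_sum by (simp add: F A.fr_sum)
  next
    case (x_e p \<nu>)
    then show ?thesis using m Xo_VS[OF \<mu> m, of p] by (auto simp: F Eo_eq Xo_arith)
  next
    case (c_e p \<nu>)
    then show ?thesis
      using m C_VS[OF \<mu> c_e(2) m] by (auto simp: F flip_Jseq Eo_eq flip_eq_iff C_arith)
  next
    case (x_x p r)
    then show ?thesis using Xo_Xo[OF \<mu> m] by (simp add: F)
  next
    case (c_c p r)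
    then show ?thesis using C_anticommute[OF mA, of p r] by (auto simp: F fr_2 C_C)
  next
    case (c_x p r)
    then show ?thesis using Xo_C[OF mA, of p r] by (auto simp: F Xo_arith C_arith)
  next
    case (s_e a \<nu>)
    then have "swp a \<mu> = \<nu> \<longleftrightarrow> \<mu> = swp a \<nu>" using len length_Jseq by (metis swp_swp)
    then show ?thesis
      using s_e m So_VS[OF \<mu> m s_e(2)] by (auto simp: F swp_Jseq Eo_eq So_arith)
  next
    case (s_c a p)
    then show ?thesis using So_C[OF mA s_c(2) tr_less[OF s_c(2,3)]] tr_less[OF s_c(2,3)] by (simp add: F)
  next
    case (s_x a p)
    then show ?thesis using So_Xo[OF \<mu> m, of a p] by (simp add: F)
  next
    case (s_x_right a \<nu>)
    have C: "C (Suc a) (C a m) \<in> VS (flip (Suc a) (flip a \<mu>))"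
      using s_x_right \<mu> m by (intro C_VS flip_Jseq) auto
    have E: "A.fr ((gs a * gx (Suc a) - gx a * gs a) * ge \<nu>) m = Eo \<nu> (Xo (Suc a) (So a m) - So a (Xo a m))"
      using s_x_right by (simp add: F)
    have R: "A.fr (gc a * gc (Suc a) * ge \<nu>) m = Eo \<nu> (C (Suc a) (C a m))"
      using s_x_right by (simp add: F)
    have CA: "C (Suc a) (C a m) \<in> VA" using s_x_right by (intro C_VA mA) auto
    \<comment> \<open>\<open>e(\<nu>)\<close> acts last, so the condition refers to the target
      summand. Flipping both places preserves whether the entries there are equal or exchanged by
      \<open>c\<close>, so it agrees with the one for \<open>\<mu>\<close>.\<close>
    show ?thesis
      unfolding s_x_right(1) A.fr_simps E So_x_right[OF \<mu> m s_x_right(2)]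
      using flip_flip_iff[of a \<mu> "Suc a"] s_x_right len m C CA mA
      by (auto simp: A.fr_simps R Eo_eq linop_Eo_arith linop_0[OF Eo_linop] flipJ_neq)
  next
    case (s_x_left a \<nu>)
    have C: "C (Suc a) (C a m) \<in> VS (flip (Suc a) (flip a \<mu>))"
      using s_x_left \<mu> m by (intro C_VS flip_Jseq) auto
    have E: "A.fr ((gx (Suc a) * gs a - gs a * gx a) * ge \<nu>) m = Eo \<nu> (So a (Xo (Suc a) m) - Xo a (So a m))"
      using s_x_left by (simp add: F)
    have R: "A.fr (gc a * gc (Suc a) * ge \<nu>) m = Eo \<nu> (C (Suc a) (C a m))"
      using s_x_left by (simp add: F)
    have CA: "C (Suc a) (C a m) \<in> VA" using s_x_left by (intro C_VA mA) auto
    show ?thesis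
      unfolding s_x_left(1) A.fr_simps E So_x_left[OF \<mu> m s_x_left(2)]
      using flip_flip_iff[of a \<mu> "Suc a"] s_x_left len m C CA mA
      by (auto simp: A.fr_simps R Eo_eq linop_Eo_arith linop_0[OF Eo_linop] flipJ_neq)
  next
    case (s_square a \<nu>)
    have q: "qact i j (Xo a m) (Xo (Suc a) m) m \<in> VS \<mu>" for i j
      by (intro qact_VS Xo_VS \<mu> m)
    then have qA: "qact i j (Xo a m) (Xo (Suc a) m) m \<in> VA" for i j using VS_VA[OF \<mu>] by blast
    show ?thesis
      unfolding s_square(1) using s_square(2,3) So_So[OF \<mu> m s_square(2)]
      by (auto simp: F fr_Qt[OF mA] Eo_eq[OF q] Eo_eq[OF m])
  next
    case (s_commute a b)
    then show ?thesis using So_commute[OF \<mu> m s_commute(2,3)] by (auto simp: F)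
  next
    case (s_braid a \<nu>)
    let ?a3 = "Suc (Suc a)"
    have al: "a < l" "Suc a < l" "?a3 < l" using s_braid by auto
    have C: "C ?a3 (C a m) \<in> VS (flip ?a3 (flip a \<mu>))"
      using al \<mu> m by (intro C_VS flip_Jseq)
    have CA: "C ?a3 (C a m) \<in> VA" by (intro C_VA mA al)
    have E: "A.fr ((gs (Suc a) * gs a * gs (Suc a) - gs a * gs (Suc a) * gs a) * ge \<nu>) m =
        Eo \<nu> (So (Suc a) (So a (So (Suc a) m)) - So a (So (Suc a) (So a m)))"
      using s_braid by (simp add: F)
    have R: "A.fr (scal c * (gc a * gc ?a3) * ge \<nu>) m = vscale c (Eo \<nu> (C ?a3 (C a m)))"
      "A.fr (scal c * ge \<nu>) m = vscale c (Eo \<nu> m)" for c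
      using s_braid al CA by (simp_all add: F supp_closed C_arith linop_Eo_arith)
    show ?thesis
      unfolding s_braid(1) A.fr_simps E So_braid[OF \<mu> m s_braid(2)] ddiff_Qt_poly_scal
      using flip_flip_iff[of a \<mu> ?a3] al s_braid(3) len m C CA mA
      by (auto simp: A.fr_simps R Eo_eq linop_Eo_arith linop_0[OF Eo_linop] flipJ_neq)
  qed
qed

lemma relation_VA:
  assumes "x \<in> RC_rels \<beta>" "m \<in> VA"
  shows "A.fr x m = 0"
proof -
  have x: "x \<in> FA (RC_gens \<beta>)" using assms(1) A.rels_carrier by blast
  show ?thesis
    using assms(2)
  proof (induction rule: supp_induct)
    case zero
    then show ?case using A.Rt.act_add_right[OF x supp_closed(1) supp_closed(1)] by (simp add: free_ract_eq)
  next
    case (single b f)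
    then show ?case using relation_VS[OF assms(1)] by (auto simp: VS_def supp_closed)
  next
    case (add m m')
    then show ?case using A.Rt.act_add_right[OF x add(1,2)] by (simp add: free_ract_eq)
  qed
qed

end

context rc_ring
begin

definition par_WR :: "bit \<Rightarrow> VT set" where
  "par_WR d = WR {d}"

lemma WR_subspace: "vs.subspace (WR D)"
  unfolding vs.subspace_def by (auto intro: WR_closed)

lemma WR_UNIV: "WR UNIV = {m \<in> VA. \<forall>b. Poly_Mapping.lookup m b \<in> R}"
  by (simp add: WR_def)

lemma superspace_WR: "superspace vscale (WR UNIV) par_WR"
proof (intro superspace.intro vs.vector_space_axioms superspace_axioms.intro)
  show "vs.subspace (WR UNIV)" "vs.subspace (par_WR d)" for d by (simp_all add: WR_subspace par_WR_def)
  show "WR UNIV = {v + w |v w. v \<in> par_WR 0 \<and> w \<in> par_WR 1}"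
  proof (intro equalityI subsetI)
    fix m assume m: "m \<in> WR UNIV"
    define part where "part d = Poly_Mapping.mapp (\<lambda>(\<nu>, w) c. c when wpr M w = d) m" for d
    have lk: "Poly_Mapping.lookup (part d) (\<nu>, w) = (Poly_Mapping.lookup m (\<nu>, w) when wpr M w = d)" for d \<nu> w
      by (auto simp: part_def lookup_mapp when_def in_keys_iff)
    have lk': "Poly_Mapping.lookup (part d) b = (Poly_Mapping.lookup m b when wpr M (snd b) = d)" for d b
      using lk[of d "fst b" "snd b"] by simp
    have "part d \<in> par_WR d" for d
      using m unfolding par_WR_def WR_def supp_iff
      by (auto simp: lk' when_def R_0 in_keys_iff split: if_splits)
    moreover have "m = part 0 + part 1"
      by (rule poly_mapping_eqI) (auto simp: lookup_add lk' when_def)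
    ultimately show "m \<in> {v + w |v w. v \<in> par_WR 0 \<and> w \<in> par_WR 1}" by blast
  next
    fix m assume "m \<in> {v + w |v w. v \<in> par_WR 0 \<and> w \<in> par_WR 1}"
    moreover have "par_WR d \<subseteq> WR UNIV" for d by (auto simp: par_WR_def WR_def)
    ultimately show "m \<in> WR UNIV" using WR_closed(2)[of _ UNIV] by blast
  qed
  show "par_WR 0 \<inter> par_WR 1 = {0}"
  proof (intro equalityI subsetI)
    fix m assume "m \<in> par_WR 0 \<inter> par_WR 1"
    then have "Poly_Mapping.keys m = {}" by (fastforce simp: par_WR_def WR_def)
    then show "m \<in> {0}" by simp
  qed (auto simp: par_WR_def WR_closed)
qed

lemma Eo_WR: "m \<in> WR D \<Longrightarrow> Eo \<mu> m \<in> WR D"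
  unfolding RC_op.simps by (rule WR_lin_ext) (auto intro!: WR_closed dest: WR_keys)

lemma RC_op_WR: "g \<in> RC_gens \<beta> \<Longrightarrow> m \<in> par_WR d \<Longrightarrow> RC_op M P s g m \<in> par_WR (RC_par g + d)"
  using Eo_WR[of m "{d}"] Xo_WR[of m "{d}"] So_WR[of m "{d}"] C_WR[of m "{d}"]
  by (auto simp: RC_gens_def par_WR_def shift_def add.commute)

lemma RC_op_WR_UNIV: "g \<in> RC_gens \<beta> \<Longrightarrow> m \<in> WR UNIV \<Longrightarrow> RC_op M P s g m \<in> WR UNIV"
proof -
  assume g: "g \<in> RC_gens \<beta>" and m: "m \<in> WR UNIV"
  have "C p m \<in> WR UNIV" if "p < l" for p
    using C_WR[OF m that] by (auto simp: WR_def)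
  then show "RC_op M P s g m \<in> WR UNIV"
    using g m Eo_WR[of m UNIV] Xo_WR[of m UNIV] So_WR[of m UNIV]
    by (auto simp: RC_gens_def)
qed

sublocale W: gen_module vscale "RC_gens \<beta>" "RC_rels \<beta>" RC_par "WR UNIV" "RC_op M P s"
  by (rule gen_module_RC) (auto intro: WR_subspace RC_op_WR_UNIV WR_VA)

lemma right_supermodule_WR:
  "right_supermodule (RC \<beta>) (RC_sc \<beta>) (RC_parity \<beta>) vscale (WR UNIV) par_WR (ract M P s)"
  unfolding ract_def
  by (rule W.right_supermodule_presented[OF _ superspace_WR RC_op_WR]) (auto intro: relation_VA WR_VA)

lemma ract_cls:
  assumes "x \<in> FA (RC_gens \<beta>)" "m \<in> WR UNIV"
  shows "ract M P s m (cls (RC_gens \<beta>) (RC_rels \<beta>) x) = A.fr x m"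
  unfolding ract_def by (rule W.coset_ract_cls) (use assms relation_VA WR_VA in auto)

end

section \<open>The action of \<open>\<U>(\<epsilon>)\<close>\<close>

text \<open>The generators of the quantum group do not twist coefficients, so their operators are
  linear over \<open>K\<close> and determined by basis vectors with coefficient 1.\<close>

definition klin :: "(VT \<Rightarrow> VT) \<Rightarrow> bool" where
  "klin F \<longleftrightarrow> (\<forall>m m'. F (m + m') = F m + F m') \<and> (\<forall>c m. F (kscale c m) = kscale c (F m))"

lemma klinD: "klin F \<Longrightarrow> F (m + m') = F m + F m'" "klin F \<Longrightarrow> F (kscale c m) = kscale c (F m)"
  by (simp_all add: klin_def)

lemma klin_0: "klin F \<Longrightarrow> F 0 = 0"
  using klinD(2)[of F 0 0] by (simp add: kscale_simps)

lemma klin_minus: "klin F \<Longrightarrow> F (- m) = - F m" "klin F \<Longrightarrow> F (m - m') = F m - F m'"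
proof -
  assume F: "klin F"
  show *: "F (- m) = - F m" for m using klinD(2)[OF F, of "-1" m] by (simp add: kscale_simps)
  show "F (m - m') = F m - F m'" using klinD(1)[OF F, of m "- m'"] by (simp add: *)
qed

lemma klin_closed:
  "klin (\<lambda>m. m)" "klin (\<lambda>m. 0)" "klin F \<Longrightarrow> klin G \<Longrightarrow> klin (\<lambda>m. F (G m))" "klin F \<Longrightarrow> klin G \<Longrightarrow> klin (\<lambda>m. F m + G m)"
  "klin F \<Longrightarrow> klin G \<Longrightarrow> klin (\<lambda>m. F m - G m)" "klin F \<Longrightarrow> klin (\<lambda>m. kscale c (F m))"
  by (simp_all add: klin_def kscale_simps mult.commute)

lemma klin_sum_list: "(\<And>x. x \<in> set xs \<Longrightarrow> klin (F x)) \<Longrightarrow> klin (\<lambda>m. \<Sum>x\<leftarrow>xs. F x m)"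
  by (induction xs) (auto intro: klin_closed)

lemma mem_supp_UNIV: "m \<in> supp UNIV"
  by (simp add: supp_def)

lemma lin_ext_klin:
  assumes "\<And>f b. h f b = kscale f (h 1 b)"
  shows "lin_ext h (Poly_Mapping.single b f) = h f b" and "klin (lin_ext h)"
proof -
  have a: "add_at h b" for b unfolding add_at_def by (subst (1 2 3) assms) (simp add: kscale_simps)
  show *: "lin_ext h (Poly_Mapping.single b f) = h f b" for b f by (rule lin_ext_single[OF a])
  have h: "h (c * f) b = kscale c (h f b)" for c f b by (subst (1 2) assms) (simp add: kscale_simps)
  have L: "linop (supp UNIV) (supp UNIV) (lin_ext h)"
    by (rule linop_lin_ext) (simp_all add: a h vscale_def mem_supp_UNIV)
  have "lin_ext h (kscale c m) = kscale c (lin_ext h m)" for c m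
    using mem_supp_UNIV[of m]
    by (induction rule: supp_induct)
      (simp_all add: linop_0[OF L] linop_add[OF L] kscale_simps * h mem_supp_UNIV)
  then show "klin (lin_ext h)" by (simp add: klin_def linop_add[OF L] mem_supp_UNIV)
qed

lemma klin_ext_on:
  assumes "klin F" "klin G"
    and "\<And>\<nu> w. (\<nu>, w) \<in> B \<Longrightarrow> F (Poly_Mapping.single (\<nu>, w) 1) = G (Poly_Mapping.single (\<nu>, w) 1)"
    and "m \<in> supp B"
  shows "F m = G m"
  using assms(4)
proof (induction rule: supp_induct)
  case (single b f)
  have "Poly_Mapping.single b f = kscale f (Poly_Mapping.single (fst b, snd b) 1)" by (simp add: kscale_simps)
  then show ?case using assms(3)[of "fst b" "snd b"] single
    by (simp only: klinD(2)[OF assms(1)] klinD(2)[OF assms(2)] prod.collapse)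
qed (simp_all add: klin_0[OF assms(1)] klin_0[OF assms(2)] klinD(1)[OF assms(1)] klinD(1)[OF assms(2)])

lemmas klin_ext = klin_ext_on[where B = UNIV, OF _ _ _ mem_supp_UNIV]

text \<open>
  In the passage from \<open>l\<close> to \<open>l + 1\<close> tensor factors the coproduct of \<open>e\<^sub>i\<close> has the form \<open>A\<^sub>i + B\<^sub>i\<close> with
  \<open>A\<^sub>i B\<^sub>j = c\<^sub>i\<^sub>j B\<^sub>j A\<^sub>i\<close>; in the relations for \<open>A\<^sub>i + B\<^sub>i\<close> all mixed terms cancel.
\<close>

locale serre =
  fixes A B :: "nat \<Rightarrow> VT \<Rightarrow> VT" and c :: "nat \<Rightarrow> nat \<Rightarrow> K"
  assumes A_klin: "klin (A i)" and B_klin: "klin (B i)" and AB: "A i (B j m) = kscale (c i j) (B j (A i m))"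
begin

abbreviation S :: "nat \<Rightarrow> VT \<Rightarrow> VT" where
  "S i m \<equiv> A i m + B i m"

lemmas exp = klinD[OF A_klin] klinD[OF B_klin] klin_0[OF A_klin] klin_0[OF B_klin]
  klin_minus[OF A_klin] klin_minus[OF B_klin] AB kscale_simps(1-10)

text \<open>The mixed terms add up to \<open>(1 + c_ii) B_i A_i\<close>.\<close>

lemma square:
  assumes "c i i = -1" "\<And>m. A i (A i m) = 0" "\<And>m. B i (B i m) = 0"
  shows "S i (S i m) = 0"
  by (simp add: exp assms)

lemma commute:
  assumes "c i j = 1" "c j i = 1" "\<And>m. A i (A j m) = A j (A i m)" "\<And>m. B i (B j m) = B j (B i m)"
  shows "S i (S j m) = S j (S i m)"
  by (simp add: exp assms ac_simps)

text \<open>In use \<open>x\<close> is \<open>q_i^2\<close>, \<open>t\<close> is the inverse of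
  \<open>q_i\<close> and \<open>k\<close> is \<open>[2]\<close> up to sign. The relation for
  \<open>A\<close> eliminates \<open>A_i A_i A_j\<close>, after which the coefficients of the mixed
  products vanish by \<open>co\<close>. \<open>B_i\<close> and \<open>B_j\<close> act at one place,
  hence can be composed in at most one order.\<close>

lemma even_serre:
  assumes c: "c i i = x" "c i j = t" "c j i = t" "x * (t * t) = 1" "k = t + x * t"
    and A: "A i (A i (A j m)) - kscale k (A i (A j (A i m))) + A j (A i (A i m)) = 0"
    and B: "\<And>m. B i (B i m) = 0" "(\<forall>m. B i (B j m) = 0) \<or> (\<forall>m. B j (B i m) = 0)"
  shows "S i (S i (S j m)) - kscale k (S i (S j (S i m))) + S j (S i (S i m)) = 0"
proof -
  have A': "A i (A i (A j m)) = kscale k (A i (A j (A i m))) - A j (A i (A i m))"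
    using A by (simp add: algebra_simps add_eq_0_iff)
  have co: "t * t - k * t + 1 = 0" "x + 1 - k * (x * t) = 0" "t + x * t - k = 0" "x * t + t - k = 0"
    using c(4) by (simp_all add: c(5) algebra_simps)
  show ?thesis
    using B(2)
  proof
    assume z: "\<forall>m. B i (B j m) = 0"
    have "S i (S i (S j m)) - kscale k (S i (S j (S i m))) + S j (S i (S i m)) =
      kscale (t * t - k * t + 1) (B j (A i (A i m))) + kscale (x + 1 - k * (x * t)) (B i (A i (A j m)))
      + kscale (t + x * t - k) (B i (A j (A i m))) + kscale (x + 1 - k * (x * t)) (B j (B i (A i m)))"
      using z c(1-3) B(1) by (simp add: exp A') (simp add: vec_simps)
    then show ?thesis by (simp add: co kscale_simps)
  next
    assume z: "\<forall>m. B j (B i m) = 0"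
    have "S i (S i (S j m)) - kscale k (S i (S j (S i m))) + S j (S i (S i m)) =
      kscale (t * t - k * t + 1) (B j (A i (A i m))) + kscale (x + 1 - k * (x * t)) (B i (A i (A j m)))
      + kscale (t + x * t - k) (B i (A j (A i m))) + kscale (x * t + t - k) (B i (B j (A i m)))"
      using z c(1-3) B(1) by (simp add: exp A') (simp add: vec_simps)
    then show ?thesis by (simp add: co kscale_simps)
  qed
qed

text \<open>\<open>p\<close> is the odd index with neighbours \<open>u\<close> and \<open>v\<close>;
  in use \<open>a\<close> is the inverse of \<open>q_p\<close> and \<open>b\<close> is
  \<open>- q_p\<close>. By \<open>a b = -1\<close> the mixed terms become expressions in
  \<open>a\<close> and its inverse, which vanish for \<open>k = a - b\<close>.\<close>

lemma odd_serre:
  assumes c: "c p p = -1" "c p u = a" "c u p = a" "c p v = b" "c v p = b" "c u v = 1" "c v u = 1"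
    and ab: "a * b = -1" and k: "k = a - b"
    and A: "A p (A u (A p (A v m))) - A p (A v (A p (A u m))) + A v (A p (A u (A p m)))
      - A u (A p (A v (A p m))) + kscale k (A p (A u (A v (A p m)))) = 0"
    and AA: "\<And>m. A p (A p m) = 0" "\<And>m. A u (A v m) = A v (A u m)"
    and B: "\<And>i m. B i (B i m) = 0" "\<And>m. B u (B v m) = 0" "\<And>m. B v (B u m) = 0"
    and BB: "(\<forall>m. B p (B u m) = 0 \<and> B v (B p m) = 0) \<or> (\<forall>m. B u (B p m) = 0 \<and> B p (B v m) = 0)"
  shows "S p (S u (S p (S v m))) - S p (S v (S p (S u m))) + S v (S p (S u (S p m)))
      - S u (S p (S v (S p m))) + kscale k (S p (S u (S v (S p m)))) = 0"
proof -
  have A': "A p (A u (A p (A v m))) = A p (A v (A p (A u m))) - A v (A p (A u (A p m)))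
      + A u (A p (A v (A p m))) - kscale k (A p (A v (A u (A p m))))"
    using A by (simp add: AA algebra_simps add_eq_0_iff)
  have a: "a \<noteq> 0" using ab by auto
  then have "inverse a * (a * b) = b" by (simp add: mult.assoc[symmetric])
  then have b: "b = - inverse a" using ab by simp
  show ?thesis
    using BB
  proof
    assume z: "\<forall>m. B p (B u m) = 0 \<and> B v (B p m) = 0"
    show ?thesis
      using z by (simp add: exp AA B c A') (simp add: vec_simps k b a)
  next
    assume z: "\<forall>m. B u (B p m) = 0 \<and> B p (B v m) = 0"
    show ?thesis
      using z by (simp add: exp AA B c A') (simp add: vec_simps k b a)
  qed
qed

end

text \<open>\<open>M \<ge> 2\<close> gives at least four indices modulo \<open>n\<close>, so the two
  neighbours of an index are distinct and not adjacent to each other.\<close>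

locale uq =
  fixes M :: nat and s :: sharp
  assumes M: "M \<ge> 2"
begin

abbreviation "cy \<equiv> cyc M"
abbreviation "q \<equiv> qi M"

section \<open>Indices modulo \<open>n\<close> and the constants \<open>q_i\<close>\<close>

lemma cyc_range: "cy i \<in> {1..2 * M}"
  using M mod_less_divisor[of "2 * M" i] by (auto simp: cyc_def intro: less_imp_le)

lemma cyc_mod: "cy i mod (2 * M) = i mod (2 * M)"
  by (simp add: cyc_def)

lemma cyc_eq_iff: "cy i = cy j \<longleftrightarrow> i mod (2 * M) = j mod (2 * M)"
  using cyc_mod[of i] cyc_mod[of j] by (auto simp: cyc_def)

lemma cyc_cyc [simp]: "cy (cy i) = cy i" "cy (i mod (2 * M)) = cy i"
  by (simp_all add: cyc_eq_iff cyc_mod)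

lemma cyc_Suc_cong: "cy i = cy j \<Longrightarrow> cy (i + k) = cy (j + k)"
  unfolding cyc_eq_iff by (rule mod_add_cong) auto

lemma cyc_neq:
  assumes "0 < k" "k < 2 * M" shows "cy (i + k) \<noteq> cy i"
proof
  assume "cy (i + k) = cy i"
  then have "2 * M dvd (i + k) - i" unfolding cyc_eq_iff by (subst mod_eq_dvd_iff_nat[symmetric]) auto
  with assms show False by (auto dest: dvd_imp_le)
qed

lemma cyc_neq_simps [simp]:
  "cy (Suc i) \<noteq> cy i" "cy i \<noteq> cy (Suc i)" "cy (Suc (Suc i)) \<noteq> cy i" "cy i \<noteq> cy (Suc (Suc i))"
  using cyc_neq[of 1 i] cyc_neq[of 2 i] M by auto

lemma eps_cong: "cy i = cy j \<Longrightarrow> eps M i = eps M j" and qi_cong: "cy i = cy j \<Longrightarrow> q i = q j"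
  by (simp_all add: eps_def qi_def)

lemma dl_cong: "cy i = cy j \<Longrightarrow> dl M i = dl M j" and al_cong: "cy i = cy j \<Longrightarrow> al M i = al M j"
  using cyc_Suc_cong[of i j 1] by (simp_all add: dl_def al_def)

lemma eps_cases: "eps M i = 0 \<or> eps M i = 1"
  by (simp add: eps_def)

lemma qi_eps: "eps M i = 0 \<Longrightarrow> q i = qq" "eps M i = 1 \<Longrightarrow> q i = - inverse qq"
  by (simp_all add: qi_def)

lemma qi_nonzero [simp]: "q i \<noteq> 0"
  using eps_cases[of i] by (auto simp: qi_eps)

lemma qi_even: "even_ix M i \<Longrightarrow> q (Suc i) = q i"
  by (simp add: even_ix_def qi_def)

lemma qi_odd: "\<not> even_ix M i \<Longrightarrow> q i * q (Suc i) = -1"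
  using eps_cases[of i] eps_cases[of "Suc i"] by (auto simp: qi_eps even_ix_def)

lemma qi_two_q: "q i + inverse (q i) = (-1) ^ eps M i * two_q"
  using eps_cases[of i] by (auto simp: qi_eps two_q_def inverse_minus_eq)

lemma qi_diff_nonzero: "q i - inverse (q i) \<noteq> 0"
proof
  assume "q i - inverse (q i) = 0"
  then have "qq = inverse qq" using eps_cases[of i] by (auto simp: qi_eps inverse_minus_eq)
  then have "qq ^ 2 = 1" by (metis power2_eq_square qq_nonzero right_inverse)
  then show False by simp
qed


subsection \<open>Weights\<close>

lemma bq_add: "bq M (\<mu> + \<mu>') \<rho> = bq M \<mu> \<rho> * bq M \<mu>' \<rho>"
  by (simp add: bq_def lookup_add distrib_right power_int_add prod.distrib)

lemma bq_minus: "bq M (- \<mu>) \<rho> = inverse (bq M \<mu> \<rho>)"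
  by (simp add: bq_def power_int_minus prod_inversef[symmetric])

lemma bq_commute: "bq M \<mu> \<rho> = bq M \<rho> \<mu>"
  by (simp add: bq_def mult.commute)

lemma bq_nonzero [simp]: "bq M \<mu> \<rho> \<noteq> 0"
  by (simp add: bq_def)

lemma bq_dl: "bq M \<mu> (dl M j) = q j powi (Poly_Mapping.lookup \<mu> (cy j))"
proof -
  have "bq M \<mu> (dl M j) = (\<Prod>i\<in>{1..2 * M}. if cy j = i then q (cy j) powi (Poly_Mapping.lookup \<mu> i) else 1)"
    unfolding bq_def by (rule prod.cong) (auto simp: dl_def lookup_single)
  also have "\<dots> = q (cy j) powi (Poly_Mapping.lookup \<mu> (cy j))"
    using cyc_range[of j] by simp
  finally show ?thesis using qi_cong[of "cy j" j] by simp
qed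

lemma bq_minus_right: "bq M \<rho> (- \<mu>) = inverse (bq M \<rho> \<mu>)"
  by (subst (1 2) bq_commute) (rule bq_minus)

lemma bq_al: "bq M \<mu> (al M i) = bq M \<mu> (dl M i) * inverse (bq M \<mu> (dl M (Suc i)))"
proof -
  have "al M i = dl M i + - dl M (Suc i)" by (simp add: al_def)
  then show ?thesis unfolding bq_commute[of \<mu>] by (simp only: bq_add bq_minus)
qed

lemma lookup_al: "Poly_Mapping.lookup (al M i) k = (1 when cy i = k) - (1 when cy (Suc i) = k)"
  by (simp add: al_def dl_def lookup_minus lookup_single)

text \<open>The constant up to which operators of the indices \<open>i\<close> and \<open>j\<close>
  at different places commute; the lemmas below evaluate it on the cyclic diagram.\<close>

definition cc :: "nat \<Rightarrow> nat \<Rightarrow> base" where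
  "cc i j = bq M (al M j) (al M i)"

lemma cc_commute: "cc i j = cc j i"
  unfolding cc_def by (rule bq_commute)

lemma cc_cong: "cy j = cy j' \<Longrightarrow> cc i j = cc i j'"
  using al_cong[of j j'] by (simp add: cc_def)

lemma cc_same: "cc i i = q i * q (Suc i)"
  by (simp add: cc_def bq_al bq_dl lookup_al when_def)

lemma cc_next: "cy j = cy (Suc i) \<Longrightarrow> cc i j = inverse (q (Suc i))"
  by (subst cc_cong[of j "Suc i"]) (simp_all add: cc_def bq_al bq_dl lookup_al when_def power_int_minus)

lemma cc_prev: "cy (Suc j) = cy i \<Longrightarrow> cc i j = inverse (q i)"
  using cc_next[of i j] qi_cong[of "Suc j" i] by (simp add: cc_commute)

lemma cc_far: "cy i \<noteq> cy j \<Longrightarrow> cy (Suc i) \<noteq> cy j \<Longrightarrow> cy i \<noteq> cy (Suc j) \<Longrightarrow> cc i j = 1"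
proof -
  assume a: "cy i \<noteq> cy j" "cy (Suc i) \<noteq> cy j" "cy i \<noteq> cy (Suc j)"
  have "cy (Suc i) \<noteq> cy (Suc j)"
    using a(1) cyc_Suc_cong[of "Suc i" "Suc j" "2 * M - 1"] M by (auto simp: cyc_eq_iff)
  with a show ?thesis by (auto simp: cc_def bq_al bq_dl lookup_al when_def)
qed

definition kw :: "(nat \<Rightarrow>\<^sub>0 int) \<Rightarrow> nat list \<Rightarrow> base" where
  "kw \<mu> w = (\<Prod>j\<leftarrow>w. bq M \<mu> (dl M j))"

lemma kw_simps [simp]: "kw \<mu> [] = 1" "kw \<mu> (j # w) = bq M \<mu> (dl M j) * kw \<mu> w"
    "kw \<mu> (w @ w') = kw \<mu> w * kw \<mu> w'"
  by (simp_all add: kw_def)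

lemma kw_add: "kw (\<mu> + \<mu>') w = kw \<mu> w * kw \<mu>' w"
  by (induction w) (simp_all add: bq_add)

lemma kw_minus: "kw (- \<mu>) w = inverse (kw \<mu> w)"
  by (induction w) (simp_all add: bq_minus)

lemma kw_nonzero [simp]: "kw \<mu> w \<noteq> 0"
  by (induction w) simp_all

lemma kw_update:
  assumes "p < length w"
  shows "kw \<mu> (w[p := b]) = kw \<mu> w * (bq M \<mu> (dl M b) * inverse (bq M \<mu> (dl M (w ! p))))"
proof -
  have "kw \<mu> w = kw \<mu> (take p w @ w ! p # drop (Suc p) w)" using id_take_nth_drop[OF assms] by simp
  then show ?thesis unfolding upd_conv_take_nth_drop[OF assms] by simp
qed

text \<open>To the left of the place stand weights of \<mu>, to the right weights of \<mu>', so
  consecutive summands cancel. With \<mu>' = - \<mu> this is behind the commutator of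
  \<open>e_i\<close> and \<open>f_i\<close>.\<close>

lemma kw_telescope:
  "(\<Sum>p<length w. kw \<mu> (take p w) * (bq M \<mu> (dl M (w ! p)) - bq M \<mu>' (dl M (w ! p))) * kw \<mu>' (drop (Suc p) w))
    = kw \<mu> w - kw \<mu>' w"
proof (induction w)
  case (Cons j w)
  have "(\<Sum>p<length w. bq M \<mu> (dl M j) * kw \<mu> (take p w) * (bq M \<mu> (dl M (w ! p)) - bq M \<mu>' (dl M (w ! p)))
      * kw \<mu>' (drop (Suc p) w)) = bq M \<mu> (dl M j) * (kw \<mu> w - kw \<mu>' w)"
    unfolding Cons[symmetric] sum_distrib_left by (simp add: mult.assoc)
  then show ?case
    by (simp add: sum.lessThan_Suc_shift del: sum.lessThan_Suc) (simp add: algebra_simps)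
qed simp


subsection \<open>The operators at one place\<close>

text \<open>The parameter \<open>e\<close> distinguishes the operators of \<open>e\<^sub>i\<close> from those of \<open>f\<^sub>i\<close>.\<close>

definition src :: "bool \<Rightarrow> nat \<Rightarrow> nat" where
  "src e i = (if e then cy (Suc i) else cy i)"

definition tgt :: "bool \<Rightarrow> nat \<Rightarrow> nat" where
  "tgt e i = (if e then cy i else cy (Suc i))"

definition xf :: "bool \<Rightarrow> nat \<Rightarrow> (nat \<Rightarrow>\<^sub>0 int)" where
  "xf e i = (if e then - al M i else al M i)"

definition xx :: "bool \<Rightarrow> nat \<Rightarrow> J list \<Rightarrow> nat \<Rightarrow> K" where
  "xx e i \<nu> p = (if i = 0 then (if e then XK s \<nu> p else inverse (XK s \<nu> p)) else 1)"

definition oth :: "bool \<Rightarrow> nat \<Rightarrow> nat list \<Rightarrow> nat list" where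
  "oth e p w = (if e then drop (Suc p) w else take p w)"

text \<open>Says that \<open>r\<close> is among the places of \<open>oth e p\<close>: the operator
  at \<open>p\<close> picks up a weight factor from the letter at \<open>r\<close>.\<close>

definition bef :: "bool \<Rightarrow> nat \<Rightarrow> nat \<Rightarrow> bool" where
  "bef e p r = (if e then p < r else r < p)"

definition BU1 :: "bool \<Rightarrow> nat \<Rightarrow> nat \<Rightarrow> K \<Rightarrow> J list \<times> nat list \<Rightarrow> VT" where
  "BU1 e i p f = (\<lambda>(\<nu>, w). if p < length w \<and> w ! p = src e i
     then Poly_Mapping.single (\<nu>, w[p := tgt e i]) (xx e i \<nu> p * cK (kw (xf e i) (oth e p w)) * f) else 0)"

definition BU :: "bool \<Rightarrow> nat \<Rightarrow> nat \<Rightarrow> VT \<Rightarrow> VT" where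
  "BU e i p = lin_ext (BU1 e i p)"

lemma BU1_scale: "BU1 e i p f b = kscale f (BU1 e i p 1 b)"
  by (simp add: BU1_def kscale_simps mult.commute split: prod.split)

lemma BU_klin: "klin (BU e i p)"
  unfolding BU_def by (rule lin_ext_klin(2)) (rule BU1_scale)

lemma BU_single: "BU e i p (Poly_Mapping.single (\<nu>, w) f) = (if p < length w \<and> w ! p = src e i
     then Poly_Mapping.single (\<nu>, w[p := tgt e i]) (xx e i \<nu> p * cK (kw (xf e i) (oth e p w)) * f) else 0)"
  unfolding BU_def lin_ext_klin(1)[OF BU1_scale] by (simp add: BU1_def)

lemmas BU_lin = klinD[OF BU_klin] klin_0[OF BU_klin] klin_minus[OF BU_klin]

lemma src_neq_tgt: "src e i \<noteq> tgt e i"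
  by (simp add: src_def tgt_def)

text \<open>The inner operator leaves the letter \<open>tgt e' j\<close> at \<open>p\<close>, which
  the outer one does not accept.\<close>

lemma BU_same:
  assumes "src e i \<noteq> tgt e' j" shows "BU e i p (BU e' j p m) = 0"
  by (rule klin_ext[where F = "\<lambda>m. BU e i p (BU e' j p m)" and G = "\<lambda>m. 0"])
    (use assms in \<open>auto simp: BU_single BU_lin intro: klin_closed(2,3) BU_klin\<close>)

lemma bq_tgt: "bq M \<mu> (dl M (tgt e i)) * inverse (bq M \<mu> (dl M (src e i))) = bq M \<mu> (- xf e i)"
  using dl_cong[OF cyc_cyc(1)] by (simp add: tgt_def src_def xf_def bq_al bq_minus_right)

lemma kw_oth:
  assumes "p < length w" "r < length w" "p \<noteq> r" "w ! p = src e' i"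
  shows "kw \<mu> (oth e r (w[p := tgt e' i])) = kw \<mu> (oth e r w) * (if bef e r p then bq M \<mu> (- xf e' i) else 1)"
  using assms
  by (auto simp: oth_def bef_def drop_update_swap take_update_swap kw_update bq_tgt list_update_beyond)

text \<open>Each operator changes one letter, and thereby the weight the other one picks up there if
  it looks at that place; the ratio of the two orders is made of these changes.\<close>

lemma BU_BU:
  assumes "p \<noteq> r"
  shows "BU e' i p (BU e j r m) = kscale (cK ((if bef e' p r then bq M (xf e' i) (- xf e j) else 1)
    * inverse (if bef e r p then bq M (xf e j) (- xf e' i) else 1))) (BU e j r (BU e' i p m))"
proof -
  let ?c = "cK ((if bef e' p r then bq M (xf e' i) (- xf e j) else 1)
    * inverse (if bef e r p then bq M (xf e j) (- xf e' i) else 1))"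
  show ?thesis
  proof (rule klin_ext[where F = "\<lambda>m. BU e' i p (BU e j r m)" and G = "\<lambda>m. kscale ?c (BU e j r (BU e' i p m))"])
    fix \<nu> w
    show "BU e' i p (BU e j r (Poly_Mapping.single (\<nu>, w) 1)) =
      kscale ?c (BU e j r (BU e' i p (Poly_Mapping.single (\<nu>, w) 1)))"
    proof (cases "p < length w \<and> r < length w \<and> w ! p = src e' i \<and> w ! r = src e j")
      case True
      have [simp]: "w[r := a, p := b] = w[p := b, r := a]" for a b using assms by (simp add: list_update_swap)
      have d: "cK (bq M (xf e j) (- xf e' i)) \<noteq> 0" by (simp only: cK_eq_0_iff bq_nonzero not_False_eq_True)
      have d': "d \<noteq> 0 \<Longrightarrow> d * inverse d = 1" "d \<noteq> 0 \<Longrightarrow> d * (x * inverse d) = x" for d x :: K by simp_all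
      show ?thesis
        using True assms
        by (cases "bef e r p"; cases "bef e' p r"; simp add: BU_single kw_oth kscale_simps cK_hom;
            simp only: mult_ac d'[OF d] mult_1_left mult_1_right)
    qed (use assms in \<open>auto simp: BU_single BU_lin kscale_simps\<close>)
  qed (rule klin_closed(3)[OF BU_klin BU_klin], rule klin_closed(6)[OF klin_closed(3)[OF BU_klin BU_klin]])
qed

lemma BU_BU_bef:
  assumes "bef e r p" shows "BU e i p (BU e j r m) = kscale (cK (cc i j)) (BU e j r (BU e i p m))"
proof -
  have "p \<noteq> r" "\<not> bef e p r" using assms by (auto simp: bef_def split: if_splits)
  with assms show ?thesis
    by (cases e) (simp_all add: BU_BU[OF \<open>p \<noteq> r\<close>] xf_def cc_def bq_minus bq_minus_right)
qed

text \<open>Of \<open>e_i\<close> and \<open>f_j\<close> at different places, either both look at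
  each other's place or neither does, and the two factors cancel.\<close>

lemma BU_BU_mixed:
  assumes "p \<noteq> r" shows "BU True i p (BU False j r m) = BU False j r (BU True i p m)"
proof -
  have "bef False r p = bef True p r" by (simp add: bef_def)
  then show ?thesis using bq_commute[of "al M i" "al M j"]
    by (simp add: BU_BU[OF assms] xf_def bq_minus bq_minus_right kscale_simps)
qed


end

context uq
begin

subsection \<open>Sums over several places\<close>

text \<open>\<open>rev\<close> puts the head of the list last, so that a new place enters as the
  summand \<open>B\<close> of the locale \<open>serre\<close>.\<close>

definition WU :: "bool \<Rightarrow> nat \<Rightarrow> nat list \<Rightarrow> VT \<Rightarrow> VT" where
  "WU e i ps m = (\<Sum>p\<leftarrow>rev ps. BU e i p m)"

lemma WU_Nil: "WU e i [] m = 0" and WU_Cons: "WU e i (p # ps) m = WU e i ps m + BU e i p m"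
  by (simp_all add: WU_def)

lemma WU_klin: "klin (WU e i ps)"
  unfolding WU_def[abs_def] by (rule klin_sum_list) (rule BU_klin)

lemma serre_WU: "\<forall>p\<in>set ps. bef e r p \<Longrightarrow> serre (\<lambda>i. WU e i ps) (\<lambda>i. BU e i r) (\<lambda>i j. cK (cc i j))"
proof (unfold_locales, rule WU_klin, rule BU_klin)
  fix i j m assume "\<forall>p\<in>set ps. bef e r p"
  then show "WU e i ps (BU e j r m) = kscale (cK (cc i j)) (BU e j r (WU e i ps m))"
    by (induction ps) (simp_all add: WU_Nil WU_Cons BU_lin kscale_simps BU_BU_bef)
qed

lemma WU_square:
  assumes "sorted_wrt (bef e) ps" "\<not> even_ix M i"
  shows "WU e i ps (WU e i ps m) = 0"
  using assms(1)
proof (induction ps arbitrary: m)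
  case (Cons r ps)
  then interpret serre "\<lambda>i. WU e i ps" "\<lambda>i. BU e i r" "\<lambda>i j. cK (cc i j)" by (intro serre_WU) simp
  show ?case unfolding WU_Cons
    by (rule square) (use Cons assms(2) in \<open>simp_all add: cc_same qi_odd cK_hom BU_same src_neq_tgt\<close>)
qed (simp add: WU_Nil)

lemma WU_commute:
  assumes "sorted_wrt (bef e) ps" "cy (Suc i) \<noteq> cy j" "cy i \<noteq> cy (Suc j)" "cy i = cy j \<Longrightarrow> i = j"
  shows "WU e i ps (WU e j ps m) = WU e j ps (WU e i ps m)"
proof (cases "cy i = cy j")
  case True
  then show ?thesis using assms(4) by simp
next
  case False
  show ?thesis
    using assms(1)
  proof (induction ps arbitrary: m)
    case (Cons r ps)
    then interpret serre "\<lambda>i. WU e i ps" "\<lambda>i. BU e i r" "\<lambda>i j. cK (cc i j)" by (intro serre_WU) simp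
    have c: "cc i j = 1" "cc j i = 1" using cc_far[OF False assms(2,3)] cc_commute[of i j] by simp_all
    show ?case unfolding WU_Cons
      by (rule commute)
        (use Cons assms(2,3) in \<open>simp_all add: c cK_hom BU_same src_def tgt_def eq_commute[of "cy j"] eq_commute[of "cy (Suc j)"]\<close>)
  qed (simp add: WU_Nil)
qed

lemma WU_even_serre:
  assumes "sorted_wrt (bef e) ps" "even_ix M i" "cy (Suc i) = cy j \<or> cy i = cy (Suc j)"
  shows "WU e i ps (WU e i ps (WU e j ps m)) - kscale (cK ((-1) ^ eps M i * two_q)) (WU e i ps (WU e j ps (WU e i ps m)))
    + WU e j ps (WU e i ps (WU e i ps m)) = 0"
  using assms(1)
proof (induction ps arbitrary: m)
  case (Cons r ps)
  then interpret serre "\<lambda>i. WU e i ps" "\<lambda>i. BU e i r" "\<lambda>i j. cK (cc i j)" by (intro serre_WU) simp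
  have c: "cc i j = inverse (q i)" "cc j i = inverse (q i)"
    using assms(3) cc_next[of j i] cc_prev[of j i] cc_commute[of i j] qi_even[OF assms(2)] by auto
  \<comment> \<open>\<open>j\<close> cannot be both the successor and the predecessor of
    \<open>i\<close>; hence at one place the two operators can be composed in at most one
    order.\<close>
  have n: "cy (Suc i) \<noteq> cy j \<or> cy (Suc j) \<noteq> cy i"
    using cyc_Suc_cong[of "Suc i" j 1] by auto
  show ?case unfolding WU_Cons
  proof (rule even_serre[where x = "cK (q i * q i)" and t = "cK (inverse (q i))"])
    show "(\<forall>m. BU e i r (BU e j r m) = 0) \<or> (\<forall>m. BU e j r (BU e i r m) = 0)"
    proof -
      have "src e i \<noteq> tgt e j \<or> src e j \<noteq> tgt e i" using n by (cases e) (auto simp: src_def tgt_def)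
      then show ?thesis using BU_same by blast
    qed
    show "cK ((-1) ^ eps M i * two_q) = cK (inverse (q i)) + cK (q i * q i) * cK (inverse (q i))"
      unfolding qi_two_q[symmetric] cK_hom(3)[symmetric] cK_hom(6)[symmetric] by (simp add: mult.assoc add.commute)
    have "q i * q i * (inverse (q i) * inverse (q i)) = q i * inverse (q i) * (q i * inverse (q i))"
      by (simp only: mult_ac)
    then show "cK (q i * q i) * (cK (inverse (q i)) * cK (inverse (q i))) = 1"
      unfolding cK_hom(6)[symmetric] by (simp add: cK_hom(2))
  qed (use Cons in \<open>simp_all add: c cc_same qi_even[OF assms(2)] BU_same src_neq_tgt\<close>)
qed (simp add: WU_Nil kscale_simps)

lemma WU_odd_serre:
  assumes "sorted_wrt (bef e) ps" "\<not> even_ix M p" and u: "cy (Suc u) = cy p" and v: "cy v = cy (Suc p)"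
  shows "WU e p ps (WU e u ps (WU e p ps (WU e v ps m))) - WU e p ps (WU e v ps (WU e p ps (WU e u ps m)))
    + WU e v ps (WU e p ps (WU e u ps (WU e p ps m))) - WU e u ps (WU e p ps (WU e v ps (WU e p ps m)))
    + kscale (cK ((-1) ^ eps M p * two_q)) (WU e p ps (WU e u ps (WU e v ps (WU e p ps m)))) = 0"
proof -
  have vu: "cy v = cy (Suc (Suc u))" using v cyc_Suc_cong[OF u, of 1] by simp
  have v1: "cy (Suc v) = cy (Suc (Suc (Suc u)))" using cyc_Suc_cong[OF vu, of 1] by simp
  \<comment> \<open>As \<open>v\<close> is \<open>u + 2\<close>, the three inequalities say that
    \<open>n\<close> divides neither 2 nor 1 nor 3.\<close>
  have n: "cy u \<noteq> cy v" "cy (Suc u) \<noteq> cy v" "cy u \<noteq> cy (Suc v)"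
    using cyc_neq[of 3 u] M by (simp_all add: vu v1 numeral_3_eq_3)
  have n': "cy u \<noteq> cy (Suc p)" "cy p \<noteq> cy (Suc v)"
    using vu v n v1 u by auto
  have uv: "cc u v = 1" "cc v u = 1" using cc_far[OF n] cc_commute[of u v] by simp_all
  have pu: "cc p u = inverse (q p)" "cc u p = inverse (q p)" using cc_prev[OF u] cc_commute[of u p] by simp_all
  have pv: "cc p v = inverse (q (Suc p))" "cc v p = inverse (q (Suc p))" using cc_next[OF v] cc_commute[of v p] by simp_all
  have q1: "inverse (q (Suc p)) = - q p" using qi_odd[OF assms(2)] by (simp add: field_simps)
  show ?thesis
    using assms(1)
  proof (induction ps arbitrary: m)
    case (Cons r ps)
    then interpret serre "\<lambda>i. WU e i ps" "\<lambda>i. BU e i r" "\<lambda>i j. cK (cc i j)" by (intro serre_WU) simp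
    have ps: "sorted_wrt (bef e) ps" using Cons by simp
    show ?case unfolding WU_Cons
    proof (rule odd_serre[where a = "cK (inverse (q p))" and b = "cK (inverse (q (Suc p)))"])
      show "(\<forall>m. BU e p r (BU e u r m) = 0 \<and> BU e v r (BU e p r m) = 0) \<or>
          (\<forall>m. BU e u r (BU e p r m) = 0 \<and> BU e p r (BU e v r m) = 0)"
        using n' by (cases e) (auto simp: src_def tgt_def intro!: BU_same)
      show "BU e u r (BU e v r m) = 0" "BU e v r (BU e u r m) = 0" for m
        using n by (auto simp: src_def tgt_def intro!: BU_same split: if_splits)
      show "cK ((-1) ^ eps M p * two_q) = cK (inverse (q p)) - cK (inverse (q (Suc p)))"
        unfolding qi_two_q[symmetric] cK_hom(4)[symmetric] q1 by (simp add: add.commute)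
      show "cK (inverse (q p)) * cK (inverse (q (Suc p))) = -1"
        unfolding cK_hom(6)[symmetric] q1 by (simp add: cK_hom)
      show "WU e u ps (WU e v ps m) = WU e v ps (WU e u ps m)" for m
        by (rule WU_commute[OF ps]) (use n in \<open>auto simp: eq_commute\<close>)
    qed (use Cons WU_square[OF ps assms(2)] in
        \<open>simp_all add: pu pv uv cc_same qi_odd[OF assms(2)] cK_hom BU_same src_neq_tgt\<close>)
  qed (simp add: WU_Nil kscale_simps)
qed

end

context uq
begin

subsection \<open>The operators of the generators\<close>

abbreviation "Kop \<mu> \<equiv> U_op M s (UK \<mu>)"

lemma U_op1_scale: "U_op1 M s g f b = kscale f (U_op1 M s g 1 b)"
proof (cases b)
  case (Pair \<nu> w)
  have i: "kscale f (if a then x else 0) = (if a then kscale f x else 0)" for a and x :: VT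
    by (simp add: kscale_simps)
  show ?thesis unfolding Pair
    by (cases g) (simp_all add: kscale_simps(11) kscale_sum i mult_ac cong: if_cong)
qed

lemma U_op_klin: "klin (U_op M s g)"
  unfolding U_op_def by (rule lin_ext_klin(2)) (rule U_op1_scale)

lemma U_op_single: "U_op M s g (Poly_Mapping.single b f) = U_op1 M s g f b"
  unfolding U_op_def by (rule lin_ext_klin(1)) (rule U_op1_scale)

lemma Kop_single: "Kop \<mu> (Poly_Mapping.single (\<nu>, w) f) = Poly_Mapping.single (\<nu>, w) (cK (kw \<mu> w) * f)"
  by (simp add: U_op_single kw_def)

text \<open>The order of places in which each one looks at all later ones of the list: increasing
  for \<open>e_i\<close>, decreasing for \<open>f_i\<close>.\<close>

definition PL :: "bool \<Rightarrow> nat \<Rightarrow> nat list" where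
  "PL e n = (if e then [0..<n] else rev [0..<n])"

lemma sorted_PL: "sorted_wrt (bef e) (PL e n)"
  by (auto simp: PL_def bef_def sorted_wrt_rev sorted_wrt_upt intro: sorted_wrt_mono_rel[OF _ sorted_wrt_upt])

lemma WU_sum: "WU e i (PL e n) m = (\<Sum>p<n. BU e i p m)"
proof -
  have "WU e i (PL e n) m = (\<Sum>p\<leftarrow>[0..<n]. BU e i p m)"
    by (simp add: WU_def PL_def rev_map[symmetric] sum_list_rev)
  then show ?thesis by (simp add: interv_sum_list_conv_sum_set_nat atLeast0LessThan)
qed

lemma U_op_WU:
  assumes "m \<in> supp {b. length (snd b) = n}"
  shows "U_op M s (UE i) m = WU True i (PL True n) m" and "U_op M s (UF i) m = WU False i (PL False n) m"
proof -
  show "U_op M s (UE i) m = WU True i (PL True n) m"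
  proof (rule klin_ext_on[OF U_op_klin WU_klin _ assms])
    fix \<nu> :: "J list" and w :: "nat list" assume "(\<nu>, w) \<in> {b. length (snd b) = n}"
    then show "U_op M s (UE i) (Poly_Mapping.single (\<nu>, w) 1) = WU True i (PL True n) (Poly_Mapping.single (\<nu>, w) 1)"
      unfolding WU_sum U_op_single U_op1.simps
      by (intro sum.cong) (auto simp: BU_single src_def tgt_def xx_def oth_def xf_def kw_def)
  qed
  show "U_op M s (UF i) m = WU False i (PL False n) m"
  proof (rule klin_ext_on[OF U_op_klin WU_klin _ assms])
    fix \<nu> :: "J list" and w :: "nat list" assume "(\<nu>, w) \<in> {b. length (snd b) = n}"
    then show "U_op M s (UF i) (Poly_Mapping.single (\<nu>, w) 1) = WU False i (PL False n) (Poly_Mapping.single (\<nu>, w) 1)"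
      unfolding WU_sum U_op_single U_op1.simps
      by (intro sum.cong) (auto simp: BU_single src_def tgt_def xx_def oth_def xf_def kw_def)
  qed
qed

lemma Kop_0: "Kop 0 m = m"
  by (rule klin_ext[OF U_op_klin klin_closed(1)])
    (use kw_add[of 0 0] in \<open>simp add: Kop_single cK_hom\<close>)

lemma Kop_add: "Kop \<mu> (Kop \<mu>' m) = Kop (\<mu> + \<mu>') m"
  by (rule klin_ext[OF klin_closed(3)[OF U_op_klin U_op_klin] U_op_klin])
    (simp add: Kop_single kw_add cK_hom)

lemma Kop_BU: "Kop \<mu> (BU e i p (Kop (- \<mu>) m)) = kscale (cK (bq M \<mu> (- xf e i))) (BU e i p m)"
proof -
  have c: "cK (kw (- \<mu>) w) = inverse (cK (kw \<mu> w))" "cK (kw \<mu> w) \<noteq> 0" for w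
    by (simp_all only: kw_minus cK_hom cK_eq_0_iff kw_nonzero not_False_eq_True)
  have alg: "k * b * (x * h * inverse k) = b * (x * h)" if "k \<noteq> 0" for k b x h :: K
    using that by (simp add: field_simps)
  show ?thesis
    by (rule klin_ext[OF klin_closed(3)[OF U_op_klin klin_closed(3)[OF BU_klin U_op_klin]] klin_closed(6)[OF BU_klin]])
      (simp add: BU_single Kop_single kscale_simps klin_0[OF U_op_klin] kw_update bq_tgt cK_hom(6) c alg)
qed

lemma Kop_WU: "Kop \<mu> (WU e i ps (Kop (- \<mu>) m)) = kscale (cK (bq M \<mu> (- xf e i))) (WU e i ps m)"
  by (induction ps) (simp_all add: WU_Nil WU_Cons klinD[OF U_op_klin] klin_0[OF U_op_klin] Kop_BU kscale_simps)

lemma bq_al_letter: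
  assumes "j \<in> {1..2 * M}"
  shows "bq M (al M i) (dl M j) = (if j = cy i then q i else if j = cy (Suc i) then inverse (q (Suc i)) else 1)"
proof -
  have "cy j = j" using assms by (auto simp: cyc_def le_less)
  then show ?thesis using qi_cong[of j i] qi_cong[of j "Suc i"]
    by (auto simp: bq_dl lookup_al when_def power_int_minus)
qed

text \<open>At the letter \<open>i + 1\<close> the weight of \<alpha>_i is the inverse of
  \<open>q_{i+1}\<close>; by this identity the one denominator in the relation of \<open>e_i\<close>
  and \<open>f_i\<close> serves both letters, also for odd \<open>i\<close>.\<close>

lemma qi_diff_Suc: "inverse (q (Suc i)) - q (Suc i) = - (q i - inverse (q i))"
proof (cases "even_ix M i")
  case False
  then have "q (Suc i) = - inverse (q i)" using qi_odd[of i] by (simp add: field_simps)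
  then show ?thesis by (simp add: inverse_minus_eq)
qed (simp add: qi_even)

text \<open>Only the letters \<open>i\<close> and \<open>i + 1\<close> contribute, and there the
  difference of the two weights is, up to sign, the denominator of the relation; written with these
  weights the result is a summand of \<open>kw_telescope\<close>.\<close>

lemma BU_commutator:
  assumes w: "w \<in> words M n" and p: "p < n"
  shows "BU True i p (BU False i p (Poly_Mapping.single (\<nu>, w) 1)) - BU False i p (BU True i p (Poly_Mapping.single (\<nu>, w) 1))
    = Poly_Mapping.single (\<nu>, w) (cK (inverse (q i - inverse (q i)) * (kw (al M i) (take p w)
      * (bq M (al M i) (dl M (w ! p)) - bq M (- al M i) (dl M (w ! p))) * kw (- al M i) (drop (Suc p) w))))"
proof -
  have len: "p < length w" using w p by (simp add: words_def)
  have l: "w ! p \<in> {1..2 * M}" using w nth_mem[OF len] by (auto simp: words_def)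
  have x: "xx True i \<nu> p * xx False i \<nu> p = 1" "xx False i \<nu> p * xx True i \<nu> p = 1" by (auto simp: xx_def)
  have x': "xx True i \<nu> p * a * (xx False i \<nu> p * b) = a * b" "xx False i \<nu> p * a * (xx True i \<nu> p * b) = b * a" for a b
  proof -
    have "xx True i \<nu> p * a * (xx False i \<nu> p * b) = xx True i \<nu> p * xx False i \<nu> p * (a * b)"
      "xx False i \<nu> p * a * (xx True i \<nu> p * b) = xx False i \<nu> p * xx True i \<nu> p * (b * a)" by (simp_all only: mult_ac)
    then show "xx True i \<nu> p * a * (xx False i \<nu> p * b) = a * b" "xx False i \<nu> p * a * (xx True i \<nu> p * b) = b * a"
      by (simp_all only: x mult_1_left)
  qed
  have u: "w[p := a, p := w ! p] = w" for a by simp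
  let ?q = "q i - inverse (q i)"
  have c': "inverse d * (a * d * b) = b * a" "inverse d * (a * (- d) * b) = - (b * a)" if "d \<noteq> 0" for a b d :: base
    using that by (simp_all add: field_simps)
  note c = c'[OF qi_diff_nonzero[of i]]
  consider "w ! p = cy i" | "w ! p = cy (Suc i)" | "w ! p \<noteq> cy i" "w ! p \<noteq> cy (Suc i)" by blast
  then show ?thesis
  proof cases
    case 1
    then have "bq M (al M i) (dl M (w ! p)) - bq M (- al M i) (dl M (w ! p)) = ?q"
      using l by (simp add: bq_al_letter bq_minus)
    then show ?thesis using len 1 u[of "cy (Suc i)"]
      by (simp add: c BU_single src_def tgt_def oth_def xf_def drop_update_cancel x' cK_hom(6) BU_lin)
  next
    case 2
    then have "bq M (al M i) (dl M (w ! p)) - bq M (- al M i) (dl M (w ! p)) = - ?q"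
      using l qi_diff_Suc[of i] by (simp add: bq_al_letter bq_minus)
    then show ?thesis using len 2 u[of "cy i"]
      by (simp only: c) (simp add: BU_single src_def tgt_def oth_def xf_def take_update_cancel x' cK_hom(5,6) BU_lin single_uminus)
  next
    case 3
    then show ?thesis using l
      by (simp add: BU_single src_def tgt_def bq_al_letter bq_minus BU_lin cK_hom)
  qed
qed

lemma WU_mixed:
  assumes "i < 2 * M" "j < 2 * M" and m: "m \<in> supp {b. snd b \<in> words M n}"
  shows "WU True i (PL True n) (WU False j (PL False n) m) - WU False j (PL False n) (WU True i (PL True n) m)
    = (if i = j then kscale (cK (inverse (q i - inverse (q i)))) (Kop (al M i) m - Kop (- al M i) m) else 0)"
proof -
  have s: "F (\<Sum>r<n. G r) = (\<Sum>r<n. F (G r))" if "klin F" for F and G :: "nat \<Rightarrow> VT"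
    by (induction n) (simp_all add: klin_0[OF that] klinD(1)[OF that])
  let ?D = "\<lambda>p m. BU True i p (BU False j p m) - BU False j p (BU True i p m)"
  have "WU True i (PL True n) (WU False j (PL False n) m) - WU False j (PL False n) (WU True i (PL True n) m)
      = (\<Sum>p<n. \<Sum>r<n. BU True i p (BU False j r m)) - (\<Sum>r<n. \<Sum>p<n. BU False j r (BU True i p m))"
    by (simp add: WU_sum s[OF BU_klin])
  also have "(\<Sum>r<n. \<Sum>p<n. BU False j r (BU True i p m)) = (\<Sum>p<n. \<Sum>r<n. BU False j r (BU True i p m))"
    by (rule sum.swap)
  also have "(\<Sum>p<n. \<Sum>r<n. BU True i p (BU False j r m)) - (\<Sum>p<n. \<Sum>r<n. BU False j r (BU True i p m))
      = (\<Sum>p<n. \<Sum>r<n. if r = p then ?D p m else 0)"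
    unfolding sum_subtractf[symmetric] by (intro sum.cong refl) (simp add: BU_BU_mixed)
  also have "\<dots> = (\<Sum>p<n. ?D p m)" by simp
  also have "\<dots> = (if i = j then kscale (cK (inverse (q i - inverse (q i)))) (Kop (al M i) m - Kop (- al M i) m) else 0)"
  proof (cases "i = j")
    case True
    let ?F = "\<lambda>m. \<Sum>p<n. ?D p m" and ?G = "\<lambda>m. kscale (cK (inverse (q i - inverse (q i)))) (Kop (al M i) m - Kop (- al M i) m)"
    have "?F m = ?G m"
    proof (rule klin_ext_on[where F = ?F and G = ?G, OF _ _ _ m])
      show "klin ?F"
        by (simp add: klin_def BU_lin sum.distrib[symmetric] kscale_sum kscale_simps algebra_simps)
      show "klin ?G" by (rule klin_closed(6)[OF klin_closed(5)[OF U_op_klin U_op_klin]])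
      fix \<nu> :: "J list" and w :: "nat list" assume "(\<nu>, w) \<in> {b. snd b \<in> words M n}"
      then have w: "w \<in> words M n" and len: "length w = n" by (auto simp: words_def)
      have "?F (Poly_Mapping.single (\<nu>, w) 1) = (\<Sum>p<n. Poly_Mapping.single (\<nu>, w)
          (cK (inverse (q i - inverse (q i)) * (kw (al M i) (take p w)
      * (bq M (al M i) (dl M (w ! p)) - bq M (- al M i) (dl M (w ! p))) * kw (- al M i) (drop (Suc p) w)))))"
        unfolding True[symmetric] by (intro sum.cong refl BU_commutator[OF w]) simp
      also have "\<dots> = Poly_Mapping.single (\<nu>, w) (cK (\<Sum>p<n. inverse (q i - inverse (q i)) * (kw (al M i) (take p w)
      * (bq M (al M i) (dl M (w ! p)) - bq M (- al M i) (dl M (w ! p))) * kw (- al M i) (drop (Suc p) w))))"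
      proof -
        have "(\<Sum>p<n. Poly_Mapping.single (\<nu>, w) (cK (f p))) = Poly_Mapping.single (\<nu>, w) (cK (\<Sum>p<n. f p))" for f
          by (induction n) (simp_all add: cK_hom single_add)
        then show ?thesis .
      qed
      also have "\<dots> = Poly_Mapping.single (\<nu>, w) (cK (inverse (q i - inverse (q i)) * (kw (al M i) w - kw (- al M i) w)))"
        unfolding sum_distrib_left[symmetric] len[symmetric] kw_telescope ..
      also have "\<dots> = ?G (Poly_Mapping.single (\<nu>, w) 1)"
        by (simp add: Kop_single single_diff[symmetric] kscale_simps(11) cK_hom(4,6))
      finally show "?F (Poly_Mapping.single (\<nu>, w) 1) = ?G (Poly_Mapping.single (\<nu>, w) 1)" .
    qed
    with True show ?thesis by simp
  next
    case False
    \<comment> \<open>At one place \<open>e_i\<close> needs the letter \<open>i + 1\<close> while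
      \<open>f_j\<close> leaves \<open>j + 1\<close>, and \<open>f_j\<close> needs \<open>j\<close>
      while \<open>e_i\<close> leaves \<open>i\<close>.\<close>
    have "cy i \<noteq> cy j" using False assms(1,2) by (simp add: cyc_eq_iff)
    moreover have "cy (Suc i) \<noteq> cy (Suc j)"
      using \<open>cy i \<noteq> cy j\<close> cyc_Suc_cong[of "Suc i" "Suc j" "2 * M - 1"] M by (auto simp: cyc_eq_iff)
    ultimately have "?D p m = 0" for p
      using BU_same[of True i False j p m] BU_same[of False j True i p m] by (simp add: src_def tgt_def)
    then show ?thesis using False by simp
  qed
  finally show ?thesis .
qed

end

subsection \<open>Homogeneity of the relations\<close>

abbreviation U_hom :: "nat \<Rightarrow> bit \<Rightarrow> ugen fa set" where
  "U_hom M \<equiv> presentation.hom (U_gens M) (U_par M)"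

lemmas U_hom_closed = presentation.hom_closed[OF presentation_empty, where pr = "U_par M" and G = "U_gens M" for M]
lemmas U_hom_FA = presentation.hom_FA[OF presentation_empty, where pr = "U_par M" and G = "U_gens M" for M]

lemma wts_closed: "0 \<in> wts M" "\<mu> \<in> wts M \<Longrightarrow> \<mu>' \<in> wts M \<Longrightarrow> \<mu> + \<mu>' \<in> wts M" "\<mu> \<in> wts M \<Longrightarrow> - \<mu> \<in> wts M"
  using Poly_Mapping.keys_add[of \<mu> \<mu>'] by (auto simp: wts_def in_keys_iff lookup_add)

context uq
begin

lemma al_wts: "al M i \<in> wts M"
  using cyc_range[of i] cyc_range[of "Suc i"]
  by (auto simp: wts_def in_keys_iff lookup_al when_def split: if_splits)

abbreviation "pd i \<equiv> U_par M (UE (i mod (2 * M)))"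

lemma U_gen_hom: "\<mu> \<in> wts M \<Longrightarrow> uk \<mu> \<in> U_hom M 0" "ue M i \<in> U_hom M (pd i)" "uf M i \<in> U_hom M (pd i)"
  using U_hom_closed(4)[of "UK \<mu>" M] U_hom_closed(4)[of "UE (i mod (2 * M))" M]
    U_hom_closed(4)[of "UF (i mod (2 * M))" M] M
  by (auto simp: U_gens_def)

lemma U_gens_hom: "y = ue M \<or> y = uf M \<Longrightarrow> y k \<in> U_hom M (pd k)"
  by (elim disjE) (simp_all only: U_gen_hom)

lemma scal_U_hom: "x \<in> U_hom M d \<Longrightarrow> scal c * x \<in> U_hom M d"
  using U_hom_closed(8)[OF U_hom_closed(3)[of c M], of x d] by (simp only: add_0)

lemma U_rels_hom:
  assumes "x \<in> U_rels M" shows "\<exists>d. x \<in> U_hom M d"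
  using assms
proof cases
  case k_zero
  then show ?thesis using U_hom_closed(6)[OF U_gen_hom(1)[OF wts_closed(1)] U_hom_closed(2)] by blast
next
  case (k_add \<mu> \<mu>')
  have "uk \<mu> * uk \<mu>' \<in> U_hom M 0"
    using U_hom_closed(8)[OF U_gen_hom(1)[OF k_add(2)] U_gen_hom(1)[OF k_add(3)]] by (simp only: add_0)
  then show ?thesis unfolding k_add(1)
    using U_hom_closed(6)[OF U_gen_hom(1)[OF wts_closed(2)[OF k_add(2,3)]]] by blast
next
  case (k_e \<mu> i)
  have "uk \<mu> * ue M i * uk (- \<mu>) \<in> U_hom M (pd i)"
    using U_hom_closed(8)[OF U_hom_closed(8)[OF U_gen_hom(1)[OF k_e(2)] U_gen_hom(2)[of i]] U_gen_hom(1)[OF wts_closed(3)[OF k_e(2)]]]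
    by (simp only: add_0 add_0_right)
  then show ?thesis unfolding k_e(1) using U_hom_closed(6)[OF _ scal_U_hom[OF U_gen_hom(2)]] by blast
next
  case (k_f \<mu> i)
  have "uk \<mu> * uf M i * uk (- \<mu>) \<in> U_hom M (pd i)"
    using U_hom_closed(8)[OF U_hom_closed(8)[OF U_gen_hom(1)[OF k_f(2)] U_gen_hom(3)[of i]] U_gen_hom(1)[OF wts_closed(3)[OF k_f(2)]]]
    by (simp only: add_0 add_0_right)
  then show ?thesis unfolding k_f(1) using U_hom_closed(6)[OF _ scal_U_hom[OF U_gen_hom(3)]] by blast
next
  case (e_f i j)
  let ?r = "if i = j then scal (inverse (q i - inverse (q i))) * (uk (al M i) - uk (- al M i)) else 0"
  have k: "scal (inverse (q i - inverse (q i))) * (uk (al M i) - uk (- al M i)) \<in> U_hom M 0"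
    by (intro scal_U_hom U_hom_closed(6) U_gen_hom(1) al_wts wts_closed(3))
  \<comment> \<open>For \<open>i = j\<close> the products of \<open>e_i\<close> and
    \<open>f_i\<close> are even whatever the parity of \<open>i\<close>, as the right hand side is;
    otherwise the latter is 0, which has every parity.\<close>
  have 0: "a + a = 0" for a :: bit by (cases a) simp_all
  have r: "?r \<in> U_hom M (pd i + pd j)"
  proof (cases "i = j")
    case True
    show ?thesis using k unfolding True by (simp only: 0 simp_thms if_True)
  qed (simp only: if_False U_hom_closed(1))
  have "uf M j * ue M i \<in> U_hom M (pd i + pd j)"
    using U_hom_closed(8)[OF U_gen_hom(3)[of j] U_gen_hom(2)[of i]] by (simp only: add.commute)
  then show ?thesis unfolding e_f(1)
    using U_hom_closed(6)[OF U_hom_closed(6)[OF U_hom_closed(8)[OF U_gen_hom(2)[of i] U_gen_hom(3)[of j]]] r] by blast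
next
  case (odd_square y i)
  have "y k \<in> U_hom M (pd k)" for k by (rule U_gens_hom[OF odd_square(2)])
  then show ?thesis unfolding odd_square(1) using U_hom_closed(8) by blast
next
  case (commute y i j)
  have y: "y k \<in> U_hom M (pd k)" for k by (rule U_gens_hom[OF commute(2)])
  have "y j * y i \<in> U_hom M (pd i + pd j)" using U_hom_closed(8)[OF y[of j] y[of i]] by (simp only: add.commute)
  then show ?thesis unfolding commute(1) using U_hom_closed(6)[OF U_hom_closed(8)[OF y y]] by blast
next
  case (even_serre y i j)
  have y: "y k \<in> U_hom M (pd k)" for k by (rule U_gens_hom[OF even_serre(2)])
  let ?d = "pd i + (pd i + pd j)"
  note t = U_hom_closed(8)[OF U_hom_closed(8)[OF y y] y]
  have "y i * y i * y j \<in> U_hom M ?d" "y i * y j * y i \<in> U_hom M ?d" "y j * y i * y i \<in> U_hom M ?d"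
    using t[of i i j] t[of i j i] t[of j i i] by (simp_all only: add_ac)
  then have "y i * y i * y j - scal ((-1) ^ eps M i * two_q) * (y i * y j * y i) + y j * y i * y i \<in> U_hom M ?d"
    by (intro U_hom_closed(5,6) scal_U_hom)
  then show ?thesis unfolding even_serre(1) by blast
next
  case (odd_serre y i h)
  have y: "y k \<in> U_hom M (pd k)" for k by (rule U_gens_hom[OF odd_serre(2)])
  let ?d = "pd i + (pd i + (pd h + pd (i + 1)))"
  note t = U_hom_closed(8)[OF U_hom_closed(8)[OF U_hom_closed(8)[OF y y] y] y]
  have "y i * y h * y i * y (i + 1) \<in> U_hom M ?d" "y i * y (i + 1) * y i * y h \<in> U_hom M ?d"
      "y (i + 1) * y i * y h * y i \<in> U_hom M ?d" "y h * y i * y (i + 1) * y i \<in> U_hom M ?d"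
      "y i * y h * y (i + 1) * y i \<in> U_hom M ?d"
    using t[of i h i "i + 1"] t[of i "i + 1" i h] t[of "i + 1" i h i] t[of h i "i + 1" i] t[of i h "i + 1" i]
    by (simp_all only: add_ac)
  then have "y i * y h * y i * y (i + 1) - y i * y (i + 1) * y i * y h
    + y (i + 1) * y i * y h * y i - y h * y i * y (i + 1) * y i
    + scal ((-1) ^ eps M i * two_q) * (y i * y h * y (i + 1) * y i) \<in> U_hom M ?d"
    by (intro U_hom_closed(5,6) scal_U_hom)
  then show ?thesis unfolding odd_serre(1) by blast
qed

lemma U_super_presentation: "super_presentation (U_gens M) (U_rels M) (U_par M)"
proof (intro super_presentation.intro presentation.intro super_presentation_axioms.intro)
  show "U_rels M \<subseteq> FA (U_gens M)" using U_rels_hom U_hom_FA by blast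
  show "\<exists>d. x \<in> U_hom M d" if "x \<in> U_rels M" for x using U_rels_hom[OF that] .
qed

end

subsection \<open>The left module\<close>

lemma wpr_upd:
  assumes "p < length w"
  shows "wpr M (w[p := b]) = of_nat (eps M b + eps M (w ! p)) + wpr M w"
proof -
  have "w = take p w @ w ! p # drop (Suc p) w" by (rule id_take_nth_drop[OF assms])
  then have w: "wpr M w = wpr M (take p w) + (of_nat (eps M (w ! p)) + wpr M (drop (Suc p) w))"
    unfolding wpr_def by (metis list.map(2) map_append of_nat_add sum_list.Cons sum_list_append)
  have u: "wpr M (w[p := b]) = wpr M (take p w) + (of_nat (eps M b) + wpr M (drop (Suc p) w))"
    unfolding wpr_def upd_conv_take_nth_drop[OF assms]
    by (simp only: map_append sum_list_append list.map sum_list.Cons of_nat_add)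
  have "t + (y + d) = (y + x) + (t + (x + d))" for t x y d :: bit
    by (cases t; cases x; cases y; cases d; simp)
  then show ?thesis unfolding w u of_nat_add .
qed

text \<open>\<open>e_0\<close> and \<open>f_0\<close> multiply by \<open>X_p\<close> and its
  inverse, so \<open>X_p\<close> has to be a unit of \<open>R\<close>. In the power series ring it
  is one because its constant term is a power of \<open>q\<close>.\<close>

locale rc_u = rc_ring M P s \<beta> R + uq M s for M P s \<beta> R +
  assumes R_XK: "p < l \<Longrightarrow> XK s \<nu> p \<in> R" "p < l \<Longrightarrow> inverse (XK s \<nu> p) \<in> R"
begin

lemma U_op_WR:
  assumes "m \<in> WR D" "\<And>d. d \<in> D \<Longrightarrow> U_par M g + d \<in> D'"
  shows "U_op M s g m \<in> WR D'"
  unfolding U_op_def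
proof (rule WR_lin_ext[OF assms(1)])
  fix \<nu> w assume b: "(\<nu>, w) \<in> Poly_Mapping.keys m"
  note k = WR_keys[OF assms(1) b]
  have len: "length w = l" using k(2) words_length by blast
  have R1: "1 \<in> R" using R_cK[of 1] by (simp add: cK_hom)
  have p: "w[p := cy j] \<in> wds" if "p < l" for p j
    using k(2) cyc_range[of j] set_update_subset_insert[of w p "cy j"] by (fastforce simp: words_def)
  have e: "eps M (cy j) = eps M j" for j by (rule eps_cong) simp
  have E: "wpr M (w[p := cy i]) \<in> D'" if "p < l" "w ! p = cy (i + 1)" "g = UE i" for p i
    using assms(2)[OF k(3)] wpr_upd[of p w M "cy i"] that by (simp only: len e U_par.simps)
  have F: "wpr M (w[p := cy (i + 1)]) \<in> D'" if "p < l" "w ! p = cy i" "g = UF i" for p i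
    using assms(2)[OF k(3)] wpr_upd[of p w M "cy (i + 1)"] that by (simp only: len e U_par.simps add.commute[of "eps M i"])
  have F0: "wpr M (w[p := cy 1]) \<in> D'" if "p < l" "w ! p = cy 0" "g = UF 0" for p
    using F[of p 0] that by simp
  show "U_op1 M s g (Poly_Mapping.lookup m (\<nu>, w)) (\<nu>, w) \<in> WR D'"
  proof (cases g)
    case (UK \<mu>)
    have "wpr M w \<in> D'" using assms(2)[OF k(3)] by (simp only: UK U_par.simps add_0)
    then show ?thesis unfolding UK U_op1.simps by (intro WR_closed k R_mult R_cK)
  next
    case (UE i)
    show ?thesis unfolding UE U_op1.simps len
      by (intro WR_sum) (use UE in \<open>auto intro!: WR_closed k R_mult R_cK R_XK R1 p E simp del: One_nat_def add_Suc_right\<close>)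
  next
    case (UF i)
    show ?thesis unfolding UF U_op1.simps len
      by (intro WR_sum) (use UF in \<open>auto intro!: WR_closed k R_mult R_cK R_XK R1 p F F0 simp del: One_nat_def add_Suc_right\<close>)
  qed
qed

lemma U_op_linear: "U_op M s g (m + m') = U_op M s g m + U_op M s g m'" "U_op M s g (vscale c m) = vscale c (U_op M s g m)"
  by (simp_all add: klinD[OF U_op_klin] vscale_def)

sublocale UM: gen_module vscale "U_gens M" "U_rels M" "U_par M" "WR UNIV" "U_op M s"
  by (intro gen_module.intro vs.vector_space_axioms U_super_presentation gen_module_axioms.intro WR_subspace
      U_op_linear U_op_WR[where D = UNIV]) auto

lemma U_gen_act:
  assumes "m \<in> WR UNIV"
  shows "UM.fl (ue M i) m = WU True (i mod (2 * M)) (PL True l) m" "UM.fl (uf M i) m = WU False (i mod (2 * M)) (PL False l) m"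
    and "UM.fl (uk \<mu>) m = Kop \<mu> m"
proof -
  have "m \<in> supp {b. length (snd b) = l}"
    using WR_VA[OF assms] words_length by (auto simp: supp_def)
  then show "UM.fl (ue M i) m = WU True (i mod (2 * M)) (PL True l) m" "UM.fl (uf M i) m = WU False (i mod (2 * M)) (PL False l) m"
    by (simp_all only: UM.fl_simps U_op_WU)
qed (simp only: UM.fl_simps)

lemma gen_FA_U: "\<mu> \<in> wts M \<Longrightarrow> uk \<mu> \<in> FA (U_gens M)" "ue M i \<in> FA (U_gens M)" "uf M i \<in> FA (U_gens M)"
  using U_gen_hom U_hom_FA by blast+

lemma fl_WR: "x \<in> FA (U_gens M) \<Longrightarrow> m \<in> WR UNIV \<Longrightarrow> UM.fl x m \<in> WR UNIV"
  by (rule UM.fl_simps(8))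

lemma fl_scal_mult: "x \<in> FA (U_gens M) \<Longrightarrow> m \<in> WR UNIV \<Longrightarrow> UM.fl (scal c * x) m = kscale (cK c) (UM.fl x m)"
  by (simp only: UM.fl_mult FA_closed UM.fl_simps(6) fl_WR vscale_def)

lemma relation_WR:
  assumes x: "x \<in> U_rels M" and m: "m \<in> WR UNIV"
  shows "UM.fl x m = 0"
proof -
  \<comment> \<open>The \<open>e_i\<close> and the \<open>f_i\<close> are treated together: either
    family acts by \<open>WU e\<close> over the list \<open>PL e l\<close>, for the corresponding
    \<open>e\<close>.\<close>
  have y: "\<exists>e. \<forall>i. y i \<in> FA (U_gens M) \<and> (\<forall>m\<in>WR UNIV. UM.fl (y i) m = WU e (i mod (2 * M)) (PL e l) m
      \<and> WU e (i mod (2 * M)) (PL e l) m \<in> WR UNIV)" if "y = ue M \<or> y = uf M" for y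
    using that
  proof
    assume "y = ue M"
    then show ?thesis using gen_FA_U(2) U_gen_act(1) fl_WR by (intro exI[of _ True]) fastforce
  next
    assume "y = uf M"
    then show ?thesis using gen_FA_U(3) U_gen_act(2) fl_WR by (intro exI[of _ False]) fastforce
  qed
  have w: "m \<in> supp {b. snd b \<in> wds}" using WR_VA[OF m] by (auto simp: supp_def)
  have K: "Kop \<mu> m \<in> WR UNIV" if "m \<in> WR UNIV" for \<mu> m by (rule U_op_WR[OF that]) simp
  have Suc_mod: "cy (Suc (i mod (2 * M))) = cy (Suc i)" for i by (simp add: cyc_eq_iff mod_simps)
  have G: "gen (UE i) \<in> FA (U_gens M)" "m \<in> WR UNIV \<Longrightarrow> UM.fl (gen (UE i)) m = WU True i (PL True l) m"
    "gen (UF i) \<in> FA (U_gens M)" "m \<in> WR UNIV \<Longrightarrow> UM.fl (gen (UF i)) m = WU False i (PL False l) m"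
    if "i < 2 * M" for i m
    using gen_FA_U(2,3)[of i] U_gen_act(1,2)[of m i] that by simp_all
  note F = UM.fl_simps(1-5) UM.fl_mult fl_scal_mult gen_FA_U U_gen_act K m FA_closed fl_WR wts_closed al_wts
  show ?thesis
    using x
  proof cases
    case k_zero
    then show ?thesis by (simp add: F Kop_0)
  next
    case (k_add \<mu> \<mu>')
    then show ?thesis by (simp add: F Kop_add)
  next
    case (k_e \<mu> i)
    have W: "UM.fl (ue M i) (Kop (- \<mu>) m) = WU True i (PL True l) (Kop (- \<mu>) m)"
      using U_gen_act(1)[OF K[OF m, of "- \<mu>"], of i] mod_less[OF k_e(3)] by (simp only:)
    have "WU True i (PL True l) (Kop (- \<mu>) m) \<in> WR UNIV" unfolding W[symmetric] by (rule fl_WR[OF gen_FA_U(2) K[OF m]])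
    then have "UM.fl (uk \<mu> * ue M i * uk (- \<mu>)) m = Kop \<mu> (WU True i (PL True l) (Kop (- \<mu>) m))"
      by (simp only: UM.fl_mult FA_closed gen_FA_U k_e(2) wts_closed(3) m K W U_gen_act(3))
    then show ?thesis unfolding k_e(1) UM.fl_simps
      using k_e fl_scal_mult[OF gen_FA_U(2)[of i] m] U_gen_act(1)[OF m, of i]
      by (simp add: Kop_WU xf_def)
  next
    case (k_f \<mu> i)
    have W: "UM.fl (uf M i) (Kop (- \<mu>) m) = WU False i (PL False l) (Kop (- \<mu>) m)"
      using U_gen_act(2)[OF K[OF m, of "- \<mu>"], of i] mod_less[OF k_f(3)] by (simp only:)
    have "WU False i (PL False l) (Kop (- \<mu>) m) \<in> WR UNIV" unfolding W[symmetric] by (rule fl_WR[OF gen_FA_U(3) K[OF m]])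
    then have "UM.fl (uk \<mu> * uf M i * uk (- \<mu>)) m = Kop \<mu> (WU False i (PL False l) (Kop (- \<mu>) m))"
      by (simp only: UM.fl_mult FA_closed gen_FA_U k_f(2) wts_closed(3) m K W U_gen_act(3))
    then show ?thesis unfolding k_f(1) UM.fl_simps
      using k_f fl_scal_mult[OF gen_FA_U(3)[of i] m] U_gen_act(2)[OF m, of i]
      by (simp add: Kop_WU xf_def bq_minus_right)
  next
    case (e_f i j)
    have 1: "UM.fl (ue M i * uf M j) m = WU True i (PL True l) (WU False j (PL False l) m)"
      using fl_WR[OF gen_FA_U(3)[of j] m] e_f by (simp add: UM.fl_mult m G)
    have 2: "UM.fl (uf M j * ue M i) m = WU False j (PL False l) (WU True i (PL True l) m)"
      using fl_WR[OF gen_FA_U(2)[of i] m] e_f by (simp add: UM.fl_mult m G)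
    have 3: "UM.fl (if i = j then scal (inverse (q i - inverse (q i))) * (uk (al M i) - uk (- al M i)) else 0) m
      = (if i = j then kscale (cK (inverse (q i - inverse (q i)))) (Kop (al M i) m - Kop (- al M i) m) else 0)"
    proof (cases "i = j")
      case True
      have d: "uk (al M i) - uk (- al M i) \<in> FA (U_gens M)" by (intro FA_closed gen_FA_U al_wts wts_closed)
      show ?thesis unfolding if_P[OF True] fl_scal_mult[OF d m] by (simp only: UM.fl_simps(2) U_gen_act(3)[OF m])
    qed (simp add: UM.fl_simps)
    show ?thesis
      unfolding e_f(1) UM.fl_simps 1 2 3 using WU_mixed[OF e_f(2,3) w] by simp
  next
    case (odd_square y i)
    obtain e where e: "\<And>i. y i \<in> FA (U_gens M)" "\<And>i m. m \<in> WR UNIV \<Longrightarrow> UM.fl (y i) m = WU e (i mod (2 * M)) (PL e l) m"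
      "\<And>i m. m \<in> WR UNIV \<Longrightarrow> WU e (i mod (2 * M)) (PL e l) m \<in> WR UNIV" using y[OF odd_square(2)] by blast
    show ?thesis unfolding odd_square(1)
      using WU_square[OF sorted_PL[of e l] odd_square(4)] odd_square(3) e(3)[OF m, of i] by (simp add: UM.fl_mult e m)
  next
    case (commute y i j)
    obtain e where e: "\<And>i. y i \<in> FA (U_gens M)" "\<And>i m. m \<in> WR UNIV \<Longrightarrow> UM.fl (y i) m = WU e (i mod (2 * M)) (PL e l) m"
      "\<And>i m. m \<in> WR UNIV \<Longrightarrow> WU e (i mod (2 * M)) (PL e l) m \<in> WR UNIV" using y[OF commute(2)] by blast
    have "WU e i (PL e l) (WU e j (PL e l) m) = WU e j (PL e l) (WU e i (PL e l) m)"
      by (rule WU_commute[OF sorted_PL]) (use commute(3-5) in \<open>auto simp: adj_ix_def cyc_eq_iff\<close>)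
    then show ?thesis unfolding commute(1)
      using commute(3,4) e(3)[OF m, of i] e(3)[OF m, of j] by (simp add: UM.fl_simps UM.fl_mult e m)
  next
    case (even_serre y i j)
    obtain e where e: "\<And>i. y i \<in> FA (U_gens M)" "\<And>i m. m \<in> WR UNIV \<Longrightarrow> UM.fl (y i) m = WU e (i mod (2 * M)) (PL e l) m"
      "\<And>i m. m \<in> WR UNIV \<Longrightarrow> WU e (i mod (2 * M)) (PL e l) m \<in> WR UNIV" using y[OF even_serre(2)] by blast
    have yy: "m \<in> WR UNIV \<Longrightarrow> UM.fl (y i) m \<in> WR UNIV" for i m by (rule fl_WR[OF e(1)])
    have "cy (Suc i) = cy j \<or> cy i = cy (Suc j)" using even_serre(6) by (auto simp: adj_ix_def cyc_eq_iff)
    note S = WU_even_serre[OF sorted_PL[of e l] even_serre(5) this, of m]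
    have i: "UM.fl (y i) m = WU e i (PL e l) m" "UM.fl (y j) m = WU e j (PL e l) m" if "m \<in> WR UNIV" for m
      using e(2)[OF that, of i] e(2)[OF that, of j] even_serre(3,4) by simp_all
    show ?thesis unfolding even_serre(1) UM.fl_simps
      using S by (simp only: UM.fl_mult UM.fl_simps(6) vscale_def FA_closed e(1) m yy i[symmetric])
  next
    case (odd_serre y i h)
    obtain e where e: "\<And>i. y i \<in> FA (U_gens M)" "\<And>i m. m \<in> WR UNIV \<Longrightarrow> UM.fl (y i) m = WU e (i mod (2 * M)) (PL e l) m"
      "\<And>i m. m \<in> WR UNIV \<Longrightarrow> WU e (i mod (2 * M)) (PL e l) m \<in> WR UNIV" using y[OF odd_serre(2)] by blast
    have yy: "m \<in> WR UNIV \<Longrightarrow> UM.fl (y i) m \<in> WR UNIV" for i m by (rule fl_WR[OF e(1)])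
    have hi: "cy (Suc (h mod (2 * M))) = cy i" unfolding Suc_mod using odd_serre(5) M by (simp add: cyc_eq_iff)
    have Si: "cy ((i + 1) mod (2 * M)) = cy (Suc i)" by simp
    note S = WU_odd_serre[OF sorted_PL[of e l] odd_serre(4) hi Si, of m]
    have i: "UM.fl (y i) m = WU e i (PL e l) m" if "m \<in> WR UNIV" for m
      using e(2)[OF that, of i] odd_serre(3) by simp
    show ?thesis unfolding odd_serre(1) UM.fl_simps
      using S by (simp only: UM.fl_mult UM.fl_simps(6) vscale_def FA_closed e(1) m yy i[symmetric] e(2)[symmetric])
  qed
qed

lemma left_supermodule_WR:
  "left_supermodule (U M) (U_sc M) (U_parity M) vscale (WR UNIV) par_WR (lact M s)"
  unfolding lact_def
  by (rule UM.left_supermodule_presented[OF relation_WR superspace_WR]) (auto simp: par_WR_def intro!: U_op_WR[where D = "{_}"])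

end

section \<open>The commutant\<close>

locale two_sided =
  L: left_supermodule A scA Ap sm V Vp la + Rt: right_supermodule B scB Bp sm V Vp ra
  for A :: "('a, 'x) ring_scheme" and scA Ap and B :: "('b, 'y) ring_scheme" and scB Bp
    and sm :: "base \<Rightarrow> 'v::ab_group_add \<Rightarrow> 'v" and V Vp la ra
begin

definition com :: "'a set" where
  "com = {u \<in> carrier A. \<forall>a\<in>carrier B. \<forall>m\<in>V. la u (ra m a) = ra (la u m) a}"

lemma Vp_V: "m \<in> Vp d \<Longrightarrow> m \<in> V"
proof -
  assume m: "m \<in> Vp d"
  have "m = m + 0 \<and> m = 0 + m \<and> 0 \<in> Vp 0 \<and> 0 \<in> Vp 1" using L.spc.subspace_0[OF L.spc.subspace_parity] by simp
  then show "m \<in> V" using m unfolding L.spc.parity_sum by (cases d) blast+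
qed

lemma Vp_disjoint: "m \<in> Vp d \<Longrightarrow> m \<in> Vp (1 + d) \<Longrightarrow> m = 0"
  using L.spc.parity_direct by (cases d) auto

lemma scA_carrier: "scA c \<in> carrier A" and scB_carrier: "scB c \<in> carrier B"
  using L.alg.sc_hom Rt.alg.sc_hom by (auto simp: ring_hom_def ring_of_type_algebra_def)

text \<open>Scalars act through the elements \<open>scB c\<close>, which are central.\<close>

lemma ra_scale: "a \<in> carrier B \<Longrightarrow> m \<in> V \<Longrightarrow> ra (sm c m) a = sm c (ra m a)"
  using Rt.act_mult[of m "scB c" a] Rt.act_mult[of m a "scB c"] Rt.alg.sc_central[of a c]
  by (simp add: scB_carrier Rt.act_scalar Rt.act_closed)

lemma com_scA: "scA c \<in> com"
  by (simp add: com_def scA_carrier L.act_scalar Rt.act_closed ra_scale)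

lemma com_mult: "u \<in> com \<Longrightarrow> v \<in> com \<Longrightarrow> u \<otimes>\<^bsub>A\<^esub> v \<in> com"
  by (simp add: com_def L.act_mult L.act_closed Rt.act_closed)

lemma com_add: "u \<in> com \<Longrightarrow> v \<in> com \<Longrightarrow> u \<oplus>\<^bsub>A\<^esub> v \<in> com"
  by (simp add: com_def L.act_add_alg L.act_closed Rt.act_closed Rt.act_add_spc)

lemma com_one: "\<one>\<^bsub>A\<^esub> \<in> com"
  by (simp add: com_def L.act_one Rt.act_closed)

lemma com_uminus: assumes "u \<in> com" shows "\<ominus>\<^bsub>A\<^esub> u \<in> com"
proof -
  have u: "u \<in> carrier A" using assms by (simp add: com_def)
  have "scA 0 = scA 0 \<oplus>\<^bsub>A\<^esub> scA 0" "scA 0 = scA (- 1) \<oplus>\<^bsub>A\<^esub> scA 1" "scA 1 = \<one>\<^bsub>A\<^esub>"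
    using L.alg.sc_hom unfolding ring_hom_def ring_of_type_algebra_def by (auto, metis add.right_neutral, metis add.left_inverse)
  then have z: "scA 0 = \<zero>\<^bsub>A\<^esub>" "scA (- 1) \<oplus>\<^bsub>A\<^esub> \<one>\<^bsub>A\<^esub> = scA 0"
    using scA_carrier[of 0] L.alg.add.l_cancel_one' by auto
  have "scA (- 1) \<otimes>\<^bsub>A\<^esub> u \<oplus>\<^bsub>A\<^esub> u = (scA (- 1) \<oplus>\<^bsub>A\<^esub> \<one>\<^bsub>A\<^esub>) \<otimes>\<^bsub>A\<^esub> u"
    using u by (simp add: L.alg.l_distr scA_carrier)
  also have "\<dots> = \<zero>\<^bsub>A\<^esub>" using u by (simp add: z)
  finally have "\<ominus>\<^bsub>A\<^esub> u = scA (- 1) \<otimes>\<^bsub>A\<^esub> u"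
    using u by (intro L.alg.minus_equality) (simp_all add: scA_carrier)
  then show ?thesis using com_mult[OF com_scA assms] by simp
qed

text \<open>
  On homogeneous arguments the two defects of the homogeneous parts of an element of the commutant are
  of opposite parity, and their sum is \<open>0\<close>.
\<close>

lemma com_homogeneous:
  assumes "u0 \<in> Ap 0" "u1 \<in> Ap 1" "u0 \<oplus>\<^bsub>A\<^esub> u1 \<in> com"
  shows "u0 \<in> com" "u1 \<in> com"
proof -
  interpret a: additive_subgroup "Ap d" A for d by (rule L.alg.parity_subgroup)
  interpret b: additive_subgroup "Bp d" B for d by (rule Rt.alg.parity_subgroup)
  have u: "u0 \<in> carrier A" "u1 \<in> carrier A" using assms(1,2) a.a_subset by blast+
  define D where "D u a m = la u (ra m a) - ra (la u m) a" for u a m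
  have B: "x \<in> Bp d \<Longrightarrow> x \<in> carrier B" for x d using b.a_subset by blast
  have "D u0 a m = 0 \<and> D u1 a m = 0" if a: "a \<in> Bp e" and m: "m \<in> Vp d" for a m d e
  proof -
    have mV: "m \<in> V" and aB: "a \<in> carrier B" using a m Vp_V B by blast+
    have s: "D u0 a m + D u1 a m = 0"
      using assms(3) mV aB u
      by (simp add: D_def com_def L.act_add_alg Rt.act_closed Rt.act_add_spc L.act_closed algebra_simps)
    have p: "D u a m \<in> Vp (x + (d + e))" if "u \<in> Ap x" for u x
      unfolding D_def
      using L.act_parity[OF that Rt.act_parity[OF m a]] Rt.act_parity[OF L.act_parity[OF that m] a]
      by (intro L.spc.subspace_diff[OF L.spc.subspace_parity]) (simp_all only: add.assoc)
    have "D u0 a m = - D u1 a m" using s by (simp add: eq_neg_iff_add_eq_0)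
    then have "D u0 a m \<in> Vp (1 + (d + e))" using L.spc.subspace_neg[OF L.spc.subspace_parity p[OF assms(2)]] by (simp only:)
    moreover have "D u0 a m \<in> Vp (d + e)" using p[OF assms(1)] by (simp only: add_0)
    ultimately have "D u0 a m = 0" by (intro Vp_disjoint)
    with s show ?thesis by simp
  qed
  note hom = this
  have "D u a m = 0" if a: "a \<in> carrier B" and m: "m \<in> V" and x: "u = u0 \<or> u = u1" for a m u
  proof -
    have uA: "u \<in> carrier A" using u x by blast
    obtain m0 m1 where m: "m = m0 + m1" "m0 \<in> Vp 0" "m1 \<in> Vp 1" using m unfolding L.spc.parity_sum by blast
    obtain a0 a1 where a: "a = a0 \<oplus>\<^bsub>B\<^esub> a1" "a0 \<in> Bp 0" "a1 \<in> Bp 1"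
      using a unfolding Rt.alg.parity_sum set_add_def' by blast
    note c = Vp_V[OF m(2)] Vp_V[OF m(3)] B[OF a(2)] B[OF a(3)]
    have sub: "L.spc.subspace V" by (rule L.spc.subspace_carrier)
    have "D u a m = D u a0 m0 + D u a1 m0 + (D u a0 m1 + D u a1 m1)"
      unfolding D_def m(1) a(1) using c uA L.spc.subspace_add[OF sub]
      by (simp add: L.act_add_spc L.act_closed Rt.act_closed Rt.act_add_spc Rt.act_add_alg algebra_simps)
    also have "\<dots> = 0" using hom[OF a(2) m(2)] hom[OF a(2) m(3)] hom[OF a(3) m(2)] hom[OF a(3) m(3)] x by auto
    finally show ?thesis .
  qed
  then show "u0 \<in> com" "u1 \<in> com" using u by (simp_all add: com_def D_def)
qed

end

text \<open>The homogeneous parts of an element do not depend on \<beta>, so membership in every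
  commutant passes to them.\<close>

lemma subsuperalgebra_Inter_com:
  assumes "\<And>\<beta>. two_sided A scA Ap (B \<beta>) (scB \<beta>) (Bp \<beta>) sm (V \<beta>) (Vp \<beta>) la (ra \<beta>)"
  shows "subsuperalgebra A scA Ap (\<Inter>\<beta>. two_sided.com A (B \<beta>) (V \<beta>) la (ra \<beta>))"
proof -
  interpret T: two_sided A scA Ap "B \<beta>" "scB \<beta>" "Bp \<beta>" sm "V \<beta>" "Vp \<beta>" la "ra \<beta>" for \<beta> by (rule assms)
  let ?S = "\<Inter>\<beta>. T.com \<beta>"
  have carr: "?S \<subseteq> carrier A" by (auto simp: T.com_def)
  have "subring ?S A"
    by (rule T.L.alg.subringI) (use carr in \<open>auto intro: T.com_one T.com_uminus T.com_mult T.com_add\<close>)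
  moreover have "?S = (?S \<inter> Ap 0) <+>\<^bsub>A\<^esub> (?S \<inter> Ap 1)"
  proof
    show "?S \<subseteq> (?S \<inter> Ap 0) <+>\<^bsub>A\<^esub> (?S \<inter> Ap 1)"
    proof
      fix u assume u: "u \<in> ?S"
      then have "u \<in> Ap 0 <+>\<^bsub>A\<^esub> Ap 1" using carr T.L.alg.parity_sum by blast
      then obtain u0 u1 where h: "u0 \<in> Ap 0" "u1 \<in> Ap 1" "u = u0 \<oplus>\<^bsub>A\<^esub> u1" unfolding set_add_def' by blast
      have "u0 \<in> T.com \<beta>" "u1 \<in> T.com \<beta>" for \<beta>
        using T.com_homogeneous[OF h(1,2), of \<beta>] u unfolding h(3) by blast+
      then have "u0 \<in> ?S \<inter> Ap 0" "u1 \<in> ?S \<inter> Ap 1" using h by blast+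
      then show "u \<in> (?S \<inter> Ap 0) <+>\<^bsub>A\<^esub> (?S \<inter> Ap 1)"
        unfolding set_add_def' h(3) by blast
    qed
    show "(?S \<inter> Ap 0) <+>\<^bsub>A\<^esub> (?S \<inter> Ap 1) \<subseteq> ?S"
      unfolding set_add_def' by (auto intro: T.com_add)
  qed
  ultimately show ?thesis
    unfolding subsuperalgebra_def using T.L.alg.superalgebra_axioms T.com_scA by blast
qed


section \<open>The theorem\<close>

lemma (in rc_ring) of_parity_WR: "of_parity M (WR UNIV) = par_WR"
  by (rule ext) (auto simp: of_parity_def par_WR_def WR_def wpr_def)

lemma (in rc_ring) VK_WR: "R = ser_frac l \<Longrightarrow> VK M \<beta> = WR UNIV"
  and VO_WR: "R = Oser l \<Longrightarrow> VO M \<beta> = WR UNIV"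
  unfolding VK_def VO_def WR_UNIV supp_def Oser_def[symmetric] by blast+

context rc
begin

lemma right_VK: "right_supermodule (RC \<beta>) (RC_sc \<beta>) (RC_parity \<beta>) vscale (VK M \<beta>) (of_parity M (VK M \<beta>)) (ract M P s)"
proof -
  interpret K: rc_ring M P s \<beta> "ser_frac l" by (rule rc_ring_ser_frac)
  show ?thesis using K.right_supermodule_WR by (simp only: K.VK_WR K.of_parity_WR)
qed

lemma right_VO: "right_supermodule (RC \<beta>) (RC_sc \<beta>) (RC_parity \<beta>) vscale (VO M \<beta>) (of_parity M (VO M \<beta>)) (ract M P s)"
proof -
  interpret O: rc_ring M P s \<beta> "Oser l" by (rule rc_ring_Oser)
  show ?thesis using O.right_supermodule_WR by (simp only: O.VO_WR O.of_parity_WR)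
qed

text \<open>Identifies the action of the quotient, which is defined through cosets, with the
  prescribed operators.\<close>

lemma ract_gen:
  assumes "g \<in> RC_gens \<beta>" "m \<in> VK M \<beta>" shows "ract M P s m (RC_gen \<beta> g) = RC_op M P s g m"
proof -
  interpret K: rc_ring M P s \<beta> "ser_frac l" by (rule rc_ring_ser_frac)
  have "gen g \<in> FA (RC_gens \<beta>)" using assms(1) by (intro FA_closed)
  then show ?thesis using K.ract_cls assms(2) by (simp add: K.VK_WR A.fr_simps)
qed

lemma VO_submodule: "right_submodule (RC \<beta>) vscale (VK M \<beta>) (ract M P s) (VO M \<beta>)"
proof -
  interpret O: right_supermodule "RC \<beta>" "RC_sc \<beta>" "RC_parity \<beta>" vscale "VO M \<beta>" "of_parity M (VO M \<beta>)" "ract M P s"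
    by (rule right_VO)
  have "VO M \<beta> \<subseteq> VK M \<beta>"
    using Oser_ser_frac unfolding VO_def VK_def Oser_def[symmetric] by blast
  then show ?thesis
    using O.spc.subspace_carrier O.act_closed by (simp add: right_submodule_def)
qed

lemma left_VO:
  assumes "M \<ge> 2"
  shows "left_supermodule (U M) (U_sc M) (U_parity M) vscale (VO M \<beta>) (of_parity M (VO M \<beta>)) (lact M s)"
proof -
  interpret O: rc_ring M P s \<beta> "Oser l" by (rule rc_ring_Oser)
  interpret U: rc_u M P s \<beta> "Oser l"
  proof
    show "2 \<le> M" by fact
    show XK: "XK s \<nu> p \<in> Oser l" if "p < l" for \<nu> p unfolding XK_eq using that by (intro Oser_closed)
    show "inverse (XK s \<nu> p) \<in> Oser l" if "p < l" for \<nu> p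
      using Oser_inverse_affine[of p l p "Xval s (\<nu> ! p)" 1 0] that by (simp add: XK_eq Xval_nonzero)
  qed
  show ?thesis using U.left_supermodule_WR by (simp only: O.VO_WR O.of_parity_WR)
qed

end

theorem theorem1p3:
  fixes M :: nat
    and P :: "(nat \<Rightarrow>\<^sub>0 base) \<Rightarrow> (nat \<Rightarrow>\<^sub>0 base)"
    and \<beta> :: "int \<Rightarrow>\<^sub>0 nat"
  assumes "M \<ge> 2"
    and "odd_involution M P"
  shows "(\<forall>s. right_supermodule (RC \<beta>) (RC_sc \<beta>) (RC_parity \<beta>)
           vscale (VK M \<beta>) (of_parity M (VK M \<beta>)) (ract M P s)
         \<and> (\<forall>g\<in>RC_gens \<beta>. \<forall>m\<in>VK M \<beta>. ract M P s m (RC_gen \<beta> g) = RC_op M P s g m)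
         \<and> right_submodule (RC \<beta>) vscale (VK M \<beta>) (ract M P s) (VO M \<beta>))
    \<and> (\<forall>s. subsuperalgebra (U M) (U_sc M) (U_parity M) (U_P M P s)
         \<and> bisupermodule
             ((U M)\<lparr>carrier := U_P M P s\<rparr>) (U_sc M) (\<lambda>d. U_P M P s \<inter> U_parity M d)
             (RC \<beta>) (RC_sc \<beta>) (RC_parity \<beta>)
             vscale (VO M \<beta>) (of_parity M (VO M \<beta>)) (lact M s) (ract M P s))"
proof (intro conjI allI ballI)
  have rc: "rc M P" by (rule rc.intro) fact
  show "right_supermodule (RC \<beta>) (RC_sc \<beta>) (RC_parity \<beta>) vscale (VK M \<beta>) (of_parity M (VK M \<beta>)) (ract M P s)" for s
    by (rule rc.right_VK[OF rc])
  show "ract M P s m (RC_gen \<beta> g) = RC_op M P s g m" if "g \<in> RC_gens \<beta>" "m \<in> VK M \<beta>" for s g m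
    by (rule rc.ract_gen[OF rc that])
  show "right_submodule (RC \<beta>) vscale (VK M \<beta>) (ract M P s) (VO M \<beta>)" for s
    by (rule rc.VO_submodule[OF rc])
  \<comment> \<open>Stated for all \<beta> at once, since the subalgebra is an intersection over
    \<beta>.\<close>
  have T: "two_sided (U M) (U_sc M) (U_parity M) (RC \<beta>) (RC_sc \<beta>) (RC_parity \<beta>) vscale (VO M \<beta>)
      (of_parity M (VO M \<beta>)) (lact M s) (ract M P s)" for s \<beta>
    by (intro two_sided.intro rc.left_VO[OF rc assms(1)] rc.right_VO[OF rc])
  have U_P: "U_P M P s = (\<Inter>\<beta>. two_sided.com (U M) (RC \<beta>) (VO M \<beta>) (lact M s) (ract M P s))" for s
    unfolding U_P_def two_sided.com_def[OF T] ..
  show sub: "subsuperalgebra (U M) (U_sc M) (U_parity M) (U_P M P s)" for s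
    unfolding U_P by (rule subsuperalgebra_Inter_com[OF T])
  show "bisupermodule ((U M)\<lparr>carrier := U_P M P s\<rparr>) (U_sc M) (\<lambda>d. U_P M P s \<inter> U_parity M d)
      (RC \<beta>) (RC_sc \<beta>) (RC_parity \<beta>) vscale (VO M \<beta>) (of_parity M (VO M \<beta>)) (lact M s) (ract M P s)" for s
    unfolding bisupermodule_def
  proof (intro conjI ballI)
    show "left_supermodule ((U M)\<lparr>carrier := U_P M P s\<rparr>) (U_sc M) (\<lambda>d. U_P M P s \<inter> U_parity M d)
        vscale (VO M \<beta>) (of_parity M (VO M \<beta>)) (lact M s)"
      by (rule left_supermodule_restrict[OF sub rc.left_VO[OF rc assms(1)]])
    show "right_supermodule (RC \<beta>) (RC_sc \<beta>) (RC_parity \<beta>) vscale (VO M \<beta>) (of_parity M (VO M \<beta>)) (ract M P s)"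
      by (rule rc.right_VO[OF rc])
    fix a m b assume "a \<in> carrier ((U M)\<lparr>carrier := U_P M P s\<rparr>)" "m \<in> VO M \<beta>" "b \<in> carrier (RC \<beta>)"
    then show "ract M P s (lact M s a m) b = lact M s a (ract M P s m b)"
      by (simp add: U_P_def)
  qed
qed

end
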